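(* Let $Q$ be a finite acyclic quiver, let $X$ and $S$ be finite-dimensional representations of $Q$ over an algebraically closed field $K$, and let $\xi\in\mathrm{Ext}^1_Q(S,X)$ be a generating extension. Then for all dimension vectors $\mathbf{f},\mathbf{g}$ the image of $\Psi^\xi_{\mathbf{f},\mathbf{g}}$ is the open subset of $\mathrm{Gr}_{\mathbf{f}}(X)\times\mathrm{Gr}_{\mathbf{g}}(S)$ given by $$\mathrm{Im}(\Psi^\xi_{\mathbf{f},\mathbf{g}})=\{(N',N'')\mid \mathrm{Ext}^1_Q(N'',X/N')=0\},$$ and $\mathcal{S}^\xi_{\mathbf{f},\mathbf{g}}$ is (via $\Psi^\xi_{\mathbf{f},\mathbf{g}}$) an affine bundle of rank $\langle\mathbf{g},\mathbf{dim}\,X-\mathbf{f}\rangle$ over this image.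
   Context: $\langle\mathbf{a},\mathbf{b}\rangle=\sum_ia_ib_i-\sum_{\alpha:i\to j}a_ib_j$ is the Euler form; $\mathrm{Gr}_{\mathbf{e}}(M)$ is the projective variety (scheme) of subrepresentations of $M$ of dimension vector $\mathbf{e}$. An extension $\xi\in\mathrm{Ext}^1_Q(S,X)$ is generating if it generates the vector space $\mathrm{Ext}^1_Q(S,X)$ (so either $\mathrm{Ext}^1_Q(S,X)=0$ and $\xi$ is split, or $\dim\mathrm{Ext}^1_Q(S,X)=1$ and $\xi$ is non-split). Represent $\xi$ by $0\to X\xrightarrow{\iota}Y\xrightarrow{\pi}S\to0$. With $\mathbf{e}=\mathbf{f}+\mathbf{g}$, $\mathcal{S}^\xi_{\mathbf{f},\mathbf{g}}\subseteq\mathrm{Gr}_{\mathbf{e}}(Y)$ is the locally closed subset of all $N$ with $\mathbf{dim}\,\iota^{-1}(N)=\mathbf{f}$ and $\mathbf{dim}\,\pi(N)=\mathbf{g}$, and $\Psi^\xi_{\mathbf{f},\mathbf{g}}:\mathcal{S}^\xi_{\mathbf{f},\mathbf{g}}\to\mathrm{Gr}_{\mathbf{f}}(X)\times\mathrm{Gr}_{\mathbf{g}}(S)$ is the algebraic map $N\mapsto(\iota^{-1}(N),\pi(N))$. *)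

theory Defs
  imports
    "HOL-Analysis.Abstract_Topology"
    "HOL-Algebra.AbelCoset"
    "Graph_Theory.Digraph"
    "Jordan_Normal_Form.Determinant"
    "Jordan_Normal_Form.Missing_VectorSpace"
    "Jordan_Normal_Form.VS_Connect"
begin

section \<open>Finite-dimensional representations of a quiver\<close>

text \<open>The base field is a type \<open>'k\<close>, viewed as a ring record through \<open>class_ring\<close>.  Only the
  components at vertices and arrows of the quiver are relevant; all notions below ignore the
  others.\<close>

record ('v, 'a, 'k, 'm) rep =
  vspace :: "'v \<Rightarrow> ('k, 'm) module"
  act :: "'a \<Rightarrow> 'm \<Rightarrow> 'm"

definition representation ::
  "('v, 'a) pre_digraph \<Rightarrow> ('v, 'a, 'k::field, 'm) rep \<Rightarrow> bool" where
  "representation Q M \<longleftrightarrow>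
     (\<forall>i\<in>verts Q. vectorspace class_ring (vspace M i) \<and>
        vectorspace.fin_dim class_ring (vspace M i)) \<and>
     (\<forall>\<alpha>\<in>arcs Q. linear_map class_ring (vspace M (tail Q \<alpha>)) (vspace M (head Q \<alpha>)) (act M \<alpha>))"

definition dimvec :: "('v, 'a, 'k::field, 'm) rep \<Rightarrow> 'v \<Rightarrow> nat" where
  "dimvec M i = vectorspace.dim class_ring (vspace M i)"

definition rep_hom ::
  "('v, 'a) pre_digraph \<Rightarrow> ('v, 'a, 'k::field, 'm) rep \<Rightarrow> ('v, 'a, 'k, 'n) rep \<Rightarrow>
     ('v \<Rightarrow> 'm \<Rightarrow> 'n) \<Rightarrow> bool" where
  "rep_hom Q M N h \<longleftrightarrow>
     (\<forall>i\<in>verts Q. linear_map class_ring (vspace M i) (vspace N i) (h i)) \<and>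
     (\<forall>\<alpha>\<in>arcs Q. \<forall>x\<in>carrier (vspace M (tail Q \<alpha>)).
        h (head Q \<alpha>) (act M \<alpha> x) = act N \<alpha> (h (tail Q \<alpha>) x))"

definition euler_form :: "('v, 'a) pre_digraph \<Rightarrow> ('v \<Rightarrow> int) \<Rightarrow> ('v \<Rightarrow> int) \<Rightarrow> int" where
  "euler_form Q a b = (\<Sum>i\<in>verts Q. a i * b i) - (\<Sum>\<alpha>\<in>arcs Q. a (tail Q \<alpha>) * b (head Q \<alpha>))"

text \<open>A subrepresentation is a family of subspaces; it is required to be extensional, so that
  equal subrepresentations are equal as functions.\<close>

definition subreps ::
  "('v, 'a) pre_digraph \<Rightarrow> ('v, 'a, 'k::field, 'm) rep \<Rightarrow> ('v \<Rightarrow> 'm set) set" where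
  "subreps Q M =
     {N \<in> extensional (verts Q).
        (\<forall>i\<in>verts Q. VectorSpace.subspace class_ring (N i) (vspace M i)) \<and>
        (\<forall>\<alpha>\<in>arcs Q. act M \<alpha> ` N (tail Q \<alpha>) \<subseteq> N (head Q \<alpha>))}"

definition sub_rep ::
  "('v, 'a, 'k, 'm) rep \<Rightarrow> ('v \<Rightarrow> 'm set) \<Rightarrow> ('v, 'a, 'k, 'm) rep" where
  "sub_rep M N = M\<lparr>vspace := \<lambda>i. (vspace M i)\<lparr>carrier := N i\<rparr>\<rparr>"

text \<open>In the quotient, \<open>c \<cdot> (x + W) = W + c (x + W)\<close>, and similarly for the action of an arrow;
  adding \<open>W\<close> turns the image of a coset into a full coset.\<close>

definition quotient_space :: "('k, 'm) module \<Rightarrow> 'm set \<Rightarrow> ('k, 'm set) module" where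
  "quotient_space V W =
     \<lparr>carrier = a_rcosets\<^bsub>V\<^esub> W, mult = (\<lambda>_ _. W), one = W, zero = W,
      add = (\<lambda>A B. A <+>\<^bsub>V\<^esub> B), smult = (\<lambda>c A. W <+>\<^bsub>V\<^esub> (\<lambda>x. c \<odot>\<^bsub>V\<^esub> x) ` A)\<rparr>"

definition quotient_rep ::
  "('v, 'a) pre_digraph \<Rightarrow> ('v, 'a, 'k, 'm) rep \<Rightarrow> ('v \<Rightarrow> 'm set) \<Rightarrow>
     ('v, 'a, 'k, 'm set) rep" where
  "quotient_rep Q M N =
     \<lparr>vspace = (\<lambda>i. quotient_space (vspace M i) (N i)),
      act = (\<lambda>\<alpha> A. N (head Q \<alpha>) <+>\<^bsub>vspace M (head Q \<alpha>)\<^esub> act M \<alpha> ` A)\<rparr>"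


section \<open>Extensions\<close>

text \<open>\<open>Y\<close>, \<open>\<iota>\<close>, \<open>\<pi>\<close> form a short exact sequence \<open>0 \<rightarrow> X \<rightarrow> Y \<rightarrow> S \<rightarrow> 0\<close>.\<close>

definition extension ::
  "('v, 'a) pre_digraph \<Rightarrow> ('v, 'a, 'k::field, 's) rep \<Rightarrow> ('v, 'a, 'k, 'x) rep \<Rightarrow>
     ('v, 'a, 'k, 'y) rep \<Rightarrow> ('v \<Rightarrow> 'x \<Rightarrow> 'y) \<Rightarrow> ('v \<Rightarrow> 'y \<Rightarrow> 's) \<Rightarrow> bool" where
  "extension Q S X Y \<iota> \<pi> \<longleftrightarrow>
     representation Q Y \<and> rep_hom Q X Y \<iota> \<and> rep_hom Q Y S \<pi> \<and>
     (\<forall>i\<in>verts Q. inj_on (\<iota> i) (carrier (vspace X i)) \<and>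
        \<iota> i ` carrier (vspace X i) = {y \<in> carrier (vspace Y i). \<pi> i y = \<zero>\<^bsub>vspace S i\<^esub>} \<and>
        \<pi> i ` carrier (vspace Y i) = carrier (vspace S i))"

definition split_extension ::
  "('v, 'a) pre_digraph \<Rightarrow> ('v, 'a, 'k::field, 's) rep \<Rightarrow>
     ('v, 'a, 'k, 'y) rep \<Rightarrow> ('v \<Rightarrow> 'y \<Rightarrow> 's) \<Rightarrow> bool" where
  "split_extension Q S Y \<pi> \<longleftrightarrow>
     (\<exists>\<sigma>. rep_hom Q S Y \<sigma> \<and> (\<forall>i\<in>verts Q. \<forall>s\<in>carrier (vspace S i). \<pi> i (\<sigma> i s) = s))"

text \<open>The class of the extension \<open>(Z, \<kappa>, \<rho>)\<close> is \<open>c\<close> times the class of \<open>(Y, \<iota>, \<pi>)\<close>, that is, the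
  former is the pushout of the latter along multiplication by \<open>c\<close> on \<open>X\<close>; equivalently there is a
  morphism of short exact sequences which is \<open>c\<close> on \<open>X\<close> and the identity on \<open>S\<close>.\<close>

definition extension_multiple ::
  "('v, 'a) pre_digraph \<Rightarrow> ('v, 'a, 'k::field, 'x) rep \<Rightarrow> 'k \<Rightarrow>
     ('v, 'a, 'k, 'y) rep \<Rightarrow> ('v \<Rightarrow> 'x \<Rightarrow> 'y) \<Rightarrow> ('v \<Rightarrow> 'y \<Rightarrow> 's) \<Rightarrow>
     ('v, 'a, 'k, 'z) rep \<Rightarrow> ('v \<Rightarrow> 'x \<Rightarrow> 'z) \<Rightarrow> ('v \<Rightarrow> 'z \<Rightarrow> 's) \<Rightarrow> bool" where
  "extension_multiple Q X c Y \<iota> \<pi> Z \<kappa> \<rho> \<longleftrightarrow>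
     (\<exists>h. rep_hom Q Y Z h \<and>
        (\<forall>i\<in>verts Q.
          (\<forall>x\<in>carrier (vspace X i). h i (\<iota> i x) = \<kappa> i (c \<odot>\<^bsub>vspace X i\<^esub> x)) \<and>
          (\<forall>y\<in>carrier (vspace Y i). \<rho> i (h i y) = \<pi> i y)))"

text \<open>\<open>Ext\<^sup>1\<close> is understood in the sense of Yoneda.  Since a type variable cannot be quantified
  inside a definition, the middle terms range over representations on the type \<open>'x \<times> 's\<close>: this
  loses nothing, because the middle term of any extension of \<open>S\<close> by \<open>X\<close> is vertexwise in bijection
  with \<open>X i \<times> S i\<close>, so every extension is equivalent to one of this kind.\<close>

definition Ext1_vanishes ::
  "('v, 'a) pre_digraph \<Rightarrow> ('v, 'a, 'k::field, 's) rep \<Rightarrow> ('v, 'a, 'k, 'x) rep \<Rightarrow> bool" where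
  "Ext1_vanishes Q S X \<longleftrightarrow>
     (\<forall>(Z :: ('v, 'a, 'k, 'x \<times> 's) rep) \<kappa> \<rho>. extension Q S X Z \<kappa> \<rho> \<longrightarrow> split_extension Q S Z \<rho>)"

definition generating_extension ::
  "('v, 'a) pre_digraph \<Rightarrow> ('v, 'a, 'k::field, 's) rep \<Rightarrow> ('v, 'a, 'k, 'x) rep \<Rightarrow>
     ('v, 'a, 'k, 'y) rep \<Rightarrow> ('v \<Rightarrow> 'x \<Rightarrow> 'y) \<Rightarrow> ('v \<Rightarrow> 'y \<Rightarrow> 's) \<Rightarrow> bool" where
  "generating_extension Q S X Y \<iota> \<pi> \<longleftrightarrow>
     extension Q S X Y \<iota> \<pi> \<and>
     (\<forall>(Z :: ('v, 'a, 'k, 'x \<times> 's) rep) \<kappa> \<rho>. extension Q S X Z \<kappa> \<rho> \<longrightarrow>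
        (\<exists>c. extension_multiple Q X c Y \<iota> \<pi> Z \<kappa> \<rho>))"


section \<open>Varieties as spaces with functions\<close>

text \<open>A variety over \<open>'k\<close> is given by its set of (closed) points with the Zariski topology and by
  its regular \<open>'k\<close>-valued functions on open sets.  Functions are total, but only the values on the
  open set in question matter.\<close>

record ('p, 'k) kspace =
  zariski :: "'p topology"
  regular :: "'p set \<Rightarrow> ('p \<Rightarrow> 'k) set"

abbreviation points :: "('p, 'k) kspace \<Rightarrow> 'p set" where
  "points A \<equiv> topspace (zariski A)"

definition morphism :: "('p, 'k) kspace \<Rightarrow> ('q, 'k) kspace \<Rightarrow> ('p \<Rightarrow> 'q) \<Rightarrow> bool" where
  "morphism A B \<phi> \<longleftrightarrow>
     continuous_map (zariski A) (zariski B) \<phi> \<and>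
     (\<forall>V f. openin (zariski B) V \<longrightarrow> f \<in> regular B V \<longrightarrow>
        f \<circ> \<phi> \<in> regular A {x \<in> points A. \<phi> x \<in> V})"

definition isomorphism :: "('p, 'k) kspace \<Rightarrow> ('q, 'k) kspace \<Rightarrow> ('p \<Rightarrow> 'q) \<Rightarrow> bool" where
  "isomorphism A B \<phi> \<longleftrightarrow>
     morphism A B \<phi> \<and>
     (\<exists>\<psi>. morphism B A \<psi> \<and> (\<forall>x\<in>points A. \<psi> (\<phi> x) = x) \<and> (\<forall>y\<in>points B. \<phi> (\<psi> y) = y))"

definition restrict_kspace :: "('p, 'k) kspace \<Rightarrow> 'p set \<Rightarrow> ('p, 'k) kspace" where
  "restrict_kspace A T =
     \<lparr>zariski = subtopology (zariski A) T,
      regular = (\<lambda>V. {f. \<forall>x\<in>V. \<exists>U g. openin (zariski A) U \<and> x \<in> U \<and> g \<in> regular A U \<and>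
                          (\<forall>y\<in>U \<inter> V. f y = g y)})\<rparr>"

text \<open>The space with point set \<open>P\<close> whose regular functions are locally the fractions \<open>a / b\<close> with
  \<open>(a, b) \<in> F\<close>, and whose open sets are generated by the sets where such a \<open>b\<close> does not vanish.\<close>

definition fraction_space ::
  "'p set \<Rightarrow> (('p \<Rightarrow> 'k::field) \<times> ('p \<Rightarrow> 'k)) set \<Rightarrow> ('p, 'k) kspace" where
  "fraction_space P F =
     (let T = topology_generated_by {{x \<in> P. b x \<noteq> 0} | a b. (a, b) \<in> F}
      in \<lparr>zariski = T,
          regular = (\<lambda>U. {f. \<forall>x\<in>U. \<exists>V. openin T V \<and> x \<in> V \<and> V \<subseteq> U \<and>
                       (\<exists>(a, b)\<in>F. \<forall>y\<in>V. b y \<noteq> 0 \<and> f y = a y / b y)})\<rparr>)"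

inductive_set function_algebra :: "('p \<Rightarrow> 'k::field) set \<Rightarrow> ('p \<Rightarrow> 'k) set"
  for G :: "('p \<Rightarrow> 'k) set" where
  const: "(\<lambda>_. c) \<in> function_algebra G"
| generator: "f \<in> G \<Longrightarrow> f \<in> function_algebra G"
| add: "f \<in> function_algebra G \<Longrightarrow> g \<in> function_algebra G \<Longrightarrow>
    (\<lambda>x. f x + g x) \<in> function_algebra G"
| mult: "f \<in> function_algebra G \<Longrightarrow> g \<in> function_algebra G \<Longrightarrow>
    (\<lambda>x. f x * g x) \<in> function_algebra G"

definition affine_space :: "nat \<Rightarrow> ('k::field vec, 'k) kspace" where
  "affine_space n =
     (let P = function_algebra {\<lambda>v. v $ i | i. i < n}
      in fraction_space (carrier_vec n) (P \<times> P))"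

text \<open>Product of varieties: locally on \<open>U \<times> V\<close> the regular functions are the fractions of functions
  of the form \<open>\<Sum>\<^sub>j f\<^sub>j (x) g\<^sub>j (y)\<close> with \<open>f\<^sub>j\<close> regular on \<open>U\<close> and \<open>g\<^sub>j\<close> regular on \<open>V\<close>.  These
  functions are extended by zero outside \<open>U \<times> V\<close>, so that their non-vanishing loci are open.\<close>

definition product_functions ::
  "('p, 'k::field) kspace \<Rightarrow> ('q, 'k) kspace \<Rightarrow> 'p set \<Rightarrow> 'q set \<Rightarrow> ('p \<times> 'q \<Rightarrow> 'k) set" where
  "product_functions A B U V =
     {\<lambda>z. if z \<in> U \<times> V then h z else 0 | h.
        h \<in> function_algebra ({f \<circ> fst | f. f \<in> regular A U} \<union> {g \<circ> snd | g. g \<in> regular B V})}"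

definition product_kspace ::
  "('p, 'k::field) kspace \<Rightarrow> ('q, 'k) kspace \<Rightarrow> ('p \<times> 'q, 'k) kspace" where
  "product_kspace A B =
     fraction_space (points A \<times> points B)
       (\<Union>U\<in>{U. openin (zariski A) U}. \<Union>V\<in>{V. openin (zariski B) V}.
          product_functions A B U V \<times> product_functions A B U V)"

text \<open>An affine bundle of rank \<open>r\<close>: Zariski-locally over the base isomorphic to the projection
  \<open>U \<times> \<bbbA>\<^sup>r \<rightarrow> U\<close>, with transition maps which are affine-linear in the fibres.  The rank is an
  integer because it will be a value of the Euler form; a negative rank is only possible over the
  empty base.\<close>

definition bundle_chart ::
  "('e, 'k::field) kspace \<Rightarrow> ('b, 'k) kspace \<Rightarrow> ('e \<Rightarrow> 'b) \<Rightarrow> nat \<Rightarrow>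
     'b set \<Rightarrow> ('e \<Rightarrow> 'b \<times> 'k vec) \<Rightarrow> bool" where
  "bundle_chart E B p n U \<phi> \<longleftrightarrow>
     openin (zariski B) U \<and>
     isomorphism (restrict_kspace E {x \<in> points E. p x \<in> U})
       (product_kspace (restrict_kspace B U) (affine_space n)) \<phi> \<and>
     (\<forall>x\<in>points E. p x \<in> U \<longrightarrow> fst (\<phi> x) = p x)"

definition affine_bundle ::
  "('e, 'k::field) kspace \<Rightarrow> ('b, 'k) kspace \<Rightarrow> ('e \<Rightarrow> 'b) \<Rightarrow> int \<Rightarrow> bool" where
  "affine_bundle E B p r \<longleftrightarrow>
     morphism E B p \<and>
     (\<exists>\<A>. (\<Union>(U, \<phi>)\<in>\<A>. U) = points B \<and>
        (\<forall>(U, \<phi>)\<in>\<A>. \<exists>n. int n = r \<and> bundle_chart E B p n U \<phi>) \<and>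
        (\<forall>(U, \<phi>)\<in>\<A>. \<forall>(U', \<phi>')\<in>\<A>. \<forall>b\<in>U \<inter> U'.
           \<exists>A\<in>carrier_mat (nat r) (nat r). \<exists>c\<in>carrier_vec (nat r).
             \<forall>x\<in>points E. p x = b \<longrightarrow> snd (\<phi>' x) = A *\<^sub>v snd (\<phi> x) + c))"


section \<open>Quiver Grassmannians\<close>

definition linear_forms :: "('k::field, 'm) module \<Rightarrow> ('m \<Rightarrow> 'k) set" where
  "linear_forms V =
     module_hom class_ring V
       \<lparr>carrier = UNIV, mult = (*), one = 1, zero = 0, add = (+), smult = (*)\<rparr>"

definition is_frame ::
  "('v, 'a) pre_digraph \<Rightarrow> ('v, 'a, 'k::field, 'm) rep \<Rightarrow> ('v \<Rightarrow> 'm set) \<Rightarrow>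
     ('v \<Rightarrow> 'm list) \<Rightarrow> bool" where
  "is_frame Q M N b \<longleftrightarrow>
     (\<forall>i\<in>verts Q. distinct (b i) \<and>
        vectorspace.basis class_ring ((vspace M i)\<lparr>carrier := N i\<rparr>) (set (b i)))"

text \<open>Multihomogeneous polynomials in the Pluecker coordinates of the Grassmannians at the vertices,
  as functions of a frame \<open>b\<close>.  For linear forms \<open>l\<^sub>0, \<dots>, l\<^sub>e\<^sub>-\<^sub>1\<close> on \<open>M\<^sub>i\<close>, the Pluecker coordinate
  \<open>l\<^sub>0 \<and> \<dots> \<and> l\<^sub>e\<^sub>-\<^sub>1\<close> of the span of \<open>b\<^sub>0, \<dots>, b\<^sub>e\<^sub>-\<^sub>1\<close> is \<open>det (l\<^sub>r (b\<^sub>s))\<close>; choosing the forms among the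
  coordinates of a basis of \<open>M\<^sub>i\<close> one obtains the usual maximal minors.\<close>

inductive pluecker_poly ::
  "('v, 'a) pre_digraph \<Rightarrow> ('v, 'a, 'k::field, 'm) rep \<Rightarrow> ('v \<Rightarrow> nat) \<Rightarrow>
     ('v \<Rightarrow> nat) \<Rightarrow> (('v \<Rightarrow> 'm list) \<Rightarrow> 'k) \<Rightarrow> bool"
  for Q M e where
  const: "pluecker_poly Q M e (\<lambda>_. 0) (\<lambda>_. c)"
| coordinate: "i \<in> verts Q \<Longrightarrow> (\<And>r. r < e i \<Longrightarrow> l r \<in> linear_forms (vspace M i)) \<Longrightarrow>
    pluecker_poly Q M e (\<lambda>j. if j = i then 1 else 0)
      (\<lambda>b. det (mat (e i) (e i) (\<lambda>(r, s). l r (b i ! s))))"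
| add: "pluecker_poly Q M e d P \<Longrightarrow> pluecker_poly Q M e d P' \<Longrightarrow>
    pluecker_poly Q M e d (\<lambda>b. P b + P' b)"
| mult: "pluecker_poly Q M e d P \<Longrightarrow> pluecker_poly Q M e d' P' \<Longrightarrow>
    pluecker_poly Q M e (\<lambda>i. d i + d' i) (\<lambda>b. P b * P' b)"

definition quiver_grassmannian ::
  "('v, 'a) pre_digraph \<Rightarrow> ('v, 'a, 'k::field, 'm) rep \<Rightarrow> ('v \<Rightarrow> nat) \<Rightarrow> ('v \<Rightarrow> 'm set) set" where
  "quiver_grassmannian Q M e =
     {N \<in> subreps Q M. \<forall>i\<in>verts Q. dimvec (sub_rep M N) i = e i}"

text \<open>The structure of projective variety given by the Pluecker embeddings
  \<open>Gr\<^sub>e (M) \<subseteq> \<Prod>\<^sub>i Gr (e\<^sub>i, M\<^sub>i) \<subseteq> \<Prod>\<^sub>i \<bbbP> (\<Lambda>\<^sup>e\<^sup>i M\<^sub>i)\<close>: regular functions are locally fractions of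
  multihomogeneous polynomials of the same multidegree.  Neither their values nor the vanishing of
  the denominator depend on the chosen frame.\<close>

definition Gr ::
  "('v, 'a) pre_digraph \<Rightarrow> ('v, 'a, 'k::field, 'm) rep \<Rightarrow> ('v \<Rightarrow> nat) \<Rightarrow>
     ('v \<Rightarrow> 'm set, 'k) kspace" where
  "Gr Q M e =
     (let frame = (\<lambda>N. SOME b. is_frame Q M N b)
      in fraction_space (quiver_grassmannian Q M e)
           {(\<lambda>N. P (frame N), \<lambda>N. P' (frame N)) | P P' d.
              pluecker_poly Q M e d P \<and> pluecker_poly Q M e d P'})"


section \<open>The strata of the Grassmannian of an extension\<close>

definition preimage_rep ::
  "('v, 'a) pre_digraph \<Rightarrow> ('v, 'a, 'k, 'x) rep \<Rightarrow> ('v \<Rightarrow> 'x \<Rightarrow> 'y) \<Rightarrow>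
     ('v \<Rightarrow> 'y set) \<Rightarrow> 'v \<Rightarrow> 'x set" where
  "preimage_rep Q X \<iota> N = (\<lambda>i\<in>verts Q. {x \<in> carrier (vspace X i). \<iota> i x \<in> N i})"

definition image_rep ::
  "('v, 'a) pre_digraph \<Rightarrow> ('v \<Rightarrow> 'y \<Rightarrow> 's) \<Rightarrow> ('v \<Rightarrow> 'y set) \<Rightarrow> 'v \<Rightarrow> 's set" where
  "image_rep Q \<pi> N = (\<lambda>i\<in>verts Q. \<pi> i ` N i)"

definition stratum ::
  "('v, 'a) pre_digraph \<Rightarrow> ('v, 'a, 'k::field, 's) rep \<Rightarrow> ('v, 'a, 'k, 'x) rep \<Rightarrow>
     ('v, 'a, 'k, 'y) rep \<Rightarrow> ('v \<Rightarrow> 'x \<Rightarrow> 'y) \<Rightarrow> ('v \<Rightarrow> 'y \<Rightarrow> 's) \<Rightarrow>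
     ('v \<Rightarrow> nat) \<Rightarrow> ('v \<Rightarrow> nat) \<Rightarrow> ('v \<Rightarrow> 'y set) set" where
  "stratum Q S X Y \<iota> \<pi> f g =
     {N \<in> quiver_grassmannian Q Y (\<lambda>i. f i + g i). \<forall>i\<in>verts Q.
        dimvec (sub_rep X (preimage_rep Q X \<iota> N)) i = f i \<and>
        dimvec (sub_rep S (image_rep Q \<pi> N)) i = g i}"

definition Psi ::
  "('v, 'a) pre_digraph \<Rightarrow> ('v, 'a, 'k, 'x) rep \<Rightarrow> ('v \<Rightarrow> 'x \<Rightarrow> 'y) \<Rightarrow> ('v \<Rightarrow> 'y \<Rightarrow> 's) \<Rightarrow>
     ('v \<Rightarrow> 'y set) \<Rightarrow> ('v \<Rightarrow> 'x set) \<times> ('v \<Rightarrow> 's set)" where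
  "Psi Q X \<iota> \<pi> N = (preimage_rep Q X \<iota> N, image_rep Q \<pi> N)"

end

theory Submission
  imports Defs
begin

text \<open>
  Choose linear splittings \<open>Y\<^sub>i = X\<^sub>i \<oplus> S\<^sub>i\<close> at the vertices; the extension is
  then a cocycle \<open>\<xi>\<close>, a family of linear maps \<open>S\<^sub>i \<rightarrow> X\<^sub>j\<close> indexed by the arrows \<open>i \<rightarrow> j\<close>.  A family of
  subspaces \<open>N\<^sub>i \<subseteq> Y\<^sub>i\<close> with \<open>\<iota>\<^sup>-\<^sup>1 (N) = N'\<close> and \<open>\<pi> (N) = N''\<close> is the same as a family of linear maps
  \<open>\<phi>\<^sub>i : N''\<^sub>i \<rightarrow> X\<^sub>i / N'\<^sub>i\<close>, and it is stable under the arrows exactly if \<open>d \<phi> = \<xi>\<close>, where the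
  coboundary map
  \<open>d : \<Oplus>\<^sub>i Hom (N''\<^sub>i, X\<^sub>i / N'\<^sub>i) \<rightarrow> \<Oplus>\<^sub>i\<^sub>\<rightarrow>\<^sub>j Hom (N''\<^sub>i, X\<^sub>j / N'\<^sub>j)\<close>
  has cokernel \<open>Ext\<^sup>1 (N'', X / N')\<close>.  So the fibre over \<open>(N', N'')\<close> is the solution set of a system of
  linear equations.

  Every cocycle with values in \<open>X / N'\<close> on \<open>N''\<close> comes from a cocycle of \<open>S\<close> with values
  in \<open>X\<close>, hence is a multiple of \<open>\<xi>\<close> plus a coboundary because \<open>\<xi>\<close> is generating
  (\<open>generating_coordinates\<close>).  Therefore \<open>d \<phi> = \<xi>\<close> is solvable if and only if \<open>d\<close> is surjective, that
  is, if and only if \<open>Ext\<^sup>1 (N'', X / N') = 0\<close> (\<open>image_iff_surjective\<close>).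

  Near a given point, \<open>N'\<close>, \<open>N''\<close> and the quotients \<open>X\<^sub>i / N'\<^sub>i\<close> have bases depending
  regularly on the point, and \<open>d\<close> becomes a matrix of regular functions.  If \<open>d\<close> is surjective at the
  point, some maximal minor of this matrix does not vanish there.  Where the minor does not vanish, \<open>d\<close>
  stays surjective, so the image is open; moreover the unknowns outside the minor can be chosen
  freely and Cramer's rule expresses the remaining ones.  The free unknowns are the fibre coordinates
  of a chart.  Their number is the dimension of the source of \<open>d\<close> minus that of the target, which is the
  Euler form.  All charts describe the same \<open>\<phi>\<close> in different bases, so that their transition maps are
  affine-linear on the fibres.

  The geometry needed for this is contained in two facts, which describe morphisms to and from quiver
  Grassmannians through frames instead of Pluecker coordinates: a family of subrepresentations is a
  morphism as soon as it has local frames with regular entries (\<open>morphism_into_Gr\<close>), and the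
  subrepresentations parametrised by the Grassmannian itself have such frames, obtained by normalising
  with respect to linear forms (\<open>normal_frame_regular\<close>).

  The linear algebra is phrased throughout in terms of vectors and linear forms dual to each other
  (\<open>dual_basis\<close>, \<open>cobasis\<close>): to say that a frame is regular one has to evaluate linear forms
  on its vectors anyway, and identities between vectors become identities between numbers.
\<close>

section \<open>Vector spaces, linear forms and dual bases\<close>

abbreviation vsp :: "('k::field, 'm) module \<Rightarrow> bool" where
  "vsp V \<equiv> vectorspace class_ring V"

abbreviation lin :: "('k::field, 'm) module \<Rightarrow> ('k, 'n) module \<Rightarrow> ('m \<Rightarrow> 'n) \<Rightarrow> bool" where
  "lin V W h \<equiv> linear_map class_ring V W h"

abbreviation sub :: "'m set \<Rightarrow> ('k::field, 'm) module \<Rightarrow> bool" where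
  "sub N V \<equiv> VectorSpace.subspace class_ring N V"

lemma vsp_closed:
  assumes "vsp V"
  shows vsp_add: "x \<in> carrier V \<Longrightarrow> y \<in> carrier V \<Longrightarrow> x \<oplus>\<^bsub>V\<^esub> y \<in> carrier V"
    and vsp_smult: "x \<in> carrier V \<Longrightarrow> c \<odot>\<^bsub>V\<^esub> x \<in> carrier V"
    and vsp_zero: "\<zero>\<^bsub>V\<^esub> \<in> carrier V"
    and vsp_minus: "x \<in> carrier V \<Longrightarrow> y \<in> carrier V \<Longrightarrow> x \<ominus>\<^bsub>V\<^esub> y \<in> carrier V"
proof -
  interpret V: vectorspace class_ring V by fact
  show "x \<in> carrier V \<Longrightarrow> y \<in> carrier V \<Longrightarrow> x \<oplus>\<^bsub>V\<^esub> y \<in> carrier V"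
    and "x \<in> carrier V \<Longrightarrow> c \<odot>\<^bsub>V\<^esub> x \<in> carrier V"
    and "\<zero>\<^bsub>V\<^esub> \<in> carrier V"
    and "x \<in> carrier V \<Longrightarrow> y \<in> carrier V \<Longrightarrow> x \<ominus>\<^bsub>V\<^esub> y \<in> carrier V"
    by auto
qed

lemma linI:
  assumes "vsp V" "vsp W" "\<And>x. x \<in> carrier V \<Longrightarrow> h x \<in> carrier W"
    and "\<And>x y. x \<in> carrier V \<Longrightarrow> y \<in> carrier V \<Longrightarrow> h (x \<oplus>\<^bsub>V\<^esub> y) = h x \<oplus>\<^bsub>W\<^esub> h y"
    and "\<And>c x. x \<in> carrier V \<Longrightarrow> h (c \<odot>\<^bsub>V\<^esub> x) = c \<odot>\<^bsub>W\<^esub> h x"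
  shows "lin V W h"
  using assms unfolding linear_map_def mod_hom_def mod_hom_axioms_def module_hom_def
  by (auto simp: vectorspace_def)

lemma lin_facts:
  assumes "lin V W h"
  shows lin_dom: "vsp V" and lin_cod: "vsp W"
    and lin_closed: "x \<in> carrier V \<Longrightarrow> h x \<in> carrier W"
    and lin_add: "x \<in> carrier V \<Longrightarrow> y \<in> carrier V \<Longrightarrow> h (x \<oplus>\<^bsub>V\<^esub> y) = h x \<oplus>\<^bsub>W\<^esub> h y"
    and lin_smult: "x \<in> carrier V \<Longrightarrow> h (c \<odot>\<^bsub>V\<^esub> x) = c \<odot>\<^bsub>W\<^esub> h x"
    and lin_zero: "h \<zero>\<^bsub>V\<^esub> = \<zero>\<^bsub>W\<^esub>"
    and lin_minus: "x \<in> carrier V \<Longrightarrow> y \<in> carrier V \<Longrightarrow> h (x \<ominus>\<^bsub>V\<^esub> y) = h x \<ominus>\<^bsub>W\<^esub> h y"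
proof -
  interpret linear_map class_ring V W h by fact
  show "vsp V" "vsp W" by unfold_locales
  show "x \<in> carrier V \<Longrightarrow> h x \<in> carrier W"
    "x \<in> carrier V \<Longrightarrow> y \<in> carrier V \<Longrightarrow> h (x \<oplus>\<^bsub>V\<^esub> y) = h x \<oplus>\<^bsub>W\<^esub> h y"
    "x \<in> carrier V \<Longrightarrow> h (c \<odot>\<^bsub>V\<^esub> x) = c \<odot>\<^bsub>W\<^esub> h x"
    "h \<zero>\<^bsub>V\<^esub> = \<zero>\<^bsub>W\<^esub>"
    "x \<in> carrier V \<Longrightarrow> y \<in> carrier V \<Longrightarrow> h (x \<ominus>\<^bsub>V\<^esub> y) = h x \<ominus>\<^bsub>W\<^esub> h y"
    by auto
qed

lemma lin_comp: "lin V W h \<Longrightarrow> lin W U k \<Longrightarrow> lin V U (\<lambda>x. k (h x))"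
  by (rule linI) (auto simp: lin_facts)

lemma forms:
  assumes "l \<in> linear_forms V"
  shows form_add: "x \<in> carrier V \<Longrightarrow> y \<in> carrier V \<Longrightarrow> l (x \<oplus>\<^bsub>V\<^esub> y) = l x + l y"
    and form_smult: "x \<in> carrier V \<Longrightarrow> l (c \<odot>\<^bsub>V\<^esub> x) = c * l x"
  using assms unfolding linear_forms_def module_hom_def by auto

lemma formI:
  assumes "\<And>x y. x \<in> carrier V \<Longrightarrow> y \<in> carrier V \<Longrightarrow> l (x \<oplus>\<^bsub>V\<^esub> y) = l x + l y"
    and "\<And>c x. x \<in> carrier V \<Longrightarrow> l (c \<odot>\<^bsub>V\<^esub> x) = c * l x"
  shows "l \<in> linear_forms V"
  using assms unfolding linear_forms_def module_hom_def by auto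

lemma form_zero:
  assumes "vsp V" "l \<in> linear_forms V" shows "l \<zero>\<^bsub>V\<^esub> = 0"
proof -
  interpret V: vectorspace class_ring V by fact
  have "l (0 \<odot>\<^bsub>V\<^esub> \<zero>\<^bsub>V\<^esub>) = 0" using form_smult[OF assms(2), of "\<zero>\<^bsub>V\<^esub>" 0] by simp
  then show ?thesis by simp
qed

lemma form_minus:
  assumes "vsp V" "l \<in> linear_forms V" "x \<in> carrier V" "y \<in> carrier V"
  shows "l (x \<ominus>\<^bsub>V\<^esub> y) = l x - l y"
proof -
  interpret V: vectorspace class_ring V by fact
  have "l x = l ((x \<ominus>\<^bsub>V\<^esub> y) \<oplus>\<^bsub>V\<^esub> y)"
    using assms by (simp add: V.M.minus_eq V.M.a_assoc V.M.l_neg)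
  also have "\<dots> = l (x \<ominus>\<^bsub>V\<^esub> y) + l y" using assms by (intro form_add) auto
  finally show ?thesis by simp
qed

lemma form_comp: "lin V W h \<Longrightarrow> l \<in> linear_forms W \<Longrightarrow> (\<lambda>x. l (h x)) \<in> linear_forms V"
  by (rule formI) (auto simp: lin_facts forms)

lemma form_lincomb:
  assumes "\<And>s. s \<in> A \<Longrightarrow> l s \<in> linear_forms V"
  shows "(\<lambda>x. \<Sum>s\<in>A. c s * l s x) \<in> linear_forms V"
  by (rule formI) (auto simp: forms[OF assms] sum.distrib sum_distrib_left algebra_simps)

lemma form_diff:
  "l \<in> linear_forms V \<Longrightarrow> l' \<in> linear_forms V \<Longrightarrow> (\<lambda>x. l x - l' x) \<in> linear_forms V"
  by (rule formI) (auto simp: forms algebra_simps)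

lemma form_restrict: "l \<in> linear_forms V \<Longrightarrow> N \<subseteq> carrier V \<Longrightarrow> l \<in> linear_forms (V\<lparr>carrier := N\<rparr>)"
  by (rule formI) (auto simp: forms subset_iff)

lemma subs:
  assumes "sub N V"
  shows sub_vsp: "vsp V" and sub_subset: "N \<subseteq> carrier V" and sub_in: "x \<in> N \<Longrightarrow> x \<in> carrier V"
    and sub_zero: "\<zero>\<^bsub>V\<^esub> \<in> N"
    and sub_add: "x \<in> N \<Longrightarrow> y \<in> N \<Longrightarrow> x \<oplus>\<^bsub>V\<^esub> y \<in> N"
    and sub_smult: "x \<in> N \<Longrightarrow> c \<odot>\<^bsub>V\<^esub> x \<in> N"
    and sub_minus: "x \<in> N \<Longrightarrow> y \<in> N \<Longrightarrow> x \<ominus>\<^bsub>V\<^esub> y \<in> N"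
    and sub_is_vsp: "vsp (V\<lparr>carrier := N\<rparr>)"
proof -
  show V: "vsp V" using assms by (simp add: VectorSpace.subspace_def)
  interpret V: vectorspace class_ring V by fact
  have s: "submodule class_ring N V" using assms by (simp add: VectorSpace.subspace_def)
  interpret s: submodule class_ring N V by fact
  show N: "N \<subseteq> carrier V" by (rule s.subset)
  show "x \<in> N \<Longrightarrow> x \<in> carrier V" using N by auto
  show "\<zero>\<^bsub>V\<^esub> \<in> N" using s unfolding submodule_def by auto
  show ad: "x \<in> N \<Longrightarrow> y \<in> N \<Longrightarrow> x \<oplus>\<^bsub>V\<^esub> y \<in> N" for x y by simp
  show sm: "x \<in> N \<Longrightarrow> c \<odot>\<^bsub>V\<^esub> x \<in> N" for x c by simp
  show "x \<in> N \<Longrightarrow> y \<in> N \<Longrightarrow> x \<ominus>\<^bsub>V\<^esub> y \<in> N"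
  proof -
    assume xy: "x \<in> N" "y \<in> N"
    then have "x \<oplus>\<^bsub>V\<^esub> (-1) \<odot>\<^bsub>V\<^esub> y \<in> N" using ad sm by auto
    moreover have "(-1) \<odot>\<^bsub>V\<^esub> y = \<ominus>\<^bsub>V\<^esub> y"
    proof -
      have y: "y \<in> carrier V" using xy N by blast
      have "(-1) \<odot>\<^bsub>V\<^esub> y \<oplus>\<^bsub>V\<^esub> 1 \<odot>\<^bsub>V\<^esub> y = (-1 + 1) \<odot>\<^bsub>V\<^esub> y"
        by (rule V.smult_l_distr[simplified, symmetric]) (rule y)
      also have "\<dots> = \<zero>\<^bsub>V\<^esub>" unfolding left_minus by (rule V.lmult_0[simplified, OF y])
      also have "1 \<odot>\<^bsub>V\<^esub> y = y" by (rule V.smult_one[simplified, OF y])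
      finally have "\<ominus>\<^bsub>V\<^esub> y = (-1) \<odot>\<^bsub>V\<^esub> y"
        by (rule V.M.minus_equality) (use y in \<open>auto intro: V.smult_closed\<close>)
      then show ?thesis by (rule sym)
    qed
    ultimately show ?thesis by (simp add: a_minus_def)
  qed
  show "vsp (V\<lparr>carrier := N\<rparr>)" by (rule V.subspace_is_vs[OF assms])
qed

lemma subI:
  assumes "vsp V" "N \<subseteq> carrier V" "\<zero>\<^bsub>V\<^esub> \<in> N"
    and "\<And>x y. x \<in> N \<Longrightarrow> y \<in> N \<Longrightarrow> x \<oplus>\<^bsub>V\<^esub> y \<in> N"
    and "\<And>c x. x \<in> N \<Longrightarrow> c \<odot>\<^bsub>V\<^esub> x \<in> N"
  shows "sub N V"
  using assms unfolding VectorSpace.subspace_def submodule_def by (auto simp: vectorspace_def)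

lemma sub_carrier: "vsp V \<Longrightarrow> sub (carrier V) V"
  by (rule subI) (auto simp: vsp_closed)

lemma vsp_diff_zero:
  assumes "vsp V" "x \<in> carrier V" "y \<in> carrier V" "x \<ominus>\<^bsub>V\<^esub> y = \<zero>\<^bsub>V\<^esub>" shows "x = y"
proof -
  interpret V: vectorspace class_ring V by fact
  show ?thesis using assms by simp
qed

lemma lin_restrict: "lin V W h \<Longrightarrow> sub N V \<Longrightarrow> lin (V\<lparr>carrier := N\<rparr>) W h"
  by (rule linI) (auto simp: lin_facts sub_is_vsp sub_in)

lemma lin_corestrict:
  "lin V W h \<Longrightarrow> sub N W \<Longrightarrow> (\<And>x. x \<in> carrier V \<Longrightarrow> h x \<in> N) \<Longrightarrow> lin V (W\<lparr>carrier := N\<rparr>) h"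
  by (rule linI) (auto simp: lin_facts sub_is_vsp sub_in)

lemma lin_preimage_sub: "lin V W h \<Longrightarrow> sub N W \<Longrightarrow> sub {x \<in> carrier V. h x \<in> N} V"
  by (rule subI) (auto simp: lin_facts subs vsp_closed)

lemma lin_image_sub:
  assumes h: "lin V W h" and N: "sub N V" shows "sub (h ` N) W"
proof (rule subI)
  show "vsp W" "h ` N \<subseteq> carrier W" using h sub_in[OF N] by (auto simp: lin_facts)
  show "\<zero>\<^bsub>W\<^esub> \<in> h ` N" using lin_zero[OF h] sub_zero[OF N] by force
  fix x y c assume "x \<in> h ` N"
  then obtain x' where x: "x' \<in> N" "x = h x'" by auto
  show "c \<odot>\<^bsub>W\<^esub> x \<in> h ` N"
    using x lin_smult[OF h, of x' c] sub_smult[OF N x(1), of c] sub_in[OF N] by force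
  assume "y \<in> h ` N"
  then obtain y' where y: "y' \<in> N" "y = h y'" by auto
  show "x \<oplus>\<^bsub>W\<^esub> y \<in> h ` N"
    using x y lin_add[OF h, of x' y'] sub_add[OF N x(1) y(1)] sub_in[OF N] by force
qed

text \<open>Linear combinations by recursion rather than as sums over the carrier: the value does not change
  when the carrier is replaced by a subspace.\<close>
primrec comb :: "('k, 'm) module \<Rightarrow> nat \<Rightarrow> (nat \<Rightarrow> 'k) \<Rightarrow> (nat \<Rightarrow> 'm) \<Rightarrow> 'm" where
  "comb V 0 c b = \<zero>\<^bsub>V\<^esub>"
| "comb V (Suc n) c b = comb V n c b \<oplus>\<^bsub>V\<^esub> c n \<odot>\<^bsub>V\<^esub> b n"

lemma comb_carrier_update: "comb (V\<lparr>carrier := N\<rparr>) n c b = comb V n c b"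
  by (induction n) auto

lemma comb_closed: "sub N V \<Longrightarrow> (\<And>s. s < n \<Longrightarrow> b s \<in> N) \<Longrightarrow> comb V n c b \<in> N"
  by (induction n) (auto simp: subs)

lemma comb_in: "vsp V \<Longrightarrow> (\<And>s. s < n \<Longrightarrow> b s \<in> carrier V) \<Longrightarrow> comb V n c b \<in> carrier V"
  using comb_closed[OF sub_carrier] .

lemma form_comb:
  assumes "vsp V" "l \<in> linear_forms V"
  shows "(\<And>s. s < n \<Longrightarrow> b s \<in> carrier V) \<Longrightarrow> l (comb V n c b) = (\<Sum>s<n. c s * l (b s))"
  by (induction n) (auto simp: assms form_zero forms[OF assms(2)] comb_in vsp_closed)

lemma lin_comb:
  assumes "lin V W h"
  shows "(\<And>s. s < n \<Longrightarrow> b s \<in> carrier V) \<Longrightarrow> h (comb V n c b) = comb W n c (\<lambda>s. h (b s))"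
  by (induction n) (auto simp: assms lin_facts[OF assms] comb_in vsp_closed)

lemma comb_lin:
  assumes V: "vsp V" and W: "vsp W" and l: "\<And>s. s < n \<Longrightarrow> l s \<in> linear_forms V"
    and w: "\<And>s. s < n \<Longrightarrow> w s \<in> carrier W"
  shows "lin V W (\<lambda>x. comb W n (\<lambda>s. l s x) w)"
proof -
  interpret W: vectorspace class_ring W by fact
  have "m \<le> n \<Longrightarrow> lin V W (\<lambda>x. comb W m (\<lambda>s. l s x) w)" for m
  proof (induction m)
    case 0
    show ?case using V W by (intro linI) (auto intro: W.smult_r_null)
  next
    case (Suc m)
    then have IH: "lin V W (\<lambda>x. comb W m (\<lambda>s. l s x) w)" and m: "m < n" by auto
    have c: "comb W m (\<lambda>s. l s x) w \<in> carrier W" for x using w m W by (intro comb_in) auto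
    show ?case
      using lin_add[OF IH] lin_smult[OF IH] w[OF m] c
      by (intro linI V W) (auto simp: forms[OF l[OF m]] W.smult_l_distr[simplified] W.smult_r_distr[simplified]
           W.M.a_ac W.smult_assoc1[simplified])
  qed
  then show ?thesis by simp
qed

text \<open>The forms live on the ambient space \<open>V\<close>, the vectors span the subspace \<open>N\<close>.  The same forms can
  thus serve for all subspaces near a given one, which is how charts of Grassmannians arise.\<close>
definition dual_basis ::
  "('k::field, 'm) module \<Rightarrow> 'm set \<Rightarrow> nat \<Rightarrow> (nat \<Rightarrow> 'm) \<Rightarrow> (nat \<Rightarrow> 'm \<Rightarrow> 'k) \<Rightarrow> bool" where
  "dual_basis V N n b l \<longleftrightarrow>
     (\<forall>s<n. b s \<in> N) \<and> (\<forall>r<n. l r \<in> linear_forms V) \<and>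
     (\<forall>r<n. \<forall>s<n. l r (b s) = (if r = s then 1 else 0)) \<and>
     (\<forall>x\<in>N. (\<forall>r<n. l r x = 0) \<longrightarrow> x = \<zero>\<^bsub>V\<^esub>)"

lemma dual_basisD:
  assumes "dual_basis V N n b l"
  shows dual_basis_in: "s < n \<Longrightarrow> b s \<in> N"
    and dual_basis_form: "r < n \<Longrightarrow> l r \<in> linear_forms V"
    and dual_basis_delta: "r < n \<Longrightarrow> s < n \<Longrightarrow> l r (b s) = (if r = s then 1 else 0)"
    and dual_basis_zero: "x \<in> N \<Longrightarrow> (\<And>r. r < n \<Longrightarrow> l r x = 0) \<Longrightarrow> x = \<zero>\<^bsub>V\<^esub>"
  using assms unfolding dual_basis_def by auto

lemma dual_basis_eq:
  assumes b: "dual_basis V N n b l" and N: "sub N V" and xy: "x \<in> N" "y \<in> N"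
    and e: "\<And>r. r < n \<Longrightarrow> l r x = l r y"
  shows "x = y"
proof -
  have "x \<ominus>\<^bsub>V\<^esub> y = \<zero>\<^bsub>V\<^esub>"
    using b xy N e
    by (intro dual_basis_zero[OF b]) (auto simp: subs form_minus dual_basis_form)
  then show ?thesis using vsp_diff_zero[OF sub_vsp[OF N]] xy N by (auto simp: subs)
qed

lemma dual_basis_expand:
  assumes b: "dual_basis V N n b l" and N: "sub N V" and x: "x \<in> N"
  shows "x = comb V n (\<lambda>s. l s x) b"
proof (rule dual_basis_eq[OF b N x])
  show "comb V n (\<lambda>s. l s x) b \<in> N" using N dual_basis_in[OF b] by (rule comb_closed)
  fix r assume r: "r < n"
  have "l r (comb V n (\<lambda>s. l s x) b) = (\<Sum>s<n. l s x * l r (b s))"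
    using r N by (intro form_comb) (auto simp: subs dual_basis_form[OF b] dual_basis_in[OF b])
  also have "\<dots> = (\<Sum>s<n. if s = r then l r x else 0)"
    using r by (intro sum.cong) (auto simp: dual_basis_delta[OF b])
  finally show "l r x = l r (comb V n (\<lambda>s. l s x) b)" using r by simp
qed

lemma form_expand:
  assumes b: "dual_basis V N n b l" and N: "sub N V" and x: "x \<in> N"
    and k: "k \<in> linear_forms (V\<lparr>carrier := N\<rparr>)"
  shows "k x = (\<Sum>s<n. l s x * k (b s))"
proof -
  have "k x = k (comb (V\<lparr>carrier := N\<rparr>) n (\<lambda>s. l s x) b)"
    using dual_basis_expand[OF b N x] by (simp add: comb_carrier_update)
  also have "\<dots> = (\<Sum>s<n. l s x * k (b s))"
    using dual_basis_in[OF b] by (intro form_comb k sub_is_vsp[OF N]) auto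
  finally show ?thesis .
qed

lemma form_expand':
  assumes "dual_basis V N n b l" "sub N V" "x \<in> N" "k \<in> linear_forms V"
  shows "k x = (\<Sum>s<n. l s x * k (b s))"
  using form_expand[OF assms(1-3) form_restrict[OF assms(4) sub_subset[OF assms(2)]]] .

lemma form_finite_lincomb:
  assumes "vsp V" "l \<in> linear_forms V" "finite A" "A \<subseteq> carrier V"
  shows "l (LinearCombinations.module.lincomb V a A) = (\<Sum>v\<in>A. a v * l v)"
  using assms(3,4)
proof (induction A)
  interpret V: vectorspace class_ring V by fact
  case empty
  show ?case using form_zero[OF assms(1,2)] by (simp add: V.lincomb_def)
next
  interpret V: vectorspace class_ring V by fact
  case (insert v A)
  have "V.lincomb a (A \<union> {v}) = a v \<odot>\<^bsub>V\<^esub> v \<oplus>\<^bsub>V\<^esub> V.lincomb a A"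
    using insert by (intro V.lincomb_insert) auto
  moreover have "V.lincomb a A \<in> carrier V" using insert by (intro V.lincomb_closed) auto
  ultimately show ?case using insert by (simp add: forms[OF assms(2)])
qed

text \<open>The number of vectors in a dual basis is the dimension, because the forms are the coordinates of a
  linear combination and separate points.\<close>
lemma dual_basis_is_basis:
  assumes V: "vsp V" and b: "dual_basis V (carrier V) n b l"
  shows "inj_on b {..<n}" and "vectorspace.basis class_ring V (b ` {..<n})"
proof -
  interpret V: vectorspace class_ring V by fact
  show inj: "inj_on b {..<n}"
    by (rule inj_onI) (metis b dual_basis_delta lessThan_iff zero_neq_one)
  let ?A = "b ` {..<n}"
  have A: "?A \<subseteq> carrier V" "finite ?A" using dual_basis_in[OF b] by auto
  have coord: "l r (V.lincomb a ?A) = a (b r)" if r: "r < n" for r a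
  proof -
    have "l r (V.lincomb a ?A) = (\<Sum>v\<in>?A. a v * l r v)"
      by (rule form_finite_lincomb[OF V dual_basis_form[OF b r] A(2,1)])
    also have "\<dots> = (\<Sum>s<n. a (b s) * l r (b s))" by (simp add: sum.reindex[OF inj])
    also have "\<dots> = (\<Sum>s<n. if s = r then a (b r) else 0)"
      using r by (intro sum.cong) (auto simp: dual_basis_delta[OF b])
    finally show ?thesis using r by simp
  qed
  have li: "V.lin_indpt ?A"
  proof (rule V.finite_lin_indpt2[OF A(2,1)])
    fix a assume "V.lincomb a ?A = \<zero>\<^bsub>V\<^esub>"
    then have "a (b r) = 0" if "r < n" for r
      using coord[OF that, of a] form_zero[OF V dual_basis_form[OF b that]] by simp
    then show "\<forall>v\<in>?A. a v = \<zero>\<^bsub>class_ring\<^esub>" by auto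
  qed
  have "V.span ?A = carrier V"
  proof (rule equalityI)
    show "V.span ?A \<subseteq> carrier V" using A by (intro V.span_is_subset2)
    show "carrier V \<subseteq> V.span ?A"
    proof
      fix x assume x: "x \<in> carrier V"
      let ?a = "\<lambda>v. l (the_inv_into {..<n} b v) x"
      have "x = V.lincomb ?a ?A"
      proof (rule dual_basis_eq[OF b sub_carrier[OF V] x])
        show "V.lincomb ?a ?A \<in> carrier V" using A by (intro V.lincomb_closed) auto
        show "l r x = l r (V.lincomb ?a ?A)" if "r < n" for r
          using that coord[OF that, of ?a] by (simp add: the_inv_into_f_f[OF inj])
      qed
      then show "x \<in> V.span ?A" unfolding V.finite_span[OF A(2,1)] by auto
    qed
  qed
  then show "V.basis ?A" using li A unfolding V.basis_def by auto
qed

lemma dual_basis_dim: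
  assumes V: "vsp V" and b: "dual_basis V (carrier V) n b l"
  shows "vectorspace.dim class_ring V = n" and "vectorspace.fin_dim class_ring V"
proof -
  interpret V: vectorspace class_ring V by fact
  note * = dual_basis_is_basis[OF assms]
  show "V.dim = n" using V.dim_basis[OF _ *(2)] card_image[OF *(1)] by simp
  show "V.fin_dim" using *(2) unfolding V.fin_dim_def V.basis_def by blast
qed

lemma dual_basis_restrict:
  assumes "dual_basis V N n b l" "sub N V"
  shows "dual_basis (V\<lparr>carrier := N\<rparr>) N n b l"
  using assms form_restrict[OF _ sub_subset[OF assms(2)]] unfolding dual_basis_def by auto

lemma dual_basis_sub_dim:
  assumes "sub N V" "dual_basis V N n b l"
  shows "vectorspace.dim class_ring (V\<lparr>carrier := N\<rparr>) = n"
    and "vectorspace.fin_dim class_ring (V\<lparr>carrier := N\<rparr>)"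
  using dual_basis_dim[OF sub_is_vsp[OF assms(1)]] dual_basis_restrict[OF assms(2,1)] by auto

lemma nth_image_lt: "(!) xs ` {..<length xs} = set xs"
  by (auto simp: set_conv_nth)

text \<open>The forms dual to a basis are the coordinates, which are unique and hence linear.  Coordinates from the
  \<open>m\<close>-th on vanish on the span of the first \<open>m\<close> vectors; this will cut out a subspace.\<close>
lemma basis_dual_basis:
  fixes V :: "('k::field, 'm) module"
  assumes V: "vsp V" and A: "vectorspace.basis class_ring V (b ` {..<n})" and inj: "inj_on b {..<n}"
  obtains l where "dual_basis V (carrier V) n b l"
    and "\<And>x m. x \<in> LinearCombinations.module.span class_ring V (b ` {..<m}) \<Longrightarrow> m \<le> n \<Longrightarrow>
        (\<forall>r. m \<le> r \<longrightarrow> r < n \<longrightarrow> l r x = 0)"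
proof -
  interpret V: vectorspace class_ring V by fact
  let ?A = "b ` {..<n}"
  have Ac: "?A \<subseteq> carrier V" "finite ?A" using A by (auto simp: V.basis_def)
  have ex1: "\<exists>!a. a \<in> ?A \<rightarrow>\<^sub>E UNIV \<and> V.lincomb a ?A = x" if "x \<in> carrier V" for x
    using V.basis_criterion[OF Ac(2,1)] A that by auto
  define co where "co x = (THE a. a \<in> ?A \<rightarrow>\<^sub>E UNIV \<and> V.lincomb a ?A = x)" for x
  have co: "co x \<in> ?A \<rightarrow>\<^sub>E UNIV" "V.lincomb (co x) ?A = x" if "x \<in> carrier V" for x
    using theI'[OF ex1[OF that]] unfolding co_def by auto
  have co_eq: "co x v = a v" if "x = V.lincomb a ?A" "v \<in> ?A" for x a v
  proof -
    have x: "x \<in> carrier V" using that Ac by auto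
    have "V.lincomb (restrict a ?A) ?A = V.lincomb a ?A" using Ac by (intro V.lincomb_cong) auto
    then have "restrict a ?A = co x" using ex1[OF x] co[OF x] that by (metis restrict_PiE_iff UNIV_I)
    then show ?thesis using that by (metis restrict_apply')
  qed
  define l where "l r x = co x (b r)" for r x
  have l_lincomb: "l r (V.lincomb a ?A) = a (b r)" if "r < n" for r a
    using co_eq[of "V.lincomb a ?A" a "b r"] that by (auto simp: l_def)
  have single: "b s = V.lincomb (\<lambda>v. if v = b s then 1 else 0) ?A" if "s < n" for s
  proof -
    have "b s \<in> V.span ?A" using that by (intro V.span_mem Ac(1)) auto
    have "V.lincomb (\<lambda>v. if v = b s then 1 else 0) ?A
        = (\<Oplus>\<^bsub>V\<^esub>v\<in>?A. if b s = v then b s else \<zero>\<^bsub>V\<^esub>)"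
      unfolding V.lincomb_def using Ac
      by (intro V.M.finsum_cong') (auto simp: subset_iff V.lmult_0[simplified] V.smult_one[simplified])
    also have "\<dots> = b s" using Ac that by (intro V.M.add.finprod_singleton) auto
    finally show ?thesis by simp
  qed
  have db: "dual_basis V (carrier V) n b l"
    unfolding dual_basis_def
  proof (intro conjI allI impI ballI)
    show "b s \<in> carrier V" if "s < n" for s using Ac that by auto
    show "l r (b s) = (if r = s then 1 else 0)" if "r < n" "s < n" for r s
      using l_lincomb[OF that(1), of "\<lambda>v. if v = b s then 1 else 0"] single[OF that(2)] that inj
      by (auto simp: inj_on_eq_iff)
    show "x = \<zero>\<^bsub>V\<^esub>" if "x \<in> carrier V" "\<forall>r<n. l r x = 0" for x
    proof -
      have "V.lincomb (co x) ?A = V.lincomb (\<lambda>_. 0) ?A"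
        using Ac that by (intro V.lincomb_cong) (auto simp: l_def)
      also have "\<dots> = \<zero>\<^bsub>V\<^esub>" using Ac by (intro V.lincomb_zero) auto
      finally show ?thesis using co[OF that(1)] by simp
    qed
    fix r assume r: "r < n"
    show "l r \<in> linear_forms V"
    proof (rule formI)
      fix x y assume xy: "x \<in> carrier V" "y \<in> carrier V"
      have "x \<oplus>\<^bsub>V\<^esub> y = V.lincomb (\<lambda>v. co x v + co y v) ?A"
        using V.lincomb_sum[OF Ac(2,1), of "co x" "co y"] co xy by simp
      then show "l r (x \<oplus>\<^bsub>V\<^esub> y) = l r x + l r y" using l_lincomb[OF r] by (simp add: l_def)
    next
      fix c x assume x: "x \<in> carrier V"
      have "c \<odot>\<^bsub>V\<^esub> x = V.lincomb (\<lambda>v. c * co x v) ?A"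
        using V.lincomb_distrib[OF Ac(1), of "co x" c] co x by simp
      then show "l r (c \<odot>\<^bsub>V\<^esub> x) = c * l r x" using l_lincomb[OF r] by (simp add: l_def)
    qed
  qed
  have "l r x = 0" if x: "x \<in> V.span (b ` {..<m})" and m: "m \<le> n" "m \<le> r" "r < n" for x m r
  proof -
    have B: "b ` {..<m} \<subseteq> carrier V" "finite (b ` {..<m})" using Ac m by force+
    obtain a where x': "x = V.lincomb a (b ` {..<m})" using x unfolding V.finite_span[OF B(2,1)] by auto
    have "l r x = (\<Sum>v\<in>b ` {..<m}. a v * l r v)"
      unfolding x' by (rule form_finite_lincomb[OF V dual_basis_form[OF db m(3)] B(2,1)])
    also have "\<dots> = 0" using m by (intro sum.neutral) (auto simp: dual_basis_delta[OF db])
    finally show ?thesis .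
  qed
  then show ?thesis using that[OF db] by blast
qed

text \<open>A maximal independent subset of the subspace is enlarged to a maximal independent subset of the whole
  space; the coordinates belonging to the added vectors cut out the subspace.\<close>
lemma adapted_dual_basis:
  fixes V :: "('k::field, 'm) module"
  assumes fd: "vectorspace.fin_dim class_ring V" and N: "sub N V"
  obtains b l where "dual_basis V (carrier V) (vectorspace.dim class_ring V) b l"
    and "dual_basis V N (vectorspace.dim class_ring (V\<lparr>carrier := N\<rparr>)) b l"
    and "vectorspace.dim class_ring (V\<lparr>carrier := N\<rparr>) \<le> vectorspace.dim class_ring V"
    and "N = {x \<in> carrier V. \<forall>r. vectorspace.dim class_ring (V\<lparr>carrier := N\<rparr>) \<le> r \<longrightarrow>
                r < vectorspace.dim class_ring V \<longrightarrow> l r x = 0}"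
proof -
  have V: "vsp V" by (rule sub_vsp[OF N])
  interpret V: vectorspace class_ring V by fact
  interpret N: vectorspace class_ring "V\<lparr>carrier := N\<rparr>" by (rule sub_is_vsp[OF N])
  have sm: "submodule class_ring N V" using N by (simp add: VectorSpace.subspace_def)
  have Nc: "N \<subseteq> carrier V" by (rule sub_subset[OF N])
  note nd = V.span_li_not_depend[OF _ sm]
  have "\<exists>A. finite A \<and> maximal A (\<lambda>S. S \<subseteq> N \<and> V.lin_indpt S)"
  proof (rule maximal_exists)
    show "finite A \<and> card A \<le> V.dim" if "A \<subseteq> N \<and> V.lin_indpt A" for A
      using V.li_le_dim[OF fd, of A] that Nc by auto
    show "{} \<subseteq> N \<and> V.lin_indpt {}" by (auto simp: V.lin_dep_def)
  qed
  then obtain A0 where A0: "finite A0" "maximal A0 (\<lambda>S. S \<subseteq> N \<and> V.lin_indpt S)" by auto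
  have "maximal A0 (\<lambda>S. S \<subseteq> carrier (V\<lparr>carrier := N\<rparr>) \<and> N.lin_indpt S)"
    using A0(2) nd(2) unfolding maximal_def by auto
  then have A0b: "N.basis A0" by (rule N.max_li_is_basis)
  have A0': "A0 \<subseteq> N" "V.lin_indpt A0" using A0(2) unfolding maximal_def by auto
  have spanA0: "V.span A0 = N" using A0b nd(1)[OF A0'(1)] by (auto simp: N.basis_def)
  have "\<exists>A. finite A \<and> maximal A (\<lambda>S. A0 \<subseteq> S \<and> S \<subseteq> carrier V \<and> V.lin_indpt S)"
  proof (rule maximal_exists)
    show "finite A \<and> card A \<le> V.dim" if "A0 \<subseteq> A \<and> A \<subseteq> carrier V \<and> V.lin_indpt A" for A
      using V.li_le_dim[OF fd, of A] that by auto
    show "A0 \<subseteq> A0 \<and> A0 \<subseteq> carrier V \<and> V.lin_indpt A0" using A0' Nc by auto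
  qed
  then obtain A where A: "finite A" "maximal A (\<lambda>S. A0 \<subseteq> S \<and> S \<subseteq> carrier V \<and> V.lin_indpt S)"
    by auto
  then have A0A: "A0 \<subseteq> A" by (auto simp: maximal_def)
  have "maximal A (\<lambda>S. S \<subseteq> carrier V \<and> V.lin_indpt S)"
    using A(2) unfolding maximal_def by (meson order_trans)
  then have Ab: "V.basis A" by (rule V.max_li_is_basis)
  define m where "m = card A0"
  define n where "n = card A"
  have mn: "m \<le> n" using A0A A(1) by (simp add: m_def n_def card_mono)
  have dims: "N.dim = m" "V.dim = n"
    using N.dim_basis[OF A0(1) A0b] V.dim_basis[OF A(1) Ab] by (auto simp: m_def n_def)
  obtain xs where xs: "set xs = A0" "distinct xs" using finite_distinct_list[OF A0(1)] by auto
  obtain ys where ys: "set ys = A - A0" "distinct ys" using finite_distinct_list[of "A - A0"] A(1) by auto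
  define b where "b s = (xs @ ys) ! s" for s
  have len: "length xs = m" "length (xs @ ys) = n"
  proof -
    show "length xs = m" using distinct_card[OF xs(2)] xs by (simp add: m_def)
    have "distinct (xs @ ys)" "set (xs @ ys) = A" using xs ys A0A by auto
    then show "length (xs @ ys) = n" using distinct_card by (metis n_def)
  qed
  have dist: "distinct (xs @ ys)" using xs ys by auto
  have inj: "inj_on b {..<n}"
    unfolding b_def inj_on_def using dist len by (metis lessThan_iff nth_eq_iff_index_eq)
  have im: "b ` {..<n} = A" "b ` {..<m} = A0"
  proof -
    have "b ` {..<n} = set (xs @ ys)" unfolding b_def len(2)[symmetric] by (rule nth_image_lt)
    then show "b ` {..<n} = A" using xs ys A0A by auto
    have "b ` {..<m} = (!) xs ` {..<m}" unfolding b_def using len by (intro image_cong) (auto simp: nth_append)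
    then show "b ` {..<m} = A0" using xs len nth_image_lt[of xs] by simp
  qed
  obtain l where db: "dual_basis V (carrier V) n b l"
    and z: "\<And>x k. x \<in> V.span (b ` {..<k}) \<Longrightarrow> k \<le> n \<Longrightarrow> (\<forall>r. k \<le> r \<longrightarrow> r < n \<longrightarrow> l r x = 0)"
    using basis_dual_basis[OF V _ inj] Ab im(1) by metis
  have zN: "l r x = 0" if "x \<in> N" "m \<le> r" "r < n" for x r
    using z[of x m] that mn im(2) spanA0 by auto
  have bN: "b s \<in> N" if "s < m" for s using im(2) A0' that by auto
  have dbN: "dual_basis V N m b l"
    unfolding dual_basis_def
  proof (intro conjI allI impI ballI)
    show "b s \<in> N" if "s < m" for s using bN that .
    show "l r \<in> linear_forms V" if "r < m" for r using dual_basis_form[OF db] that mn by auto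
    show "l r (b s) = (if r = s then 1 else 0)" if "r < m" "s < m" for r s
      using dual_basis_delta[OF db] that mn by auto
    show "x = \<zero>\<^bsub>V\<^esub>" if "x \<in> N" "\<forall>r<m. l r x = 0" for x
    proof (rule dual_basis_zero[OF db])
      show "x \<in> carrier V" using that Nc by auto
      show "l r x = 0" if "r < n" for r using zN \<open>x \<in> N\<close> \<open>\<forall>r<m. l r x = 0\<close> that by (cases "r < m") auto
    qed
  qed
  have "N = {x \<in> carrier V. \<forall>r. m \<le> r \<longrightarrow> r < n \<longrightarrow> l r x = 0}" (is "_ = ?N")
  proof (rule equalityI; rule subsetI)
    show "x \<in> ?N" if "x \<in> N" for x using that zN Nc by auto
    show "x \<in> N" if x: "x \<in> ?N" for x
    proof -
      have "x = comb V m (\<lambda>s. l s x) b"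
      proof (rule dual_basis_eq[OF db sub_carrier[OF V]])
        show "x \<in> carrier V" using x by auto
        show "comb V m (\<lambda>s. l s x) b \<in> carrier V" using bN Nc by (intro comb_in V) auto
        fix r assume r: "r < n"
        have "l r (comb V m (\<lambda>s. l s x) b) = (\<Sum>s<m. l s x * l r (b s))"
          using r bN Nc by (intro form_comb V dual_basis_form[OF db]) auto
        also have "\<dots> = (\<Sum>s<m. if s = r then l r x else 0)"
          using r mn by (intro sum.cong) (auto simp: dual_basis_delta[OF db])
        also have "\<dots> = l r x" using x r by (cases "r < m") auto
        finally show "l r x = l r (comb V m (\<lambda>s. l s x) b)" by simp
      qed
      then show ?thesis by (subst \<open>x = _\<close>) (rule comb_closed[OF N bN])
    qed
  qed
  then show ?thesis by (intro that[of b l, unfolded dims] db dbN mn)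
qed

lemma dual_basis_exists:
  assumes "vectorspace.fin_dim class_ring V" "sub N V"
  obtains b l where "dual_basis V N (vectorspace.dim class_ring (V\<lparr>carrier := N\<rparr>)) b l"
  by (rule adapted_dual_basis[OF assms])

lemma left_inverse_matrix_right:
  fixes A B :: "nat \<Rightarrow> nat \<Rightarrow> 'k::field"
  assumes "\<And>i j. i < n \<Longrightarrow> j < n \<Longrightarrow> (\<Sum>k<n. A i k * B k j) = (if i = j then 1 else 0)"
    and "i < n" "j < n"
  shows "(\<Sum>k<n. B i k * A k j) = (if i = j then 1 else 0)"
proof -
  define MA where "MA = mat n n (\<lambda>(i, j). A i j)"
  define MB where "MB = mat n n (\<lambda>(i, j). B i j)"
  have c: "MA \<in> carrier_mat n n" "MB \<in> carrier_mat n n" by (auto simp: MA_def MB_def)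
  have p: "(MA * MB) $$ (i, j) = (\<Sum>k<n. A i k * B k j)" "(MB * MA) $$ (i, j) = (\<Sum>k<n. B i k * A k j)"
    if "i < n" "j < n" for i j
    using that by (auto simp: MA_def MB_def scalar_prod_def intro!: sum.cong)
  have "MA * MB = 1\<^sub>m n" using p(1) assms(1) c by (intro eq_matI) auto
  then have "MB * MA = 1\<^sub>m n" using mat_mult_left_right_inverse[OF c] by simp
  then show ?thesis using p(2)[OF assms(2,3)] assms(2,3) by simp
qed

text \<open>Comparing with any dual basis \<open>b0\<close>, \<open>l0\<close> of \<open>N\<close> turns duality into a one-sided matrix identity, and
  one-sided inverses of square matrices are two-sided.\<close>
lemma dual_basis_of_dim:
  assumes fd: "vectorspace.fin_dim class_ring V" and N: "sub N V"
    and n: "vectorspace.dim class_ring (V\<lparr>carrier := N\<rparr>) = n"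
    and b: "\<And>s. s < n \<Longrightarrow> b s \<in> N" and l: "\<And>r. r < n \<Longrightarrow> l r \<in> linear_forms V"
    and d: "\<And>r s. r < n \<Longrightarrow> s < n \<Longrightarrow> l r (b s) = (if r = s then 1 else 0)"
  shows "dual_basis V N n b l"
proof -
  obtain b0 l0 where db0: "dual_basis V N n b0 l0" using adapted_dual_basis[OF fd N] n by metis
  \<comment> \<open>the matrices of \<open>l\<close> on \<open>b0\<close> and of \<open>b\<close> in terms of \<open>b0\<close>\<close>
  have id1: "(\<Sum>t<n. l r (b0 t) * l0 t (b s)) = (if r = s then 1 else 0)" if "r < n" "s < n" for r s
    using form_expand'[OF db0 N b l, of s r] d that by (simp add: mult.commute)
  note id2 = left_inverse_matrix_right[OF id1]
  have "x = \<zero>\<^bsub>V\<^esub>" if x: "x \<in> N" and z: "\<forall>r<n. l r x = 0" for x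
  proof (rule dual_basis_zero[OF db0 x])
    fix u assume u: "u < n"
    have "0 = (\<Sum>r<n. l0 u (b r) * l r x)" using z by simp
    also have "\<dots> = (\<Sum>r<n. l0 u (b r) * (\<Sum>t<n. l0 t x * l r (b0 t)))"
      using form_expand'[OF db0 N x l] by (intro sum.cong) auto
    also have "\<dots> = (\<Sum>r<n. \<Sum>t<n. l0 t x * (l0 u (b r) * l r (b0 t)))"
      by (simp add: sum_distrib_left mult_ac)
    also have "\<dots> = (\<Sum>t<n. l0 t x * (\<Sum>r<n. l0 u (b r) * l r (b0 t)))"
      by (subst sum.swap) (simp add: sum_distrib_left)
    also have "\<dots> = (\<Sum>t<n. if t = u then l0 u x else 0)" using id2 u by (intro sum.cong) auto
    finally show "l0 u x = 0" using u by simp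
  qed
  then show ?thesis using b l d unfolding dual_basis_def by auto
qed



section \<open>Quotient spaces\<close>
text \<open>Transport of structure along a surjection, which spares a verification of the vector space axioms
  for cosets.\<close>
lemma vsp_image:
  assumes V: "vsp (V :: ('k::field, 'm) module)" and im: "h ` carrier V = carrier W"
    and add: "\<And>x y. x \<in> carrier V \<Longrightarrow> y \<in> carrier V \<Longrightarrow> h (x \<oplus>\<^bsub>V\<^esub> y) = h x \<oplus>\<^bsub>W\<^esub> h y"
    and smult: "\<And>c x. x \<in> carrier V \<Longrightarrow> h (c \<odot>\<^bsub>V\<^esub> x) = c \<odot>\<^bsub>W\<^esub> h x"
    and zero: "h \<zero>\<^bsub>V\<^esub> = \<zero>\<^bsub>W\<^esub>"
  shows "vsp W" and "lin V W h"
proof -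
  interpret V: vectorspace class_ring V by fact
  have h: "x \<in> carrier V \<Longrightarrow> h x \<in> carrier W" for x using im by auto
  have ex: "\<exists>x\<in>carrier V. v = h x" if "v \<in> carrier W" for v using im that by auto
  note sy = add[symmetric] smult[symmetric] zero[symmetric]
  show W: "vsp W"
  proof (rule vs_criteria; (intro allI ballI impI)?; (elim conjE)?)
    show "field (class_ring :: 'k ring)" by (rule class_field)
    show "\<zero>\<^bsub>W\<^esub> \<in> carrier W" using h[OF V.M.zero_closed] zero by simp
  next
    fix v w assume "v \<in> carrier W" "w \<in> carrier W"
    then obtain x y where xy: "x \<in> carrier V" "y \<in> carrier V" "v = h x" "w = h y" using ex by metis
    then show "v \<oplus>\<^bsub>W\<^esub> w \<in> carrier W" "v \<oplus>\<^bsub>W\<^esub> w = w \<oplus>\<^bsub>W\<^esub> v"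
      by (auto simp: sy h V.M.a_ac)
    fix u assume "u \<in> carrier W"
    then obtain z where "z \<in> carrier V" "u = h z" using ex by metis
    then show "v \<oplus>\<^bsub>W\<^esub> w \<oplus>\<^bsub>W\<^esub> u = v \<oplus>\<^bsub>W\<^esub> (w \<oplus>\<^bsub>W\<^esub> u)" using xy by (auto simp: sy V.M.a_ac)
  next
    fix v assume "v \<in> carrier W"
    then obtain x where x: "x \<in> carrier V" "v = h x" using ex by metis
    show "\<exists>u\<in>carrier W. v \<oplus>\<^bsub>W\<^esub> u = \<zero>\<^bsub>W\<^esub>"
      using x by (intro bexI[of _ "h (\<ominus>\<^bsub>V\<^esub> x)"]) (auto simp: sy h V.M.r_neg)
    show "v \<oplus>\<^bsub>W\<^esub> \<zero>\<^bsub>W\<^esub> = v" using x by (simp add: sy)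
    show "\<one>\<^bsub>class_ring\<^esub> \<odot>\<^bsub>W\<^esub> v = v"
      using x smult[of x 1] V.smult_one[simplified, of x] by simp
  next
    fix c :: 'k and v assume "v \<in> carrier W"
    then obtain x where x: "x \<in> carrier V" "v = h x" using ex by metis
    then show "c \<odot>\<^bsub>W\<^esub> v \<in> carrier W" by (simp add: sy h V.smult_closed)
  next
    fix a b :: 'k and v assume "v \<in> carrier W"
    then obtain x where x: "x \<in> carrier V" "v = h x" using ex by metis
    show "(a \<otimes>\<^bsub>class_ring\<^esub> b) \<odot>\<^bsub>W\<^esub> v = a \<odot>\<^bsub>W\<^esub> (b \<odot>\<^bsub>W\<^esub> v)"
      using x V.smult_assoc1[simplified, of x a b] vsp_smult[OF V x(1)]
      by (simp add: sy)
    show "(a \<oplus>\<^bsub>class_ring\<^esub> b) \<odot>\<^bsub>W\<^esub> v = a \<odot>\<^bsub>W\<^esub> v \<oplus>\<^bsub>W\<^esub> b \<odot>\<^bsub>W\<^esub> v"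
      using x V.smult_l_distr[simplified, of x a b] vsp_smult[OF V x(1)]
      by (simp add: sy)
  next
    fix a :: 'k and v w assume "v \<in> carrier W" "w \<in> carrier W"
    then obtain x y where xy: "x \<in> carrier V" "y \<in> carrier V" "v = h x" "w = h y" using ex by metis
    then show "a \<odot>\<^bsub>W\<^esub> (v \<oplus>\<^bsub>W\<^esub> w) = a \<odot>\<^bsub>W\<^esub> v \<oplus>\<^bsub>W\<^esub> a \<odot>\<^bsub>W\<^esub> w"
      using V.smult_r_distr[simplified, of x y a] vsp_smult[OF V] by (simp add: sy)
  qed
  show "lin V W h" by (rule linI) (auto simp: V W h add smult)
qed

abbreviation cls :: "('k::field, 'm) module \<Rightarrow> 'm set \<Rightarrow> 'm \<Rightarrow> 'm set" where
  "cls V N x \<equiv> a_r_coset V N x"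

lemma cls_eq_Collect:
  assumes N: "sub N V" and x: "x \<in> carrier V"
  shows "cls V N x = {y \<in> carrier V. y \<ominus>\<^bsub>V\<^esub> x \<in> N}"
proof -
  interpret V: vectorspace class_ring V by (rule sub_vsp[OF N])
  have "y \<in> carrier V \<and> y \<ominus>\<^bsub>V\<^esub> x \<in> N \<longleftrightarrow> (\<exists>w\<in>N. y = w \<oplus>\<^bsub>V\<^esub> x)" for y
  proof safe
    assume y: "y \<in> carrier V" "y \<ominus>\<^bsub>V\<^esub> x \<in> N"
    then show "\<exists>w\<in>N. y = w \<oplus>\<^bsub>V\<^esub> x"
      using x by (intro bexI[of _ "y \<ominus>\<^bsub>V\<^esub> x"]) (simp_all add: V.M.minus_eq V.M.a_assoc V.M.l_neg)
  next
    fix w assume w: "w \<in> N"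
    then have w': "w \<in> carrier V" using N by (simp add: sub_in)
    show "w \<oplus>\<^bsub>V\<^esub> x \<in> carrier V" using w' x by simp
    show "w \<oplus>\<^bsub>V\<^esub> x \<ominus>\<^bsub>V\<^esub> x \<in> N"
      using w w' x by (simp add: V.M.minus_eq V.M.a_assoc V.M.r_neg)
  qed
  then show ?thesis unfolding a_r_coset_def r_coset_def by auto
qed

lemma cls_self: "sub N V \<Longrightarrow> x \<in> carrier V \<Longrightarrow> x \<in> cls V N x"
proof -
  assume N: "sub N V" and x: "x \<in> carrier V"
  interpret V: vectorspace class_ring V by (rule sub_vsp[OF N])
  have "x \<ominus>\<^bsub>V\<^esub> x = \<zero>\<^bsub>V\<^esub>" using x by (simp add: V.M.minus_eq V.M.r_neg)
  then have "x \<ominus>\<^bsub>V\<^esub> x \<in> N" by (rule ssubst) (rule sub_zero[OF N])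
  then show ?thesis using x by (simp only: cls_eq_Collect[OF N x] mem_Collect_eq)
qed

lemma cls_memD: "sub N V \<Longrightarrow> x \<in> carrier V \<Longrightarrow> y \<in> cls V N x \<Longrightarrow> y \<in> carrier V \<and> (\<exists>w\<in>N. y = w \<oplus>\<^bsub>V\<^esub> x)"
  using cls_eq_Collect[of N V x] unfolding a_r_coset_def r_coset_def by auto

lemma cls_zero: "sub N V \<Longrightarrow> cls V N \<zero>\<^bsub>V\<^esub> = N"
proof -
  assume N: "sub N V"
  interpret V: vectorspace class_ring V by (rule sub_vsp[OF N])
  show ?thesis using sub_in[OF N] unfolding a_r_coset_def r_coset_def by force
qed

text \<open>Scalar multiplication and the action of an arrow on a quotient are both of this form.\<close>
lemma cls_image:
  assumes h: "lin V W h" and N: "sub N V" and N': "sub N' W" and hN: "h ` N \<subseteq> N'"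
    and x: "x \<in> carrier V"
  shows "N' <+>\<^bsub>W\<^esub> h ` cls V N x = cls W N' (h x)"
proof -
  interpret W: vectorspace class_ring W by (rule sub_vsp[OF N'])
  have hx: "h x \<in> carrier W" using h x by (simp add: lin_facts)
  show ?thesis
  proof (rule equalityI; rule subsetI)
    fix z assume "z \<in> N' <+>\<^bsub>W\<^esub> h ` cls V N x"
    then obtain n y where n: "n \<in> N'" "y \<in> cls V N x" "z = n \<oplus>\<^bsub>W\<^esub> h y"
      unfolding set_add_def set_mult_def by auto
    then obtain w where w: "w \<in> N" "y = w \<oplus>\<^bsub>V\<^esub> x" using cls_memD[OF N x] by blast
    then have "h y = h w \<oplus>\<^bsub>W\<^esub> h x" using lin_add[OF h] sub_in[OF N] x by simp
    moreover have hw: "h w \<in> N'" using w hN by auto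
    ultimately have "z = (n \<oplus>\<^bsub>W\<^esub> h w) \<oplus>\<^bsub>W\<^esub> h x"
      using n hx sub_in[OF N'] by (simp add: W.M.a_assoc)
    then show "z \<in> cls W N' (h x)"
      using sub_add[OF N' n(1) hw] unfolding a_r_coset_def r_coset_def by auto
  next
    fix z assume "z \<in> cls W N' (h x)"
    then obtain n where "n \<in> N'" "z = n \<oplus>\<^bsub>W\<^esub> h x" using cls_memD[OF N' hx] by blast
    then show "z \<in> N' <+>\<^bsub>W\<^esub> h ` cls V N x"
      using cls_self[OF N x] unfolding set_add_def set_mult_def by auto
  qed
qed

lemma cls_add:
  assumes N: "sub N V" and x: "x \<in> carrier V" "y \<in> carrier V"
  shows "cls V N x <+>\<^bsub>V\<^esub> cls V N y = cls V N (x \<oplus>\<^bsub>V\<^esub> y)"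
proof -
  interpret V: vectorspace class_ring V by (rule sub_vsp[OF N])
  show ?thesis
  proof (rule equalityI; rule subsetI)
    fix z assume "z \<in> cls V N x <+>\<^bsub>V\<^esub> cls V N y"
    then obtain a b where "a \<in> cls V N x" "b \<in> cls V N y" "z = a \<oplus>\<^bsub>V\<^esub> b"
      unfolding set_add_def set_mult_def by auto
    then obtain n m where nm: "n \<in> N" "m \<in> N" "z = (n \<oplus>\<^bsub>V\<^esub> x) \<oplus>\<^bsub>V\<^esub> (m \<oplus>\<^bsub>V\<^esub> y)"
      using cls_memD[OF N x(1)] cls_memD[OF N x(2)] by metis
    then have "z = (n \<oplus>\<^bsub>V\<^esub> m) \<oplus>\<^bsub>V\<^esub> (x \<oplus>\<^bsub>V\<^esub> y)"
      using sub_in[OF N] x by (simp add: V.M.a_ac)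
    then show "z \<in> cls V N (x \<oplus>\<^bsub>V\<^esub> y)"
      using sub_add[OF N nm(1,2)] unfolding a_r_coset_def r_coset_def by auto
  next
    fix z assume "z \<in> cls V N (x \<oplus>\<^bsub>V\<^esub> y)"
    then obtain n where n: "n \<in> N" "z = n \<oplus>\<^bsub>V\<^esub> (x \<oplus>\<^bsub>V\<^esub> y)"
      using cls_memD[OF N, of "x \<oplus>\<^bsub>V\<^esub> y"] x by auto
    then have "z = (n \<oplus>\<^bsub>V\<^esub> x) \<oplus>\<^bsub>V\<^esub> y" using sub_in[OF N] x by (simp add: V.M.a_assoc)
    moreover have "n \<oplus>\<^bsub>V\<^esub> x \<in> cls V N x" using n unfolding a_r_coset_def r_coset_def by auto
    ultimately show "z \<in> cls V N x <+>\<^bsub>V\<^esub> cls V N y"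
      using cls_self[OF N x(2)] unfolding set_add_def set_mult_def by auto
  qed
qed

lemma lin_smult_map: 
  assumes V: "vsp V" shows "lin V V (\<lambda>x. c \<odot>\<^bsub>V\<^esub> x)"
proof -
  interpret V: vectorspace class_ring V by (rule V)
  show ?thesis
    by (rule linI[OF V V]) (auto simp: V.smult_r_distr[simplified] V.smult_assoc1[simplified, symmetric] mult.commute)
qed

lemma quotient_space:
  assumes N: "sub N V"
  shows quotient_vsp: "vsp (quotient_space V N)" and lin_cls: "lin V (quotient_space V N) (cls V N)"
proof -
  have V: "vsp V" by (rule sub_vsp[OF N])
  have im: "cls V N ` carrier V = carrier (quotient_space V N)"
    unfolding quotient_space_def A_RCOSETS_def RCOSETS_def a_r_coset_def by auto
  note * = vsp_image[OF V im]
  have sm: "cls V N (c \<odot>\<^bsub>V\<^esub> x) = c \<odot>\<^bsub>quotient_space V N\<^esub> cls V N x" if "x \<in> carrier V" for c x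
    using cls_image[OF lin_smult_map[OF V] N N _ that, of c] sub_smult[OF N]
    by (auto simp: quotient_space_def)
  show "vsp (quotient_space V N)" "lin V (quotient_space V N) (cls V N)"
    by (rule *; use sm in \<open>simp add: quotient_space_def cls_add[OF N] cls_zero[OF N]\<close>)+
qed

lemma quotient_carrierE:
  assumes "A \<in> carrier (quotient_space V N)" 
  obtains x where "x \<in> carrier V" "A = cls V N x"
  using assms unfolding quotient_space_def A_RCOSETS_def RCOSETS_def a_r_coset_def by auto

text \<open>Coordinates on the quotient by \<open>N\<close>: forms cutting out \<open>N\<close> and representatives dual to them.\<close>

definition cobasis ::
  "('k::field, 'm) module \<Rightarrow> 'm set \<Rightarrow> nat \<Rightarrow> (nat \<Rightarrow> 'm) \<Rightarrow> (nat \<Rightarrow> 'm \<Rightarrow> 'k) \<Rightarrow> bool" where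
  "cobasis V N c w \<kappa> \<longleftrightarrow>
     (\<forall>r<c. w r \<in> carrier V) \<and> (\<forall>r<c. \<kappa> r \<in> linear_forms V) \<and>
     (\<forall>r<c. \<forall>t<c. \<kappa> r (w t) = (if r = t then 1 else 0)) \<and>
     N = {x \<in> carrier V. \<forall>r<c. \<kappa> r x = 0}"

lemma cobasisD:
  assumes "cobasis V N c w \<kappa>"
  shows cobasis_in: "r < c \<Longrightarrow> w r \<in> carrier V"
    and cobasis_form: "r < c \<Longrightarrow> \<kappa> r \<in> linear_forms V"
    and cobasis_delta: "r < c \<Longrightarrow> t < c \<Longrightarrow> \<kappa> r (w t) = (if r = t then 1 else 0)"
    and cobasis_iff: "x \<in> N \<longleftrightarrow> x \<in> carrier V \<and> (\<forall>r<c. \<kappa> r x = 0)"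
  using assms unfolding cobasis_def by auto

definition coset_form :: "('m \<Rightarrow> 'k) \<Rightarrow> 'm set \<Rightarrow> 'k" where
  "coset_form k A = k (SOME x. x \<in> A)"

lemma coset_form_cls:
  assumes N: "sub N V" and cb: "cobasis V N c w \<kappa>" and r: "r < c" and x: "x \<in> carrier V"
  shows "coset_form (\<kappa> r) (cls V N x) = \<kappa> r x"
proof -
  have "(SOME y. y \<in> cls V N x) \<in> cls V N x" using cls_self[OF N x] by (rule someI)
  then obtain n where n: "n \<in> N" "(SOME y. y \<in> cls V N x) = n \<oplus>\<^bsub>V\<^esub> x" using cls_memD[OF N x] by blast
  then show ?thesis
    using form_add[OF cobasis_form[OF cb r], of n x] n r x cobasis_iff[OF cb, of n]
    by (simp add: coset_form_def)
qed

lemma quotient_dual_basis: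
  assumes N: "sub N V" and cb: "cobasis V N c w \<kappa>"
  shows "dual_basis (quotient_space V N) (carrier (quotient_space V N)) c
           (\<lambda>r. cls V N (w r)) (\<lambda>r. coset_form (\<kappa> r))"
  unfolding dual_basis_def
proof (intro conjI allI impI ballI)
  note cf = coset_form_cls[OF N cb] and L = lin_cls[OF N]
  show "cls V N (w r) \<in> carrier (quotient_space V N)" if "r < c" for r
    using lin_closed[OF L] cobasis_in[OF cb that] .
  show "coset_form (\<kappa> r) (cls V N (w s)) = (if r = s then 1 else 0)" if "r < c" "s < c" for r s
    using that by (simp add: cf cobasis_in[OF cb] cobasis_delta[OF cb])
  show "coset_form (\<kappa> r) \<in> linear_forms (quotient_space V N)" if "r < c" for r
  proof (rule formI)
    fix A B a assume "A \<in> carrier (quotient_space V N)"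
    then obtain x where x: "x \<in> carrier V" "A = cls V N x" by (rule quotient_carrierE)
    show "coset_form (\<kappa> r) (a \<odot>\<^bsub>quotient_space V N\<^esub> A) = a * coset_form (\<kappa> r) A"
      using that x lin_smult[OF L x(1), of a] vsp_smult[OF sub_vsp[OF N] x(1), of a]
        form_smult[OF cobasis_form[OF cb that] x(1), of a]
      by (simp add: cf[OF that, symmetric])
    assume "B \<in> carrier (quotient_space V N)"
    then obtain y where y: "y \<in> carrier V" "B = cls V N y" by (rule quotient_carrierE)
    show "coset_form (\<kappa> r) (A \<oplus>\<^bsub>quotient_space V N\<^esub> B) = coset_form (\<kappa> r) A + coset_form (\<kappa> r) B"
      using lin_add[OF L x(1) y(1)] vsp_add[OF sub_vsp[OF N] x(1) y(1)]
        form_add[OF cobasis_form[OF cb that] x(1) y(1)] cf[OF that] x y by metis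
  qed
  fix A assume A: "A \<in> carrier (quotient_space V N)" and z: "\<forall>r<c. coset_form (\<kappa> r) A = 0"
  then obtain x where x: "x \<in> carrier V" "A = cls V N x" by (metis quotient_carrierE)
  then have xN: "x \<in> N" using z cf cobasis_iff[OF cb] by auto
  interpret V: vectorspace class_ring V by (rule sub_vsp[OF N])
  have "cls V N x = N"
  proof (rule equalityI; rule subsetI)
    show "y \<in> N" if "y \<in> cls V N x" for y
      using cls_memD[OF N x(1) that] sub_add[OF N _ xN] by auto
    show "y \<in> cls V N x" if "y \<in> N" for y
      using that sub_minus[OF N that xN] sub_in[OF N that] by (simp add: cls_eq_Collect[OF N x(1)])
  qed
  then show "A = \<zero>\<^bsub>quotient_space V N\<^esub>" using x by (simp add: quotient_space_def)
qed

section \<open>Representations\<close>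

lemma repD:
  assumes "representation Q M"
  shows rep_vsp: "i \<in> verts Q \<Longrightarrow> vsp (vspace M i)"
    and rep_fin_dim: "i \<in> verts Q \<Longrightarrow> vectorspace.fin_dim class_ring (vspace M i)"
    and rep_lin: "\<alpha> \<in> arcs Q \<Longrightarrow> lin (vspace M (tail Q \<alpha>)) (vspace M (head Q \<alpha>)) (act M \<alpha>)"
  using assms unfolding representation_def by auto

lemma subrepD:
  assumes "N \<in> subreps Q M"
  shows subrep_sub: "i \<in> verts Q \<Longrightarrow> sub (N i) (vspace M i)"
    and subrep_act: "\<alpha> \<in> arcs Q \<Longrightarrow> x \<in> N (tail Q \<alpha>) \<Longrightarrow> act M \<alpha> x \<in> N (head Q \<alpha>)"
    and subrep_ext: "N \<in> extensional (verts Q)"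
  using assms unfolding subreps_def by auto

lemma rep_homD:
  assumes "rep_hom Q M N h"
  shows rep_hom_lin: "i \<in> verts Q \<Longrightarrow> lin (vspace M i) (vspace N i) (h i)"
    and rep_hom_act: "\<alpha> \<in> arcs Q \<Longrightarrow> x \<in> carrier (vspace M (tail Q \<alpha>)) \<Longrightarrow>
        h (head Q \<alpha>) (act M \<alpha> x) = act N \<alpha> (h (tail Q \<alpha>) x)"
  using assms unfolding rep_hom_def by auto

lemma sub_rep_simps [simp]:
  "vspace (sub_rep M N) i = (vspace M i)\<lparr>carrier := N i\<rparr>" "act (sub_rep M N) = act M"
  by (simp_all add: sub_rep_def)

lemma sub_rep_representation:
  assumes Q: "wf_digraph Q" and M: "representation Q M" and N: "N \<in> subreps Q M"
  shows "representation Q (sub_rep M N)"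
  unfolding representation_def
proof (intro conjI ballI)
  fix i assume i: "i \<in> verts Q"
  show "vsp (vspace (sub_rep M N) i)" using sub_is_vsp[OF subrep_sub[OF N i]] by simp
  obtain b l where "dual_basis (vspace M i) (N i)
      (vectorspace.dim class_ring ((vspace M i)\<lparr>carrier := N i\<rparr>)) b l"
    by (rule dual_basis_exists[OF rep_fin_dim[OF M i] subrep_sub[OF N i]])
  then show "vectorspace.fin_dim class_ring (vspace (sub_rep M N) i)"
    using dual_basis_sub_dim(2)[OF subrep_sub[OF N i]] by simp
next
  fix \<alpha> assume a: "\<alpha> \<in> arcs Q"
  then have v: "tail Q \<alpha> \<in> verts Q" "head Q \<alpha> \<in> verts Q"
    using Q by (auto simp: wf_digraph.tail_in_verts wf_digraph.head_in_verts)
  show "lin (vspace (sub_rep M N) (tail Q \<alpha>)) (vspace (sub_rep M N) (head Q \<alpha>)) (act (sub_rep M N) \<alpha>)"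
    using lin_corestrict[OF lin_restrict[OF rep_lin[OF M a] subrep_sub[OF N v(1)]] subrep_sub[OF N v(2)]]
      subrep_act[OF N a] by simp
qed

lemma quotient_rep_simps [simp]:
  "vspace (quotient_rep Q M N) i = quotient_space (vspace M i) (N i)"
  by (simp add: quotient_rep_def)

lemma quotient_act:
  assumes Q: "wf_digraph Q" and M: "representation Q M" and N: "N \<in> subreps Q M" and a: "\<alpha> \<in> arcs Q"
    and x: "x \<in> carrier (vspace M (tail Q \<alpha>))"
  shows "act (quotient_rep Q M N) \<alpha> (cls (vspace M (tail Q \<alpha>)) (N (tail Q \<alpha>)) x)
     = cls (vspace M (head Q \<alpha>)) (N (head Q \<alpha>)) (act M \<alpha> x)"
proof -
  have v: "tail Q \<alpha> \<in> verts Q" "head Q \<alpha> \<in> verts Q"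
    using Q a by (auto simp: wf_digraph.tail_in_verts wf_digraph.head_in_verts)
  show ?thesis
    using cls_image[OF rep_lin[OF M a] subrep_sub[OF N v(1)] subrep_sub[OF N v(2)] _ x]
      subrep_act[OF N a] by (auto simp: quotient_rep_def)
qed

lemma quotient_lin:
  assumes Q: "wf_digraph Q" and M: "representation Q M" and N: "N \<in> subreps Q M" and a: "\<alpha> \<in> arcs Q"
  shows "lin (vspace (quotient_rep Q M N) (tail Q \<alpha>)) (vspace (quotient_rep Q M N) (head Q \<alpha>))
     (act (quotient_rep Q M N) \<alpha>)"
proof -
  have v: "tail Q \<alpha> \<in> verts Q" "head Q \<alpha> \<in> verts Q"
    using Q a by (auto simp: wf_digraph.tail_in_verts wf_digraph.head_in_verts)
  let ?V = "vspace M (tail Q \<alpha>)" let ?W = "vspace M (head Q \<alpha>)"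
  let ?N = "N (tail Q \<alpha>)" let ?N' = "N (head Q \<alpha>)"
  note L = lin_cls[OF subrep_sub[OF N v(1)]] and L' = lin_cls[OF subrep_sub[OF N v(2)]]
  note q = quotient_act[OF Q M N a] and A = rep_lin[OF M a]
  show ?thesis unfolding quotient_rep_simps
  proof (rule linI)
    show "vsp (quotient_space ?V ?N)" "vsp (quotient_space ?W ?N')"
      using L L' by (simp_all add: lin_facts)
    fix B C c assume "B \<in> carrier (quotient_space ?V ?N)"
    then obtain x where x: "x \<in> carrier ?V" "B = cls ?V ?N x" by (rule quotient_carrierE)
    show "act (quotient_rep Q M N) \<alpha> B \<in> carrier (quotient_space ?W ?N')"
      using x q[OF x(1)] lin_closed[OF L'] lin_closed[OF A] by simp
    have sm: "c \<odot>\<^bsub>?V\<^esub> x \<in> carrier ?V" using vsp_smult[OF lin_dom[OF A] x(1)] .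
    show "act (quotient_rep Q M N) \<alpha> (c \<odot>\<^bsub>quotient_space ?V ?N\<^esub> B)
        = c \<odot>\<^bsub>quotient_space ?W ?N'\<^esub> act (quotient_rep Q M N) \<alpha> B"
      using x(2) q[OF x(1)] q[OF sm] lin_smult[OF L x(1), of c] lin_smult[OF A x(1), of c]
        lin_smult[OF L' lin_closed[OF A x(1)], of c] by simp
    assume "C \<in> carrier (quotient_space ?V ?N)"
    then obtain y where y: "y \<in> carrier ?V" "C = cls ?V ?N y" by (rule quotient_carrierE)
    have ad: "x \<oplus>\<^bsub>?V\<^esub> y \<in> carrier ?V" using vsp_add[OF lin_dom[OF A] x(1) y(1)] .
    show "act (quotient_rep Q M N) \<alpha> (B \<oplus>\<^bsub>quotient_space ?V ?N\<^esub> C)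
        = act (quotient_rep Q M N) \<alpha> B \<oplus>\<^bsub>quotient_space ?W ?N'\<^esub> act (quotient_rep Q M N) \<alpha> C"
      using x(2) y(2) q[OF x(1)] q[OF y(1)] q[OF ad] lin_add[OF L x(1) y(1)] lin_add[OF A x(1) y(1)]
        lin_add[OF L' lin_closed[OF A x(1)] lin_closed[OF A y(1)]] by simp
  qed
qed

lemma quotient_representation:
  assumes Q: "wf_digraph Q" and M: "representation Q M" and N: "N \<in> subreps Q M"
    and cb: "\<And>i. i \<in> verts Q \<Longrightarrow> cobasis (vspace M i) (N i) (c i) (w i) (\<kappa> i)"
  shows "representation Q (quotient_rep Q M N)"
  unfolding representation_def
proof (intro conjI ballI quotient_lin[OF Q M N])
  fix i assume i: "i \<in> verts Q"
  show v: "vsp (vspace (quotient_rep Q M N) i)" using quotient_vsp[OF subrep_sub[OF N i]] by simp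
  show "vectorspace.fin_dim class_ring (vspace (quotient_rep Q M N) i)"
    using dual_basis_dim(2)[OF _ quotient_dual_basis[OF subrep_sub[OF N i] cb[OF i]]] v by simp
qed

section \<open>Extensions and cocycles\<close>

text \<open>Preimages of a basis of \<open>S\<close> give the section; what remains of a vector after subtracting its
  image under the section lies in the kernel of \<open>\<rho>\<close>, that is, in the image of \<open>\<kappa>\<close>.\<close>
lemma vertex_splitting:
  assumes k: "lin X Z \<kappa>" and r: "lin Z S \<rho>" and fd: "vectorspace.fin_dim class_ring S"
    and inj: "inj_on \<kappa> (carrier X)"
    and im: "\<kappa> ` carrier X = {z \<in> carrier Z. \<rho> z = \<zero>\<^bsub>S\<^esub>}"
    and surj: "\<rho> ` carrier Z = carrier S"
  obtains \<tau> p where "lin S Z \<tau>" "lin Z X p" "\<And>s. s \<in> carrier S \<Longrightarrow> \<rho> (\<tau> s) = s"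
    "\<And>x. x \<in> carrier X \<Longrightarrow> p (\<kappa> x) = x"
    "\<And>s. s \<in> carrier S \<Longrightarrow> p (\<tau> s) = \<zero>\<^bsub>X\<^esub>"
    "\<And>z. z \<in> carrier Z \<Longrightarrow> z = \<kappa> (p z) \<oplus>\<^bsub>Z\<^esub> \<tau> (\<rho> z)"
proof -
  have vs: "vsp X" "vsp Z" "vsp S" using k r by (auto simp: lin_facts)
  interpret X: vectorspace class_ring X by fact
  interpret Z: vectorspace class_ring Z by fact
  interpret S: vectorspace class_ring S by fact
  obtain b l where db: "dual_basis S (carrier S) S.dim b l"
    using adapted_dual_basis[OF fd sub_carrier[OF vs(3)]] by metis
  have "\<forall>s. \<exists>z. s < S.dim \<longrightarrow> z \<in> carrier Z \<and> \<rho> z = b s"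
    using dual_basis_in[OF db] surj by (metis imageE)
  then obtain zz where zz: "\<And>s. s < S.dim \<Longrightarrow> zz s \<in> carrier Z \<and> \<rho> (zz s) = b s" by metis
  define \<tau> where "\<tau> x = comb Z S.dim (\<lambda>s. l s x) zz" for x
  have t: "lin S Z \<tau>" unfolding \<tau>_def
    using zz by (intro comb_lin vs dual_basis_form[OF db]) auto
  have rt: "\<rho> (\<tau> s) = s" if "s \<in> carrier S" for s
  proof (rule dual_basis_eq[OF db sub_carrier[OF vs(3)] _ that])
    show "\<rho> (\<tau> s) \<in> carrier S" using that r t by (auto simp: lin_facts)
    fix u assume u: "u < S.dim"
    have "l u (\<rho> (\<tau> s)) = l u (comb S S.dim (\<lambda>s'. l s' s) (\<lambda>s. \<rho> (zz s)))"
      unfolding \<tau>_def using zz by (subst lin_comb[OF r]) auto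
    also have "\<dots> = (\<Sum>s'<S.dim. l s' s * l u (\<rho> (zz s')))"
      using zz dual_basis_in[OF db] by (intro form_comb vs dual_basis_form[OF db u]) auto
    also have "\<dots> = (\<Sum>s'<S.dim. if s' = u then l u s else 0)"
      using zz u by (intro sum.cong) (auto simp: dual_basis_delta[OF db])
    finally show "l u (\<rho> (\<tau> s)) = l u s" using u by simp
  qed
  have ker: "\<exists>!x. x \<in> carrier X \<and> \<kappa> x = z \<ominus>\<^bsub>Z\<^esub> \<tau> (\<rho> z)" if z: "z \<in> carrier Z" for z
  proof -
    have c: "\<rho> z \<in> carrier S" "\<tau> (\<rho> z) \<in> carrier Z" using z r t by (auto simp: lin_facts)
    have "\<rho> (z \<ominus>\<^bsub>Z\<^esub> \<tau> (\<rho> z)) = \<zero>\<^bsub>S\<^esub>"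
      using lin_minus[OF r z c(2)] rt[OF c(1)] c by (simp add: S.M.minus_eq S.M.r_neg)
    then have "z \<ominus>\<^bsub>Z\<^esub> \<tau> (\<rho> z) \<in> \<kappa> ` carrier X" unfolding im using z c by simp
    then show ?thesis using inj by (auto simp: inj_on_def)
  qed
  define p where "p z = (THE x. x \<in> carrier X \<and> \<kappa> x = z \<ominus>\<^bsub>Z\<^esub> \<tau> (\<rho> z))" for z
  have p: "p z \<in> carrier X" "\<kappa> (p z) = z \<ominus>\<^bsub>Z\<^esub> \<tau> (\<rho> z)" if "z \<in> carrier Z" for z
    using theI'[OF ker[OF that]] unfolding p_def by auto
  have peq: "p z = x" if "z \<in> carrier Z" "x \<in> carrier X" "\<kappa> x = z \<ominus>\<^bsub>Z\<^esub> \<tau> (\<rho> z)" for z x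
    using p[OF that(1)] that inj by (metis inj_on_eq_iff)
  have tz: "\<tau> (\<rho> z) \<in> carrier Z" if "z \<in> carrier Z" for z using that r t by (auto simp: lin_facts)
  have dec: "z = \<kappa> (p z) \<oplus>\<^bsub>Z\<^esub> \<tau> (\<rho> z)" if "z \<in> carrier Z" for z
    using p[OF that] tz[OF that] that by (simp add: Z.M.minus_eq Z.M.a_assoc Z.M.l_neg)
  have lp: "lin Z X p"
  proof (rule linI[OF vs(2,1)])
    show "p x \<in> carrier X" if "x \<in> carrier Z" for x using p that by simp
    fix x y c assume x: "x \<in> carrier Z"
    let ?d = "\<lambda>z. z \<ominus>\<^bsub>Z\<^esub> \<tau> (\<rho> z)"
    have d_lin: "lin Z Z ?d"
    proof (rule linI[OF vs(2,2)])
      show "?d z \<in> carrier Z" if "z \<in> carrier Z" for z using that tz by simp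
      fix z y c assume z: "z \<in> carrier Z"
      have "c \<odot>\<^bsub>Z\<^esub> z \<ominus>\<^bsub>Z\<^esub> c \<odot>\<^bsub>Z\<^esub> \<tau> (\<rho> z) = c \<odot>\<^bsub>Z\<^esub> ?d z"
        using lin_minus[OF lin_smult_map[OF vs(2)] z tz[OF z], of c] by simp
      then show "?d (c \<odot>\<^bsub>Z\<^esub> z) = c \<odot>\<^bsub>Z\<^esub> ?d z"
        using z lin_smult[OF r z] lin_smult[OF t] lin_closed[OF r z] by simp
      assume y: "y \<in> carrier Z"
      have "\<tau> (\<rho> (z \<oplus>\<^bsub>Z\<^esub> y)) = \<tau> (\<rho> z) \<oplus>\<^bsub>Z\<^esub> \<tau> (\<rho> y)"
        using lin_add[OF r z y] lin_add[OF t] lin_closed[OF r] z y by simp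
      then show "?d (z \<oplus>\<^bsub>Z\<^esub> y) = ?d z \<oplus>\<^bsub>Z\<^esub> ?d y"
        using z y tz[OF z] tz[OF y] by (simp add: Z.M.minus_eq Z.M.minus_add Z.M.a_ac)
    qed
    show "p (c \<odot>\<^bsub>Z\<^esub> x) = c \<odot>\<^bsub>X\<^esub> p x"
      using p[OF x] lin_smult[OF k, of "p x" c] lin_smult[OF d_lin x, of c] x
      by (intro peq) (auto simp: vsp_smult[OF vs(1)] vsp_smult[OF vs(2)])
    assume y: "y \<in> carrier Z"
    show "p (x \<oplus>\<^bsub>Z\<^esub> y) = p x \<oplus>\<^bsub>X\<^esub> p y"
      using p[OF x] p[OF y] lin_add[OF k, of "p x" "p y"] lin_add[OF d_lin x y] x y
      by (intro peq) auto
  qed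
  have pk: "p (\<kappa> x) = x" if x: "x \<in> carrier X" for x
  proof (rule peq[OF _ x])
    show c: "\<kappa> x \<in> carrier Z" using lin_closed[OF k x] .
    have "\<rho> (\<kappa> x) = \<zero>\<^bsub>S\<^esub>" using im x by auto
    then have "\<tau> (\<rho> (\<kappa> x)) = \<zero>\<^bsub>Z\<^esub>" using lin_zero[OF t] by simp
    then show "\<kappa> x = \<kappa> x \<ominus>\<^bsub>Z\<^esub> \<tau> (\<rho> (\<kappa> x))" using c by (simp add: Z.M.minus_eq)
  qed
  have pt: "p (\<tau> s) = \<zero>\<^bsub>X\<^esub>" if s: "s \<in> carrier S" for s
    using lin_closed[OF t s] rt[OF s] lin_zero[OF k]
    by (intro peq) (auto simp: Z.M.minus_eq Z.M.r_neg)
  show ?thesis by (rule that[OF t lp rt pk pt dec])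
qed

text \<open>Linear splittings at the vertices; they are not required to be compatible with the arrows.\<close>
definition vertex_splitting_of ::
  "('v, 'a) pre_digraph \<Rightarrow> ('v, 'a, 'k::field, 's) rep \<Rightarrow> ('v, 'a, 'k, 'x) rep \<Rightarrow>
     ('v, 'a, 'k, 'y) rep \<Rightarrow> ('v \<Rightarrow> 'x \<Rightarrow> 'y) \<Rightarrow> ('v \<Rightarrow> 'y \<Rightarrow> 's) \<Rightarrow> ('v \<Rightarrow> 's \<Rightarrow> 'y) \<Rightarrow> ('v \<Rightarrow> 'y \<Rightarrow> 'x) \<Rightarrow> bool"
  where
  "vertex_splitting_of Q S X Z \<kappa> \<rho> \<tau> p \<longleftrightarrow>
     (\<forall>i\<in>verts Q. lin (vspace S i) (vspace Z i) (\<tau> i) \<and> lin (vspace Z i) (vspace X i) (p i) \<and>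
        (\<forall>s\<in>carrier (vspace S i). \<rho> i (\<tau> i s) = s \<and> p i (\<tau> i s) = \<zero>\<^bsub>vspace X i\<^esub>) \<and>
        (\<forall>x\<in>carrier (vspace X i). p i (\<kappa> i x) = x) \<and>
        (\<forall>z\<in>carrier (vspace Z i). z = \<kappa> i (p i z) \<oplus>\<^bsub>vspace Z i\<^esub> \<tau> i (\<rho> i z)))"

lemma vertex_splitting_ofD:
  assumes "vertex_splitting_of Q S X Z \<kappa> \<rho> \<tau> p" "i \<in> verts Q"
  shows vsplit_tau: "lin (vspace S i) (vspace Z i) (\<tau> i)"
    and vsplit_p: "lin (vspace Z i) (vspace X i) (p i)"
    and vsplit_rt: "s \<in> carrier (vspace S i) \<Longrightarrow> \<rho> i (\<tau> i s) = s"
    and vsplit_pt: "s \<in> carrier (vspace S i) \<Longrightarrow> p i (\<tau> i s) = \<zero>\<^bsub>vspace X i\<^esub>"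
    and vsplit_pk: "x \<in> carrier (vspace X i) \<Longrightarrow> p i (\<kappa> i x) = x"
    and vsplit_dec: "z \<in> carrier (vspace Z i) \<Longrightarrow> z = \<kappa> i (p i z) \<oplus>\<^bsub>vspace Z i\<^esub> \<tau> i (\<rho> i z)"
  using assms unfolding vertex_splitting_of_def by auto

lemma extensionD:
  assumes "extension Q S X Y \<iota> \<pi>"
  shows ext_rep: "representation Q Y" and ext_iota: "rep_hom Q X Y \<iota>" and ext_pi: "rep_hom Q Y S \<pi>"
    and ext_inj: "i \<in> verts Q \<Longrightarrow> inj_on (\<iota> i) (carrier (vspace X i))"
    and ext_exact: "i \<in> verts Q \<Longrightarrow>
        \<iota> i ` carrier (vspace X i) = {y \<in> carrier (vspace Y i). \<pi> i y = \<zero>\<^bsub>vspace S i\<^esub>}"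
    and ext_surj: "i \<in> verts Q \<Longrightarrow> \<pi> i ` carrier (vspace Y i) = carrier (vspace S i)"
  using assms unfolding extension_def by auto

lemma vertex_splitting_exists:
  assumes E: "extension Q S X Z \<kappa> \<rho>" and S: "representation Q S"
  obtains \<tau> p where "vertex_splitting_of Q S X Z \<kappa> \<rho> \<tau> p"
proof -
  have "\<forall>i. \<exists>t p. i \<in> verts Q \<longrightarrow> lin (vspace S i) (vspace Z i) t \<and> lin (vspace Z i) (vspace X i) p \<and>
        (\<forall>s\<in>carrier (vspace S i). \<rho> i (t s) = s \<and> p (t s) = \<zero>\<^bsub>vspace X i\<^esub>) \<and>
        (\<forall>x\<in>carrier (vspace X i). p (\<kappa> i x) = x) \<and>
        (\<forall>z\<in>carrier (vspace Z i). z = \<kappa> i (p z) \<oplus>\<^bsub>vspace Z i\<^esub> t (\<rho> i z))"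
  proof (intro allI)
    fix i
    show "\<exists>t p. i \<in> verts Q \<longrightarrow> lin (vspace S i) (vspace Z i) t \<and> lin (vspace Z i) (vspace X i) p \<and>
        (\<forall>s\<in>carrier (vspace S i). \<rho> i (t s) = s \<and> p (t s) = \<zero>\<^bsub>vspace X i\<^esub>) \<and>
        (\<forall>x\<in>carrier (vspace X i). p (\<kappa> i x) = x) \<and>
        (\<forall>z\<in>carrier (vspace Z i). z = \<kappa> i (p z) \<oplus>\<^bsub>vspace Z i\<^esub> t (\<rho> i z))"
    proof (cases "i \<in> verts Q")
      case True
      show ?thesis
        by (rule vertex_splitting[OF rep_hom_lin[OF ext_iota[OF E] True] rep_hom_lin[OF ext_pi[OF E] True]
              rep_fin_dim[OF S True] ext_inj[OF E True] ext_exact[OF E True] ext_surj[OF E True]]) blast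
    qed auto
  qed
  then obtain t p where "\<forall>i. i \<in> verts Q \<longrightarrow> lin (vspace S i) (vspace Z i) (t i) \<and> lin (vspace Z i) (vspace X i) (p i) \<and>
        (\<forall>s\<in>carrier (vspace S i). \<rho> i (t i s) = s \<and> p i (t i s) = \<zero>\<^bsub>vspace X i\<^esub>) \<and>
        (\<forall>x\<in>carrier (vspace X i). p i (\<kappa> i x) = x) \<and>
        (\<forall>z\<in>carrier (vspace Z i). z = \<kappa> i (p i z) \<oplus>\<^bsub>vspace Z i\<^esub> t i (\<rho> i z))"
    by metis
  then show ?thesis using that[of t p] unfolding vertex_splitting_of_def by blast
qed

text \<open>The failure of the section to be a morphism, which takes values in \<open>X\<close>.\<close>
definition cocycle_of ::
  "('v, 'a) pre_digraph \<Rightarrow> ('v, 'a, 'k, 'y) rep \<Rightarrow> ('v \<Rightarrow> 's \<Rightarrow> 'y) \<Rightarrow> ('v \<Rightarrow> 'y \<Rightarrow> 'x) \<Rightarrow> 'a \<Rightarrow> 's \<Rightarrow> 'x" where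
  "cocycle_of Q Z \<tau> p \<alpha> s = p (head Q \<alpha>) (act Z \<alpha> (\<tau> (tail Q \<alpha>) s))"

lemma cocycle_facts:
  assumes Q: "wf_digraph Q" and E: "extension Q S X Z \<kappa> \<rho>"
    and v: "vertex_splitting_of Q S X Z \<kappa> \<rho> \<tau> p" and a: "\<alpha> \<in> arcs Q"
  shows cocycle_lin: "lin (vspace S (tail Q \<alpha>)) (vspace X (head Q \<alpha>)) (cocycle_of Q Z \<tau> p \<alpha>)"
    and act_section: "s \<in> carrier (vspace S (tail Q \<alpha>)) \<Longrightarrow>
       act Z \<alpha> (\<tau> (tail Q \<alpha>) s) = \<kappa> (head Q \<alpha>) (cocycle_of Q Z \<tau> p \<alpha> s)
          \<oplus>\<^bsub>vspace Z (head Q \<alpha>)\<^esub> \<tau> (head Q \<alpha>) (act S \<alpha> s)"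
    and p_act: "representation Q X \<Longrightarrow> z \<in> carrier (vspace Z (tail Q \<alpha>)) \<Longrightarrow>
       p (head Q \<alpha>) (act Z \<alpha> z) = act X \<alpha> (p (tail Q \<alpha>) z)
          \<oplus>\<^bsub>vspace X (head Q \<alpha>)\<^esub> cocycle_of Q Z \<tau> p \<alpha> (\<rho> (tail Q \<alpha>) z)"
proof -
  have i: "tail Q \<alpha> \<in> verts Q" "head Q \<alpha> \<in> verts Q"
    using Q a by (auto simp: wf_digraph.tail_in_verts wf_digraph.head_in_verts)
  note A = rep_lin[OF ext_rep[OF E] a] and h = rep_hom_lin[OF ext_pi[OF E]] rep_hom_lin[OF ext_iota[OF E]]
  show "lin (vspace S (tail Q \<alpha>)) (vspace X (head Q \<alpha>)) (cocycle_of Q Z \<tau> p \<alpha>)"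
    unfolding cocycle_of_def
    by (rule lin_comp[OF lin_comp[OF vsplit_tau[OF v i(1)] A] vsplit_p[OF v i(2)]])
  show "act Z \<alpha> (\<tau> (tail Q \<alpha>) s) = \<kappa> (head Q \<alpha>) (cocycle_of Q Z \<tau> p \<alpha> s)
          \<oplus>\<^bsub>vspace Z (head Q \<alpha>)\<^esub> \<tau> (head Q \<alpha>) (act S \<alpha> s)"
    if s: "s \<in> carrier (vspace S (tail Q \<alpha>))"
  proof -
    have t: "\<tau> (tail Q \<alpha>) s \<in> carrier (vspace Z (tail Q \<alpha>))" using lin_closed[OF vsplit_tau[OF v i(1)] s] .
    have "\<rho> (head Q \<alpha>) (act Z \<alpha> (\<tau> (tail Q \<alpha>) s)) = act S \<alpha> s"
      using rep_hom_act[OF ext_pi[OF E] a t] vsplit_rt[OF v i(1) s] by simp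
    then show ?thesis
      using vsplit_dec[OF v i(2) lin_closed[OF A t]] by (simp add: cocycle_of_def)
  qed
  show "p (head Q \<alpha>) (act Z \<alpha> z) = act X \<alpha> (p (tail Q \<alpha>) z)
          \<oplus>\<^bsub>vspace X (head Q \<alpha>)\<^esub> cocycle_of Q Z \<tau> p \<alpha> (\<rho> (tail Q \<alpha>) z)"
    if X: "representation Q X" and z: "z \<in> carrier (vspace Z (tail Q \<alpha>))"
  proof -
    have c: "p (tail Q \<alpha>) z \<in> carrier (vspace X (tail Q \<alpha>))" "\<rho> (tail Q \<alpha>) z \<in> carrier (vspace S (tail Q \<alpha>))"
      using lin_closed[OF vsplit_p[OF v i(1)] z] lin_closed[OF h(1)[OF i(1)] z] .
    have c2: "\<kappa> (tail Q \<alpha>) (p (tail Q \<alpha>) z) \<in> carrier (vspace Z (tail Q \<alpha>))"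
      "\<tau> (tail Q \<alpha>) (\<rho> (tail Q \<alpha>) z) \<in> carrier (vspace Z (tail Q \<alpha>))"
      using lin_closed[OF h(2)[OF i(1)] c(1)] lin_closed[OF vsplit_tau[OF v i(1)] c(2)] .
    have "act Z \<alpha> z = act Z \<alpha> (\<kappa> (tail Q \<alpha>) (p (tail Q \<alpha>) z)) \<oplus>\<^bsub>vspace Z (head Q \<alpha>)\<^esub>
        act Z \<alpha> (\<tau> (tail Q \<alpha>) (\<rho> (tail Q \<alpha>) z))"
      using vsplit_dec[OF v i(1) z] lin_add[OF A c2] by simp
    also have "act Z \<alpha> (\<kappa> (tail Q \<alpha>) (p (tail Q \<alpha>) z)) = \<kappa> (head Q \<alpha>) (act X \<alpha> (p (tail Q \<alpha>) z))"
      using rep_hom_act[OF ext_iota[OF E] a c(1)] by simp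
    finally have "p (head Q \<alpha>) (act Z \<alpha> z) = p (head Q \<alpha>) (\<kappa> (head Q \<alpha>) (act X \<alpha> (p (tail Q \<alpha>) z)))
        \<oplus>\<^bsub>vspace X (head Q \<alpha>)\<^esub> p (head Q \<alpha>) (act Z \<alpha> (\<tau> (tail Q \<alpha>) (\<rho> (tail Q \<alpha>) z)))"
      using lin_add[OF vsplit_p[OF v i(2)]] lin_closed[OF A c2(2)]
        lin_closed[OF h(2)[OF i(2)]] lin_closed[OF rep_lin[OF X a] c(1)] by simp
    then show ?thesis
      using vsplit_pk[OF v i(2)] lin_closed[OF rep_lin[OF X a] c(1)] by (simp add: cocycle_of_def)
  qed
qed

definition cocycle_ext ::
  "('v, 'a) pre_digraph \<Rightarrow> ('v, 'a, 'k, 's) rep \<Rightarrow> ('v, 'a, 'k, 'x) rep \<Rightarrow> ('a \<Rightarrow> 's \<Rightarrow> 'x) \<Rightarrow>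
     ('v, 'a, 'k, 'x \<times> 's) rep" where
  "cocycle_ext Q S X \<zeta> =
     \<lparr>vspace = (\<lambda>i. direct_sum (vspace X i) (vspace S i)),
      act = (\<lambda>\<alpha> z. (act X \<alpha> (fst z) \<oplus>\<^bsub>vspace X (head Q \<alpha>)\<^esub> \<zeta> \<alpha> (snd z), act S \<alpha> (snd z)))\<rparr>"

lemma direct_sum_simps [simp]:
  "carrier (direct_sum V W) = carrier V \<times> carrier W"
  "x \<oplus>\<^bsub>direct_sum V W\<^esub> y = (fst x \<oplus>\<^bsub>V\<^esub> fst y, snd x \<oplus>\<^bsub>W\<^esub> snd y)"
  "c \<odot>\<^bsub>direct_sum V W\<^esub> x = (c \<odot>\<^bsub>V\<^esub> fst x, c \<odot>\<^bsub>W\<^esub> snd x)"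
  "\<zero>\<^bsub>direct_sum V W\<^esub> = (\<zero>\<^bsub>V\<^esub>, \<zero>\<^bsub>W\<^esub>)"
  by (simp_all add: direct_sum_def)

lemma direct_sum_fin_dim:
  assumes V: "vsp V" and W: "vsp W" and fd: "vectorspace.fin_dim class_ring V" "vectorspace.fin_dim class_ring W"
  shows "vectorspace.fin_dim class_ring (direct_sum V W)"
proof -
  define m n where "m = vectorspace.dim class_ring V" and "n = vectorspace.dim class_ring W"
  obtain b l where b: "dual_basis V (carrier V) m b l"
    using adapted_dual_basis[OF fd(1) sub_carrier[OF V]] m_def by metis
  obtain b' l' where b': "dual_basis W (carrier W) n b' l'"
    using adapted_dual_basis[OF fd(2) sub_carrier[OF W]] n_def by metis
  have "dual_basis (direct_sum V W) (carrier (direct_sum V W)) (m + n)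
      (\<lambda>s. if s < m then (b s, \<zero>\<^bsub>W\<^esub>) else (\<zero>\<^bsub>V\<^esub>, b' (s - m)))
      (\<lambda>r x. if r < m then l r (fst x) else l' (r - m) (snd x))"
    unfolding dual_basis_def
  proof (intro conjI allI impI ballI)
    fix r s assume r: "r < m + n"
    show "(if r < m then (b r, \<zero>\<^bsub>W\<^esub>) else (\<zero>\<^bsub>V\<^esub>, b' (r - m))) \<in> carrier (direct_sum V W)"
      using r dual_basis_in[OF b, of r] dual_basis_in[OF b', of "r - m"] V W by (auto simp: vsp_zero)
    show "(\<lambda>x. if r < m then l r (fst x) else l' (r - m) (snd x)) \<in> linear_forms (direct_sum V W)"
      using r by (intro formI)
        (auto simp: forms[OF dual_basis_form[OF b]] forms[OF dual_basis_form[OF b', of "r - m"]])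
    assume s: "s < m + n"
    show "(if r < m then l r (fst (if s < m then (b s, \<zero>\<^bsub>W\<^esub>) else (\<zero>\<^bsub>V\<^esub>, b' (s - m))))
         else l' (r - m) (snd (if s < m then (b s, \<zero>\<^bsub>W\<^esub>) else (\<zero>\<^bsub>V\<^esub>, b' (s - m))))) =
        (if r = s then 1 else 0)"
      using r s dual_basis_delta[OF b, of r s] dual_basis_delta[OF b', of "r - m" "s - m"]
        form_zero[OF V dual_basis_form[OF b, of r]] form_zero[OF W dual_basis_form[OF b', of "r - m"]]
      by auto
  next
    fix x assume x: "x \<in> carrier (direct_sum V W)"
      and z: "\<forall>r<m + n. (if r < m then l r (fst x) else l' (r - m) (snd x)) = 0"
    have "fst x = \<zero>\<^bsub>V\<^esub>"
    proof (rule dual_basis_zero[OF b])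
      show "l r (fst x) = 0" if "r < m" for r using z[rule_format, of r] that by simp
    qed (use x in auto)
    moreover have "snd x = \<zero>\<^bsub>W\<^esub>"
    proof (rule dual_basis_zero[OF b'])
      show "l' r (snd x) = 0" if "r < n" for r using z[rule_format, of "r + m"] that by simp
    qed (use x in auto)
    ultimately show "x = \<zero>\<^bsub>direct_sum V W\<^esub>" by (simp add: prod_eq_iff)
  qed
  then show ?thesis using dual_basis_dim(2)[OF direct_sum_is_vs[OF V W]] by blast
qed

text \<open>Conversely every family of linear maps is the cocycle of an extension: a quiver has no relations that
  would have to be respected.\<close>
lemma cocycle_extension:
  assumes Q: "wf_digraph Q" and X: "representation Q X" and S: "representation Q S"
    and z: "\<And>\<alpha>. \<alpha> \<in> arcs Q \<Longrightarrow> lin (vspace S (tail Q \<alpha>)) (vspace X (head Q \<alpha>)) (\<zeta> \<alpha>)"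
  shows "extension Q S X (cocycle_ext Q S X \<zeta>) (\<lambda>i x. (x, \<zero>\<^bsub>vspace S i\<^esub>)) (\<lambda>i. snd)"
proof -
  have vs: "vsp (direct_sum (vspace X i) (vspace S i))" if "i \<in> verts Q" for i
    using direct_sum_is_vs[OF rep_vsp[OF X that] rep_vsp[OF S that]] .
  have ends: "tail Q \<alpha> \<in> verts Q" "head Q \<alpha> \<in> verts Q" if "\<alpha> \<in> arcs Q" for \<alpha>
    using Q that by (auto simp: wf_digraph.tail_in_verts wf_digraph.head_in_verts)
  show ?thesis
    unfolding extension_def
  proof (intro conjI ballI)
    show "representation Q (cocycle_ext Q S X \<zeta>)"
      unfolding representation_def cocycle_ext_def rep.simps
    proof (intro conjI ballI)
      fix i assume i: "i \<in> verts Q"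
      show "vsp (direct_sum (vspace X i) (vspace S i))" using vs[OF i] .
      show "vectorspace.fin_dim class_ring (direct_sum (vspace X i) (vspace S i))"
        using i X S by (intro direct_sum_fin_dim) (auto simp: repD)
    next
      fix \<alpha> assume a: "\<alpha> \<in> arcs Q"
      interpret H: vectorspace class_ring "vspace X (head Q \<alpha>)" using rep_vsp[OF X ends(2)[OF a]] .
      note l = lin_facts[OF rep_lin[OF X a]] lin_facts[OF rep_lin[OF S a]] lin_facts[OF z[OF a]]
      show "lin (direct_sum (vspace X (tail Q \<alpha>)) (vspace S (tail Q \<alpha>)))
         (direct_sum (vspace X (head Q \<alpha>)) (vspace S (head Q \<alpha>)))
         (\<lambda>z. (act X \<alpha> (fst z) \<oplus>\<^bsub>vspace X (head Q \<alpha>)\<^esub> \<zeta> \<alpha> (snd z), act S \<alpha> (snd z)))"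
        by (rule linI[OF vs vs]) (auto simp: ends[OF a] l H.M.a_ac H.smult_r_distr[simplified])
    qed
    show "rep_hom Q X (cocycle_ext Q S X \<zeta>) (\<lambda>i x. (x, \<zero>\<^bsub>vspace S i\<^esub>))"
      unfolding rep_hom_def cocycle_ext_def rep.simps
    proof (intro conjI ballI)
      fix i assume i: "i \<in> verts Q"
      interpret S: vectorspace class_ring "vspace S i" using rep_vsp[OF S i] .
      show "lin (vspace X i) (direct_sum (vspace X i) (vspace S i)) (\<lambda>x. (x, \<zero>\<^bsub>vspace S i\<^esub>))"
        by (rule linI[OF rep_vsp[OF X i] vs[OF i]]) (auto simp: S.smult_r_null[simplified])
    next
      fix \<alpha> x assume a: "\<alpha> \<in> arcs Q" and x: "x \<in> carrier (vspace X (tail Q \<alpha>))"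
      interpret H: vectorspace class_ring "vspace X (head Q \<alpha>)" using rep_vsp[OF X ends(2)[OF a]] .
      show "(act X \<alpha> x, \<zero>\<^bsub>vspace S (head Q \<alpha>)\<^esub>) =
         (act X \<alpha> (fst (x, \<zero>\<^bsub>vspace S (tail Q \<alpha>)\<^esub>)) \<oplus>\<^bsub>vspace X (head Q \<alpha>)\<^esub> \<zeta> \<alpha> (snd (x, \<zero>\<^bsub>vspace S (tail Q \<alpha>)\<^esub>)),
          act S \<alpha> (snd (x, \<zero>\<^bsub>vspace S (tail Q \<alpha>)\<^esub>)))"
        using lin_zero[OF rep_lin[OF S a]] lin_zero[OF z[OF a]] lin_closed[OF rep_lin[OF X a] x] by simp
    qed
    show "rep_hom Q (cocycle_ext Q S X \<zeta>) S (\<lambda>i. snd)"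
      unfolding rep_hom_def cocycle_ext_def rep.simps
      using vs rep_vsp[OF S] by (auto intro!: linI)
  next
    fix i assume i: "i \<in> verts Q"
    show "inj_on (\<lambda>x. (x, \<zero>\<^bsub>vspace S i\<^esub>)) (carrier (vspace X i))" by (auto simp: inj_on_def)
    show "(\<lambda>x. (x, \<zero>\<^bsub>vspace S i\<^esub>)) ` carrier (vspace X i)
       = {y \<in> carrier (vspace (cocycle_ext Q S X \<zeta>) i). snd y = \<zero>\<^bsub>vspace S i\<^esub>}"
      using vsp_zero[OF rep_vsp[OF S i]] by (auto simp: cocycle_ext_def)
    show "snd ` carrier (vspace (cocycle_ext Q S X \<zeta>) i) = carrier (vspace S i)"
      using vsp_zero[OF rep_vsp[OF X i]] by (force simp: cocycle_ext_def)
  qed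
qed

definition coboundary ::
  "('v, 'a) pre_digraph \<Rightarrow> ('v, 'a, 'k::field, 's) rep \<Rightarrow> ('v, 'a, 'k, 'x) rep \<Rightarrow> ('a \<Rightarrow> 's \<Rightarrow> 'x) \<Rightarrow>
     ('v \<Rightarrow> 's \<Rightarrow> 'x) \<Rightarrow> bool" where
  "coboundary Q S X \<zeta> \<phi> \<longleftrightarrow>
     (\<forall>i\<in>verts Q. lin (vspace S i) (vspace X i) (\<phi> i)) \<and>
     (\<forall>\<alpha>\<in>arcs Q. \<forall>s\<in>carrier (vspace S (tail Q \<alpha>)).
        \<zeta> \<alpha> s \<oplus>\<^bsub>vspace X (head Q \<alpha>)\<^esub> act X \<alpha> (\<phi> (tail Q \<alpha>) s) = \<phi> (head Q \<alpha>) (act S \<alpha> s))"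

text \<open>\<open>Ext\<^sup>1\<close> is the cokernel of the coboundary map: the sections of the extension with cocycle \<open>\<zeta>\<close> are the
  graphs of the families \<open>\<phi>\<close> with coboundary \<open>\<zeta>\<close>.\<close>
lemma Ext1_vanishes_iff_coboundary:
  fixes S :: "('v, 'a, 'k::field, 's) rep" and X :: "('v, 'a, 'k, 'x) rep"
  assumes Q: "wf_digraph Q" and X: "representation Q X" and S: "representation Q S"
  shows "Ext1_vanishes Q S X \<longleftrightarrow>
    (\<forall>\<zeta>. (\<forall>\<alpha>\<in>arcs Q. lin (vspace S (tail Q \<alpha>)) (vspace X (head Q \<alpha>)) (\<zeta> \<alpha>)) \<longrightarrow>
       (\<exists>\<phi>. coboundary Q S X \<zeta> \<phi>))"
proof (intro iffI allI impI)
  have ends: "tail Q \<alpha> \<in> verts Q" "head Q \<alpha> \<in> verts Q" if "\<alpha> \<in> arcs Q" for \<alpha>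
    using Q that by (auto simp: wf_digraph.tail_in_verts wf_digraph.head_in_verts)
  {
    fix \<zeta> :: "'a \<Rightarrow> 's \<Rightarrow> 'x"
    assume E: "Ext1_vanishes Q S X"
      and z: "\<forall>\<alpha>\<in>arcs Q. lin (vspace S (tail Q \<alpha>)) (vspace X (head Q \<alpha>)) (\<zeta> \<alpha>)"
    have "split_extension Q S (cocycle_ext Q S X \<zeta>) (\<lambda>i. snd)"
      using E cocycle_extension[OF Q X S] z unfolding Ext1_vanishes_def by blast
    then obtain \<sigma> where s: "rep_hom Q S (cocycle_ext Q S X \<zeta>) \<sigma>"
      and sn: "\<And>i s. i \<in> verts Q \<Longrightarrow> s \<in> carrier (vspace S i) \<Longrightarrow> snd (\<sigma> i s) = s"
      unfolding split_extension_def by blast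
    have l: "lin (vspace S i) (vspace X i) (\<lambda>s. fst (\<sigma> i s))" if i: "i \<in> verts Q" for i
    proof -
      have "lin (direct_sum (vspace X i) (vspace S i)) (vspace X i) fst"
        using rep_vsp[OF X i] rep_vsp[OF S i] by (intro linI direct_sum_is_vs) auto
      moreover have "lin (vspace S i) (direct_sum (vspace X i) (vspace S i)) (\<sigma> i)"
        using rep_hom_lin[OF s i] by (simp add: cocycle_ext_def)
      ultimately show ?thesis by (rule lin_comp[rotated])
    qed
    have "coboundary Q S X \<zeta> (\<lambda>i s. fst (\<sigma> i s))"
      unfolding coboundary_def
    proof (intro conjI ballI l)
      fix \<alpha> s assume a: "\<alpha> \<in> arcs Q" and s': "s \<in> carrier (vspace S (tail Q \<alpha>))"
      interpret H: vectorspace class_ring "vspace X (head Q \<alpha>)" using rep_vsp[OF X ends(2)[OF a]] .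
      show "\<zeta> \<alpha> s \<oplus>\<^bsub>vspace X (head Q \<alpha>)\<^esub> act X \<alpha> (fst (\<sigma> (tail Q \<alpha>) s)) = fst (\<sigma> (head Q \<alpha>) (act S \<alpha> s))"
        using rep_hom_act[OF s a s'] sn[OF ends(1)[OF a] s'] lin_closed[OF z[rule_format, OF a] s']
          lin_closed[OF rep_lin[OF X a] lin_closed[OF l[OF ends(1)[OF a]] s']]
        by (simp add: cocycle_ext_def H.M.a_comm)
    qed
    then show "\<exists>\<phi>. coboundary Q S X \<zeta> \<phi>" by blast
  }
  assume C: "\<forall>\<zeta>. (\<forall>\<alpha>\<in>arcs Q. lin (vspace S (tail Q \<alpha>)) (vspace X (head Q \<alpha>)) (\<zeta> \<alpha>)) \<longrightarrow>
       (\<exists>\<phi>. coboundary Q S X \<zeta> \<phi>)"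
  show "Ext1_vanishes Q S X"
    unfolding Ext1_vanishes_def
  proof (intro allI impI)
    fix Z :: "('v, 'a, 'k, 'x \<times> 's) rep" and \<kappa> \<rho> assume E: "extension Q S X Z \<kappa> \<rho>"
    obtain \<tau> p where v: "vertex_splitting_of Q S X Z \<kappa> \<rho> \<tau> p" using vertex_splitting_exists[OF E S] .
    define \<zeta> where "\<zeta> = cocycle_of Q Z \<tau> p"
    have "\<forall>\<alpha>\<in>arcs Q. lin (vspace S (tail Q \<alpha>)) (vspace X (head Q \<alpha>)) (\<zeta> \<alpha>)"
      unfolding \<zeta>_def using cocycle_lin[OF Q E v] by blast
    then obtain \<phi> where cb: "coboundary Q S X \<zeta> \<phi>" using C by blast
    have ph: "lin (vspace S i) (vspace X i) (\<phi> i)" if "i \<in> verts Q" for i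
      using cb that unfolding coboundary_def by blast
    \<comment> \<open>correct the linear section by \<open>\<phi>\<close> to make it a morphism\<close>
    define \<sigma> where "\<sigma> i s = \<tau> i s \<oplus>\<^bsub>vspace Z i\<^esub> \<kappa> i (\<phi> i s)" for i s
    note k = rep_hom_lin[OF ext_iota[OF E]] and t = vsplit_tau[OF v] and r = rep_hom_lin[OF ext_pi[OF E]]
    have c: "\<tau> i s \<in> carrier (vspace Z i)" "\<phi> i s \<in> carrier (vspace X i)" "\<kappa> i (\<phi> i s) \<in> carrier (vspace Z i)"
      if "i \<in> verts Q" "s \<in> carrier (vspace S i)" for i s
      using lin_closed[OF t] lin_closed[OF ph] lin_closed[OF k] that by auto
    have "rep_hom Q S Z \<sigma>"
      unfolding rep_hom_def
    proof (intro conjI ballI)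
      fix i assume i: "i \<in> verts Q"
      interpret Z: vectorspace class_ring "vspace Z i" using rep_vsp[OF ext_rep[OF E] i] .
      note l = lin_facts[OF t[OF i]] lin_facts[OF ph[OF i]] lin_facts[OF k[OF i]]
      show "lin (vspace S i) (vspace Z i) (\<sigma> i)"
        unfolding \<sigma>_def
        by (rule linI) (auto simp: l Z.M.a_ac Z.smult_r_distr[simplified])
    next
      fix \<alpha> s assume a: "\<alpha> \<in> arcs Q" and s: "s \<in> carrier (vspace S (tail Q \<alpha>))"
      note e = ends[OF a]
      interpret Z: vectorspace class_ring "vspace Z (head Q \<alpha>)" using rep_vsp[OF ext_rep[OF E] e(2)] .
      have Ss: "act S \<alpha> s \<in> carrier (vspace S (head Q \<alpha>))" using lin_closed[OF rep_lin[OF S a] s] .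
      have zs: "\<zeta> \<alpha> s \<in> carrier (vspace X (head Q \<alpha>))"
        unfolding \<zeta>_def using lin_closed[OF cocycle_lin[OF Q E v a] s] .
      have Xs: "act X \<alpha> (\<phi> (tail Q \<alpha>) s) \<in> carrier (vspace X (head Q \<alpha>))"
        using lin_closed[OF rep_lin[OF X a]] c(2)[OF e(1) s] .
      have "act Z \<alpha> (\<sigma> (tail Q \<alpha>) s) = act Z \<alpha> (\<tau> (tail Q \<alpha>) s) \<oplus>\<^bsub>vspace Z (head Q \<alpha>)\<^esub>
          act Z \<alpha> (\<kappa> (tail Q \<alpha>) (\<phi> (tail Q \<alpha>) s))"
        unfolding \<sigma>_def using lin_add[OF rep_lin[OF ext_rep[OF E] a]] c[OF e(1) s] by blast
      also have "\<dots> = (\<kappa> (head Q \<alpha>) (\<zeta> \<alpha> s) \<oplus>\<^bsub>vspace Z (head Q \<alpha>)\<^esub> \<tau> (head Q \<alpha>) (act S \<alpha> s))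
          \<oplus>\<^bsub>vspace Z (head Q \<alpha>)\<^esub> \<kappa> (head Q \<alpha>) (act X \<alpha> (\<phi> (tail Q \<alpha>) s))"
        using act_section[OF Q E v a s] rep_hom_act[OF ext_iota[OF E] a c(2)[OF e(1) s]] by (simp add: \<zeta>_def)
      also have "\<dots> = \<tau> (head Q \<alpha>) (act S \<alpha> s) \<oplus>\<^bsub>vspace Z (head Q \<alpha>)\<^esub>
          \<kappa> (head Q \<alpha>) (\<zeta> \<alpha> s \<oplus>\<^bsub>vspace X (head Q \<alpha>)\<^esub> act X \<alpha> (\<phi> (tail Q \<alpha>) s))"
        using lin_add[OF k[OF e(2)] zs Xs] lin_closed[OF k[OF e(2)] zs] lin_closed[OF k[OF e(2)] Xs]
          c(1)[OF e(2) Ss] by (simp add: Z.M.a_ac)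
      also have "\<dots> = \<sigma> (head Q \<alpha>) (act S \<alpha> s)"
        using cb a s unfolding coboundary_def \<sigma>_def by simp
      finally show "\<sigma> (head Q \<alpha>) (act S \<alpha> s) = act Z \<alpha> (\<sigma> (tail Q \<alpha>) s)" by simp
    qed
    moreover have "\<rho> i (\<sigma> i s) = s" if i: "i \<in> verts Q" and s: "s \<in> carrier (vspace S i)" for i s
    proof -
      interpret S: vectorspace class_ring "vspace S i" using rep_vsp[OF S i] .
      have "\<rho> i (\<kappa> i (\<phi> i s)) = \<zero>\<^bsub>vspace S i\<^esub>" using ext_exact[OF E i] c(2)[OF i s] by blast
      then show ?thesis
        unfolding \<sigma>_def using lin_add[OF r[OF i]] c[OF i s] vsplit_rt[OF v i s] s by simp
    qed
    ultimately show "split_extension Q S Z \<rho>" unfolding split_extension_def by blast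
  qed
qed

text \<open>The morphism of extensions that exhibits the extension with cocycle \<open>\<zeta>\<close> as the multiple by \<open>c\<close> sends the
  section of \<open>Y\<close> to the graph of a family \<open>u\<close>; comparing the actions of the arrows yields the equation.\<close>
lemma generating_extension_cocycle:
  fixes S :: "('v, 'a, 'k::field, 's) rep" and X :: "('v, 'a, 'k, 'x) rep" and Y :: "('v, 'a, 'k, 'y) rep"
  assumes Q: "wf_digraph Q" and X: "representation Q X" and S: "representation Q S"
    and G: "generating_extension Q S X Y \<iota> \<pi>"
    and v: "vertex_splitting_of Q S X Y \<iota> \<pi> \<sigma> p"
    and z: "\<And>\<alpha>. \<alpha> \<in> arcs Q \<Longrightarrow> lin (vspace S (tail Q \<alpha>)) (vspace X (head Q \<alpha>)) (\<zeta> \<alpha>)"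
  obtains c u where "\<And>i. i \<in> verts Q \<Longrightarrow> lin (vspace S i) (vspace X i) (u i)"
    and "\<And>\<alpha> s. \<alpha> \<in> arcs Q \<Longrightarrow> s \<in> carrier (vspace S (tail Q \<alpha>)) \<Longrightarrow>
       \<zeta> \<alpha> s \<oplus>\<^bsub>vspace X (head Q \<alpha>)\<^esub> act X \<alpha> (u (tail Q \<alpha>) s) =
       c \<odot>\<^bsub>vspace X (head Q \<alpha>)\<^esub> cocycle_of Q Y \<sigma> p \<alpha> s \<oplus>\<^bsub>vspace X (head Q \<alpha>)\<^esub> u (head Q \<alpha>) (act S \<alpha> s)"
proof -
  have E: "extension Q S X Y \<iota> \<pi>" using G by (simp add: generating_extension_def)
  have ends: "tail Q \<alpha> \<in> verts Q" "head Q \<alpha> \<in> verts Q" if "\<alpha> \<in> arcs Q" for \<alpha>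
    using Q that by (auto simp: wf_digraph.tail_in_verts wf_digraph.head_in_verts)
  let ?Z = "cocycle_ext Q S X \<zeta>"
  obtain c where "extension_multiple Q X c Y \<iota> \<pi> ?Z (\<lambda>i x. (x, \<zero>\<^bsub>vspace S i\<^esub>)) (\<lambda>i. snd)"
    using G cocycle_extension[OF Q X S z] unfolding generating_extension_def by blast
  then obtain h where h: "rep_hom Q Y ?Z h"
    and hi: "\<And>i x. i \<in> verts Q \<Longrightarrow> x \<in> carrier (vspace X i) \<Longrightarrow> h i (\<iota> i x) = (c \<odot>\<^bsub>vspace X i\<^esub> x, \<zero>\<^bsub>vspace S i\<^esub>)"
    and hp: "\<And>i y. i \<in> verts Q \<Longrightarrow> y \<in> carrier (vspace Y i) \<Longrightarrow> snd (h i y) = \<pi> i y"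
    unfolding extension_multiple_def by blast
  define u where "u i s = fst (h i (\<sigma> i s))" for i s
  have hl: "lin (vspace Y i) (direct_sum (vspace X i) (vspace S i)) (h i)" if "i \<in> verts Q" for i
    using rep_hom_lin[OF h that] by (simp add: cocycle_ext_def)
  have ul: "lin (vspace S i) (vspace X i) (u i)" if i: "i \<in> verts Q" for i
  proof -
    have "lin (direct_sum (vspace X i) (vspace S i)) (vspace X i) fst"
      using rep_vsp[OF X i] rep_vsp[OF S i] by (intro linI direct_sum_is_vs) auto
    then show ?thesis unfolding u_def by (rule lin_comp[OF lin_comp[OF vsplit_tau[OF v i] hl[OF i]]])
  qed
  show ?thesis
  proof (rule that[of u c, OF ul])
    fix \<alpha> s assume a: "\<alpha> \<in> arcs Q" and s: "s \<in> carrier (vspace S (tail Q \<alpha>))"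
    note e = ends[OF a]
    interpret H: vectorspace class_ring "vspace X (head Q \<alpha>)" using rep_vsp[OF X e(2)] .
    let ?x = "cocycle_of Q Y \<sigma> p \<alpha> s"
    have xs: "?x \<in> carrier (vspace X (head Q \<alpha>))" using lin_closed[OF cocycle_lin[OF Q E v a] s] .
    have Ss: "act S \<alpha> s \<in> carrier (vspace S (head Q \<alpha>))" using lin_closed[OF rep_lin[OF S a] s] .
    have ss: "\<sigma> (tail Q \<alpha>) s \<in> carrier (vspace Y (tail Q \<alpha>))" using lin_closed[OF vsplit_tau[OF v e(1)] s] .
    have c2: "\<iota> (head Q \<alpha>) ?x \<in> carrier (vspace Y (head Q \<alpha>))"
      "\<sigma> (head Q \<alpha>) (act S \<alpha> s) \<in> carrier (vspace Y (head Q \<alpha>))"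
      using lin_closed[OF rep_hom_lin[OF ext_iota[OF E] e(2)] xs] lin_closed[OF vsplit_tau[OF v e(2)] Ss] .
    have sn: "snd (h (tail Q \<alpha>) (\<sigma> (tail Q \<alpha>) s)) = s"
      using hp[OF e(1) ss] vsplit_rt[OF v e(1) s] by simp
    have "h (head Q \<alpha>) (act Y \<alpha> (\<sigma> (tail Q \<alpha>) s)) = act ?Z \<alpha> (h (tail Q \<alpha>) (\<sigma> (tail Q \<alpha>) s))"
      using rep_hom_act[OF h a ss] .
    then have "fst (h (head Q \<alpha>) (act Y \<alpha> (\<sigma> (tail Q \<alpha>) s))) =
        act X \<alpha> (u (tail Q \<alpha>) s) \<oplus>\<^bsub>vspace X (head Q \<alpha>)\<^esub> \<zeta> \<alpha> s"
      using sn by (simp add: cocycle_ext_def u_def)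
    also have "act Y \<alpha> (\<sigma> (tail Q \<alpha>) s) = \<iota> (head Q \<alpha>) ?x \<oplus>\<^bsub>vspace Y (head Q \<alpha>)\<^esub> \<sigma> (head Q \<alpha>) (act S \<alpha> s)"
      using act_section[OF Q E v a s] .
    also have "h (head Q \<alpha>) \<dots> = h (head Q \<alpha>) (\<iota> (head Q \<alpha>) ?x)
        \<oplus>\<^bsub>direct_sum (vspace X (head Q \<alpha>)) (vspace S (head Q \<alpha>))\<^esub> h (head Q \<alpha>) (\<sigma> (head Q \<alpha>) (act S \<alpha> s))"
      by (rule lin_add[OF hl[OF e(2)] c2])
    finally show "\<zeta> \<alpha> s \<oplus>\<^bsub>vspace X (head Q \<alpha>)\<^esub> act X \<alpha> (u (tail Q \<alpha>) s) =
       c \<odot>\<^bsub>vspace X (head Q \<alpha>)\<^esub> ?x \<oplus>\<^bsub>vspace X (head Q \<alpha>)\<^esub> u (head Q \<alpha>) (act S \<alpha> s)"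
      using hi[OF e(2) xs] lin_closed[OF z[OF a] s]
        lin_closed[OF rep_lin[OF X a] lin_closed[OF ul[OF e(1)] s]]
      by (simp add: H.M.a_comm u_def)
  qed
qed

section \<open>The coboundary map in coordinates\<close>

text \<open>The coboundary map in coordinates.  Here \<open>\<Phi> i\<close> is the matrix of the component at the vertex \<open>i\<close>, of
  size \<open>c i \<times> g i\<close>, and \<open>B\<close>, \<open>A\<close> are the matrices of the arrows on the source and on the target:
  for every arrow this is the matrix expression \<open>\<Phi> B - A \<Phi>\<close> of Sylvester's equation.\<close>
definition sylvester ::
  "('v, 'a) pre_digraph \<Rightarrow> ('v \<Rightarrow> nat) \<Rightarrow> ('v \<Rightarrow> nat) \<Rightarrow> ('a \<Rightarrow> nat \<Rightarrow> nat \<Rightarrow> 'k) \<Rightarrow> ('a \<Rightarrow> nat \<Rightarrow> nat \<Rightarrow> 'k) \<Rightarrow>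
     ('v \<Rightarrow> nat \<Rightarrow> nat \<Rightarrow> 'k::field) \<Rightarrow> 'a \<Rightarrow> nat \<Rightarrow> nat \<Rightarrow> 'k" where
  "sylvester Q g c B A \<Phi> \<alpha> r s =
     (\<Sum>u<g (head Q \<alpha>). B \<alpha> u s * \<Phi> (head Q \<alpha>) r u) - (\<Sum>t<c (tail Q \<alpha>). A \<alpha> r t * \<Phi> (tail Q \<alpha>) t s)"

text \<open>Linear maps and matrices correspond to each other through the dual bases; a linear identity need only
  be checked on the basis vectors \<open>m i s\<close> and after applying the forms \<open>\<omega> i r\<close>.\<close>
lemma Ext1_vanishes_iff_sylvester:
  fixes S :: "('v, 'a, 'k::field, 's) rep" and X :: "('v, 'a, 'k, 'x) rep"
  assumes Q: "wf_digraph Q" and X: "representation Q X" and S: "representation Q S"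
    and m: "\<And>i. i \<in> verts Q \<Longrightarrow> dual_basis (vspace S i) (carrier (vspace S i)) (g i) (m i) (\<mu> i)"
    and w: "\<And>i. i \<in> verts Q \<Longrightarrow> dual_basis (vspace X i) (carrier (vspace X i)) (c i) (w i) (\<omega> i)"
  shows "Ext1_vanishes Q S X \<longleftrightarrow> (\<forall>y. \<exists>\<Phi>. \<forall>\<alpha>\<in>arcs Q. \<forall>r<c (head Q \<alpha>). \<forall>s<g (tail Q \<alpha>).
     sylvester Q g c (\<lambda>\<alpha> u s. \<mu> (head Q \<alpha>) u (act S \<alpha> (m (tail Q \<alpha>) s)))
       (\<lambda>\<alpha> r t. \<omega> (head Q \<alpha>) r (act X \<alpha> (w (tail Q \<alpha>) t))) \<Phi> \<alpha> r s = y \<alpha> r s)"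
proof -
  let ?T = "sylvester Q g c (\<lambda>\<alpha> u s. \<mu> (head Q \<alpha>) u (act S \<alpha> (m (tail Q \<alpha>) s)))
       (\<lambda>\<alpha> r t. \<omega> (head Q \<alpha>) r (act X \<alpha> (w (tail Q \<alpha>) t)))"
  have ends: "tail Q \<alpha> \<in> verts Q" "head Q \<alpha> \<in> verts Q" if "\<alpha> \<in> arcs Q" for \<alpha>
    using Q that by (auto simp: wf_digraph.tail_in_verts wf_digraph.head_in_verts)
  note vX = rep_vsp[OF X] and vS = rep_vsp[OF S]
  \<comment> \<open>the matrices of linear maps \<open>\<phi> i\<close> solve the equations for the matrix of their coboundary\<close>
  have T: "?T (\<lambda>i r s. \<omega> i r (\<phi> i (m i s))) \<alpha> r s =
      \<omega> (head Q \<alpha>) r (\<phi> (head Q \<alpha>) (act S \<alpha> (m (tail Q \<alpha>) s)))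
        - \<omega> (head Q \<alpha>) r (act X \<alpha> (\<phi> (tail Q \<alpha>) (m (tail Q \<alpha>) s)))"
    if ph: "\<And>i. i \<in> verts Q \<Longrightarrow> lin (vspace S i) (vspace X i) (\<phi> i)"
      and a: "\<alpha> \<in> arcs Q" and r: "r < c (head Q \<alpha>)" and s: "s < g (tail Q \<alpha>)" for \<phi> \<alpha> r s
  proof -
    note e = ends[OF a]
    note ms = dual_basis_in[OF m[OF e(1)] s]
    note om = dual_basis_form[OF w[OF e(2)] r]
    show ?thesis
      unfolding sylvester_def
      using form_expand'[OF m[OF e(2)] sub_carrier[OF vS[OF e(2)]] lin_closed[OF rep_lin[OF S a] ms]
          form_comp[OF ph[OF e(2)] om]]
        form_expand'[OF w[OF e(1)] sub_carrier[OF vX[OF e(1)]] lin_closed[OF ph[OF e(1)] ms]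
          form_comp[OF rep_lin[OF X a] om]]
      by (simp add: mult.commute)
  qed
  show ?thesis
    unfolding Ext1_vanishes_iff_coboundary[OF Q X S]
  proof (intro iffI allI impI)
    fix y :: "'a \<Rightarrow> nat \<Rightarrow> nat \<Rightarrow> 'k"
    assume C: "\<forall>\<zeta>. (\<forall>\<alpha>\<in>arcs Q. lin (vspace S (tail Q \<alpha>)) (vspace X (head Q \<alpha>)) (\<zeta> \<alpha>)) \<longrightarrow>
         (\<exists>\<phi>. coboundary Q S X \<zeta> \<phi>)"
    define \<zeta> where "\<zeta> \<alpha> x = comb (vspace X (head Q \<alpha>)) (c (head Q \<alpha>))
        (\<lambda>r. \<Sum>s<g (tail Q \<alpha>). y \<alpha> r s * \<mu> (tail Q \<alpha>) s x) (w (head Q \<alpha>))" for \<alpha> x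
    have zl: "lin (vspace S (tail Q \<alpha>)) (vspace X (head Q \<alpha>)) (\<zeta> \<alpha>)" if "\<alpha> \<in> arcs Q" for \<alpha>
      unfolding \<zeta>_def using ends[OF that] dual_basis_form[OF m] dual_basis_in[OF w]
      by (intro comb_lin vS vX form_lincomb) auto
    then obtain \<phi> where cb: "coboundary Q S X \<zeta> \<phi>" using C by blast
    then have ph: "lin (vspace S i) (vspace X i) (\<phi> i)" if "i \<in> verts Q" for i
      using that unfolding coboundary_def by blast
    have "?T (\<lambda>i r s. \<omega> i r (\<phi> i (m i s))) \<alpha> r s = y \<alpha> r s"
      if a: "\<alpha> \<in> arcs Q" and r: "r < c (head Q \<alpha>)" and s: "s < g (tail Q \<alpha>)" for \<alpha> r s
    proof -
      note e = ends[OF a]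
      note ms = dual_basis_in[OF m[OF e(1)] s]
      note om = dual_basis_form[OF w[OF e(2)] r]
      let ?ms = "m (tail Q \<alpha>) s"
      have "\<omega> (head Q \<alpha>) r (\<zeta> \<alpha> ?ms) =
          (\<Sum>r'<c (head Q \<alpha>). (\<Sum>s'<g (tail Q \<alpha>). y \<alpha> r' s' * \<mu> (tail Q \<alpha>) s' ?ms) * \<omega> (head Q \<alpha>) r (w (head Q \<alpha>) r'))"
        unfolding \<zeta>_def using dual_basis_in[OF w[OF e(2)]] by (intro form_comb vX e om)
      also have "\<dots> = (\<Sum>r'<c (head Q \<alpha>). if r' = r then (\<Sum>s'<g (tail Q \<alpha>). y \<alpha> r s' * \<mu> (tail Q \<alpha>) s' ?ms) else 0)"
        using r by (intro sum.cong) (auto simp: dual_basis_delta[OF w[OF e(2)]])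
      also have "\<dots> = (\<Sum>s'<g (tail Q \<alpha>). y \<alpha> r s' * \<mu> (tail Q \<alpha>) s' ?ms)" using r by simp
      also have "\<dots> = (\<Sum>s'<g (tail Q \<alpha>). if s' = s then y \<alpha> r s else 0)"
        using s by (intro sum.cong) (auto simp: dual_basis_delta[OF m[OF e(1)]])
      also have "\<dots> = y \<alpha> r s" using s by simp
      finally have y: "\<omega> (head Q \<alpha>) r (\<zeta> \<alpha> ?ms) = y \<alpha> r s" .
      have "\<zeta> \<alpha> ?ms \<oplus>\<^bsub>vspace X (head Q \<alpha>)\<^esub> act X \<alpha> (\<phi> (tail Q \<alpha>) ?ms) = \<phi> (head Q \<alpha>) (act S \<alpha> ?ms)"
        using cb a ms unfolding coboundary_def by blast
      moreover have "\<omega> (head Q \<alpha>) r (\<zeta> \<alpha> ?ms \<oplus>\<^bsub>vspace X (head Q \<alpha>)\<^esub> act X \<alpha> (\<phi> (tail Q \<alpha>) ?ms)) =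
          \<omega> (head Q \<alpha>) r (\<zeta> \<alpha> ?ms) + \<omega> (head Q \<alpha>) r (act X \<alpha> (\<phi> (tail Q \<alpha>) ?ms))"
        by (intro form_add[OF om] lin_closed[OF zl[OF a] ms] lin_closed[OF rep_lin[OF X a]]
            lin_closed[OF ph[OF e(1)] ms])
      ultimately show ?thesis using T[OF ph a r s] y by simp
    qed
    then show "\<exists>\<Phi>. \<forall>\<alpha>\<in>arcs Q. \<forall>r<c (head Q \<alpha>). \<forall>s<g (tail Q \<alpha>). ?T \<Phi> \<alpha> r s = y \<alpha> r s" by blast
  next
    fix \<zeta> :: "'a \<Rightarrow> 's \<Rightarrow> 'x"
    assume C: "\<forall>y. \<exists>\<Phi>. \<forall>\<alpha>\<in>arcs Q. \<forall>r<c (head Q \<alpha>). \<forall>s<g (tail Q \<alpha>). ?T \<Phi> \<alpha> r s = y \<alpha> r s"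
      and z: "\<forall>\<alpha>\<in>arcs Q. lin (vspace S (tail Q \<alpha>)) (vspace X (head Q \<alpha>)) (\<zeta> \<alpha>)"
    obtain \<Phi> where P: "\<And>\<alpha> r s. \<alpha> \<in> arcs Q \<Longrightarrow> r < c (head Q \<alpha>) \<Longrightarrow> s < g (tail Q \<alpha>) \<Longrightarrow>
        ?T \<Phi> \<alpha> r s = \<omega> (head Q \<alpha>) r (\<zeta> \<alpha> (m (tail Q \<alpha>) s))"
      using spec[OF C, of "\<lambda>\<alpha> r s. \<omega> (head Q \<alpha>) r (\<zeta> \<alpha> (m (tail Q \<alpha>) s))"] by blast
    define \<phi> where "\<phi> i x = comb (vspace X i) (c i) (\<lambda>r. \<Sum>s<g i. \<Phi> i r s * \<mu> i s x) (w i)" for i x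
    have ph: "lin (vspace S i) (vspace X i) (\<phi> i)" if "i \<in> verts Q" for i
      unfolding \<phi>_def using that dual_basis_form[OF m] dual_basis_in[OF w]
      by (intro comb_lin vS vX form_lincomb) auto
    have om_ph: "\<omega> i r (\<phi> i (m i s)) = \<Phi> i r s" if i: "i \<in> verts Q" and r: "r < c i" and s: "s < g i" for i r s
    proof -
      have "\<omega> i r (\<phi> i (m i s)) = (\<Sum>r'<c i. (\<Sum>s'<g i. \<Phi> i r' s' * \<mu> i s' (m i s)) * \<omega> i r (w i r'))"
        unfolding \<phi>_def using dual_basis_in[OF w[OF i]] by (intro form_comb vX i dual_basis_form[OF w[OF i] r])
      also have "\<dots> = (\<Sum>r'<c i. if r' = r then (\<Sum>s'<g i. \<Phi> i r s' * \<mu> i s' (m i s)) else 0)"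
        using r by (intro sum.cong) (auto simp: dual_basis_delta[OF w[OF i]])
      also have "\<dots> = (\<Sum>s'<g i. \<Phi> i r s' * \<mu> i s' (m i s))" using r by simp
      also have "\<dots> = (\<Sum>s'<g i. if s' = s then \<Phi> i r s else 0)"
        using s by (intro sum.cong) (auto simp: dual_basis_delta[OF m[OF i]])
      also have "\<dots> = \<Phi> i r s" using s by simp
      finally show ?thesis .
    qed
    have "coboundary Q S X \<zeta> \<phi>"
      unfolding coboundary_def
    proof (intro conjI ballI ph)
      fix \<alpha> x assume a: "\<alpha> \<in> arcs Q" and x: "x \<in> carrier (vspace S (tail Q \<alpha>))"
      note e = ends[OF a]
      note A = rep_lin[OF X a] and B = rep_lin[OF S a] and Z = z[rule_format, OF a]
      show "\<zeta> \<alpha> x \<oplus>\<^bsub>vspace X (head Q \<alpha>)\<^esub> act X \<alpha> (\<phi> (tail Q \<alpha>) x) = \<phi> (head Q \<alpha>) (act S \<alpha> x)"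
      proof (rule dual_basis_eq[OF w[OF e(2)] sub_carrier[OF vX[OF e(2)]]])
        show "\<zeta> \<alpha> x \<oplus>\<^bsub>vspace X (head Q \<alpha>)\<^esub> act X \<alpha> (\<phi> (tail Q \<alpha>) x) \<in> carrier (vspace X (head Q \<alpha>))"
          by (intro vsp_add vX e lin_closed[OF Z x] lin_closed[OF A] lin_closed[OF ph] x)
        show "\<phi> (head Q \<alpha>) (act S \<alpha> x) \<in> carrier (vspace X (head Q \<alpha>))"
          by (intro lin_closed[OF ph] e lin_closed[OF B x])
        fix r assume r: "r < c (head Q \<alpha>)"
        note om = dual_basis_form[OF w[OF e(2)] r]
        let ?k = "\<lambda>x. \<omega> (head Q \<alpha>) r (\<phi> (head Q \<alpha>) (act S \<alpha> x)) - \<omega> (head Q \<alpha>) r (act X \<alpha> (\<phi> (tail Q \<alpha>) x))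
           - \<omega> (head Q \<alpha>) r (\<zeta> \<alpha> x)"
        have k: "?k \<in> linear_forms (vspace S (tail Q \<alpha>))"
          by (intro form_diff form_comp[OF lin_comp[OF B ph[OF e(2)]] om]
              form_comp[OF lin_comp[OF ph[OF e(1)] A] om] form_comp[OF Z om])
        have "?k (m (tail Q \<alpha>) s) = 0" if s: "s < g (tail Q \<alpha>)" for s
        proof -
          have "?T (\<lambda>i r s. \<omega> i r (\<phi> i (m i s))) \<alpha> r s = ?T \<Phi> \<alpha> r s"
            unfolding sylvester_def using r s e by (simp add: om_ph)
          then show ?thesis using T[OF ph a r s] P[OF a r s] by simp
        qed
        then have "?k x = 0"
          using form_expand'[OF m[OF e(1)] sub_carrier[OF vS[OF e(1)]] x k] by simp
        moreover have "\<omega> (head Q \<alpha>) r (\<zeta> \<alpha> x \<oplus>\<^bsub>vspace X (head Q \<alpha>)\<^esub> act X \<alpha> (\<phi> (tail Q \<alpha>) x)) =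
            \<omega> (head Q \<alpha>) r (\<zeta> \<alpha> x) + \<omega> (head Q \<alpha>) r (act X \<alpha> (\<phi> (tail Q \<alpha>) x))"
          by (intro form_add[OF om] lin_closed[OF Z x] lin_closed[OF A] lin_closed[OF ph[OF e(1)] x])
        ultimately show "\<omega> (head Q \<alpha>) r (\<zeta> \<alpha> x \<oplus>\<^bsub>vspace X (head Q \<alpha>)\<^esub> act X \<alpha> (\<phi> (tail Q \<alpha>) x)) =
            \<omega> (head Q \<alpha>) r (\<phi> (head Q \<alpha>) (act S \<alpha> x))" by (simp add: diff_eq_eq add.commute)
      qed
    qed
    then show "\<exists>\<phi>. coboundary Q S X \<zeta> \<phi>" by blast
  qed
qed

text \<open>The form needed below: no cosets occur in the matrices, since the forms \<open>\<kappa> i r\<close> factor through the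
  quotient.\<close>
lemma Ext1_vanishes_sub_quotient_iff:
  fixes S :: "('v, 'a, 'k::field, 's) rep" and X :: "('v, 'a, 'k, 'x) rep"
  assumes Q: "wf_digraph Q" and X: "representation Q X" and S: "representation Q S"
    and N': "N' \<in> subreps Q X" and N'': "N'' \<in> subreps Q S"
    and m: "\<And>i. i \<in> verts Q \<Longrightarrow> dual_basis (vspace S i) (N'' i) (g i) (m i) (\<mu> i)"
    and w: "\<And>i. i \<in> verts Q \<Longrightarrow> cobasis (vspace X i) (N' i) (c i) (w i) (\<kappa> i)"
  shows "Ext1_vanishes Q (sub_rep S N'') (quotient_rep Q X N') \<longleftrightarrow>
   (\<forall>y. \<exists>\<Phi>. \<forall>\<alpha>\<in>arcs Q. \<forall>r<c (head Q \<alpha>). \<forall>s<g (tail Q \<alpha>).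
     sylvester Q g c (\<lambda>\<alpha> u s. \<mu> (head Q \<alpha>) u (act S \<alpha> (m (tail Q \<alpha>) s)))
       (\<lambda>\<alpha> r t. \<kappa> (head Q \<alpha>) r (act X \<alpha> (w (tail Q \<alpha>) t))) \<Phi> \<alpha> r s = y \<alpha> r s)"
proof -
  have ends: "tail Q \<alpha> \<in> verts Q" "head Q \<alpha> \<in> verts Q" if "\<alpha> \<in> arcs Q" for \<alpha>
    using Q that by (auto simp: wf_digraph.tail_in_verts wf_digraph.head_in_verts)
  have m': "dual_basis (vspace (sub_rep S N'') i) (carrier (vspace (sub_rep S N'') i)) (g i) (m i) (\<mu> i)"
    if "i \<in> verts Q" for i
    using dual_basis_restrict[OF m[OF that] subrep_sub[OF N'' that]] by simp
  have w': "dual_basis (vspace (quotient_rep Q X N') i) (carrier (vspace (quotient_rep Q X N') i)) (c i)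
      (\<lambda>r. cls (vspace X i) (N' i) (w i r)) (\<lambda>r. coset_form (\<kappa> i r))"
    if "i \<in> verts Q" for i
    using quotient_dual_basis[OF subrep_sub[OF N' that] w[OF that]] by simp
  have "sylvester Q g c (\<lambda>\<alpha> u s. \<mu> (head Q \<alpha>) u (act S \<alpha> (m (tail Q \<alpha>) s)))
       (\<lambda>\<alpha> r t. coset_form (\<kappa> (head Q \<alpha>) r) (act (quotient_rep Q X N') \<alpha>
           (cls (vspace X (tail Q \<alpha>)) (N' (tail Q \<alpha>)) (w (tail Q \<alpha>) t)))) \<Phi> \<alpha> r s
     = sylvester Q g c (\<lambda>\<alpha> u s. \<mu> (head Q \<alpha>) u (act S \<alpha> (m (tail Q \<alpha>) s)))
       (\<lambda>\<alpha> r t. \<kappa> (head Q \<alpha>) r (act X \<alpha> (w (tail Q \<alpha>) t))) \<Phi> \<alpha> r s"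
    if a: "\<alpha> \<in> arcs Q" and r: "r < c (head Q \<alpha>)" for \<Phi> \<alpha> r s
  proof -
    note e = ends[OF a]
    have "coset_form (\<kappa> (head Q \<alpha>) r) (act (quotient_rep Q X N') \<alpha>
           (cls (vspace X (tail Q \<alpha>)) (N' (tail Q \<alpha>)) (w (tail Q \<alpha>) t)))
        = \<kappa> (head Q \<alpha>) r (act X \<alpha> (w (tail Q \<alpha>) t))" if "t < c (tail Q \<alpha>)" for t
    proof -
      note wt = cobasis_in[OF w[OF e(1)] that]
      show ?thesis
        unfolding quotient_act[OF Q X N' a wt]
        by (rule coset_form_cls[OF subrep_sub[OF N' e(2)] w[OF e(2)] r lin_closed[OF rep_lin[OF X a] wt]])
    qed
    then show ?thesis by (simp add: sylvester_def)
  qed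
  note T = this
  show ?thesis
    using Ext1_vanishes_iff_sylvester[OF Q quotient_representation[OF Q X N' w]
        sub_rep_representation[OF Q S N''] m' w'] T
    unfolding sub_rep_simps by simp
qed



section \<open>Spaces with functions\<close>
text \<open>Regular functions form a sheaf of rings, their zero sets are closed, and a regular function that vanishes
  nowhere is invertible.  These properties, shared by all the spaces below, are all that is used about them.\<close>
locale space_with_functions =
  fixes A :: "('p, 'k::field) kspace"
  assumes regular_cong: "openin (zariski A) U \<Longrightarrow> f \<in> regular A U \<Longrightarrow> (\<And>x. x \<in> U \<Longrightarrow> h x = f x) \<Longrightarrow> h \<in> regular A U"
    and regular_local: "openin (zariski A) U \<Longrightarrow>
      (\<And>x. x \<in> U \<Longrightarrow> \<exists>V. openin (zariski A) V \<and> x \<in> V \<and> V \<subseteq> U \<and> f \<in> regular A V) \<Longrightarrow> f \<in> regular A U"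
    and regular_mono: "f \<in> regular A U \<Longrightarrow> openin (zariski A) U \<Longrightarrow> openin (zariski A) V \<Longrightarrow> V \<subseteq> U \<Longrightarrow> f \<in> regular A V"
    and regular_const: "openin (zariski A) U \<Longrightarrow> (\<lambda>_. c) \<in> regular A U"
    and regular_add: "openin (zariski A) U \<Longrightarrow> f \<in> regular A U \<Longrightarrow> h \<in> regular A U \<Longrightarrow> (\<lambda>x. f x + h x) \<in> regular A U"
    and regular_mult: "openin (zariski A) U \<Longrightarrow> f \<in> regular A U \<Longrightarrow> h \<in> regular A U \<Longrightarrow> (\<lambda>x. f x * h x) \<in> regular A U"
    and nonzero_open: "openin (zariski A) U \<Longrightarrow> f \<in> regular A U \<Longrightarrow> openin (zariski A) {x \<in> U. f x \<noteq> 0}"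
    and regular_inverse: "openin (zariski A) U \<Longrightarrow> f \<in> regular A U \<Longrightarrow> (\<lambda>x. 1 / f x) \<in> regular A {x \<in> U. f x \<noteq> 0}"
begin

lemma regular_sum:
  assumes "openin (zariski A) U" "\<And>i. i \<in> I \<Longrightarrow> f i \<in> regular A U"
  shows "(\<lambda>x. \<Sum>i\<in>I. f i x) \<in> regular A U"
  using assms(2) by (induction I rule: infinite_finite_induct) (auto intro: regular_const regular_add assms(1))

lemma regular_prod:
  assumes "openin (zariski A) U" "\<And>i. i \<in> I \<Longrightarrow> f i \<in> regular A U"
  shows "(\<lambda>x. \<Prod>i\<in>I. f i x) \<in> regular A U"
  using assms(2) by (induction I rule: infinite_finite_induct) (auto intro: regular_const regular_mult assms(1))

lemma regular_diff:
  assumes "openin (zariski A) U" "f \<in> regular A U" "h \<in> regular A U"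
  shows "(\<lambda>x. f x - h x) \<in> regular A U"
  using regular_add[OF assms(1,2) regular_mult[OF assms(1) regular_const[OF assms(1), of "- 1"] assms(3)]]
  by simp

lemma regular_divide:
  assumes "openin (zariski A) U" "f \<in> regular A U" "h \<in> regular A U" "\<And>x. x \<in> U \<Longrightarrow> h x \<noteq> 0"
  shows "(\<lambda>x. f x / h x) \<in> regular A U"
proof -
  have "{x \<in> U. h x \<noteq> 0} = U" using assms(4) by auto
  then have "(\<lambda>x. 1 / h x) \<in> regular A U" using regular_inverse[OF assms(1,3)] by simp
  then show ?thesis using regular_mult[OF assms(1,2), of "\<lambda>x. 1 / h x"] by simp
qed

lemma regular_det:
  assumes U: "openin (zariski A) U" and a: "\<And>i j. i < n \<Longrightarrow> j < n \<Longrightarrow> a i j \<in> regular A U"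
  shows "(\<lambda>x. det (mat n n (\<lambda>(i, j). a i j x))) \<in> regular A U"
proof -
  have "det (mat n n (\<lambda>(i, j). a i j x)) =
      (\<Sum>p\<in>{p. p permutes {0..<n}}. signof p * (\<Prod>i = 0..<n. a i (p i) x))" for x
    by (subst det_def'[of _ n]) (auto intro!: sum.cong prod.cong simp: permutes_in_image)
  moreover have "(\<lambda>x. \<Sum>p\<in>{p. p permutes {0..<n}}. signof p * (\<Prod>i = 0..<n. a i (p i) x)) \<in> regular A U"
    by (intro regular_sum regular_mult regular_prod regular_const U a) (auto simp: permutes_in_image)
  ultimately show ?thesis by simp
qed

lemma open_points: "openin (zariski A) (points A)" by simp

end

abbreviation swf :: "('p, 'k::field) kspace \<Rightarrow> bool" where "swf \<equiv> space_with_functions"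

subsection \<open>Spaces of fractions\<close>

lemma fraction_space_regular:
  "f \<in> regular (fraction_space P F) U \<longleftrightarrow>
     (\<forall>x\<in>U. \<exists>V. openin (zariski (fraction_space P F)) V \<and> x \<in> V \<and> V \<subseteq> U \<and>
        (\<exists>(a, b)\<in>F. \<forall>y\<in>V. b y \<noteq> 0 \<and> f y = a y / b y))"
  by (simp add: fraction_space_def Let_def)

lemma fraction_space_regular_iff:
  "f \<in> regular (fraction_space P F) U \<longleftrightarrow>
     (\<forall>x\<in>U. \<exists>V a b. openin (zariski (fraction_space P F)) V \<and> x \<in> V \<and> V \<subseteq> U \<and>
        (a, b) \<in> F \<and> (\<forall>y\<in>V. b y \<noteq> 0 \<and> f y = a y / b y))"
  by (simp add: fraction_space_regular Bex_def split_paired_Ex)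

lemma fraction_space_open:
  "(a, b) \<in> F \<Longrightarrow> openin (zariski (fraction_space P F)) {x \<in> P. b x \<noteq> 0}"
  unfolding fraction_space_def Let_def kspace.simps by (rule topology_generated_by_Basis) blast

lemma fraction_space_points_subset: "points (fraction_space P F) \<subseteq> P"
  unfolding fraction_space_def Let_def kspace.simps topology_generated_by_topspace by blast

lemma fraction_space_points:
  assumes "(a, b) \<in> F" "\<And>x. x \<in> P \<Longrightarrow> b x \<noteq> 0" shows "points (fraction_space P F) = P"
proof -
  have "{x \<in> P. b x \<noteq> 0} = P" using assms(2) by auto
  then have "P \<subseteq> points (fraction_space P F)"
    using openin_subset[OF fraction_space_open[OF assms(1), of P]] by simp
  then show ?thesis using fraction_space_points_subset[of P F] by blast
qed

lemma regular_fraction: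
  assumes "(a, b) \<in> F" "openin (zariski (fraction_space P F)) U" "\<And>x. x \<in> U \<Longrightarrow> b x \<noteq> 0"
    "\<And>x. x \<in> U \<Longrightarrow> f x = a x / b x"
  shows "f \<in> regular (fraction_space P F) U"
  unfolding fraction_space_regular using assms by blast

text \<open>The assumptions say that the fractions with numerator and denominator in \<open>F\<close> are closed under sums,
  products and inverses.  They are required on \<open>P\<close> only, because functions on a product are extended by
  zero.\<close>
lemma fraction_space_swf:
  fixes F :: "(('p \<Rightarrow> 'k::field) \<times> ('p \<Rightarrow> 'k)) set"
  assumes c: "\<And>c. \<exists>a b. (a, b) \<in> F \<and> (\<forall>x\<in>P. a x = c \<and> b x = 1)"
    and ad: "\<And>a b a' b'. (a, b) \<in> F \<Longrightarrow> (a', b') \<in> F \<Longrightarrow>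
        \<exists>a'' b''. (a'', b'') \<in> F \<and> (\<forall>x\<in>P. a'' x = a x * b' x + a' x * b x \<and> b'' x = b x * b' x)"
    and mu: "\<And>a b a' b'. (a, b) \<in> F \<Longrightarrow> (a', b') \<in> F \<Longrightarrow>
        \<exists>a'' b''. (a'', b'') \<in> F \<and> (\<forall>x\<in>P. a'' x = a x * a' x \<and> b'' x = b x * b' x)"
    and sw: "\<And>a b. (a, b) \<in> F \<Longrightarrow> (b, a) \<in> F"
  shows "swf (fraction_space P F)"
proof -
  let ?A = "fraction_space P F"
  let ?T = "zariski ?A"
  have P: "points ?A = P" using c[of 0] by (metis fraction_space_points zero_neq_one)
  have opP: "x \<in> P" if "openin ?T U" "x \<in> U" for U x using openin_subset[OF that(1)] that(2) P by auto
  note reg = fraction_space_regular_iff[of _ P F]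
  have regE: "\<exists>V a b. openin ?T V \<and> x \<in> V \<and> V \<subseteq> U \<and> (a, b) \<in> F \<and> (\<forall>y\<in>V. b y \<noteq> 0 \<and> f y = a y / b y)"
    if "f \<in> regular ?A U" "x \<in> U" for f U x
    using bspec[OF iffD1[OF reg that(1)] that(2)] by blast
  have regI: "f \<in> regular ?A U"
    if "\<And>x. x \<in> U \<Longrightarrow> \<exists>V a b. openin ?T V \<and> x \<in> V \<and> V \<subseteq> U \<and> (a, b) \<in> F \<and> (\<forall>y\<in>V. b y \<noteq> 0 \<and> f y = a y / b y)"
    for f U unfolding reg by (intro ballI that)
  show ?thesis
  proof
    fix U :: "'p set" and f h :: "'p \<Rightarrow> 'k"
    assume U: "openin ?T U" and f: "f \<in> regular ?A U" and e: "\<And>x. x \<in> U \<Longrightarrow> h x = f x"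
    show "h \<in> regular ?A U"
    proof (rule regI)
      fix x assume x: "x \<in> U"
      obtain V a b where V: "openin ?T V" "x \<in> V" "V \<subseteq> U" "(a, b) \<in> F" "\<forall>y\<in>V. b y \<noteq> 0 \<and> f y = a y / b y"
        using regE[OF f x] by (elim exE conjE)
      then have "\<forall>y\<in>V. b y \<noteq> 0 \<and> h y = a y / b y" using e by auto
      then show "\<exists>V a b. openin ?T V \<and> x \<in> V \<and> V \<subseteq> U \<and> (a, b) \<in> F \<and> (\<forall>y\<in>V. b y \<noteq> 0 \<and> h y = a y / b y)"
        using V by blast
    qed
  next
    fix U :: "'p set" and f :: "'p \<Rightarrow> 'k"
    assume U: "openin ?T U" and l: "\<And>x. x \<in> U \<Longrightarrow> \<exists>V. openin ?T V \<and> x \<in> V \<and> V \<subseteq> U \<and> f \<in> regular ?A V"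
    show "f \<in> regular ?A U"
    proof (rule regI)
      fix x assume "x \<in> U"
      then obtain V where V: "openin ?T V" "x \<in> V" "V \<subseteq> U" "f \<in> regular ?A V" using l by blast
      then show "\<exists>V a b. openin ?T V \<and> x \<in> V \<and> V \<subseteq> U \<and> (a, b) \<in> F \<and> (\<forall>y\<in>V. b y \<noteq> 0 \<and> f y = a y / b y)"
        using regE[OF V(4,2)] by blast
    qed
  next
    fix U V :: "'p set" and f :: "'p \<Rightarrow> 'k"
    assume f: "f \<in> regular ?A U" and V: "openin ?T V" "V \<subseteq> U"
    show "f \<in> regular ?A V"
    proof (rule regI)
      fix x assume x: "x \<in> V"
      then obtain W a b where W: "openin ?T W" "x \<in> W" "(a, b) \<in> F" "\<forall>y\<in>W. b y \<noteq> 0 \<and> f y = a y / b y"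
        using regE[OF f, of x] V by blast
      then show "\<exists>V' a b. openin ?T V' \<and> x \<in> V' \<and> V' \<subseteq> V \<and> (a, b) \<in> F \<and> (\<forall>y\<in>V'. b y \<noteq> 0 \<and> f y = a y / b y)"
        using x V by (intro exI[of _ "W \<inter> V"] exI[of _ a] exI[of _ b]) auto
    qed
  next
    fix U :: "'p set" and d :: 'k
    assume U: "openin ?T U"
    obtain a b where ab: "(a, b) \<in> F" "\<forall>x\<in>P. a x = d \<and> b x = 1" using c by blast
    show "(\<lambda>_. d) \<in> regular ?A U" by (rule regular_fraction[OF ab(1) U]) (use ab opP[OF U] in auto)
  next
    fix U :: "'p set" and f h :: "'p \<Rightarrow> 'k"
    assume U: "openin ?T U" and f: "f \<in> regular ?A U" and h: "h \<in> regular ?A U"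
    have *: "\<exists>V a b a' b'. openin ?T V \<and> x \<in> V \<and> V \<subseteq> U \<and> (a, b) \<in> F \<and> (a', b') \<in> F \<and>
        (\<forall>y\<in>V. y \<in> P \<and> b y \<noteq> 0 \<and> f y = a y / b y \<and> b' y \<noteq> 0 \<and> h y = a' y / b' y)" if x: "x \<in> U" for x
    proof -
      obtain V a b where V: "openin ?T V" "x \<in> V" "V \<subseteq> U" "(a, b) \<in> F" "\<forall>y\<in>V. b y \<noteq> 0 \<and> f y = a y / b y"
        using regE[OF f x] by blast
      obtain W a' b' where W: "openin ?T W" "x \<in> W" "W \<subseteq> U" "(a', b') \<in> F" "\<forall>y\<in>W. b' y \<noteq> 0 \<and> h y = a' y / b' y"
        using regE[OF h x] by blast
      show ?thesis
        using V W opP[OF U]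
        by (intro exI[of _ "V \<inter> W"] exI[of _ a] exI[of _ b] exI[of _ a'] exI[of _ b']) auto
    qed
    show "(\<lambda>x. f x + h x) \<in> regular ?A U"
    proof (rule regI)
      fix x assume "x \<in> U"
      from *[OF this] obtain V a b a' b' where V: "openin ?T V" "x \<in> V" "V \<subseteq> U" "(a, b) \<in> F" "(a', b') \<in> F"
        and e: "\<forall>y\<in>V. y \<in> P \<and> b y \<noteq> 0 \<and> f y = a y / b y \<and> b' y \<noteq> 0 \<and> h y = a' y / b' y" by blast
      obtain a'' b'' where ab: "(a'', b'') \<in> F" "\<forall>x\<in>P. a'' x = a x * b' x + a' x * b x \<and> b'' x = b x * b' x"
        using ad[OF V(4,5)] by blast
      have "\<forall>y\<in>V. b'' y \<noteq> 0 \<and> f y + h y = a'' y / b'' y"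
        using e ab(2) by (auto simp: add_frac_eq)
      then show "\<exists>V a b. openin ?T V \<and> x \<in> V \<and> V \<subseteq> U \<and> (a, b) \<in> F \<and> (\<forall>y\<in>V. b y \<noteq> 0 \<and> f y + h y = a y / b y)"
        using V ab by blast
    qed
    show "(\<lambda>x. f x * h x) \<in> regular ?A U"
    proof (rule regI)
      fix x assume "x \<in> U"
      from *[OF this] obtain V a b a' b' where V: "openin ?T V" "x \<in> V" "V \<subseteq> U" "(a, b) \<in> F" "(a', b') \<in> F"
        and e: "\<forall>y\<in>V. y \<in> P \<and> b y \<noteq> 0 \<and> f y = a y / b y \<and> b' y \<noteq> 0 \<and> h y = a' y / b' y" by blast
      obtain a'' b'' where ab: "(a'', b'') \<in> F" "\<forall>x\<in>P. a'' x = a x * a' x \<and> b'' x = b x * b' x"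
        using mu[OF V(4,5)] by blast
      have "\<forall>y\<in>V. b'' y \<noteq> 0 \<and> f y * h y = a'' y / b'' y"
        using e ab(2) by auto
      then show "\<exists>V a b. openin ?T V \<and> x \<in> V \<and> V \<subseteq> U \<and> (a, b) \<in> F \<and> (\<forall>y\<in>V. b y \<noteq> 0 \<and> f y * h y = a y / b y)"
        using V ab by blast
    qed
  next
    fix U :: "'p set" and f :: "'p \<Rightarrow> 'k"
    assume U: "openin ?T U" and f: "f \<in> regular ?A U"
    have *: "\<exists>V a b. openin ?T V \<and> x \<in> V \<and> V \<subseteq> {x \<in> U. f x \<noteq> 0} \<and> (a, b) \<in> F \<and>
        (\<forall>y\<in>V. b y \<noteq> 0 \<and> 1 / f y = a y / b y)" if x: "x \<in> {x \<in> U. f x \<noteq> 0}" for x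
    proof -
      have xU: "x \<in> U" using x by simp
      obtain V a b where V: "openin ?T V" "x \<in> V" "V \<subseteq> U" "(a, b) \<in> F" "\<forall>y\<in>V. b y \<noteq> 0 \<and> f y = a y / b y"
        using regE[OF f xU] by (elim exE conjE)
      have "openin ?T (V \<inter> {y \<in> P. a y \<noteq> 0})"
        using V(1) fraction_space_open[OF sw[OF V(4)], of P] by blast
      then show ?thesis
        using V x sw[OF V(4)] opP[OF U]
        by (intro exI[of _ "V \<inter> {y \<in> P. a y \<noteq> 0}"] exI[of _ b] exI[of _ a]) auto
    qed
    show "openin ?T {x \<in> U. f x \<noteq> 0}"
      by (subst openin_subopen) (use * in blast)
    show "(\<lambda>x. 1 / f x) \<in> regular ?A {x \<in> U. f x \<noteq> 0}"
      by (rule regI) (rule *)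
  qed
qed

subsection \<open>Morphisms\<close>

lemma morphismD:
  assumes "morphism A B \<phi>"
  shows morphism_points: "x \<in> points A \<Longrightarrow> \<phi> x \<in> points B"
    and morphism_open: "openin (zariski B) V \<Longrightarrow> openin (zariski A) {x \<in> points A. \<phi> x \<in> V}"
    and morphism_regular: "openin (zariski B) V \<Longrightarrow> f \<in> regular B V \<Longrightarrow>
        (\<lambda>x. f (\<phi> x)) \<in> regular A {x \<in> points A. \<phi> x \<in> V}"
  using assms unfolding morphism_def continuous_map_def by (auto simp: Pi_iff comp_def)

lemma morphism_regular_global:
  assumes "morphism A B \<phi>" "f \<in> regular B (points B)"
  shows "(\<lambda>x. f (\<phi> x)) \<in> regular A (points A)"
proof -
  have "{x \<in> points A. \<phi> x \<in> points B} = points A" using morphism_points[OF assms(1)] by auto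
  then show ?thesis using morphism_regular[OF assms(1) openin_topspace assms(2)] by simp
qed

lemma morphismI:
  assumes "\<And>x. x \<in> points A \<Longrightarrow> \<phi> x \<in> points B"
    and "\<And>V. openin (zariski B) V \<Longrightarrow> openin (zariski A) {x \<in> points A. \<phi> x \<in> V}"
    and "\<And>V f. openin (zariski B) V \<Longrightarrow> f \<in> regular B V \<Longrightarrow> (\<lambda>x. f (\<phi> x)) \<in> regular A {x \<in> points A. \<phi> x \<in> V}"
  shows "morphism A B \<phi>"
  using assms unfolding morphism_def continuous_map_def by (auto simp: Pi_iff comp_def)

lemma morphism_comp:
  assumes f: "morphism A B \<phi>" and g: "morphism B C \<psi>" shows "morphism A C (\<lambda>x. \<psi> (\<phi> x))"
proof (rule morphismI)
  have e: "{x \<in> points A. \<phi> x \<in> {y \<in> points B. \<psi> y \<in> V}} = {x \<in> points A. \<psi> (\<phi> x) \<in> V}" for V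
    using morphism_points[OF f] by auto
  show "\<psi> (\<phi> x) \<in> points C" if "x \<in> points A" for x
    using morphism_points[OF g morphism_points[OF f that]] .
  fix V assume V: "openin (zariski C) V"
  show "openin (zariski A) {x \<in> points A. \<psi> (\<phi> x) \<in> V}"
    using morphism_open[OF f morphism_open[OF g V]] unfolding e .
  show "(\<lambda>x. h (\<psi> (\<phi> x))) \<in> regular A {x \<in> points A. \<psi> (\<phi> x) \<in> V}" if "h \<in> regular C V" for h
    using morphism_regular[OF f morphism_open[OF g V] morphism_regular[OF g V that]] unfolding e .
qed

text \<open>Both continuity and regularity need only be tested on the fractions that define the target.\<close>
lemma morphism_into_fraction_space:
  fixes F :: "(('q \<Rightarrow> 'k::field) \<times> ('q \<Rightarrow> 'k)) set" and A :: "('p, 'k) kspace"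
  assumes A: "swf A" and P: "points (fraction_space P F) = P"
    and im: "\<And>x. x \<in> points A \<Longrightarrow> \<phi> x \<in> P"
    and loc: "\<And>a b x. (a, b) \<in> F \<Longrightarrow> x \<in> points A \<Longrightarrow> b (\<phi> x) \<noteq> 0 \<Longrightarrow>
       \<exists>W. openin (zariski A) W \<and> x \<in> W \<and> (\<forall>y\<in>W. b (\<phi> y) \<noteq> 0) \<and> (\<lambda>y. a (\<phi> y) / b (\<phi> y)) \<in> regular A W"
  shows "morphism A (fraction_space P F) \<phi>"
proof -
  interpret space_with_functions A by (rule A)
  let ?B = "fraction_space P F"
  have "continuous_map (zariski A) (zariski ?B) \<phi>"
  proof -
    have B: "zariski ?B = topology_generated_by {{x \<in> P. b x \<noteq> 0} | a b. (a, b) \<in> F}"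
      by (simp add: fraction_space_def Let_def)
    show ?thesis
      unfolding B
    proof (rule continuous_on_generated_topo)
      show "\<phi> ` points A \<subseteq> \<Union> {{x \<in> P. b x \<noteq> 0} | a b. (a, b) \<in> F}"
        using im P[unfolded B topology_generated_by_topspace] by auto
      fix U assume "U \<in> {{x \<in> P. b x \<noteq> 0} | a b. (a, b) \<in> F}"
      then obtain a b where ab: "(a, b) \<in> F" "U = {x \<in> P. b x \<noteq> 0}" by blast
      show "openin (zariski A) (\<phi> -` U \<inter> points A)"
      proof (subst openin_subopen, intro ballI)
        fix x assume "x \<in> \<phi> -` U \<inter> points A"
        then have x: "x \<in> points A" "b (\<phi> x) \<noteq> 0" using ab by auto
        obtain W where W: "openin (zariski A) W" "x \<in> W" "\<forall>y\<in>W. b (\<phi> y) \<noteq> 0"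
          using loc[OF ab(1) x] by blast
        then have "W \<subseteq> \<phi> -` U \<inter> points A" using ab im openin_subset[OF W(1)] by auto
        then show "\<exists>T. openin (zariski A) T \<and> x \<in> T \<and> T \<subseteq> \<phi> -` U \<inter> points A" using W by blast
      qed
    qed
  qed
  note cont = this
  show ?thesis
  proof (rule morphismI)
    show "\<phi> x \<in> points ?B" if "x \<in> points A" for x using im[OF that] P by simp
    show op: "openin (zariski A) {x \<in> points A. \<phi> x \<in> V}" if "openin (zariski ?B) V" for V
      using cont that unfolding continuous_map_def by blast
    fix V f assume V: "openin (zariski ?B) V" and f: "f \<in> regular ?B V"
    let ?W = "{x \<in> points A. \<phi> x \<in> V}"
    show "(\<lambda>x. f (\<phi> x)) \<in> regular A ?W"
    proof (rule regular_local[OF op[OF V]])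
      fix x assume x: "x \<in> ?W"
      then obtain V' a b where V': "openin (zariski ?B) V'" "\<phi> x \<in> V'" "V' \<subseteq> V" "(a, b) \<in> F"
        "\<forall>y\<in>V'. b y \<noteq> 0 \<and> f y = a y / b y"
        using bspec[OF f[unfolded fraction_space_regular_iff], of "\<phi> x"] by blast
      have "b (\<phi> x) \<noteq> 0" using V' by auto
      then obtain W where W: "openin (zariski A) W" "x \<in> W"
        "(\<lambda>y. a (\<phi> y) / b (\<phi> y)) \<in> regular A W" using loc[OF V'(4)] x by blast
      let ?W' = "W \<inter> {x \<in> points A. \<phi> x \<in> V'}"
      have W': "openin (zariski A) ?W'" using W op[OF V'(1)] by blast
      have "(\<lambda>y. a (\<phi> y) / b (\<phi> y)) \<in> regular A ?W'" by (rule regular_mono[OF W(3,1) W']) auto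
      then have "(\<lambda>y. f (\<phi> y)) \<in> regular A ?W'" by (rule regular_cong[OF W']) (use V' in auto)
      then show "\<exists>V. openin (zariski A) V \<and> x \<in> V \<and> V \<subseteq> ?W \<and> (\<lambda>x. f (\<phi> x)) \<in> regular A V"
        using W' W x V' by (intro exI[of _ ?W']) auto
    qed
  qed
qed

subsection \<open>Subspaces\<close>

lemma restrict_points [simp]: "points (restrict_kspace A T) = points A \<inter> T"
  by (simp add: restrict_kspace_def)

lemma restrict_openin:
  "openin (zariski (restrict_kspace A T)) U \<longleftrightarrow> (\<exists>D. openin (zariski A) D \<and> U = D \<inter> T)"
  by (simp add: restrict_kspace_def openin_subtopology)

lemma restrict_regular:
  "f \<in> regular (restrict_kspace A T) V \<longleftrightarrow>
    (\<forall>x\<in>V. \<exists>U g. openin (zariski A) U \<and> x \<in> U \<and> g \<in> regular A U \<and> (\<forall>y\<in>U \<inter> V. f y = g y))"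
  by (simp add: restrict_kspace_def)

lemma restrict_swf:
  fixes A :: "('p, 'k::field) kspace"
  assumes A: "swf A" shows "swf (restrict_kspace A T)"
proof -
  interpret A: space_with_functions A by (rule A)
  let ?R = "restrict_kspace A T"
  note reg = restrict_regular[of _ A T]
  have regE: "\<exists>U g. openin (zariski A) U \<and> x \<in> U \<and> g \<in> regular A U \<and> (\<forall>y\<in>U \<inter> V. f y = g y)"
    if "f \<in> regular ?R V" "x \<in> V" for f V x using that unfolding reg by blast
  show ?thesis
  proof
    fix U :: "'p set" and f h :: "'p \<Rightarrow> 'k"
    assume "f \<in> regular ?R U" "\<And>x. x \<in> U \<Longrightarrow> h x = f x"
    then show "h \<in> regular ?R U" unfolding reg by (metis IntD2)
  next
    fix U :: "'p set" and f :: "'p \<Rightarrow> 'k"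
    assume l: "\<And>x. x \<in> U \<Longrightarrow> \<exists>V. openin (zariski ?R) V \<and> x \<in> V \<and> V \<subseteq> U \<and> f \<in> regular ?R V"
      and U: "openin (zariski ?R) U"
    show "f \<in> regular ?R U"
      unfolding reg
    proof
      fix x assume "x \<in> U"
      then obtain V where V: "openin (zariski ?R) V" "x \<in> V" "V \<subseteq> U" "f \<in> regular ?R V" using l by blast
      obtain W g where W: "openin (zariski A) W" "x \<in> W" "g \<in> regular A W" "\<forall>y\<in>W \<inter> V. f y = g y"
        using regE[OF V(4,2)] by blast
      obtain D where D: "openin (zariski A) D" "V = D \<inter> T" using V(1) unfolding restrict_openin by blast
      have WO: "openin (zariski A) (W \<inter> D)" using W D by blast
      have "g \<in> regular A (W \<inter> D)" by (rule A.regular_mono[OF W(3,1) WO]) auto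
      moreover have "U \<subseteq> T" using U unfolding restrict_openin by blast
      ultimately show "\<exists>V g. openin (zariski A) V \<and> x \<in> V \<and> g \<in> regular A V \<and> (\<forall>y\<in>V \<inter> U. f y = g y)"
        using WO W V D by (intro exI[of _ "W \<inter> D"] exI[of _ g]) auto
    qed
  next
    fix U V :: "'p set" and f :: "'p \<Rightarrow> 'k"
    assume f: "f \<in> regular ?R U" and V: "V \<subseteq> U"
    show "f \<in> regular ?R V"
      unfolding reg
    proof
      fix x assume "x \<in> V"
      then have "x \<in> U" using V by blast
      from regE[OF f this] show "\<exists>W g. openin (zariski A) W \<and> x \<in> W \<and> g \<in> regular A W \<and> (\<forall>y\<in>W \<inter> V. f y = g y)"
        using V by blast
    qed
  next
    fix U :: "'p set" and c :: 'k
    assume "openin (zariski ?R) U"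
    then have "U \<subseteq> points A" using openin_subset[of "zariski A"] unfolding restrict_openin by blast
    then show "(\<lambda>_. c) \<in> regular ?R U"
      unfolding reg using A.regular_const[OF A.open_points] A.open_points by blast
  next
    fix U :: "'p set" and f h :: "'p \<Rightarrow> 'k"
    assume f: "f \<in> regular ?R U" and h: "h \<in> regular ?R U"
    have *: "\<exists>V a b. openin (zariski A) V \<and> x \<in> V \<and> a \<in> regular A V \<and> b \<in> regular A V \<and>
        (\<forall>y\<in>V \<inter> U. f y = a y \<and> h y = b y)" if x: "x \<in> U" for x
    proof -
      obtain V a where V: "openin (zariski A) V" "x \<in> V" "a \<in> regular A V" "\<forall>y\<in>V \<inter> U. f y = a y"
        using regE[OF f x] by blast
      obtain W b where W: "openin (zariski A) W" "x \<in> W" "b \<in> regular A W" "\<forall>y\<in>W \<inter> U. h y = b y"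
        using regE[OF h x] by blast
      have VW: "openin (zariski A) (V \<inter> W)" using V W by blast
      have "a \<in> regular A (V \<inter> W)" "b \<in> regular A (V \<inter> W)"
        using A.regular_mono[OF V(3,1) VW] A.regular_mono[OF W(3,1) VW] by auto
      then show ?thesis using VW V W by (intro exI[of _ "V \<inter> W"] exI[of _ a] exI[of _ b]) auto
    qed
    show "(\<lambda>x. f x + h x) \<in> regular ?R U"
      unfolding reg
    proof
      fix x assume "x \<in> U"
      from *[OF this] obtain V a b where V: "openin (zariski A) V" "x \<in> V" "a \<in> regular A V" "b \<in> regular A V"
        "\<forall>y\<in>V \<inter> U. f y = a y \<and> h y = b y" by blast
      then show "\<exists>V g. openin (zariski A) V \<and> x \<in> V \<and> g \<in> regular A V \<and> (\<forall>y\<in>V \<inter> U. f y + h y = g y)"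
        using A.regular_add[OF V(1,3,4)] by (intro exI[of _ V] exI[of _ "\<lambda>x. a x + b x"]) auto
    qed
    show "(\<lambda>x. f x * h x) \<in> regular ?R U"
      unfolding reg
    proof
      fix x assume "x \<in> U"
      from *[OF this] obtain V a b where V: "openin (zariski A) V" "x \<in> V" "a \<in> regular A V" "b \<in> regular A V"
        "\<forall>y\<in>V \<inter> U. f y = a y \<and> h y = b y" by blast
      then show "\<exists>V g. openin (zariski A) V \<and> x \<in> V \<and> g \<in> regular A V \<and> (\<forall>y\<in>V \<inter> U. f y * h y = g y)"
        using A.regular_mult[OF V(1,3,4)] by (intro exI[of _ V] exI[of _ "\<lambda>x. a x * b x"]) auto
    qed
  next
    fix U :: "'p set" and f :: "'p \<Rightarrow> 'k"
    assume U: "openin (zariski ?R) U" and f: "f \<in> regular ?R U"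
    obtain D where D: "openin (zariski A) D" "U = D \<inter> T" using U unfolding restrict_openin by blast
    have *: "\<exists>V a. openin (zariski A) V \<and> x \<in> V \<and> a \<in> regular A V \<and> (\<forall>y\<in>V. a y \<noteq> 0) \<and>
        (\<forall>y\<in>V \<inter> U. f y = a y)" if x: "x \<in> {x \<in> U. f x \<noteq> 0}" for x
    proof -
      obtain V a where V: "openin (zariski A) V" "x \<in> V" "a \<in> regular A V" "\<forall>y\<in>V \<inter> U. f y = a y"
        using regE[OF f] x by blast
      have o: "openin (zariski A) {y \<in> V. a y \<noteq> 0}" by (rule A.nonzero_open[OF V(1,3)])
      have "a \<in> regular A {y \<in> V. a y \<noteq> 0}" by (rule A.regular_mono[OF V(3,1) o]) auto
      then show ?thesis using o V x by (intro exI[of _ "{y \<in> V. a y \<noteq> 0}"] exI[of _ a]) auto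
    qed
    show "openin (zariski ?R) {x \<in> U. f x \<noteq> 0}"
    proof (subst openin_subopen, intro ballI)
      fix x assume x: "x \<in> {x \<in> U. f x \<noteq> 0}"
      obtain V a where V: "openin (zariski A) V" "x \<in> V" "\<forall>y\<in>V. a y \<noteq> 0" "\<forall>y\<in>V \<inter> U. f y = a y"
        using *[OF x] by blast
      have "openin (zariski ?R) (V \<inter> U)" unfolding restrict_openin using V(1) D by blast
      then show "\<exists>S. openin (zariski ?R) S \<and> x \<in> S \<and> S \<subseteq> {x \<in> U. f x \<noteq> 0}"
        using V x by (intro exI[of _ "V \<inter> U"]) auto
    qed
    show "(\<lambda>x. 1 / f x) \<in> regular ?R {x \<in> U. f x \<noteq> 0}"
      unfolding reg
    proof
      fix x assume x: "x \<in> {x \<in> U. f x \<noteq> 0}"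
      obtain V a where V: "openin (zariski A) V" "x \<in> V" "a \<in> regular A V" "\<forall>y\<in>V. a y \<noteq> 0" "\<forall>y\<in>V \<inter> U. f y = a y"
        using *[OF x] by blast
      have "(\<lambda>x. 1 / a x) \<in> regular A V"
        using A.regular_divide[OF V(1) A.regular_const[OF V(1)] V(3)] V(4) by blast
      then show "\<exists>V g. openin (zariski A) V \<and> x \<in> V \<and> g \<in> regular A V \<and>
          (\<forall>y\<in>V \<inter> {x \<in> U. f x \<noteq> 0}. 1 / f y = g y)"
        using V by (intro exI[of _ V] exI[of _ "\<lambda>x. 1 / a x"]) auto
    qed
  qed
qed

lemma restrict_inclusion: "morphism (restrict_kspace A T) A (\<lambda>x. x)"
proof (rule morphismI)
  fix V assume V: "openin (zariski A) V"
  have e: "{x \<in> points (restrict_kspace A T). x \<in> V} = V \<inter> T" using openin_subset[OF V] by auto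
  show "openin (zariski (restrict_kspace A T)) {x \<in> points (restrict_kspace A T). x \<in> V}"
    unfolding e restrict_openin using V by blast
  show "(\<lambda>x. f x) \<in> regular (restrict_kspace A T) {x \<in> points (restrict_kspace A T). x \<in> V}"
    if "f \<in> regular A V" for f
    unfolding e restrict_regular using V that by blast
qed auto

lemma morphism_restrict: "morphism A B \<phi> \<Longrightarrow> morphism (restrict_kspace A T) B \<phi>"
  using morphism_comp[OF restrict_inclusion] .

lemma regular_restrict:
  assumes "openin (zariski A) U" "f \<in> regular A U" shows "f \<in> regular (restrict_kspace A T) (U \<inter> T)"
  using assms unfolding restrict_regular by blast

text \<open>The regular functions of a subspace are locally restrictions of regular functions of the ambient
  space, so nothing has to be checked beyond the image being contained in the subspace.\<close>
lemma morphism_into_restrict: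
  assumes A: "swf A" and f: "morphism A B \<phi>" and im: "\<And>x. x \<in> points A \<Longrightarrow> \<phi> x \<in> T"
  shows "morphism A (restrict_kspace B T) \<phi>"
proof (rule morphismI)
  interpret space_with_functions A by (rule A)
  show "\<phi> x \<in> points (restrict_kspace B T)" if "x \<in> points A" for x
    using im[OF that] morphism_points[OF f that] by simp
  show op: "openin (zariski A) {x \<in> points A. \<phi> x \<in> V}" if V: "openin (zariski (restrict_kspace B T)) V" for V
  proof -
    obtain D where D: "openin (zariski B) D" "V = D \<inter> T" using V unfolding restrict_openin by blast
    have "{x \<in> points A. \<phi> x \<in> V} = {x \<in> points A. \<phi> x \<in> D}" using D im by auto
    then show ?thesis using morphism_open[OF f D(1)] by simp
  qed
  fix V h assume V: "openin (zariski (restrict_kspace B T)) V" and h: "h \<in> regular (restrict_kspace B T) V"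
  show "(\<lambda>x. h (\<phi> x)) \<in> regular A {x \<in> points A. \<phi> x \<in> V}"
  proof (rule regular_local[OF op[OF V]])
    fix x assume x: "x \<in> {x \<in> points A. \<phi> x \<in> V}"
    obtain U g where U: "openin (zariski B) U" "\<phi> x \<in> U" "g \<in> regular B U" "\<forall>y\<in>U \<inter> V. h y = g y"
      using h x unfolding restrict_regular by blast
    let ?W = "{x \<in> points A. \<phi> x \<in> U} \<inter> {x \<in> points A. \<phi> x \<in> V}"
    have W: "openin (zariski A) ?W" using morphism_open[OF f U(1)] op[OF V] by blast
    have "(\<lambda>x. g (\<phi> x)) \<in> regular A ?W"
      by (rule regular_mono[OF morphism_regular[OF f U(1,3)] morphism_open[OF f U(1)] W]) auto
    then have "(\<lambda>x. h (\<phi> x)) \<in> regular A ?W" by (rule regular_cong[OF W]) (use U in auto)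
    then show "\<exists>W. openin (zariski A) W \<and> x \<in> W \<and> W \<subseteq> {x \<in> points A. \<phi> x \<in> V} \<and> (\<lambda>x. h (\<phi> x)) \<in> regular A W"
      using W x U by (intro exI[of _ ?W]) auto
  qed
qed

subsection \<open>Products and affine spaces\<close>

lemma product_pair:
  assumes "openin (zariski A) U" "openin (zariski B) V" "a \<in> product_functions A B U V" "b \<in> product_functions A B U V"
  shows "(a, b) \<in> (\<Union>U\<in>{U. openin (zariski A) U}. \<Union>V\<in>{V. openin (zariski B) V}.
          product_functions A B U V \<times> product_functions A B U V)"
  using assms by blast

lemma product_functionsI:
  assumes "h \<in> function_algebra ({f \<circ> fst | f. f \<in> regular A U} \<union> {g \<circ> snd | g. g \<in> regular B V})"
  shows "(\<lambda>z. if z \<in> U \<times> V then h z else 0) \<in> product_functions A B U V"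
  using assms unfolding product_functions_def by blast

lemma product_functions_const: "(\<lambda>z. if z \<in> U \<times> V then c else 0) \<in> product_functions A B U V"
  by (rule product_functionsI[OF function_algebra.const])

lemma product_points: "points (product_kspace A B) = points A \<times> points B"
  unfolding product_kspace_def
  by (rule fraction_space_points[OF product_pair[OF openin_topspace openin_topspace
        product_functions_const product_functions_const[of _ _ 1]]]) auto

text \<open>A single function \<open>h\<close> represents \<open>a\<close> on the large and on the small rectangle, so that functions given on
  different rectangles can be compared on the intersection.\<close>
lemma product_functions_restrict:
  fixes A :: "('p, 'k::field) kspace" and B :: "('q, 'k) kspace"
  assumes A: "swf A" and B: "swf B"
    and U: "openin (zariski A) U" "openin (zariski A) U'" and V: "openin (zariski B) V" "openin (zariski B) V'"
    and sub: "U' \<subseteq> U" "V' \<subseteq> V" and a: "a \<in> product_functions A B U V"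
  obtains h where "h \<in> function_algebra ({f \<circ> fst | f. f \<in> regular A U'} \<union> {g \<circ> snd | g. g \<in> regular B V'})"
    and "\<And>z. z \<in> U' \<times> V' \<Longrightarrow> a z = h z" and "\<And>z. a z = (if z \<in> U \<times> V then h z else 0)"
proof -
  let ?G = "{f \<circ> fst | f. f \<in> regular A U'} \<union> {g \<circ> snd | g. g \<in> regular B V'}"
  have "h \<in> function_algebra ?G"
    if "h \<in> function_algebra ({f \<circ> fst | f. f \<in> regular A U} \<union> {g \<circ> snd | g. g \<in> regular B V})" for h
    using that
  proof induction
    case (generator f)
    then have "f \<in> ?G"
      using space_with_functions.regular_mono[OF A _ U sub(1)] space_with_functions.regular_mono[OF B _ V sub(2)]
      by blast
    then show ?case by (rule function_algebra.generator)
  qed (auto intro: function_algebra.intros)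
  moreover obtain h where h: "h \<in> function_algebra ({f \<circ> fst | f. f \<in> regular A U} \<union> {g \<circ> snd | g. g \<in> regular B V})"
    "a = (\<lambda>z. if z \<in> U \<times> V then h z else 0)" using a unfolding product_functions_def by blast
  moreover have "a z = h z" if "z \<in> U' \<times> V'" for z using that h sub by auto
  ultimately show ?thesis using that[of h] by simp
qed

lemma product_functions_ring:
  fixes A :: "('p, 'k::field) kspace" and B :: "('q, 'k) kspace"
  assumes A: "swf A" and B: "swf B"
    and U: "openin (zariski A) U" "openin (zariski A) U'" and V: "openin (zariski B) V" "openin (zariski B) V'"
    and a: "a \<in> product_functions A B U V" and b: "b \<in> product_functions A B U' V'"
  shows "(\<lambda>z. a z * b z) \<in> product_functions A B (U \<inter> U') (V \<inter> V')"
proof -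
  have o: "openin (zariski A) (U \<inter> U')" "openin (zariski B) (V \<inter> V')" using U V by auto
  let ?G = "{f \<circ> fst | f. f \<in> regular A (U \<inter> U')} \<union> {g \<circ> snd | g. g \<in> regular B (V \<inter> V')}"
  obtain h where h: "h \<in> function_algebra ?G" "\<And>z. a z = (if z \<in> U \<times> V then h z else 0)"
    by (rule product_functions_restrict[OF A B U(1) o(1) V(1) o(2) Int_lower1 Int_lower1 a]) blast
  obtain h' where h': "h' \<in> function_algebra ?G" "\<And>z. b z = (if z \<in> U' \<times> V' then h' z else 0)"
    by (rule product_functions_restrict[OF A B U(2) o(1) V(2) o(2) Int_lower2 Int_lower2 b]) blast
  have "(\<lambda>z. a z * b z) = (\<lambda>z. if z \<in> (U \<inter> U') \<times> (V \<inter> V') then h z * h' z else 0)"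
    using h h' by (auto simp: fun_eq_iff)
  then show ?thesis using product_functionsI[OF function_algebra.mult[OF h(1) h'(1)]] by simp
qed

lemma product_functions_add:
  assumes "a \<in> product_functions A B U V" "b \<in> product_functions A B U V"
  shows "(\<lambda>z. a z + b z) \<in> product_functions A B U V"
proof -
  let ?G = "{f \<circ> fst | f. f \<in> regular A U} \<union> {g \<circ> snd | g. g \<in> regular B V}"
  obtain h where h: "h \<in> function_algebra ?G" "a = (\<lambda>z. if z \<in> U \<times> V then h z else 0)"
    using assms(1) unfolding product_functions_def by blast
  obtain h' where h': "h' \<in> function_algebra ?G" "b = (\<lambda>z. if z \<in> U \<times> V then h' z else 0)"
    using assms(2) unfolding product_functions_def by blast
  have "(\<lambda>z. a z + b z) = (\<lambda>z. if z \<in> U \<times> V then h z + h' z else 0)"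
    using h h' by (auto simp: fun_eq_iff)
  then show ?thesis using product_functionsI[OF function_algebra.add[OF h(1) h'(1)]] by simp
qed

lemma product_swf:
  fixes A :: "('p, 'k::field) kspace" and B :: "('q, 'k) kspace"
  assumes A: "swf A" and B: "swf B"
  shows "swf (product_kspace A B)"
  unfolding product_kspace_def
proof (rule fraction_space_swf; (elim UN_E SigmaE2)?)
  let ?F = "\<Union>U\<in>{U. openin (zariski A) U}. \<Union>V\<in>{V. openin (zariski B) V}.
          product_functions A B U V \<times> product_functions A B U V"
  fix c
  show "\<exists>a b. (a, b) \<in> ?F \<and> (\<forall>x\<in>points A \<times> points B. a x = c \<and> b x = 1)"
    by (rule exI, rule exI, rule conjI[OF product_pair[OF openin_topspace openin_topspace
        product_functions_const[of _ _ c] product_functions_const[of _ _ 1]]]) auto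
next
  let ?F = "\<Union>U\<in>{U. openin (zariski A) U}. \<Union>V\<in>{V. openin (zariski B) V}.
          product_functions A B U V \<times> product_functions A B U V"
  fix a b a' b' U V U' V'
  assume "U \<in> {U. openin (zariski A) U}" "V \<in> {V. openin (zariski B) V}"
    and ab: "a \<in> product_functions A B U V" "b \<in> product_functions A B U V"
    and "U' \<in> {U. openin (zariski A) U}" "V' \<in> {V. openin (zariski B) V}"
    and ab': "a' \<in> product_functions A B U' V'" "b' \<in> product_functions A B U' V'"
  then have U: "openin (zariski A) U" "openin (zariski A) U'" and V: "openin (zariski B) V" "openin (zariski B) V'"
    by auto
  have o: "openin (zariski A) (U \<inter> U')" "openin (zariski B) (V \<inter> V')" using U V by auto
  note m = product_functions_ring[OF A B U V]
  have c: "(\<lambda>z. a' z * b z) \<in> product_functions A B (U \<inter> U') (V \<inter> V')"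
    using m[OF ab(2) ab'(1)] by (simp add: mult.commute)
  show "\<exists>a'' b''. (a'', b'') \<in> ?F \<and> (\<forall>x\<in>points A \<times> points B. a'' x = a x * b' x + a' x * b x \<and> b'' x = b x * b' x)"
    by (rule exI, rule exI, rule conjI[OF product_pair[OF o
          product_functions_add[OF m[OF ab(1) ab'(2)] c] m[OF ab(2) ab'(2)]]]) auto
  show "\<exists>a'' b''. (a'', b'') \<in> ?F \<and> (\<forall>x\<in>points A \<times> points B. a'' x = a x * a' x \<and> b'' x = b x * b' x)"
    by (rule exI, rule exI, rule conjI[OF product_pair[OF o
          m[OF ab(1) ab'(1)] m[OF ab(2) ab'(2)]]]) auto
next
  fix a b U V
  assume "U \<in> {U. openin (zariski A) U}" "V \<in> {V. openin (zariski B) V}"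
    and "a \<in> product_functions A B U V" "b \<in> product_functions A B U V"
  then show "(b, a) \<in> (\<Union>U\<in>{U. openin (zariski A) U}. \<Union>V\<in>{V. openin (zariski B) V}.
          product_functions A B U V \<times> product_functions A B U V)" by blast
qed

lemma product_open:
  fixes A :: "('p, 'k::field) kspace" and B :: "('q, 'k) kspace"
  assumes "openin (zariski A) U" "openin (zariski B) V" shows "openin (zariski (product_kspace A B)) (U \<times> V)"
proof -
  let ?b = "\<lambda>z. if z \<in> U \<times> V then (1::'k) else 0"
  have "{z \<in> points A \<times> points B. ?b z \<noteq> 0} = U \<times> V"
    using openin_subset[OF assms(1)] openin_subset[OF assms(2)] by auto
  moreover have "openin (zariski (product_kspace A B)) {z \<in> points A \<times> points B. ?b z \<noteq> 0}"
    unfolding product_kspace_def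
    by (rule fraction_space_open[OF product_pair[OF assms product_functions_const product_functions_const[of U V 1]]])
  ultimately show ?thesis by simp
qed

lemma product_fst:
  fixes A :: "('p, 'k::field) kspace" and B :: "('q, 'k) kspace"
  shows "morphism (product_kspace A B) A fst"
proof (rule morphismI)
  show "fst x \<in> points A" if "x \<in> points (product_kspace A B)" for x using that by (auto simp: product_points)
  fix V assume V: "openin (zariski A) V"
  have e: "{x \<in> points (product_kspace A B). fst x \<in> V} = V \<times> points B"
    using openin_subset[OF V] by (auto simp: product_points)
  show o: "openin (zariski (product_kspace A B)) {x \<in> points (product_kspace A B). fst x \<in> V}"
    unfolding e by (rule product_open[OF V openin_topspace])
  fix f assume f: "f \<in> regular A V"
  have fa: "(\<lambda>z. if z \<in> V \<times> points B then (f \<circ> fst) z else 0) \<in> product_functions A B V (points B)"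
    by (rule product_functionsI[OF function_algebra.generator]) (use f in blast)
  show "(\<lambda>x. f (fst x)) \<in> regular (product_kspace A B) {x \<in> points (product_kspace A B). fst x \<in> V}"
    unfolding product_kspace_def
    by (rule regular_fraction[OF product_pair[OF V openin_topspace fa product_functions_const[of _ _ 1]]
          o[unfolded product_kspace_def]])
      (use e[unfolded product_kspace_def] in auto)
qed

lemma product_snd:
  fixes A :: "('p, 'k::field) kspace" and B :: "('q, 'k) kspace"
  shows "morphism (product_kspace A B) B snd"
proof (rule morphismI)
  show "snd x \<in> points B" if "x \<in> points (product_kspace A B)" for x using that by (auto simp: product_points)
  fix V assume V: "openin (zariski B) V"
  have e: "{x \<in> points (product_kspace A B). snd x \<in> V} = points A \<times> V"
    using openin_subset[OF V] by (auto simp: product_points)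
  show o: "openin (zariski (product_kspace A B)) {x \<in> points (product_kspace A B). snd x \<in> V}"
    unfolding e by (rule product_open[OF openin_topspace V])
  fix f assume f: "f \<in> regular B V"
  have fa: "(\<lambda>z. if z \<in> points A \<times> V then (f \<circ> snd) z else 0) \<in> product_functions A B (points A) V"
    by (rule product_functionsI[OF function_algebra.generator]) (use f in blast)
  show "(\<lambda>x. f (snd x)) \<in> regular (product_kspace A B) {x \<in> points (product_kspace A B). snd x \<in> V}"
    unfolding product_kspace_def
    by (rule regular_fraction[OF product_pair[OF openin_topspace V fa product_functions_const[of _ _ 1]]
          o[unfolded product_kspace_def]])
      (use e[unfolded product_kspace_def] in auto)
qed

text \<open>The universal property of the product: pulled back along a pair of morphisms, the functions
  \<open>\<Sum>\<^sub>j f\<^sub>j (x) g\<^sub>j (y)\<close> are regular, and hence so are their fractions.\<close>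
lemma morphism_into_product:
  fixes A :: "('p, 'k::field) kspace"
  assumes A: "swf A" and f: "morphism A B \<phi>" and g: "morphism A C \<psi>"
  shows "morphism A (product_kspace B C) (\<lambda>x. (\<phi> x, \<psi> x))"
  unfolding product_kspace_def
proof (rule morphism_into_fraction_space[OF A])
  interpret space_with_functions A by (rule A)
  let ?F = "\<Union>U\<in>{U. openin (zariski B) U}. \<Union>V\<in>{V. openin (zariski C) V}.
          product_functions B C U V \<times> product_functions B C U V"
  show "points (fraction_space (points B \<times> points C) ?F) = points B \<times> points C"
    using product_points[of B C] unfolding product_kspace_def .
  show "(\<phi> x, \<psi> x) \<in> points B \<times> points C" if "x \<in> points A" for x
    using morphism_points[OF f that] morphism_points[OF g that] by simp
  fix a b x assume "(a, b) \<in> ?F" and x: "x \<in> points A" and nz: "b (\<phi> x, \<psi> x) \<noteq> 0"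
  then obtain U V where U: "openin (zariski B) U" and V: "openin (zariski C) V"
    and ab: "a \<in> product_functions B C U V" "b \<in> product_functions B C U V" by blast
  let ?G = "{f \<circ> fst | f. f \<in> regular B U} \<union> {g \<circ> snd | g. g \<in> regular C V}"
  obtain h where h: "h \<in> function_algebra ?G" "a = (\<lambda>z. if z \<in> U \<times> V then h z else 0)"
    using ab(1) unfolding product_functions_def by blast
  obtain h' where h': "h' \<in> function_algebra ?G" "b = (\<lambda>z. if z \<in> U \<times> V then h' z else 0)"
    using ab(2) unfolding product_functions_def by blast
  let ?W = "{x \<in> points A. \<phi> x \<in> U} \<inter> {x \<in> points A. \<psi> x \<in> V}"
  have W: "openin (zariski A) ?W" using morphism_open[OF f U] morphism_open[OF g V] by blast
  have r: "(\<lambda>x. k (\<phi> x, \<psi> x)) \<in> regular A ?W" if "k \<in> function_algebra ?G" for k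
    using that
  proof induction
    case (generator k)
    then consider u where "u \<in> regular B U" "k = u \<circ> fst" | u where "u \<in> regular C V" "k = u \<circ> snd" by blast
    then show ?case
    proof cases
      case 1
      show ?thesis
        using regular_mono[OF morphism_regular[OF f U 1(1)] morphism_open[OF f U] W] 1(2) by auto
    next
      case 2
      show ?thesis
        using regular_mono[OF morphism_regular[OF g V 2(1)] morphism_open[OF g V] W] 2(2) by auto
    qed
  qed (auto intro: regular_const regular_add regular_mult W)
  let ?W' = "{y \<in> ?W. h' (\<phi> y, \<psi> y) \<noteq> 0}"
  have W': "openin (zariski A) ?W'" by (rule nonzero_open[OF W r[OF h'(1)]])
  have m: "(\<lambda>x. k (\<phi> x, \<psi> x)) \<in> regular A ?W'" if "k \<in> function_algebra ?G" for k
    by (rule regular_mono[OF r[OF that] W W']) auto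
  have "(\<lambda>y. h (\<phi> y, \<psi> y) / h' (\<phi> y, \<psi> y)) \<in> regular A ?W'"
    by (rule regular_divide[OF W' m[OF h(1)] m[OF h'(1)]]) auto
  then have "(\<lambda>y. a (\<phi> y, \<psi> y) / b (\<phi> y, \<psi> y)) \<in> regular A ?W'"
    by (rule regular_cong[OF W']) (use h h' in auto)
  moreover have "x \<in> ?W'" using nz x unfolding h'(2) by (auto split: if_splits)
  moreover have "\<forall>y\<in>?W'. b (\<phi> y, \<psi> y) \<noteq> 0" using h' by auto
  ultimately show "\<exists>W. openin (zariski A) W \<and> x \<in> W \<and> (\<forall>y\<in>W. b (\<phi> y, \<psi> y) \<noteq> 0) \<and>
      (\<lambda>y. a (\<phi> y, \<psi> y) / b (\<phi> y, \<psi> y)) \<in> regular A W" using W' by blast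
qed

lemma affine_points: "points (affine_space n :: ('k::field vec, 'k) kspace) = carrier_vec n"
  unfolding affine_space_def Let_def
  by (rule fraction_space_points[of "\<lambda>_. 1" "\<lambda>_. 1"]) (auto intro: function_algebra.const)

lemma affine_swf: "swf (affine_space n :: ('k::field vec, 'k) kspace)"
  unfolding affine_space_def Let_def
proof (rule fraction_space_swf; (elim SigmaE2)?)
  let ?P = "function_algebra {\<lambda>v :: 'k vec. v $ i | i. i < n}"
  show "\<exists>a b. (a, b) \<in> ?P \<times> ?P \<and> (\<forall>x\<in>carrier_vec n. a x = c \<and> b x = 1)" for c
    by (rule exI[of _ "\<lambda>_. c"], rule exI[of _ "\<lambda>_. 1"]) (auto intro: function_algebra.const)
  fix a b a' b' assume "a \<in> ?P" "b \<in> ?P" "a' \<in> ?P" "b' \<in> ?P"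
  note ab = this
  show "\<exists>a'' b''. (a'', b'') \<in> ?P \<times> ?P \<and> (\<forall>x\<in>carrier_vec n. a'' x = a x * b' x + a' x * b x \<and> b'' x = b x * b' x)"
    by (rule exI[of _ "\<lambda>x. a x * b' x + a' x * b x"], rule exI[of _ "\<lambda>x. b x * b' x"])
      (simp add: ab function_algebra.add function_algebra.mult)
  show "\<exists>a'' b''. (a'', b'') \<in> ?P \<times> ?P \<and> (\<forall>x\<in>carrier_vec n. a'' x = a x * a' x \<and> b'' x = b x * b' x)"
    by (rule exI[of _ "\<lambda>x. a x * a' x"], rule exI[of _ "\<lambda>x. b x * b' x"])
      (simp add: ab function_algebra.mult)
qed auto

lemma affine_coordinate:
  assumes "i < n"
  shows "(\<lambda>v. v $ i) \<in> regular (affine_space n :: ('k::field vec, 'k) kspace) (points (affine_space n :: ('k vec, 'k) kspace))"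
  using assms
  unfolding affine_space_def Let_def
  by (intro regular_fraction[of "\<lambda>v. v $ i" "\<lambda>_. 1"])
    (auto intro!: function_algebra.generator function_algebra.const)

lemma morphism_into_affine:
  fixes A :: "('p, 'k::field) kspace" and \<phi> :: "'p \<Rightarrow> 'k vec"
  assumes A: "swf A" and im: "\<And>x. x \<in> points A \<Longrightarrow> \<phi> x \<in> carrier_vec n"
    and c: "\<And>i. i < n \<Longrightarrow> (\<lambda>x. \<phi> x $ i) \<in> regular A (points A)"
  shows "morphism A (affine_space n) \<phi>"
  unfolding affine_space_def Let_def
proof (rule morphism_into_fraction_space[OF A])
  interpret space_with_functions A by (rule A)
  let ?P = "function_algebra {\<lambda>v :: 'k vec. v $ i | i. i < n}"
  show "points (fraction_space (carrier_vec n) (?P \<times> ?P)) = carrier_vec n"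
    using affine_points[where 'k='k, of n] unfolding affine_space_def Let_def .
  show "\<phi> x \<in> carrier_vec n" if "x \<in> points A" for x using im[OF that] .
  have r: "(\<lambda>x. k (\<phi> x)) \<in> regular A (points A)" if "k \<in> ?P" for k
    using that by induction (auto intro: regular_const regular_add regular_mult c)
  fix a b x assume ab: "(a, b) \<in> ?P \<times> ?P" and x: "x \<in> points A" "b (\<phi> x) \<noteq> 0"
  let ?W = "{y \<in> points A. b (\<phi> y) \<noteq> 0}"
  have W: "openin (zariski A) ?W" using ab by (intro nonzero_open r) auto
  have m: "(\<lambda>x. k (\<phi> x)) \<in> regular A ?W" if "k \<in> ?P" for k
    by (rule regular_mono[OF r[OF that] open_points W]) auto
  have "(\<lambda>y. a (\<phi> y) / b (\<phi> y)) \<in> regular A ?W"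
    using ab by (intro regular_divide[OF W] m) auto
  then show "\<exists>W. openin (zariski A) W \<and> x \<in> W \<and> (\<forall>y\<in>W. b (\<phi> y) \<noteq> 0) \<and> (\<lambda>y. a (\<phi> y) / b (\<phi> y)) \<in> regular A W"
    using W x by (intro exI[of _ ?W]) auto
qed



section \<open>Determinants of matrices of functions\<close>

definition fdet :: "nat \<Rightarrow> (nat \<Rightarrow> nat \<Rightarrow> 'k::field) \<Rightarrow> 'k" where
  "fdet n a = det (mat n n (\<lambda>(i, j). a i j))"

definition finv :: "nat \<Rightarrow> (nat \<Rightarrow> nat \<Rightarrow> 'k::field) \<Rightarrow> nat \<Rightarrow> nat \<Rightarrow> 'k" where
  "finv n a i j = cofactor (mat n n (\<lambda>(i, j). a i j)) j i / fdet n a"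

lemma fdet_cong: "(\<And>i j. i < n \<Longrightarrow> j < n \<Longrightarrow> a i j = b i j) \<Longrightarrow> fdet n a = fdet n b"
  unfolding fdet_def by (rule arg_cong[of _ _ det]) auto

lemma fdet_mult: "fdet n (\<lambda>i j. \<Sum>k<n. a i k * b k j) = fdet n a * fdet n b"
proof -
  let ?A = "mat n n (\<lambda>(i, j). a i j)" and ?B = "mat n n (\<lambda>(i, j). b i j)"
  have "?A * ?B = mat n n (\<lambda>(i, j). \<Sum>k<n. a i k * b k j)"
    by (rule eq_matI) (auto simp: scalar_prod_def intro!: sum.cong)
  then show ?thesis unfolding fdet_def using det_mult[of ?A n ?B] by simp
qed

lemma fdet_one: "fdet n (\<lambda>i j. if i = j then 1 else 0) = (1 :: 'k::field)"
proof -
  have "mat n n (\<lambda>(i, j). if i = j then 1 else 0) = (1\<^sub>m n :: 'k mat)" by (rule eq_matI) auto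
  then show ?thesis by (simp add: fdet_def)
qed

lemma finv_right:
  assumes "fdet n a \<noteq> 0" "i < n" "j < n"
  shows "(\<Sum>k<n. a i k * finv n a k j) = (if i = j then 1 else 0)"
proof -
  let ?A = "mat n n (\<lambda>(i, j). a i j)"
  have "(\<Sum>k<n. a i k * cofactor ?A j k) = (?A * adj_mat ?A) $$ (i, j)"
    using assms by (auto simp: adj_mat_def scalar_prod_def intro!: sum.cong)
  also have "\<dots> = (if i = j then fdet n a else 0)"
    using assms by (subst adj_mat(2)[of _ n]) (auto simp: fdet_def)
  finally show ?thesis using assms(1)
    by (simp add: finv_def sum_divide_distrib[symmetric] split: if_splits)
qed

text \<open>Cramer's rule: the sum is the Laplace expansion along the row \<open>s\<close>, and the cofactors along that row
  do not see the row itself.\<close>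
lemma finv_row:
  assumes "s < n"
  shows "(\<Sum>t<n. c t * finv n a t s) = fdet n (\<lambda>i j. if i = s then c j else a i j) / fdet n a"
proof -
  let ?B = "mat n n (\<lambda>(i, j). if i = s then c j else a i j)" and ?A = "mat n n (\<lambda>(i, j). a i j)"
  have "mat_delete ?B s t = mat_delete ?A s t" if "t < n" for t
    using that assms by (intro eq_matI) (auto simp: mat_delete_def)
  then have "cofactor ?B s t = cofactor ?A s t" if "t < n" for t
    using that by (simp add: cofactor_def)
  then have "det ?B = (\<Sum>t<n. c t * cofactor ?A s t)"
    using assms by (subst laplace_expansion_row[of _ n s]) auto
  then show ?thesis by (simp add: finv_def fdet_def sum_divide_distrib)
qed

lemma fdet_column:
  assumes "r < n"
  shows "fdet n (\<lambda>i j. if j = r then c i else a i j) = (\<Sum>i<n. c i * cofactor (mat n n (\<lambda>(i, j). a i j)) i r)"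
proof -
  let ?B = "mat n n (\<lambda>(i, j). if j = r then c i else a i j)" and ?A = "mat n n (\<lambda>(i, j). a i j)"
  have "mat_delete ?B i r = mat_delete ?A i r" if "i < n" for i
    using that assms by (intro eq_matI) (auto simp: mat_delete_def)
  then have "cofactor ?B i r = cofactor ?A i r" if "i < n" for i
    using that by (simp add: cofactor_def)
  then show ?thesis
    unfolding fdet_def using assms by (subst laplace_expansion_column[of _ n r]) auto
qed

lemma finv_column:
  assumes "r < n"
  shows "(\<Sum>s<n. finv n a r s * c s) = fdet n (\<lambda>i j. if j = r then c i else a i j) / fdet n a"
  unfolding fdet_column[OF assms] by (simp add: finv_def sum_divide_distrib mult.commute)

lemma finv_left:
  assumes "fdet n a \<noteq> 0" "i < n" "j < n"
  shows "(\<Sum>k<n. finv n a i k * a k j) = (if i = j then 1 else 0)"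
  using left_inverse_matrix_right[OF finv_right[OF assms(1)] assms(2,3)] .

lemma (in space_with_functions) regular_fdet:
  assumes "openin (zariski A) U" "\<And>i j. i < n \<Longrightarrow> j < n \<Longrightarrow> (\<lambda>x. a x i j) \<in> regular A U"
  shows "(\<lambda>x. fdet n (a x)) \<in> regular A U"
  using regular_det[of U n "\<lambda>i j x. a x i j"] assms unfolding fdet_def by simp

section \<open>Quiver Grassmannians\<close>

definition frame_of ::
  "('v, 'a) pre_digraph \<Rightarrow> ('v, 'a, 'k::field, 'm) rep \<Rightarrow> ('v \<Rightarrow> 'm set) \<Rightarrow> 'v \<Rightarrow> 'm list" where
  "frame_of Q M N = (SOME b. is_frame Q M N b)"

definition pluecker_fractions where
  "pluecker_fractions Q M e =
     {(\<lambda>N. P (frame_of Q M N), \<lambda>N. P' (frame_of Q M N)) | P P' d.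
        pluecker_poly Q M e d P \<and> pluecker_poly Q M e d P'}"

lemma Gr_eq: "Gr Q M e = fraction_space (quiver_grassmannian Q M e) (pluecker_fractions Q M e)"
  by (simp add: Gr_def Let_def frame_of_def pluecker_fractions_def)

lemma pluecker_fractionsI:
  "pluecker_poly Q M e d P \<Longrightarrow> pluecker_poly Q M e d P' \<Longrightarrow>
    (\<lambda>N. P (frame_of Q M N), \<lambda>N. P' (frame_of Q M N)) \<in> pluecker_fractions Q M e"
  unfolding pluecker_fractions_def by blast

lemma pluecker_fractionsE:
  assumes "(a, b) \<in> pluecker_fractions Q M e"
  obtains P P' d where "a = (\<lambda>N. P (frame_of Q M N))" "b = (\<lambda>N. P' (frame_of Q M N))"
    "pluecker_poly Q M e d P" "pluecker_poly Q M e d P'"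
  using assms unfolding pluecker_fractions_def by blast

lemma Gr_points: "points (Gr Q M e) = quiver_grassmannian Q M e"
  unfolding Gr_eq
  by (rule fraction_space_points[OF pluecker_fractionsI[OF pluecker_poly.const pluecker_poly.const[of _ _ _ 1]]])
    simp

lemma Gr_swf: "swf (Gr Q M e)"
  unfolding Gr_eq
proof (rule fraction_space_swf)
  let ?F = "pluecker_fractions Q M e"
  show "\<exists>a b. (a, b) \<in> ?F \<and> (\<forall>x\<in>quiver_grassmannian Q M e. a x = c \<and> b x = 1)" for c
    using pluecker_fractionsI[OF pluecker_poly.const[of Q M e c] pluecker_poly.const[of Q M e 1]] by fast
  fix a b assume "(a, b) \<in> ?F"
  then obtain P P' d where 1: "a = (\<lambda>N. P (frame_of Q M N))" "b = (\<lambda>N. P' (frame_of Q M N))"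
    "pluecker_poly Q M e d P" "pluecker_poly Q M e d P'" by (rule pluecker_fractionsE)
  show "(b, a) \<in> ?F" unfolding 1 by (rule pluecker_fractionsI[OF 1(4,3)])
  fix a' b' assume "(a', b') \<in> ?F"
  then obtain R R' d' where 2: "a' = (\<lambda>N. R (frame_of Q M N))" "b' = (\<lambda>N. R' (frame_of Q M N))"
    "pluecker_poly Q M e d' R" "pluecker_poly Q M e d' R'" by (rule pluecker_fractionsE)
  have "pluecker_poly Q M e (\<lambda>i. d i + d' i) (\<lambda>b. R b * P' b)"
    using pluecker_poly.mult[OF 1(4) 2(3)] by (simp add: mult.commute)
  then have "pluecker_poly Q M e (\<lambda>i. d i + d' i) (\<lambda>b. P b * R' b + R b * P' b)"
    by (rule pluecker_poly.add[OF pluecker_poly.mult[OF 1(3) 2(4)]])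
  note 3 = pluecker_fractionsI[OF this pluecker_poly.mult[OF 1(4) 2(4)]]
  show "\<exists>a'' b''. (a'', b'') \<in> ?F \<and> (\<forall>x\<in>quiver_grassmannian Q M e. a'' x = a x * b' x + a' x * b x \<and> b'' x = b x * b' x)"
    by (rule exI, rule exI, rule conjI[OF 3]) (simp add: 1(1,2) 2(1,2))
  note 4 = pluecker_fractionsI[OF pluecker_poly.mult[OF 1(3) 2(3)] pluecker_poly.mult[OF 1(4) 2(4)]]
  show "\<exists>a'' b''. (a'', b'') \<in> ?F \<and> (\<forall>x\<in>quiver_grassmannian Q M e. a'' x = a x * a' x \<and> b'' x = b x * b' x)"
    by (rule exI, rule exI, rule conjI[OF 4]) (simp add: 1(1,2) 2(1,2))
qed

lemma grassmannianD:
  assumes "N \<in> quiver_grassmannian Q M e"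
  shows gr_subrep: "N \<in> subreps Q M"
    and gr_sub: "i \<in> verts Q \<Longrightarrow> sub (N i) (vspace M i)"
    and gr_dim: "i \<in> verts Q \<Longrightarrow> vectorspace.dim class_ring ((vspace M i)\<lparr>carrier := N i\<rparr>) = e i"
  using assms subrep_sub unfolding quiver_grassmannian_def dimvec_def by auto

lemma frame_of_is_frame:
  assumes M: "representation Q M" and N: "N \<in> quiver_grassmannian Q M e"
  shows "is_frame Q M N (frame_of Q M N)"
proof -
  have "\<forall>i. \<exists>bs. i \<in> verts Q \<longrightarrow> distinct bs \<and>
      vectorspace.basis class_ring ((vspace M i)\<lparr>carrier := N i\<rparr>) (set bs)"
  proof
    fix i
    show "\<exists>bs. i \<in> verts Q \<longrightarrow> distinct bs \<and>
      vectorspace.basis class_ring ((vspace M i)\<lparr>carrier := N i\<rparr>) (set bs)"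
    proof (cases "i \<in> verts Q")
      case True
      note sb = gr_sub[OF N True]
      obtain b l where b: "dual_basis (vspace M i) (N i) (e i) b l"
        using dual_basis_exists[OF rep_fin_dim[OF M True] sb] gr_dim[OF N True] by metis
      have d: "dual_basis ((vspace M i)\<lparr>carrier := N i\<rparr>) (carrier ((vspace M i)\<lparr>carrier := N i\<rparr>)) (e i) b l"
        using dual_basis_restrict[OF b sb] by simp
      note * = dual_basis_is_basis[OF sub_is_vsp[OF sb] d]
      have "distinct (map b [0..<e i])" using *(1) by (simp add: distinct_map atLeast0LessThan)
      moreover have "set (map b [0..<e i]) = b ` {..<e i}" by auto
      ultimately show ?thesis using *(2) by metis
    qed auto
  qed
  then obtain bs where "\<forall>i. i \<in> verts Q \<longrightarrow> distinct (bs i) \<and>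
      vectorspace.basis class_ring ((vspace M i)\<lparr>carrier := N i\<rparr>) (set (bs i))" by metis
  then have "is_frame Q M N bs" unfolding is_frame_def by blast
  then show ?thesis unfolding frame_of_def by (rule someI[of "is_frame Q M N"])
qed

lemma frame_of_dual:
  assumes M: "representation Q M" and N: "N \<in> quiver_grassmannian Q M e" and i: "i \<in> verts Q"
  obtains l where "dual_basis ((vspace M i)\<lparr>carrier := N i\<rparr>) (N i) (e i) (\<lambda>s. frame_of Q M N i ! s) l"
proof -
  let ?V = "(vspace M i)\<lparr>carrier := N i\<rparr>" and ?b = "frame_of Q M N i"
  have f: "distinct ?b" "vectorspace.basis class_ring ?V (set ?b)"
    using frame_of_is_frame[OF M N] i unfolding is_frame_def by auto
  have vs: "vsp ?V" by (rule sub_is_vsp[OF gr_sub[OF N i]])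
  have len: "length ?b = e i"
    using vectorspace.dim_basis[OF vs _ f(2)] distinct_card[OF f(1)] gr_dim[OF N i] by simp
  have im: "(!) ?b ` {..<e i} = set ?b" using nth_image_lt[of ?b] len by simp
  have inj: "inj_on ((!) ?b) {..<e i}" using f(1) len by (auto simp: inj_on_def nth_eq_iff_index_eq)
  obtain l where "dual_basis ?V (carrier ?V) (e i) ((!) ?b) l"
    using basis_dual_basis[OF vs _ inj] f(2) im by metis
  then show ?thesis using that by simp
qed

lemma frame_in:
  assumes "representation Q M" "N \<in> quiver_grassmannian Q M e" "i \<in> verts Q" "s < e i"
  shows "frame_of Q M N i ! s \<in> N i"
  using frame_of_dual[OF assms(1-3)] dual_basis_in assms(4) by (metis (mono_tags, lifting))

text \<open>The factor by which a change of frame multiplies a multihomogeneous polynomial depends on the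
  multidegree only, and therefore cancels in fractions.\<close>
lemma pluecker_change:
  fixes M :: "('v, 'a, 'k::field, 'm) rep"
  assumes fin: "finite (verts Q)" and M: "representation Q M" and N: "N \<in> quiver_grassmannian Q M e"
    and b: "\<And>i. i \<in> verts Q \<Longrightarrow> \<exists>\<theta>. dual_basis (vspace M i) (N i) (e i) (\<beta> i) \<theta>"
  obtains \<delta> where "\<And>i. i \<in> verts Q \<Longrightarrow> \<delta> i \<noteq> 0"
    and "\<And>d P. pluecker_poly Q M e d P \<Longrightarrow>
      P (\<lambda>i. map (\<beta> i) [0..<e i]) = (\<Prod>i\<in>verts Q. \<delta> i ^ d i) * P (frame_of Q M N)"
proof -
  let ?fr = "frame_of Q M N" and ?bl = "\<lambda>i. map (\<beta> i) [0..<e i]"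
  have "\<forall>i. \<exists>l. i \<in> verts Q \<longrightarrow> dual_basis ((vspace M i)\<lparr>carrier := N i\<rparr>) (N i) (e i) (\<lambda>s. ?fr i ! s) l"
    using frame_of_dual[OF M N] by metis
  then obtain l where l: "\<And>i. i \<in> verts Q \<Longrightarrow>
      dual_basis ((vspace M i)\<lparr>carrier := N i\<rparr>) (N i) (e i) (\<lambda>s. ?fr i ! s) (l i)" by metis
  define C where "C i t s = l i t (\<beta> i s)" for i t s
  have ex: "k (\<beta> i s) = (\<Sum>t<e i. k (?fr i ! t) * C i t s)"
    if i: "i \<in> verts Q" and s: "s < e i" and k: "k \<in> linear_forms (vspace M i)" for i s k
  proof -
    have bs: "\<beta> i s \<in> N i" using b[OF i] s dual_basis_in by metis
    let ?V = "(vspace M i)\<lparr>carrier := N i\<rparr>"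
    have "sub (N i) ?V" using sub_carrier[OF sub_is_vsp[OF gr_sub[OF N i]]] by simp
    from form_expand'[OF l[OF i] this bs form_restrict[OF k sub_subset[OF gr_sub[OF N i]]]]
    show ?thesis by (simp add: C_def mult.commute)
  qed
  have nz: "fdet (e i) (C i) \<noteq> 0" if i: "i \<in> verts Q" for i
  proof -
    obtain \<theta>' where d: "dual_basis (vspace M i) (N i) (e i) (\<beta> i) \<theta>'" using b[OF i] by blast
    have "fdet (e i) (\<lambda>r t. \<theta>' r (?fr i ! t)) * fdet (e i) (C i) = fdet (e i) (\<lambda>r s. \<theta>' r (\<beta> i s))"
      unfolding fdet_mult[symmetric] using ex[OF i _ dual_basis_form[OF d]] by (intro fdet_cong) simp
    also have "\<dots> = fdet (e i) (\<lambda>r s. if r = s then 1 else 0)"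
      by (intro fdet_cong) (simp add: dual_basis_delta[OF d])
    finally show ?thesis by (auto simp: fdet_one)
  qed
  have "P ?bl = (\<Prod>i\<in>verts Q. fdet (e i) (C i) ^ d i) * P ?fr" if "pluecker_poly Q M e d P" for d P
    using that
  proof induction
    case (coordinate i l')
    have "det (mat (e i) (e i) (\<lambda>(r, s). l' r (?bl i ! s))) = fdet (e i) (\<lambda>r s. l' r (\<beta> i s))"
      unfolding fdet_def by (intro arg_cong[of _ _ det] eq_matI) auto
    also have "\<dots> = fdet (e i) (\<lambda>r s. \<Sum>t<e i. l' r (?fr i ! t) * C i t s)"
      using ex[OF coordinate(1)] coordinate(2) by (intro fdet_cong) auto
    also have "\<dots> = fdet (e i) (\<lambda>r t. l' r (?fr i ! t)) * fdet (e i) (C i)" by (rule fdet_mult)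
    also have "fdet (e i) (C i) = (\<Prod>j\<in>verts Q. if j = i then fdet (e i) (C i) else 1)"
      using coordinate(1) fin by simp
    also have "\<dots> = (\<Prod>j\<in>verts Q. fdet (e j) (C j) ^ (if j = i then 1 else 0))"
      by (intro prod.cong) auto
    finally show ?case by (simp add: fdet_def mult.commute)
  qed (simp_all add: algebra_simps power_add prod.distrib)
  then show ?thesis using that[of "\<lambda>i. fdet (e i) (C i)"] nz by blast
qed

text \<open>By \<open>pluecker_change\<close> the fractions of Pluecker polynomials may be evaluated on the frames \<open>\<beta> y\<close> instead
  of the chosen ones, and there they are fractions of polynomials in regular functions.\<close>
lemma morphism_into_Gr:
  fixes M :: "('v, 'a, 'k::field, 'm) rep" and A :: "('p, 'k) kspace"
  assumes A: "swf A" and fin: "finite (verts Q)" and M: "representation Q M"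
    and im: "\<And>x. x \<in> points A \<Longrightarrow> \<phi> x \<in> quiver_grassmannian Q M e"
    and loc: "\<And>x. x \<in> points A \<Longrightarrow> \<exists>W \<beta>. openin (zariski A) W \<and> x \<in> W \<and>
      (\<forall>y\<in>W. \<forall>i\<in>verts Q. \<exists>\<theta>. dual_basis (vspace M i) (\<phi> y i) (e i) (\<beta> y i) \<theta>) \<and>
      (\<forall>i\<in>verts Q. \<forall>s<e i. \<forall>l\<in>linear_forms (vspace M i). (\<lambda>y. l (\<beta> y i s)) \<in> regular A W)"
  shows "morphism A (Gr Q M e) \<phi>"
  unfolding Gr_eq
proof (rule morphism_into_fraction_space[OF A _ im])
  interpret space_with_functions A by (rule A)
  show "points (fraction_space (quiver_grassmannian Q M e) (pluecker_fractions Q M e)) = quiver_grassmannian Q M e"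
    using Gr_points unfolding Gr_eq .
  fix a b x assume ab: "(a, b) \<in> pluecker_fractions Q M e" and x: "x \<in> points A" and nz: "b (\<phi> x) \<noteq> 0"
  obtain P P' d where P: "a = (\<lambda>N. P (frame_of Q M N))" "b = (\<lambda>N. P' (frame_of Q M N))"
    "pluecker_poly Q M e d P" "pluecker_poly Q M e d P'" using ab by (rule pluecker_fractionsE)
  obtain W \<beta> where W: "openin (zariski A) W" "x \<in> W"
    and dual': "\<forall>y\<in>W. \<forall>i\<in>verts Q. \<exists>\<theta>. dual_basis (vspace M i) (\<phi> y i) (e i) (\<beta> y i) \<theta>"
    and reg': "\<forall>i\<in>verts Q. \<forall>s<e i. \<forall>l\<in>linear_forms (vspace M i). (\<lambda>y. l (\<beta> y i s)) \<in> regular A W"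
    using loc[OF x] by (elim exE conjE)
  note dual = bspec[OF bspec[OF dual']]
  have reg: "(\<lambda>y. l (\<beta> y i s)) \<in> regular A W"
    if "i \<in> verts Q" "s < e i" "l \<in> linear_forms (vspace M i)" for i s l
    using reg' that by simp
  let ?bl = "\<lambda>y i. map (\<beta> y i) [0..<e i]"
  have r: "(\<lambda>y. R (?bl y)) \<in> regular A W" if "pluecker_poly Q M e d R" for d R
    using that
  proof induction
    case (coordinate i l)
    have "det (mat (e i) (e i) (\<lambda>(r, s). l r (?bl y i ! s))) = fdet (e i) (\<lambda>r s. l r (\<beta> y i s))" for y
      unfolding fdet_def by (intro arg_cong[of _ _ det] eq_matI) auto
    moreover have "(\<lambda>y. fdet (e i) (\<lambda>r s. l r (\<beta> y i s))) \<in> regular A W"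
      using coordinate by (intro regular_fdet W reg) auto
    ultimately show ?case by simp
  qed (auto intro: regular_const regular_add regular_mult W)
  \<comment> \<open>numerator and denominator have the same degree, hence the same factor \<open>D\<close>\<close>
  have D: "\<exists>D. D \<noteq> 0 \<and> P (?bl y) = D * P (frame_of Q M (\<phi> y)) \<and> P' (?bl y) = D * P' (frame_of Q M (\<phi> y))"
    if y: "y \<in> W" for y
  proof -
    have N: "\<phi> y \<in> quiver_grassmannian Q M e" using im openin_subset[OF W(1)] y by auto
    obtain \<delta> where d: "\<And>i. i \<in> verts Q \<Longrightarrow> \<delta> i \<noteq> 0"
      "\<And>d P. pluecker_poly Q M e d P \<Longrightarrow>
        P (\<lambda>i. map (\<beta> y i) [0..<e i]) = (\<Prod>i\<in>verts Q. \<delta> i ^ d i) * P (frame_of Q M (\<phi> y))"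
      using pluecker_change[OF fin M N dual[OF y]] by blast
    show ?thesis
      using d(1) fin d(2)[OF P(3)] d(2)[OF P(4)]
      by (intro exI[of _ "\<Prod>i\<in>verts Q. \<delta> i ^ d i"]) auto
  qed
  let ?W = "{y \<in> W. P' (?bl y) \<noteq> 0}"
  have W': "openin (zariski A) ?W" by (rule nonzero_open[OF W(1) r[OF P(4)]])
  have m: "(\<lambda>y. R (?bl y)) \<in> regular A ?W" if "pluecker_poly Q M e d R" for d R
    by (rule regular_mono[OF r[OF that] W(1) W']) auto
  have "(\<lambda>y. P (?bl y) / P' (?bl y)) \<in> regular A ?W" by (rule regular_divide[OF W' m[OF P(3)] m[OF P(4)]]) auto
  then have "(\<lambda>y. a (\<phi> y) / b (\<phi> y)) \<in> regular A ?W"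
    by (rule regular_cong[OF W']) (use D P(1,2) in force)
  moreover have "x \<in> ?W" using D[OF W(2)] W(2) nz P(2) by auto
  moreover have "\<forall>y\<in>?W. b (\<phi> y) \<noteq> 0" using D P(2) by force
  ultimately show "\<exists>W. openin (zariski A) W \<and> x \<in> W \<and> (\<forall>y\<in>W. b (\<phi> y) \<noteq> 0) \<and>
      (\<lambda>y. a (\<phi> y) / b (\<phi> y)) \<in> regular A W" using W' by blast
qed

text \<open>The frame multiplied by the inverse of the matrix of values of the given forms.  Where that matrix
  is invertible, this is the frame dual to the forms, and it does not depend on the chosen one.\<close>
definition normal_frame ::
  "('v, 'a) pre_digraph \<Rightarrow> ('v, 'a, 'k::field, 'm) rep \<Rightarrow> ('v \<Rightarrow> nat) \<Rightarrow> ('v \<Rightarrow> nat \<Rightarrow> 'm \<Rightarrow> 'k) \<Rightarrow>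
     ('v \<Rightarrow> 'm set) \<Rightarrow> 'v \<Rightarrow> nat \<Rightarrow> 'm" where
  "normal_frame Q M e \<theta> N i s =
     comb (vspace M i) (e i) (\<lambda>t. finv (e i) (\<lambda>r t. \<theta> i r (frame_of Q M N i ! t)) t s) (\<lambda>t. frame_of Q M N i ! t)"

text \<open>The standard open subset of subspaces that meet the common kernel of the forms in zero only.\<close>
definition chart_domain ::
  "('v, 'a) pre_digraph \<Rightarrow> ('v, 'a, 'k::field, 'm) rep \<Rightarrow> ('v \<Rightarrow> nat) \<Rightarrow> ('v \<Rightarrow> nat \<Rightarrow> 'm \<Rightarrow> 'k) \<Rightarrow>
     ('v \<Rightarrow> 'm set) set" where
  "chart_domain Q M e \<theta> =
     {N \<in> quiver_grassmannian Q M e. \<forall>i\<in>verts Q. fdet (e i) (\<lambda>r t. \<theta> i r (frame_of Q M N i ! t)) \<noteq> 0}"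

lemma chart_domain_gr: "N \<in> chart_domain Q M e \<theta> \<Longrightarrow> N \<in> quiver_grassmannian Q M e"
  by (simp add: chart_domain_def)

lemma normal_frame_dual_basis:
  assumes M: "representation Q M" and l: "\<And>i r. i \<in> verts Q \<Longrightarrow> r < e i \<Longrightarrow> \<theta> i r \<in> linear_forms (vspace M i)"
    and N: "N \<in> chart_domain Q M e \<theta>" and i: "i \<in> verts Q"
  shows "dual_basis (vspace M i) (N i) (e i) (normal_frame Q M e \<theta> N i) (\<theta> i)"
proof -
  note G = chart_domain_gr[OF N]
  note sb = gr_sub[OF G i] and fr = frame_in[OF M G i]
  have nz: "fdet (e i) (\<lambda>r t. \<theta> i r (frame_of Q M N i ! t)) \<noteq> 0" using N i by (simp add: chart_domain_def)
  show ?thesis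
  proof (rule dual_basis_of_dim[OF rep_fin_dim[OF M i] sb gr_dim[OF G i]])
    show "normal_frame Q M e \<theta> N i s \<in> N i" if "s < e i" for s
      unfolding normal_frame_def using comb_closed[OF sb fr] .
    show "\<theta> i r \<in> linear_forms (vspace M i)" if "r < e i" for r using l[OF i that] .
    show "\<theta> i r (normal_frame Q M e \<theta> N i s) = (if r = s then 1 else 0)" if "r < e i" "s < e i" for r s
    proof -
      have "\<theta> i r (normal_frame Q M e \<theta> N i s) =
          (\<Sum>t<e i. finv (e i) (\<lambda>r t. \<theta> i r (frame_of Q M N i ! t)) t s * \<theta> i r (frame_of Q M N i ! t))"
        unfolding normal_frame_def using fr sub_in[OF sb] by (intro form_comb rep_vsp[OF M i] l i that) auto
      then show ?thesis using finv_right[OF nz that] by (simp add: mult.commute)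
    qed
  qed
qed

lemma chart_domainI:
  assumes M: "representation Q M" and N: "N \<in> quiver_grassmannian Q M e"
    and b: "\<And>i. i \<in> verts Q \<Longrightarrow> dual_basis (vspace M i) (N i) (e i) (\<beta> i) (\<theta> i)"
  shows "N \<in> chart_domain Q M e \<theta>"
  unfolding chart_domain_def
proof (intro CollectI conjI N ballI)
  fix i assume i: "i \<in> verts Q"
  let ?V = "(vspace M i)\<lparr>carrier := N i\<rparr>" and ?fr = "frame_of Q M N i"
  note d = b[OF i] and sb = gr_sub[OF N i]
  obtain l where l: "dual_basis ?V (N i) (e i) (\<lambda>s. ?fr ! s) l" by (rule frame_of_dual[OF M N i])
  have sV: "sub (N i) ?V" using sub_carrier[OF sub_is_vsp[OF sb]] by simp
  have "fdet (e i) (\<lambda>r t. \<theta> i r (?fr ! t)) * fdet (e i) (\<lambda>t s. l t (\<beta> i s)) = fdet (e i) (\<lambda>r s. \<theta> i r (\<beta> i s))"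
    unfolding fdet_mult[symmetric]
  proof (rule fdet_cong)
    fix r s assume "r < e i" "s < e i"
    then show "(\<Sum>t<e i. \<theta> i r (?fr ! t) * l t (\<beta> i s)) = \<theta> i r (\<beta> i s)"
      using form_expand'[OF l sV dual_basis_in[OF d] form_restrict[OF dual_basis_form[OF d] sub_subset[OF sb]]]
      by (simp add: mult.commute)
  qed
  also have "\<dots> = fdet (e i) (\<lambda>r s. if r = s then 1 else 0)"
    by (intro fdet_cong) (simp add: dual_basis_delta[OF d])
  finally show "fdet (e i) (\<lambda>r t. \<theta> i r (?fr ! t)) \<noteq> 0" by (auto simp: fdet_one)
qed

lemma normal_frame_unique:
  assumes M: "representation Q M" and N: "N \<in> quiver_grassmannian Q M e"
    and b: "\<And>i. i \<in> verts Q \<Longrightarrow> dual_basis (vspace M i) (N i) (e i) (\<beta> i) (\<theta> i)"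
    and i: "i \<in> verts Q" and s: "s < e i"
  shows "normal_frame Q M e \<theta> N i s = \<beta> i s"
proof -
  have d: "dual_basis (vspace M i) (N i) (e i) (normal_frame Q M e \<theta> N i) (\<theta> i)"
    by (rule normal_frame_dual_basis[OF M dual_basis_form[OF b] chart_domainI[OF M N b] i])
  show ?thesis
    by (rule dual_basis_eq[OF d gr_sub[OF N i]])
      (use s dual_basis_in[OF d] dual_basis_in[OF b[OF i]] dual_basis_delta[OF d] dual_basis_delta[OF b[OF i]] in auto)
qed

lemma chart_domain_open:
  assumes fin: "finite (verts Q)"
    and l: "\<And>i r. i \<in> verts Q \<Longrightarrow> r < e i \<Longrightarrow> \<theta> i r \<in> linear_forms (vspace M i)"
  shows "openin (zariski (Gr Q M e)) (chart_domain Q M e \<theta>)"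
proof -
  have o: "openin (zariski (Gr Q M e)) {N \<in> quiver_grassmannian Q M e.
      fdet (e i) (\<lambda>r t. \<theta> i r (frame_of Q M N i ! t)) \<noteq> 0}" if i: "i \<in> verts Q" for i
  proof -
    have c: "pluecker_poly Q M e (\<lambda>j. if j = i then 1 else 0)
        (\<lambda>b. det (mat (e i) (e i) (\<lambda>(r, t). \<theta> i r (b i ! t))))"
      using i l[OF i] by (rule pluecker_poly.coordinate)
    show ?thesis
      unfolding Gr_eq fdet_def by (rule fraction_space_open[OF pluecker_fractionsI[OF c c]])
  qed
  have "chart_domain Q M e \<theta> = points (Gr Q M e) \<inter> (\<Inter>i\<in>verts Q. {N \<in> quiver_grassmannian Q M e.
      fdet (e i) (\<lambda>r t. \<theta> i r (frame_of Q M N i ! t)) \<noteq> 0})"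
    unfolding chart_domain_def Gr_points by auto
  then show ?thesis by (simp only:) (rule openin_Int_Inter; use o fin in auto)
qed

text \<open>By Cramer's rule the entries are quotients of two Pluecker coordinates: replace one of the forms by \<open>k\<close>
  in the numerator.\<close>
lemma normal_frame_regular:
  assumes M: "representation Q M" and fin: "finite (verts Q)"
    and l: "\<And>i r. i \<in> verts Q \<Longrightarrow> r < e i \<Longrightarrow> \<theta> i r \<in> linear_forms (vspace M i)"
    and i: "i \<in> verts Q" and s: "s < e i" and k: "k \<in> linear_forms (vspace M i)"
  shows "(\<lambda>N. k (normal_frame Q M e \<theta> N i s)) \<in> regular (Gr Q M e) (chart_domain Q M e \<theta>)"
proof -
  let ?l = "\<lambda>r. if r = s then k else \<theta> i r"
  have l': "?l r \<in> linear_forms (vspace M i)" if "r < e i" for r using l[OF i that] k by simp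
  have "pluecker_poly Q M e (\<lambda>j. if j = i then 1 else 0)
      (\<lambda>b. det (mat (e i) (e i) (\<lambda>(r, t). ?l r (b i ! t))))"
    using i l' by (rule pluecker_poly.coordinate)
  moreover have "pluecker_poly Q M e (\<lambda>j. if j = i then 1 else 0)
      (\<lambda>b. det (mat (e i) (e i) (\<lambda>(r, t). \<theta> i r (b i ! t))))"
    using i l[OF i] by (rule pluecker_poly.coordinate)
  ultimately have F: "(\<lambda>N. det (mat (e i) (e i) (\<lambda>(r, t). ?l r (frame_of Q M N i ! t))),
      \<lambda>N. det (mat (e i) (e i) (\<lambda>(r, t). \<theta> i r (frame_of Q M N i ! t)))) \<in> pluecker_fractions Q M e"
    by (rule pluecker_fractionsI)
  show ?thesis
    unfolding Gr_eq
  proof (rule regular_fraction[OF F chart_domain_open[OF fin l, unfolded Gr_eq]])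
    fix N assume N: "N \<in> chart_domain Q M e \<theta>"
    note G = chart_domain_gr[OF N]
    let ?fr = "frame_of Q M N i"
    show "det (mat (e i) (e i) (\<lambda>(r, s). \<theta> i r (?fr ! s))) \<noteq> 0"
      using N i by (simp add: chart_domain_def fdet_def)
    have "k (normal_frame Q M e \<theta> N i s) = (\<Sum>t<e i. finv (e i) (\<lambda>r t. \<theta> i r (?fr ! t)) t s * k (?fr ! t))"
      unfolding normal_frame_def using frame_in[OF M G i] sub_in[OF gr_sub[OF G i]]
      by (intro form_comb rep_vsp[OF M i] k) auto
    also have "\<dots> = (\<Sum>t<e i. k (?fr ! t) * finv (e i) (\<lambda>r t. \<theta> i r (?fr ! t)) t s)"
      by (simp add: mult.commute)
    also have "\<dots> = fdet (e i) (\<lambda>r t. if r = s then k (?fr ! t) else \<theta> i r (?fr ! t)) / fdet (e i) (\<lambda>r t. \<theta> i r (?fr ! t))"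
      by (rule finv_row[OF s])
    finally show "k (normal_frame Q M e \<theta> N i s) =
        det (mat (e i) (e i) (\<lambda>(r, t). ?l r (?fr ! t))) / det (mat (e i) (e i) (\<lambda>(r, t). \<theta> i r (?fr ! t)))"
      unfolding fdet_def by (simp add: if_distrib[of "\<lambda>f. f _"] cong: if_cong)
  qed
qed



section \<open>The fibres in coordinates\<close>

lemma sum_lessThan_add:
  fixes h :: "nat \<Rightarrow> 'a::comm_monoid_add"
  shows "(\<Sum>t<m + n. h t) = (\<Sum>t<m. h t) + (\<Sum>s<n. h (m + s))"
  by (induction n) (simp_all add: add.assoc)

text \<open>A form vanishing on \<open>N\<close> is a form on the quotient, so it is determined by the values on \<open>w\<close>.\<close>
lemma cobasis_expand:
  assumes N: "sub N V" and cb: "cobasis V N c w \<kappa>" and k: "k \<in> linear_forms V"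
    and z: "\<And>x. x \<in> N \<Longrightarrow> k x = 0" and x: "x \<in> carrier V"
  shows "k x = (\<Sum>t<c. \<kappa> t x * k (w t))"
proof -
  note V = sub_vsp[OF N]
  let ?y = "comb V c (\<lambda>t. \<kappa> t x) w"
  have y: "?y \<in> carrier V" using cobasis_in[OF cb] by (rule comb_in[OF V])
  have fy: "l ?y = (\<Sum>t<c. \<kappa> t x * l (w t))" if "l \<in> linear_forms V" for l
    using cobasis_in[OF cb] by (rule form_comb[OF V that])
  have "\<kappa> r (x \<ominus>\<^bsub>V\<^esub> ?y) = 0" if r: "r < c" for r
  proof -
    have "(\<Sum>t<c. \<kappa> t x * \<kappa> r (w t)) = (\<Sum>t<c. if t = r then \<kappa> r x else 0)"
      using r by (intro sum.cong) (auto simp: cobasis_delta[OF cb])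
    then show ?thesis
      using r fy[OF cobasis_form[OF cb r]] form_minus[OF V cobasis_form[OF cb r] x y] by simp
  qed
  then have "x \<ominus>\<^bsub>V\<^esub> ?y \<in> N" using cobasis_iff[OF cb] vsp_minus[OF V x y] by blast
  then have "k (x \<ominus>\<^bsub>V\<^esub> ?y) = 0" by (rule z)
  then show ?thesis using form_minus[OF V k x y] fy[OF k] by simp
qed

text \<open>An extension with chosen splittings at the vertices; \<open>\<rho>\<close> and \<open>\<pi>\<close> together identify \<open>Y\<^sub>i\<close> with
  \<open>X\<^sub>i \<times> S\<^sub>i\<close>, and \<open>glue\<close> is the inverse.\<close>
locale split_extension_data = fin_digraph Q
  for Q :: "('v, 'a) pre_digraph" +
  fixes X :: "('v, 'a, 'k::field, 'x) rep"
    and S :: "('v, 'a, 'k, 's) rep"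
    and Y :: "('v, 'a, 'k, 'y) rep"
    and \<iota> :: "'v \<Rightarrow> 'x \<Rightarrow> 'y"
    and \<pi> :: "'v \<Rightarrow> 'y \<Rightarrow> 's"
    and \<sigma> :: "'v \<Rightarrow> 's \<Rightarrow> 'y"
    and \<rho> :: "'v \<Rightarrow> 'y \<Rightarrow> 'x"
    and f g :: "'v \<Rightarrow> nat"
  assumes X: "representation Q X" and S: "representation Q S"
    and E: "extension Q S X Y \<iota> \<pi>"
    and split: "vertex_splitting_of Q S X Y \<iota> \<pi> \<sigma> \<rho>"
begin

abbreviation "\<xi> \<equiv> cocycle_of Q Y \<sigma> \<rho>"

abbreviation "strat \<equiv> stratum Q S X Y \<iota> \<pi> f g"

abbreviation "e \<equiv> \<lambda>i. f i + g i"

definition glue :: "'v \<Rightarrow> 'x \<Rightarrow> 's \<Rightarrow> 'y" where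
  "glue i x s = \<iota> i x \<oplus>\<^bsub>vspace Y i\<^esub> \<sigma> i s"

lemma wf: "wf_digraph Q" by unfold_locales

lemma Y: "representation Q Y" by (rule ext_rep[OF E])

lemma ends: "\<alpha> \<in> arcs Q \<Longrightarrow> tail Q \<alpha> \<in> verts Q" "\<alpha> \<in> arcs Q \<Longrightarrow> head Q \<alpha> \<in> verts Q"
  by auto

lemma iota_lin: "i \<in> verts Q \<Longrightarrow> lin (vspace X i) (vspace Y i) (\<iota> i)"
  using rep_hom_lin[OF ext_iota[OF E]] .

lemma pi_lin: "i \<in> verts Q \<Longrightarrow> lin (vspace Y i) (vspace S i) (\<pi> i)"
  using rep_hom_lin[OF ext_pi[OF E]] .

lemmas rho_lin = vsplit_p[OF split] and sigma_lin = vsplit_tau[OF split]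

lemma pi_iota: "i \<in> verts Q \<Longrightarrow> x \<in> carrier (vspace X i) \<Longrightarrow> \<pi> i (\<iota> i x) = \<zero>\<^bsub>vspace S i\<^esub>"
  using ext_exact[OF E] by blast

lemma glue:
  assumes i: "i \<in> verts Q" and x: "x \<in> carrier (vspace X i)" and s: "s \<in> carrier (vspace S i)"
  shows glue_closed: "glue i x s \<in> carrier (vspace Y i)" and rho_glue: "\<rho> i (glue i x s) = x"
    and pi_glue: "\<pi> i (glue i x s) = s"
proof -
  interpret X: vectorspace class_ring "vspace X i" by (rule rep_vsp[OF X i])
  interpret S: vectorspace class_ring "vspace S i" by (rule rep_vsp[OF S i])
  have c: "\<iota> i x \<in> carrier (vspace Y i)" "\<sigma> i s \<in> carrier (vspace Y i)"
    using lin_closed[OF iota_lin[OF i] x] lin_closed[OF sigma_lin[OF i] s] .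
  show "glue i x s \<in> carrier (vspace Y i)" unfolding glue_def using vsp_add[OF rep_vsp[OF Y i] c] .
  show "\<rho> i (glue i x s) = x"
    unfolding glue_def lin_add[OF rho_lin[OF i] c] vsplit_pk[OF split i x] vsplit_pt[OF split i s]
    using x by simp
  show "\<pi> i (glue i x s) = s"
    unfolding glue_def lin_add[OF pi_lin[OF i] c] pi_iota[OF i x] vsplit_rt[OF split i s]
    using s by simp
qed

lemma glue_eta: "i \<in> verts Q \<Longrightarrow> y \<in> carrier (vspace Y i) \<Longrightarrow> glue i (\<rho> i y) (\<pi> i y) = y"
  unfolding glue_def using vsplit_dec[OF split] by metis

lemma Y_eqI:
  "i \<in> verts Q \<Longrightarrow> y \<in> carrier (vspace Y i) \<Longrightarrow> y' \<in> carrier (vspace Y i) \<Longrightarrow> \<rho> i y = \<rho> i y' \<Longrightarrow>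
    \<pi> i y = \<pi> i y' \<Longrightarrow> y = y'"
  using glue_eta by metis

lemma rho_iota: "i \<in> verts Q \<Longrightarrow> x \<in> carrier (vspace X i) \<Longrightarrow> \<rho> i (\<iota> i x) = x"
  using vsplit_pk[OF split] .

lemma ker_pi:
  assumes i: "i \<in> verts Q" and y: "y \<in> carrier (vspace Y i)" and z: "\<pi> i y = \<zero>\<^bsub>vspace S i\<^esub>"
  shows "\<iota> i (\<rho> i y) = y"
  using assms by (intro Y_eqI[OF i])
    (auto simp: rho_iota pi_iota lin_closed[OF rho_lin] lin_closed[OF iota_lin])

lemma rho_act:
  "\<alpha> \<in> arcs Q \<Longrightarrow> y \<in> carrier (vspace Y (tail Q \<alpha>)) \<Longrightarrow>
    \<rho> (head Q \<alpha>) (act Y \<alpha> y) =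
    act X \<alpha> (\<rho> (tail Q \<alpha>) y) \<oplus>\<^bsub>vspace X (head Q \<alpha>)\<^esub> \<xi> \<alpha> (\<pi> (tail Q \<alpha>) y)"
  using p_act[OF wf E split _ X] .

lemma pi_act: "\<alpha> \<in> arcs Q \<Longrightarrow> y \<in> carrier (vspace Y (tail Q \<alpha>)) \<Longrightarrow>
    \<pi> (head Q \<alpha>) (act Y \<alpha> y) = act S \<alpha> (\<pi> (tail Q \<alpha>) y)"
  using rep_hom_act[OF ext_pi[OF E]] .

lemmas xi_lin = cocycle_lin[OF wf E split]

lemma stratumD:
  assumes "N \<in> strat"
  shows strat_gr: "N \<in> quiver_grassmannian Q Y e"
    and strat_pre: "preimage_rep Q X \<iota> N \<in> quiver_grassmannian Q X f"
    and strat_im: "image_rep Q \<pi> N \<in> quiver_grassmannian Q S g"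
proof -
  show G: "N \<in> quiver_grassmannian Q Y e" using assms by (simp add: stratum_def)
  note sN = gr_subrep[OF G]
  have "preimage_rep Q X \<iota> N \<in> subreps Q X"
    unfolding subreps_def preimage_rep_def
  proof (intro CollectI conjI ballI)
    fix i assume i: "i \<in> verts Q"
    show "sub ((\<lambda>i\<in>verts Q. {x \<in> carrier (vspace X i). \<iota> i x \<in> N i}) i) (vspace X i)"
      using lin_preimage_sub[OF iota_lin[OF i] subrep_sub[OF sN i]] i by simp
  next
    fix \<alpha> assume a: "\<alpha> \<in> arcs Q"
    have "\<iota> (head Q \<alpha>) (act X \<alpha> x) \<in> N (head Q \<alpha>)"
      if "x \<in> carrier (vspace X (tail Q \<alpha>))" "\<iota> (tail Q \<alpha>) x \<in> N (tail Q \<alpha>)" for x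
      using rep_hom_act[OF ext_iota[OF E] a that(1)] subrep_act[OF sN a that(2)] by simp
    then show "act X \<alpha> ` (\<lambda>i\<in>verts Q. {x \<in> carrier (vspace X i). \<iota> i x \<in> N i}) (tail Q \<alpha>)
        \<subseteq> (\<lambda>i\<in>verts Q. {x \<in> carrier (vspace X i). \<iota> i x \<in> N i}) (head Q \<alpha>)"
      using ends[OF a] lin_closed[OF rep_lin[OF X a]] by auto
  qed simp
  then show "preimage_rep Q X \<iota> N \<in> quiver_grassmannian Q X f"
    using assms by (simp add: quiver_grassmannian_def stratum_def)
  have "image_rep Q \<pi> N \<in> subreps Q S"
    unfolding subreps_def image_rep_def
  proof (intro CollectI conjI ballI)
    fix i assume i: "i \<in> verts Q"
    show "sub ((\<lambda>i\<in>verts Q. \<pi> i ` N i) i) (vspace S i)"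
      using lin_image_sub[OF pi_lin[OF i] subrep_sub[OF sN i]] i by simp
  next
    fix \<alpha> assume a: "\<alpha> \<in> arcs Q"
    have "act S \<alpha> (\<pi> (tail Q \<alpha>) y) \<in> \<pi> (head Q \<alpha>) ` N (head Q \<alpha>)" if "y \<in> N (tail Q \<alpha>)" for y
      using pi_act[OF a sub_in[OF subrep_sub[OF sN ends(1)[OF a]] that]] subrep_act[OF sN a that] by (metis imageI)
    then show "act S \<alpha> ` (\<lambda>i\<in>verts Q. \<pi> i ` N i) (tail Q \<alpha>) \<subseteq> (\<lambda>i\<in>verts Q. \<pi> i ` N i) (head Q \<alpha>)"
      using ends[OF a] by auto
  qed simp
  then show "image_rep Q \<pi> N \<in> quiver_grassmannian Q S g"
    using assms by (simp add: quiver_grassmannian_def stratum_def)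
qed

end

text \<open>The choices behind a chart: bases of the \<open>X\<^sub>i\<close>, the first \<open>f i\<close> vectors to be thought of as a basis of
  \<open>N'\<^sub>i\<close>, and forms \<open>\<mu>\<close> to be thought of as coordinates on \<open>N''\<close>.  The chart lives over the pairs of subrepresentations on which
  the same forms are still coordinates; the remaining basis vectors of \<open>X\<^sub>i\<close> then represent a basis of the
  quotient for all of them.\<close>
locale chart_data = split_extension_data Q X S Y \<iota> \<pi> \<sigma> \<rho> f g
  for Q :: "('v, 'a) pre_digraph"
    and X :: "('v, 'a, 'k::field, 'x) rep"
    and S :: "('v, 'a, 'k, 's) rep"
    and Y :: "('v, 'a, 'k, 'y) rep"
    and \<iota> :: "'v \<Rightarrow> 'x \<Rightarrow> 'y"
    and \<pi> :: "'v \<Rightarrow> 'y \<Rightarrow> 's"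
    and \<sigma> :: "'v \<Rightarrow> 's \<Rightarrow> 'y"
    and \<rho> :: "'v \<Rightarrow> 'y \<Rightarrow> 'x"
    and f g :: "'v \<Rightarrow> nat" +
  fixes c :: "'v \<Rightarrow> nat"
    and xb :: "'v \<Rightarrow> nat \<Rightarrow> 'x"
    and p :: "'v \<Rightarrow> nat \<Rightarrow> 'x \<Rightarrow> 'k"
    and \<mu> :: "'v \<Rightarrow> nat \<Rightarrow> 's \<Rightarrow> 'k"
  assumes xb: "\<And>i. i \<in> verts Q \<Longrightarrow> dual_basis (vspace X i) (carrier (vspace X i)) (f i + c i) (xb i) (p i)"
    and mu: "\<And>i r. i \<in> verts Q \<Longrightarrow> r < g i \<Longrightarrow> \<mu> i r \<in> linear_forms (vspace S i)"
begin

definition w :: "'v \<Rightarrow> nat \<Rightarrow> 'x" where "w i r = xb i (f i + r)"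

abbreviation "UX \<equiv> chart_domain Q X f p"
abbreviation "US \<equiv> chart_domain Q S g \<mu>"
abbreviation "\<beta>' \<equiv> normal_frame Q X f p"
abbreviation "\<beta>'' \<equiv> normal_frame Q S g \<mu>"

text \<open>The coordinates on \<open>X\<^sub>i / N'\<^sub>i\<close>: first subtract the element of \<open>N'\<^sub>i\<close> with the same coordinates
  \<open>p i t\<close> for \<open>t < f i\<close>.\<close>
definition \<kappa> :: "('v \<Rightarrow> 'x set) \<Rightarrow> 'v \<Rightarrow> nat \<Rightarrow> 'x \<Rightarrow> 'k" where
  "\<kappa> N' i r x = p i (f i + r) x - (\<Sum>t<f i. p i t x * p i (f i + r) (\<beta>' N' i t))"

text \<open>Forms on \<open>Y\<^sub>i\<close> which are coordinates on every member of the stratum that lies over the chart.\<close>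
definition \<theta>Y :: "'v \<Rightarrow> nat \<Rightarrow> 'y \<Rightarrow> 'k" where
  "\<theta>Y i t y = (if t < f i then p i t (\<rho> i y) else \<mu> i (t - f i) (\<pi> i y))"

abbreviation "UY \<equiv> chart_domain Q Y e \<theta>Y"
abbreviation "\<beta>Y \<equiv> normal_frame Q Y e \<theta>Y"

definition matS :: "('v \<Rightarrow> 's set) \<Rightarrow> 'a \<Rightarrow> nat \<Rightarrow> nat \<Rightarrow> 'k" where
  "matS N'' \<alpha> u s = \<mu> (head Q \<alpha>) u (act S \<alpha> (\<beta>'' N'' (tail Q \<alpha>) s))"

definition matX :: "('v \<Rightarrow> 'x set) \<Rightarrow> 'a \<Rightarrow> nat \<Rightarrow> nat \<Rightarrow> 'k" where
  "matX N' \<alpha> r t = \<kappa> N' (head Q \<alpha>) r (act X \<alpha> (w (tail Q \<alpha>) t))"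

definition rhs :: "('v \<Rightarrow> 'x set) \<Rightarrow> ('v \<Rightarrow> 's set) \<Rightarrow> 'a \<Rightarrow> nat \<Rightarrow> nat \<Rightarrow> 'k" where
  "rhs N' N'' \<alpha> r s = \<kappa> N' (head Q \<alpha>) r (\<xi> \<alpha> (\<beta>'' N'' (tail Q \<alpha>) s))"

text \<open>The equation \<open>d \<phi> = y\<close> in coordinates.\<close>
definition solves :: "('v \<Rightarrow> 'x set) \<Rightarrow> ('v \<Rightarrow> 's set) \<Rightarrow> ('v \<Rightarrow> nat \<Rightarrow> nat \<Rightarrow> 'k) \<Rightarrow> ('a \<Rightarrow> nat \<Rightarrow> nat \<Rightarrow> 'k) \<Rightarrow> bool" where
  "solves N' N'' \<Phi> y \<longleftrightarrow> (\<forall>\<alpha>\<in>arcs Q. \<forall>r<c (head Q \<alpha>). \<forall>s<g (tail Q \<alpha>).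
      sylvester Q g c (matS N'') (matX N') \<Phi> \<alpha> r s = y \<alpha> r s)"

text \<open>The graph of the family of maps \<open>N''\<^sub>i \<rightarrow> X\<^sub>i / N'\<^sub>i\<close> with matrices \<open>\<Phi> i\<close>.\<close>
definition sub_of :: "('v \<Rightarrow> 'x set) \<Rightarrow> ('v \<Rightarrow> 's set) \<Rightarrow> ('v \<Rightarrow> nat \<Rightarrow> nat \<Rightarrow> 'k) \<Rightarrow> 'v \<Rightarrow> 'y set" where
  "sub_of N' N'' \<Phi> = (\<lambda>i\<in>verts Q. {y \<in> carrier (vspace Y i). \<pi> i y \<in> N'' i \<and>
      (\<forall>r<c i. \<kappa> N' i r (\<rho> i y) = (\<Sum>s<g i. \<Phi> i r s * \<mu> i s (\<pi> i y)))})"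

definition frameY :: "('v \<Rightarrow> 'x set) \<Rightarrow> ('v \<Rightarrow> 's set) \<Rightarrow> ('v \<Rightarrow> nat \<Rightarrow> nat \<Rightarrow> 'k) \<Rightarrow> 'v \<Rightarrow> nat \<Rightarrow> 'y" where
  "frameY N' N'' \<Phi> i t =
     (if t < f i then \<iota> i (\<beta>' N' i t)
      else glue i (comb (vspace X i) (c i) (\<lambda>r. \<Phi> i r (t - f i)) (w i)) (\<beta>'' N'' i (t - f i)))"

text \<open>The inverse of \<open>sub_of\<close>.  The vector \<open>\<beta>Y N i (f i + s)\<close> of \<open>N\<close> lies over \<open>\<beta>'' i s\<close> and its coordinates
  \<open>p i t\<close> with \<open>t < f i\<close> vanish by normalisation, so that \<open>\<kappa>\<close> may be replaced by \<open>p\<close>.\<close>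
definition coord :: "('v \<Rightarrow> 'y set) \<Rightarrow> 'v \<Rightarrow> nat \<Rightarrow> nat \<Rightarrow> 'k" where
  "coord N i r s = p i (f i + r) (\<rho> i (\<beta>Y N i (f i + s)))"

lemma p_form: "i \<in> verts Q \<Longrightarrow> t < f i + c i \<Longrightarrow> p i t \<in> linear_forms (vspace X i)"
  using dual_basis_form[OF xb] .

lemma w_in: "i \<in> verts Q \<Longrightarrow> r < c i \<Longrightarrow> w i r \<in> carrier (vspace X i)"
  unfolding w_def using dual_basis_in[OF xb] by simp

lemma p_w: "i \<in> verts Q \<Longrightarrow> t < f i + c i \<Longrightarrow> r < c i \<Longrightarrow> p i t (w i r) = (if t = f i + r then 1 else 0)"
  unfolding w_def using dual_basis_delta[OF xb] by simp

lemma thetaY_form: "i \<in> verts Q \<Longrightarrow> t < e i \<Longrightarrow> \<theta>Y i t \<in> linear_forms (vspace Y i)"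
proof (cases "t < f i")
  case True
  assume "i \<in> verts Q"
  then show ?thesis using form_comp[OF rho_lin p_form[of i t]] True unfolding \<theta>Y_def[abs_def] by simp
next
  case False
  assume "i \<in> verts Q" "t < e i"
  then show ?thesis using form_comp[OF pi_lin mu[of i "t - f i"]] False unfolding \<theta>Y_def[abs_def] by simp
qed

lemma UX_dual: "N' \<in> UX \<Longrightarrow> i \<in> verts Q \<Longrightarrow> dual_basis (vspace X i) (N' i) (f i) (\<beta>' N' i) (p i)"
  by (rule normal_frame_dual_basis[OF X]) (auto simp: p_form)

lemma US_dual: "N'' \<in> US \<Longrightarrow> i \<in> verts Q \<Longrightarrow> dual_basis (vspace S i) (N'' i) (g i) (\<beta>'' N'' i) (\<mu> i)"
  by (rule normal_frame_dual_basis[OF S]) (auto simp: mu)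

lemma UX_sub: "N' \<in> UX \<Longrightarrow> i \<in> verts Q \<Longrightarrow> sub (N' i) (vspace X i)"
  using gr_sub[OF chart_domain_gr] .

lemma US_sub: "N'' \<in> US \<Longrightarrow> i \<in> verts Q \<Longrightarrow> sub (N'' i) (vspace S i)"
  using gr_sub[OF chart_domain_gr] .

lemma beta'_in: "N' \<in> UX \<Longrightarrow> i \<in> verts Q \<Longrightarrow> t < f i \<Longrightarrow> \<beta>' N' i t \<in> carrier (vspace X i)"
  using sub_in[OF UX_sub dual_basis_in[OF UX_dual]] .

lemma beta''_in: "N'' \<in> US \<Longrightarrow> i \<in> verts Q \<Longrightarrow> t < g i \<Longrightarrow> \<beta>'' N'' i t \<in> carrier (vspace S i)"
  using sub_in[OF US_sub dual_basis_in[OF US_dual]] .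

lemma kappa_form:
  assumes "i \<in> verts Q" "r < c i" shows "\<kappa> N' i r \<in> linear_forms (vspace X i)"
proof -
  have "(\<lambda>x. \<Sum>t<f i. p i (f i + r) (\<beta>' N' i t) * p i t x) \<in> linear_forms (vspace X i)"
    using assms by (intro form_lincomb p_form) auto
  then show ?thesis
    unfolding \<kappa>_def[abs_def] using assms by (intro form_diff p_form) (auto simp: mult.commute)
qed

lemma kappa_cobasis:
  assumes N: "N' \<in> UX" and i: "i \<in> verts Q"
  shows "cobasis (vspace X i) (N' i) (c i) (w i) (\<kappa> N' i)"
  unfolding cobasis_def
proof (intro conjI allI impI w_in[OF i] kappa_form[OF i])
  note d = UX_dual[OF N i] and sb = UX_sub[OF N i]
  show "\<kappa> N' i r (w i t) = (if r = t then 1 else 0)" if "r < c i" "t < c i" for r t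
    using that i by (simp add: \<kappa>_def p_w)
  show "N' i = {x \<in> carrier (vspace X i). \<forall>r<c i. \<kappa> N' i r x = 0}"
  proof (rule equalityI; rule subsetI)
    fix x assume x: "x \<in> N' i"
    have "\<kappa> N' i r x = 0" if r: "r < c i" for r
      using form_expand'[OF d sb x p_form[OF i, of "f i + r"]] r by (simp add: \<kappa>_def)
    then show "x \<in> {x \<in> carrier (vspace X i). \<forall>r<c i. \<kappa> N' i r x = 0}" using sub_in[OF sb x] by simp
  next
    fix x assume "x \<in> {x \<in> carrier (vspace X i). \<forall>r<c i. \<kappa> N' i r x = 0}"
    then have x: "x \<in> carrier (vspace X i)" and z: "\<And>r. r < c i \<Longrightarrow> \<kappa> N' i r x = 0" by auto
    let ?y = "comb (vspace X i) (f i) (\<lambda>t. p i t x) (\<beta>' N' i)"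
    have y: "?y \<in> N' i" using dual_basis_in[OF d] by (rule comb_closed[OF sb])
    have fy: "l ?y = (\<Sum>t<f i. p i t x * l (\<beta>' N' i t))" if "l \<in> linear_forms (vspace X i)" for l
      using beta'_in[OF N i] by (rule form_comb[OF rep_vsp[OF X i] that])
    have "x = ?y"
    proof (rule dual_basis_eq[OF xb[OF i] sub_carrier[OF rep_vsp[OF X i]] x sub_in[OF sb y]])
      fix r assume r: "r < f i + c i"
      show "p i r x = p i r ?y"
      proof (cases "r < f i")
        case True
        have "p i r ?y = (\<Sum>t<f i. if t = r then p i r x else 0)"
          unfolding fy[OF p_form[OF i r]] using True by (intro sum.cong) (auto simp: dual_basis_delta[OF d])
        then show ?thesis using True by simp
      next
        case False
        then have "\<kappa> N' i (r - f i) x = 0" using r by (intro z) auto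
        then show ?thesis using False unfolding fy[OF p_form[OF i r]] by (simp add: \<kappa>_def)
      qed
    qed
    then show "x \<in> N' i" using y by simp
  qed
qed

lemma kappa_zero: "N' \<in> UX \<Longrightarrow> i \<in> verts Q \<Longrightarrow> r < c i \<Longrightarrow> x \<in> N' i \<Longrightarrow> \<kappa> N' i r x = 0"
  using cobasis_iff[OF kappa_cobasis] by blast

text \<open>Applying the arrow first and \<open>\<kappa>\<close> afterwards gives a form that vanishes on \<open>N'\<close>, because \<open>N'\<close> is a
  subrepresentation.\<close>
lemma kappa_act_expand:
  assumes N: "N' \<in> UX" and a: "\<alpha> \<in> arcs Q" and r: "r < c (head Q \<alpha>)"
    and x: "x \<in> carrier (vspace X (tail Q \<alpha>))"
  shows "\<kappa> N' (head Q \<alpha>) r (act X \<alpha> x) = (\<Sum>t<c (tail Q \<alpha>). matX N' \<alpha> r t * \<kappa> N' (tail Q \<alpha>) t x)"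
proof -
  note en = ends[OF a]
  have "\<kappa> N' (head Q \<alpha>) r (act X \<alpha> x) =
      (\<Sum>t<c (tail Q \<alpha>). \<kappa> N' (tail Q \<alpha>) t x * \<kappa> N' (head Q \<alpha>) r (act X \<alpha> (w (tail Q \<alpha>) t)))"
  proof (rule cobasis_expand[OF UX_sub[OF N en(1)] kappa_cobasis[OF N en(1)] _ _ x])
    show "(\<lambda>x. \<kappa> N' (head Q \<alpha>) r (act X \<alpha> x)) \<in> linear_forms (vspace X (tail Q \<alpha>))"
      by (rule form_comp[OF rep_lin[OF X a] kappa_form[OF en(2) r]])
    show "\<kappa> N' (head Q \<alpha>) r (act X \<alpha> x) = 0" if "x \<in> N' (tail Q \<alpha>)" for x
      by (rule kappa_zero[OF N en(2) r subrep_act[OF gr_subrep[OF chart_domain_gr[OF N]] a that]])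
  qed
  then show ?thesis by (simp add: matX_def mult.commute)
qed

lemma mu_act_expand:
  assumes N: "N'' \<in> US" and a: "\<alpha> \<in> arcs Q" and u: "u < g (head Q \<alpha>)" and s: "s \<in> N'' (tail Q \<alpha>)"
  shows "\<mu> (head Q \<alpha>) u (act S \<alpha> s) = (\<Sum>t<g (tail Q \<alpha>). \<mu> (tail Q \<alpha>) t s * matS N'' \<alpha> u t)"
  using form_expand'[OF US_dual[OF N ends(1)[OF a]] US_sub[OF N ends(1)[OF a]] s
      form_comp[OF rep_lin[OF S a] mu[OF ends(2)[OF a] u]]]
  by (simp add: matS_def)

subsection \<open>From coordinates to subrepresentations\<close>

context
  fixes N' :: "'v \<Rightarrow> 'x set" and N'' :: "'v \<Rightarrow> 's set" and \<Phi> :: "'v \<Rightarrow> nat \<Rightarrow> nat \<Rightarrow> 'k"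
  assumes N': "N' \<in> UX" and N'': "N'' \<in> US"
begin

lemma comb_w:
  assumes i: "i \<in> verts Q"
  shows comb_w_in: "comb (vspace X i) (c i) a (w i) \<in> carrier (vspace X i)"
    and p_comb_w: "t < f i \<Longrightarrow> p i t (comb (vspace X i) (c i) a (w i)) = 0"
    and kappa_comb_w: "r < c i \<Longrightarrow> \<kappa> N' i r (comb (vspace X i) (c i) a (w i)) = a r"
    and p'_comb_w: "r < c i \<Longrightarrow> p i (f i + r) (comb (vspace X i) (c i) a (w i)) = a r"
proof -
  show "comb (vspace X i) (c i) a (w i) \<in> carrier (vspace X i)"
    using w_in[OF i] by (rule comb_in[OF rep_vsp[OF X i]])
  have fc: "l (comb (vspace X i) (c i) a (w i)) = (\<Sum>t<c i. a t * l (w i t))"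
    if "l \<in> linear_forms (vspace X i)" for l
    using w_in[OF i] by (rule form_comb[OF rep_vsp[OF X i] that])
  show "p i t (comb (vspace X i) (c i) a (w i)) = 0" if "t < f i"
    using that i by (subst fc) (auto simp: p_form p_w)
  show "p i (f i + r) (comb (vspace X i) (c i) a (w i)) = a r" if "r < c i"
  proof -
    have "(\<Sum>t<c i. a t * p i (f i + r) (w i t)) = (\<Sum>t<c i. if t = r then a r else 0)"
      using that i by (intro sum.cong) (auto simp: p_w)
    then show ?thesis using that i by (subst fc) (auto simp: p_form)
  qed
  show "\<kappa> N' i r (comb (vspace X i) (c i) a (w i)) = a r" if "r < c i"
  proof -
    have "(\<Sum>t<c i. a t * \<kappa> N' i r (w i t)) = (\<Sum>t<c i. if t = r then a r else 0)"
      using that i by (intro sum.cong) (auto simp: cobasis_delta[OF kappa_cobasis[OF N' i]])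
    then show ?thesis using that i by (subst fc) (auto simp: kappa_form)
  qed
qed

lemma sub_of_iff:
  "i \<in> verts Q \<Longrightarrow> y \<in> sub_of N' N'' \<Phi> i \<longleftrightarrow> y \<in> carrier (vspace Y i) \<and> \<pi> i y \<in> N'' i \<and>
      (\<forall>r<c i. \<kappa> N' i r (\<rho> i y) = (\<Sum>s<g i. \<Phi> i r s * \<mu> i s (\<pi> i y)))"
  by (simp add: sub_of_def)

lemma sub_of_sub:
  assumes i: "i \<in> verts Q" shows "sub (sub_of N' N'' \<Phi> i) (vspace Y i)"
proof (rule subI)
  note vY = rep_vsp[OF Y i]
  note fk = form_comp[OF rho_lin[OF i] kappa_form[OF i]]
  have fm: "(\<lambda>y. \<Sum>s<g i. \<Phi> i r s * \<mu> i s (\<pi> i y)) \<in> linear_forms (vspace Y i)" for r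
    using i by (intro form_lincomb form_comp[OF pi_lin] mu) auto
  show "vsp (vspace Y i)" by (rule vY)
  show "sub_of N' N'' \<Phi> i \<subseteq> carrier (vspace Y i)" using sub_of_iff[OF i] by auto
  show "\<zero>\<^bsub>vspace Y i\<^esub> \<in> sub_of N' N'' \<Phi> i"
    unfolding sub_of_iff[OF i]
    using form_zero[OF vY fk] form_zero[OF vY fm] lin_zero[OF pi_lin[OF i]] sub_zero[OF US_sub[OF N'' i]] vsp_zero[OF vY]
    by simp
  fix y z a assume y: "y \<in> sub_of N' N'' \<Phi> i"
  then have yc: "y \<in> carrier (vspace Y i)" using sub_of_iff[OF i] by blast
  show "a \<odot>\<^bsub>vspace Y i\<^esub> y \<in> sub_of N' N'' \<Phi> i"
    using y yc form_smult[OF fk yc, of _ N' a] form_smult[OF fm yc, of _ a] lin_smult[OF pi_lin[OF i] yc, of a]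
      sub_smult[OF US_sub[OF N'' i]] vsp_smult[OF vY yc, of a]
    unfolding sub_of_iff[OF i] by simp
  assume z: "z \<in> sub_of N' N'' \<Phi> i"
  then have zc: "z \<in> carrier (vspace Y i)" using sub_of_iff[OF i] by blast
  show "y \<oplus>\<^bsub>vspace Y i\<^esub> z \<in> sub_of N' N'' \<Phi> i"
    using y z yc zc form_add[OF fk yc zc, of _ N'] form_add[OF fm yc zc] lin_add[OF pi_lin[OF i] yc zc]
      sub_add[OF US_sub[OF N'' i]] vsp_add[OF vY yc zc]
    unfolding sub_of_iff[OF i] by simp
qed

text \<open>The frame consists of the image under \<open>\<iota>\<close> of the frame of \<open>N'\<close> and of the points of the graph over the frame of \<open>N''\<close>.\<close>
lemma frameY_dual:
  assumes i: "i \<in> verts Q" shows "dual_basis (vspace Y i) (sub_of N' N'' \<Phi> i) (e i) (frameY N' N'' \<Phi> i) (\<theta>Y i)"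
proof -
  note d' = UX_dual[OF N' i] and d'' = US_dual[OF N'' i]
  note vS = rep_vsp[OF S i]
  have 1: "frameY N' N'' \<Phi> i t \<in> sub_of N' N'' \<Phi> i \<and> \<rho> i (frameY N' N'' \<Phi> i t) = \<beta>' N' i t \<and>
      \<pi> i (frameY N' N'' \<Phi> i t) = \<zero>\<^bsub>vspace S i\<^esub>" if t: "t < f i" for t
  proof -
    note b = beta'_in[OF N' i t]
    show ?thesis
      unfolding sub_of_iff[OF i] frameY_def
      using t i b lin_closed[OF iota_lin[OF i] b] sub_zero[OF US_sub[OF N'' i]]
        kappa_zero[OF N' i _ dual_basis_in[OF d' t]] form_zero[OF vS mu[OF i]]
      by (simp add: rho_iota pi_iota)
  qed
  have 2: "frameY N' N'' \<Phi> i (f i + s) \<in> sub_of N' N'' \<Phi> i \<and>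
      \<rho> i (frameY N' N'' \<Phi> i (f i + s)) = comb (vspace X i) (c i) (\<lambda>r. \<Phi> i r s) (w i) \<and>
      \<pi> i (frameY N' N'' \<Phi> i (f i + s)) = \<beta>'' N'' i s" if s: "s < g i" for s
  proof -
    note b = beta''_in[OF N'' i s]
    have "(\<Sum>s'<g i. \<Phi> i r s' * \<mu> i s' (\<beta>'' N'' i s)) = (\<Sum>s'<g i. if s' = s then \<Phi> i r s else 0)" for r
      using s by (intro sum.cong) (auto simp: dual_basis_delta[OF d''])
    then show ?thesis
      unfolding sub_of_iff[OF i] frameY_def
      using s i glue[OF i comb_w_in[OF i] b] dual_basis_in[OF d'' s] by (simp add: kappa_comb_w)
  qed
  show ?thesis
    unfolding dual_basis_def
  proof (intro conjI allI impI ballI thetaY_form[OF i])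
    fix r t assume t: "t < e i"
    have t': "t < f i \<or> (\<exists>s<g i. t = f i + s)"
      using t by (metis less_diff_conv2 add.commute add_diff_inverse_nat leI)
    then show "frameY N' N'' \<Phi> i t \<in> sub_of N' N'' \<Phi> i" using 1 2 by blast
    assume r: "r < e i"
    show "\<theta>Y i r (frameY N' N'' \<Phi> i t) = (if r = t then 1 else 0)"
      using t'
    proof
      assume t: "t < f i"
      show ?thesis
        using 1[OF t] t r i dual_basis_delta[OF d', of r t] form_zero[OF vS mu[OF i, of "r - f i"]]
        by (auto simp: \<theta>Y_def)
    next
      assume "\<exists>s<g i. t = f i + s"
      then obtain s where s: "s < g i" "t = f i + s" by blast
      show ?thesis
        unfolding s(2)
        using 2[OF s(1)] r i s dual_basis_delta[OF d'', of "r - f i" s] p_comb_w[OF i, of r]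
        by (auto simp: \<theta>Y_def)
    qed
  next
    fix y assume y: "y \<in> sub_of N' N'' \<Phi> i" and z: "\<forall>r<e i. \<theta>Y i r y = 0"
    have yc: "y \<in> carrier (vspace Y i)" and pN: "\<pi> i y \<in> N'' i" using y unfolding sub_of_iff[OF i] by auto
    have m0: "\<mu> i s (\<pi> i y) = 0" if "s < g i" for s
      using z[rule_format, of "f i + s"] that by (simp add: \<theta>Y_def)
    then have p0: "\<pi> i y = \<zero>\<^bsub>vspace S i\<^esub>" using dual_basis_zero[OF d'' pN] by blast
    have "\<kappa> N' i r (\<rho> i y) = 0" if "r < c i" for r using y that m0 unfolding sub_of_iff[OF i] by simp
    then have rN: "\<rho> i y \<in> N' i"
      using cobasis_iff[OF kappa_cobasis[OF N' i]] lin_closed[OF rho_lin[OF i] yc] by blast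
    have "\<rho> i y = \<zero>\<^bsub>vspace X i\<^esub>"
    proof (rule dual_basis_zero[OF d' rN])
      show "p i r (\<rho> i y) = 0" if "r < f i" for r using z[rule_format, of r] that by (simp add: \<theta>Y_def)
    qed
    then show "y = \<zero>\<^bsub>vspace Y i\<^esub>"
      using p0 yc by (intro Y_eqI[OF i])
        (auto simp: vsp_zero[OF rep_vsp[OF Y i]] lin_zero[OF rho_lin[OF i]] lin_zero[OF pi_lin[OF i]])
  qed
qed

text \<open>The equation is what makes the graph stable under the arrows: apply \<open>\<kappa>\<close> to
  \<open>\<rho> (Y\<^sub>\<alpha> y) = X\<^sub>\<alpha> (\<rho> y) + \<xi>\<^sub>\<alpha> (\<pi> y)\<close> and expand in the frames.\<close>
lemma sub_of_stratum:
  assumes sol: "solves N' N'' \<Phi> (rhs N' N'')"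
  shows "sub_of N' N'' \<Phi> \<in> strat" and "Psi Q X \<iota> \<pi> (sub_of N' N'' \<Phi>) = (N', N'')"
    and "sub_of N' N'' \<Phi> \<in> UY"
    and "i \<in> verts Q \<Longrightarrow> t < e i \<Longrightarrow> \<beta>Y (sub_of N' N'' \<Phi>) i t = frameY N' N'' \<Phi> i t"
    and "i \<in> verts Q \<Longrightarrow> r < c i \<Longrightarrow> s < g i \<Longrightarrow> coord (sub_of N' N'' \<Phi>) i r s = \<Phi> i r s"
proof -
  let ?N = "sub_of N' N'' \<Phi>"
  have act: "act Y \<alpha> y \<in> ?N (head Q \<alpha>)" if a: "\<alpha> \<in> arcs Q" and y: "y \<in> ?N (tail Q \<alpha>)" for \<alpha> y
  proof -
    note en = ends[OF a]
    let ?i = "tail Q \<alpha>" and ?j = "head Q \<alpha>"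
    have yc: "y \<in> carrier (vspace Y ?i)" and pN: "\<pi> ?i y \<in> N'' ?i"
      and k: "\<And>t. t < c ?i \<Longrightarrow> \<kappa> N' ?i t (\<rho> ?i y) = (\<Sum>s<g ?i. \<Phi> ?i t s * \<mu> ?i s (\<pi> ?i y))"
      using y unfolding sub_of_iff[OF en(1)] by auto
    have pS: "\<pi> ?i y \<in> carrier (vspace S ?i)" and rX: "\<rho> ?i y \<in> carrier (vspace X ?i)"
      using lin_closed[OF pi_lin[OF en(1)] yc] lin_closed[OF rho_lin[OF en(1)] yc] .
    have "\<kappa> N' ?j r (\<rho> ?j (act Y \<alpha> y)) = (\<Sum>u<g ?j. \<Phi> ?j r u * \<mu> ?j u (\<pi> ?j (act Y \<alpha> y)))"
      if r: "r < c ?j" for r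
    proof -
      have "\<kappa> N' ?j r (\<rho> ?j (act Y \<alpha> y)) = \<kappa> N' ?j r (act X \<alpha> (\<rho> ?i y)) + \<kappa> N' ?j r (\<xi> \<alpha> (\<pi> ?i y))"
        unfolding rho_act[OF a yc]
        by (rule form_add[OF kappa_form[OF en(2) r] lin_closed[OF rep_lin[OF X a] rX] lin_closed[OF xi_lin[OF a] pS]])
      also have "\<kappa> N' ?j r (act X \<alpha> (\<rho> ?i y)) = (\<Sum>t<c ?i. matX N' \<alpha> r t * (\<Sum>s<g ?i. \<Phi> ?i t s * \<mu> ?i s (\<pi> ?i y)))"
        unfolding kappa_act_expand[OF N' a r rX] using k by (intro sum.cong) auto
      also have "\<dots> = (\<Sum>t<c ?i. \<Sum>s<g ?i. \<mu> ?i s (\<pi> ?i y) * (matX N' \<alpha> r t * \<Phi> ?i t s))"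
        by (simp add: sum_distrib_left mult_ac)
      also have "\<dots> = (\<Sum>s<g ?i. \<mu> ?i s (\<pi> ?i y) * (\<Sum>t<c ?i. matX N' \<alpha> r t * \<Phi> ?i t s))"
        by (subst sum.swap) (simp add: sum_distrib_left)
      also have "\<kappa> N' ?j r (\<xi> \<alpha> (\<pi> ?i y)) = (\<Sum>s<g ?i. \<mu> ?i s (\<pi> ?i y) * rhs N' N'' \<alpha> r s)"
        unfolding rhs_def
        using form_expand'[OF US_dual[OF N'' en(1)] US_sub[OF N'' en(1)] pN form_comp[OF xi_lin[OF a] kappa_form[OF en(2) r]]] .
      also have "(\<Sum>s<g ?i. \<mu> ?i s (\<pi> ?i y) * (\<Sum>t<c ?i. matX N' \<alpha> r t * \<Phi> ?i t s)) + (\<Sum>s<g ?i. \<mu> ?i s (\<pi> ?i y) * rhs N' N'' \<alpha> r s)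
          = (\<Sum>s<g ?i. \<mu> ?i s (\<pi> ?i y) * (\<Sum>u<g ?j. matS N'' \<alpha> u s * \<Phi> ?j r u))"
        unfolding sum.distrib[symmetric]
      proof (rule sum.cong[OF refl])
        fix s assume "s \<in> {..<g ?i}"
        then have "rhs N' N'' \<alpha> r s = (\<Sum>u<g ?j. matS N'' \<alpha> u s * \<Phi> ?j r u) - (\<Sum>t<c ?i. matX N' \<alpha> r t * \<Phi> ?i t s)"
          using sol a r unfolding solves_def sylvester_def by simp
        then show "\<mu> ?i s (\<pi> ?i y) * (\<Sum>t<c ?i. matX N' \<alpha> r t * \<Phi> ?i t s) + \<mu> ?i s (\<pi> ?i y) * rhs N' N'' \<alpha> r s
            = \<mu> ?i s (\<pi> ?i y) * (\<Sum>u<g ?j. matS N'' \<alpha> u s * \<Phi> ?j r u)" by (simp add: right_diff_distrib)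
      qed
      also have "\<dots> = (\<Sum>s<g ?i. \<Sum>u<g ?j. \<Phi> ?j r u * (\<mu> ?i s (\<pi> ?i y) * matS N'' \<alpha> u s))"
        by (simp add: sum_distrib_left mult_ac)
      also have "\<dots> = (\<Sum>u<g ?j. \<Phi> ?j r u * (\<Sum>s<g ?i. \<mu> ?i s (\<pi> ?i y) * matS N'' \<alpha> u s))"
        by (subst sum.swap) (simp add: sum_distrib_left)
      also have "\<dots> = (\<Sum>u<g ?j. \<Phi> ?j r u * \<mu> ?j u (\<pi> ?j (act Y \<alpha> y)))"
        unfolding pi_act[OF a yc] using mu_act_expand[OF N'' a _ pN] by (intro sum.cong) auto
      finally show ?thesis .
    qed
    moreover have "\<pi> ?j (act Y \<alpha> y) \<in> N'' ?j"
      unfolding pi_act[OF a yc] using subrep_act[OF gr_subrep[OF chart_domain_gr[OF N'']] a pN] .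
    ultimately show ?thesis
      unfolding sub_of_iff[OF en(2)] using lin_closed[OF rep_lin[OF Y a] yc] by blast
  qed
  have sr: "?N \<in> subreps Q Y"
    unfolding subreps_def using sub_of_sub act by (auto simp: sub_of_def)
  have gr: "?N \<in> quiver_grassmannian Q Y e"
    unfolding quiver_grassmannian_def dimvec_def
    using sr dual_basis_sub_dim(1)[OF sub_of_sub frameY_dual] by simp
  have pre: "preimage_rep Q X \<iota> ?N = N'"
  proof (rule extensionalityI[of _ "verts Q"])
    show "preimage_rep Q X \<iota> ?N \<in> extensional (verts Q)" by (simp add: preimage_rep_def)
    show "N' \<in> extensional (verts Q)" using subrep_ext[OF gr_subrep[OF chart_domain_gr[OF N']]] .
    fix i assume i: "i \<in> verts Q"
    have "x \<in> N' i \<longleftrightarrow> x \<in> carrier (vspace X i) \<and> \<iota> i x \<in> ?N i" for x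
    proof -
      have "\<iota> i x \<in> ?N i \<longleftrightarrow> (\<forall>r<c i. \<kappa> N' i r x = 0)" if x: "x \<in> carrier (vspace X i)"
        unfolding sub_of_iff[OF i]
        using x i lin_closed[OF iota_lin[OF i] x] sub_zero[OF US_sub[OF N'' i]] form_zero[OF rep_vsp[OF S i] mu[OF i]]
        by (simp add: rho_iota pi_iota)
      then show ?thesis using cobasis_iff[OF kappa_cobasis[OF N' i]] by blast
    qed
    then show "preimage_rep Q X \<iota> ?N i = N' i" using i by (auto simp: preimage_rep_def)
  qed
  have im: "image_rep Q \<pi> ?N = N''"
  proof (rule extensionalityI[of _ "verts Q"])
    show "image_rep Q \<pi> ?N \<in> extensional (verts Q)" by (simp add: image_rep_def)
    show "N'' \<in> extensional (verts Q)" using subrep_ext[OF gr_subrep[OF chart_domain_gr[OF N'']]] .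
    fix i assume i: "i \<in> verts Q"
    have "s \<in> \<pi> i ` ?N i" if s: "s \<in> N'' i" for s
    proof -
      \<comment> \<open>a representative of \<open>\<phi> (s)\<close>\<close>
      let ?x = "comb (vspace X i) (c i) (\<lambda>r. \<Sum>s'<g i. \<Phi> i r s' * \<mu> i s' s) (w i)"
      have "glue i ?x s \<in> ?N i"
        unfolding sub_of_iff[OF i]
        using glue[OF i comb_w_in[OF i] sub_in[OF US_sub[OF N'' i] s]] s i by (simp add: kappa_comb_w)
      then show ?thesis
        by (rule rev_image_eqI) (rule pi_glue[OF i comb_w_in[OF i] sub_in[OF US_sub[OF N'' i] s], symmetric])
    qed
    moreover have "\<pi> i ` ?N i \<subseteq> N'' i" using sub_of_iff[OF i] by auto
    ultimately show "image_rep Q \<pi> ?N i = N'' i" using i by (auto simp: image_rep_def)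
  qed
  show "?N \<in> strat"
    using gr chart_domain_gr[OF N'] chart_domain_gr[OF N'']
    by (simp add: stratum_def pre im quiver_grassmannian_def)
  show "Psi Q X \<iota> \<pi> ?N = (N', N'')" by (simp add: Psi_def pre im)
  show "?N \<in> UY" using frameY_dual by (rule chart_domainI[OF Y gr])
  show b: "\<beta>Y ?N i t = frameY N' N'' \<Phi> i t" if "i \<in> verts Q" "t < e i" for i t
    using frameY_dual that by (rule normal_frame_unique[OF Y gr])
  show "coord ?N i r s = \<Phi> i r s" if "i \<in> verts Q" "r < c i" "s < g i"
    unfolding coord_def using b[of i "f i + s"] that beta''_in[OF N'']
    by (simp add: frameY_def rho_glue comb_w_in p'_comb_w)
qed

end

subsection \<open>From subrepresentations to coordinates\<close>

text \<open>Every \<open>N\<close> in the stratum is a graph: lifts to \<open>N\<close> of the frame of \<open>N''\<close> can be normalised by subtracting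
  elements of \<open>\<iota> (N')\<close>, and together with the frame of \<open>\<iota> (N')\<close> they form a frame of \<open>N\<close> by
  counting dimensions.  Two vectors of \<open>Y\<^sub>i\<close> with the same projection to \<open>S\<^sub>i\<close> and the same \<open>\<kappa>\<close>-coordinates
  differ by an element of \<open>\<iota> (N')\<close>, hence the last equality.\<close>
lemma stratum_frame:
  assumes N: "N \<in> strat" and N': "preimage_rep Q X \<iota> N \<in> UX" and N'': "image_rep Q \<pi> N \<in> US"
  shows "N \<in> UY"
    and "i \<in> verts Q \<Longrightarrow> t < f i \<Longrightarrow> \<beta>Y N i t = \<iota> i (\<beta>' (preimage_rep Q X \<iota> N) i t)"
    and "i \<in> verts Q \<Longrightarrow> s < g i \<Longrightarrow> \<pi> i (\<beta>Y N i (f i + s)) = \<beta>'' (image_rep Q \<pi> N) i s"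
    and "i \<in> verts Q \<Longrightarrow> y \<in> N i \<Longrightarrow> r < c i \<Longrightarrow>
      \<kappa> (preimage_rep Q X \<iota> N) i r (\<rho> i y) = (\<Sum>s<g i. coord N i r s * \<mu> i s (\<pi> i y))"
    and "solves (preimage_rep Q X \<iota> N) (image_rep Q \<pi> N) (coord N) (rhs (preimage_rep Q X \<iota> N) (image_rep Q \<pi> N))"
    and "sub_of (preimage_rep Q X \<iota> N) (image_rep Q \<pi> N) (coord N) = N"
proof -
  let ?N' = "preimage_rep Q X \<iota> N" and ?N'' = "image_rep Q \<pi> N"
  note G = strat_gr[OF N] and sN = gr_subrep[OF strat_gr[OF N]]
  have preD: "x \<in> ?N' i \<longleftrightarrow> x \<in> carrier (vspace X i) \<and> \<iota> i x \<in> N i" if "i \<in> verts Q" for i x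
    using that by (simp add: preimage_rep_def)
  have imD: "?N'' i = \<pi> i ` N i" if "i \<in> verts Q" for i
    using that by (simp add: image_rep_def)
  have NY: "y \<in> carrier (vspace Y i)" if "i \<in> verts Q" "y \<in> N i" for i y
    using sub_in[OF subrep_sub[OF sN that(1)] that(2)] .
  have lift: "\<exists>y\<in>N i. \<pi> i y = \<beta>'' ?N'' i s \<and> (\<forall>t<f i. p i t (\<rho> i y) = 0)" if i: "i \<in> verts Q" and s: "s < g i" for i s
  proof -
    have "\<beta>'' ?N'' i s \<in> \<pi> i ` N i" using dual_basis_in[OF US_dual[OF N'' i] s] imD[OF i] by simp
    then obtain y where y: "y \<in> N i" "\<pi> i y = \<beta>'' ?N'' i s" by (metis imageE)
    interpret S: vectorspace class_ring "vspace S i" by (rule rep_vsp[OF S i])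
    note yc = NY[OF i y(1)] and d = UX_dual[OF N' i] and vX = rep_vsp[OF X i]
    \<comment> \<open>subtract the element of \<open>\<iota> (N')\<close> with the same coordinates \<open>p i t\<close>, \<open>t < f i\<close>\<close>
    let ?x = "comb (vspace X i) (f i) (\<lambda>t. p i t (\<rho> i y)) (\<beta>' ?N' i)"
    have xN: "?x \<in> ?N' i" using dual_basis_in[OF d] by (rule comb_closed[OF UX_sub[OF N' i]])
    then have x: "?x \<in> carrier (vspace X i)" "\<iota> i ?x \<in> N i" using preD[OF i] by auto
    note ix = NY[OF i x(2)]
    have "p i t (\<rho> i (y \<ominus>\<^bsub>vspace Y i\<^esub> \<iota> i ?x)) = 0" if t: "t < f i" for t
    proof -
      have pf: "p i t \<in> linear_forms (vspace X i)" using p_form[OF i] t by simp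
      have "p i t ?x = (\<Sum>t'<f i. p i t' (\<rho> i y) * p i t (\<beta>' ?N' i t'))"
        using beta'_in[OF N' i] by (rule form_comb[OF vX pf])
      also have "\<dots> = (\<Sum>t'<f i. if t' = t then p i t (\<rho> i y) else 0)"
        using t by (intro sum.cong) (auto simp: dual_basis_delta[OF d])
      finally have "p i t ?x = p i t (\<rho> i y)" using t by simp
      then show ?thesis
        using lin_minus[OF rho_lin[OF i] yc ix] rho_iota[OF i x(1)]
          form_minus[OF vX pf lin_closed[OF rho_lin[OF i] yc] x(1)] by simp
    qed
    moreover have "\<pi> i (y \<ominus>\<^bsub>vspace Y i\<^esub> \<iota> i ?x) = \<beta>'' ?N'' i s"
      using lin_minus[OF pi_lin[OF i] yc ix] pi_iota[OF i x(1)] y(2) beta''_in[OF N'' i s]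
      by (simp add: S.M.minus_eq)
    ultimately show ?thesis using sub_minus[OF subrep_sub[OF sN i] y(1) x(2)] by blast
  qed
  then have "\<forall>i s. \<exists>y. i \<in> verts Q \<longrightarrow> s < g i \<longrightarrow> y \<in> N i \<and> \<pi> i y = \<beta>'' ?N'' i s \<and> (\<forall>t<f i. p i t (\<rho> i y) = 0)" by blast
  then obtain ys where ys: "\<And>i s. i \<in> verts Q \<Longrightarrow> s < g i \<Longrightarrow>
      ys i s \<in> N i \<and> \<pi> i (ys i s) = \<beta>'' ?N'' i s \<and> (\<forall>t<f i. p i t (\<rho> i (ys i s)) = 0)" by metis
  define b where "b i t = (if t < f i then \<iota> i (\<beta>' ?N' i t) else ys i (t - f i))" for i t
  have b: "dual_basis (vspace Y i) (N i) (e i) (b i) (\<theta>Y i)" if i: "i \<in> verts Q" for i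
  proof (rule dual_basis_of_dim[OF rep_fin_dim[OF Y i] subrep_sub[OF sN i] gr_dim[OF G i] _ thetaY_form[OF i]])
    note d' = UX_dual[OF N' i] and d'' = US_dual[OF N'' i]
    show "b i s \<in> N i" if "s < e i" for s
      using that ys[OF i, of "s - f i"] dual_basis_in[OF d', of s] preD[OF i] by (auto simp: b_def)
    show "\<theta>Y i r (b i s) = (if r = s then 1 else 0)" if r: "r < e i" and s: "s < e i" for r s
      using r s ys[OF i, of "s - f i"] beta'_in[OF N' i, of s] i dual_basis_delta[OF d', of r s]
        dual_basis_delta[OF d'', of "r - f i" "s - f i"] form_zero[OF rep_vsp[OF S i] mu[OF i, of "r - f i"]]
      by (auto simp: \<theta>Y_def b_def rho_iota pi_iota)
  qed
  show "N \<in> UY" using b by (rule chart_domainI[OF Y G])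
  have bY: "\<beta>Y N i t = b i t" if "i \<in> verts Q" "t < e i" for i t
    using b that by (rule normal_frame_unique[OF Y G])
  show "\<beta>Y N i t = \<iota> i (\<beta>' ?N' i t)" if "i \<in> verts Q" "t < f i" for i t
    using bY[of i t] that by (simp add: b_def)
  show pib: "\<pi> i (\<beta>Y N i (f i + s)) = \<beta>'' ?N'' i s" if "i \<in> verts Q" "s < g i" for i s
    using bY[of i "f i + s"] ys[OF that] that by (simp add: b_def)
  have co: "coord N i r s = \<kappa> ?N' i r (\<rho> i (ys i s))" if "i \<in> verts Q" "r < c i" "s < g i" for i r s
    using bY[of i "f i + s"] ys[of i s] that by (simp add: coord_def \<kappa>_def b_def)
  show ko: "\<kappa> ?N' i r (\<rho> i y) = (\<Sum>s<g i. coord N i r s * \<mu> i s (\<pi> i y))"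
    if i: "i \<in> verts Q" and y: "y \<in> N i" and r: "r < c i" for i y r
  proof -
    have "\<kappa> ?N' i r (\<rho> i y) = (\<Sum>t<f i + g i. \<theta>Y i t y * \<kappa> ?N' i r (\<rho> i (b i t)))"
      by (rule form_expand'[OF b[OF i] subrep_sub[OF sN i] y form_comp[OF rho_lin[OF i] kappa_form[OF i r]]])
    also have "\<dots> = (\<Sum>t<f i. \<theta>Y i t y * \<kappa> ?N' i r (\<rho> i (b i t))) + (\<Sum>s<g i. \<theta>Y i (f i + s) y * \<kappa> ?N' i r (\<rho> i (b i (f i + s))))"
      by (rule sum_lessThan_add)
    also have "(\<Sum>t<f i. \<theta>Y i t y * \<kappa> ?N' i r (\<rho> i (b i t))) = 0"
      using beta'_in[OF N' i] kappa_zero[OF N' i r dual_basis_in[OF UX_dual[OF N' i]]] i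
      by (intro sum.neutral) (auto simp: b_def rho_iota)
    also have "(\<Sum>s<g i. \<theta>Y i (f i + s) y * \<kappa> ?N' i r (\<rho> i (b i (f i + s)))) = (\<Sum>s<g i. coord N i r s * \<mu> i s (\<pi> i y))"
      using co i r by (intro sum.cong) (auto simp: \<theta>Y_def b_def mult.commute)
    finally show ?thesis by simp
  qed
  show "solves ?N' ?N'' (coord N) (rhs ?N' ?N'')"
    unfolding solves_def
  proof (intro ballI allI impI)
    fix \<alpha> r s assume a: "\<alpha> \<in> arcs Q" and r: "r < c (head Q \<alpha>)" and s: "s < g (tail Q \<alpha>)"
    note en = ends[OF a]
    let ?i = "tail Q \<alpha>" and ?j = "head Q \<alpha>" and ?y = "ys (tail Q \<alpha>) s"
    have y: "?y \<in> N ?i" "\<pi> ?i ?y = \<beta>'' ?N'' ?i s" using ys[OF en(1) s] by auto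
    note yc = NY[OF en(1) y(1)] and Ay = subrep_act[OF sN a y(1)]
    have rX: "\<rho> ?i ?y \<in> carrier (vspace X ?i)" using lin_closed[OF rho_lin[OF en(1)] yc] .
    have "\<kappa> ?N' ?j r (act X \<alpha> (\<rho> ?i ?y)) + \<kappa> ?N' ?j r (\<xi> \<alpha> (\<pi> ?i ?y)) = \<kappa> ?N' ?j r (\<rho> ?j (act Y \<alpha> ?y))"
      unfolding rho_act[OF a yc]
      by (rule form_add[OF kappa_form[OF en(2) r] lin_closed[OF rep_lin[OF X a] rX]
            lin_closed[OF xi_lin[OF a] lin_closed[OF pi_lin[OF en(1)] yc]], symmetric])
    also have "\<dots> = (\<Sum>u<g ?j. coord N ?j r u * \<mu> ?j u (act S \<alpha> (\<beta>'' ?N'' ?i s)))"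
      using ko[OF en(2) Ay r] pi_act[OF a yc] y(2) by simp
    also have "\<dots> = (\<Sum>u<g ?j. matS ?N'' \<alpha> u s * coord N ?j r u)" by (simp add: matS_def mult.commute)
    also have "\<kappa> ?N' ?j r (act X \<alpha> (\<rho> ?i ?y)) = (\<Sum>t<c ?i. matX ?N' \<alpha> r t * coord N ?i t s)"
      unfolding kappa_act_expand[OF N' a r rX] using co[OF en(1) _ s] by (intro sum.cong) auto
    finally show "sylvester Q g c (matS ?N'') (matX ?N') (coord N) \<alpha> r s = rhs ?N' ?N'' \<alpha> r s"
      by (simp add: sylvester_def rhs_def y(2) algebra_simps)
  qed
  show "sub_of ?N' ?N'' (coord N) = N"
  proof (rule extensionalityI[of _ "verts Q"])
    show "sub_of ?N' ?N'' (coord N) \<in> extensional (verts Q)" by (simp add: sub_of_def)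
    show "N \<in> extensional (verts Q)" using subrep_ext[OF sN] .
    fix i assume i: "i \<in> verts Q"
    show "sub_of ?N' ?N'' (coord N) i = N i"
    proof (rule equalityI; rule subsetI)
      fix y assume "y \<in> N i"
      then show "y \<in> sub_of ?N' ?N'' (coord N) i"
        using NY[OF i] ko[OF i] imD[OF i] i by (simp add: sub_of_def)
    next
      fix y assume "y \<in> sub_of ?N' ?N'' (coord N) i"
      then have yc: "y \<in> carrier (vspace Y i)" and py: "\<pi> i y \<in> ?N'' i"
        and k: "\<And>r. r < c i \<Longrightarrow> \<kappa> ?N' i r (\<rho> i y) = (\<Sum>s<g i. coord N i r s * \<mu> i s (\<pi> i y))"
        using i by (auto simp: sub_of_def)
      obtain z where z: "z \<in> N i" "\<pi> i y = \<pi> i z" using py imD[OF i] by (metis imageE)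
      note zc = NY[OF i z(1)]
      interpret S: vectorspace class_ring "vspace S i" by (rule rep_vsp[OF S i])
      interpret Y: vectorspace class_ring "vspace Y i" by (rule rep_vsp[OF Y i])
      have ry: "\<rho> i y \<in> carrier (vspace X i)" and rz: "\<rho> i z \<in> carrier (vspace X i)"
        using lin_closed[OF rho_lin[OF i] yc] lin_closed[OF rho_lin[OF i] zc] .
      have "\<kappa> ?N' i r (\<rho> i y \<ominus>\<^bsub>vspace X i\<^esub> \<rho> i z) = 0" if r: "r < c i" for r
        using form_minus[OF rep_vsp[OF X i] kappa_form[OF i r] ry rz] k[OF r] ko[OF i z(1) r] z(2) by simp
      then have "\<rho> i y \<ominus>\<^bsub>vspace X i\<^esub> \<rho> i z \<in> ?N' i"
        using cobasis_iff[OF kappa_cobasis[OF N' i]] vsp_minus[OF rep_vsp[OF X i] ry rz] by blast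
      then have inN: "\<iota> i (\<rho> i y \<ominus>\<^bsub>vspace X i\<^esub> \<rho> i z) \<in> N i" using preD[OF i] by blast
      let ?d = "y \<ominus>\<^bsub>vspace Y i\<^esub> z"
      have dc: "?d \<in> carrier (vspace Y i)" using yc zc by simp
      have "\<pi> i ?d = \<zero>\<^bsub>vspace S i\<^esub>"
        using lin_minus[OF pi_lin[OF i] yc zc] z(2) lin_closed[OF pi_lin[OF i] zc]
        by (simp add: S.M.minus_eq S.M.r_neg)
      then have "\<iota> i (\<rho> i ?d) = ?d" using ker_pi[OF i dc] by simp
      then have "?d \<in> N i" using inN lin_minus[OF rho_lin[OF i] yc zc] by simp
      then have "?d \<oplus>\<^bsub>vspace Y i\<^esub> z \<in> N i" using sub_add[OF subrep_sub[OF sN i] _ z(1)] by blast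
      then show "y \<in> N i" using yc zc by (simp add: Y.M.minus_eq Y.M.a_assoc Y.M.l_neg)
    qed
  qed
qed

text \<open>The converse, which makes the projection a morphism: the last \<open>g i\<close> vectors of the normalised frame of \<open>N\<close>
  project to a frame of \<open>\<pi> (N)\<close> by counting dimensions, and then the first \<open>f i\<close> project to zero.\<close>
lemma stratum_UY:
  assumes N: "N \<in> strat" and U: "N \<in> UY"
  shows "preimage_rep Q X \<iota> N \<in> UX" and "image_rep Q \<pi> N \<in> US"
    and "i \<in> verts Q \<Longrightarrow> dual_basis (vspace X i) (preimage_rep Q X \<iota> N i) (f i) (\<lambda>t. \<rho> i (\<beta>Y N i t)) (p i)"
    and "i \<in> verts Q \<Longrightarrow> dual_basis (vspace S i) (image_rep Q \<pi> N i) (g i) (\<lambda>s. \<pi> i (\<beta>Y N i (f i + s))) (\<mu> i)"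
proof -
  let ?N' = "preimage_rep Q X \<iota> N" and ?N'' = "image_rep Q \<pi> N"
  note sN = gr_subrep[OF strat_gr[OF N]]
  have d: "dual_basis (vspace Y i) (N i) (e i) (\<beta>Y N i) (\<theta>Y i)" if "i \<in> verts Q" for i
    using thetaY_form U that by (rule normal_frame_dual_basis[OF Y])
  show d'': "dual_basis (vspace S i) (?N'' i) (g i) (\<lambda>s. \<pi> i (\<beta>Y N i (f i + s))) (\<mu> i)" if i: "i \<in> verts Q" for i
  proof (rule dual_basis_of_dim[OF rep_fin_dim[OF S i] gr_sub[OF strat_im[OF N] i] gr_dim[OF strat_im[OF N] i] _ mu[OF i]])
    show "\<pi> i (\<beta>Y N i (f i + s)) \<in> ?N'' i" if "s < g i" for s
      using dual_basis_in[OF d[OF i], of "f i + s"] that i by (simp add: image_rep_def)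
    show "\<mu> i r (\<pi> i (\<beta>Y N i (f i + s))) = (if r = s then 1 else 0)" if "r < g i" "s < g i" for r s
      using dual_basis_delta[OF d[OF i], of "f i + r" "f i + s"] that by (simp add: \<theta>Y_def)
  qed
  show d': "dual_basis (vspace X i) (?N' i) (f i) (\<lambda>t. \<rho> i (\<beta>Y N i t)) (p i)" if i: "i \<in> verts Q" for i
  proof (rule dual_basis_of_dim[OF rep_fin_dim[OF X i] gr_sub[OF strat_pre[OF N] i] gr_dim[OF strat_pre[OF N] i]])
    show "p i r \<in> linear_forms (vspace X i)" if "r < f i" for r using p_form[OF i] that by simp
    fix t assume t: "t < f i"
    have bN: "\<beta>Y N i t \<in> N i" using dual_basis_in[OF d[OF i]] t by simp
    note bc = sub_in[OF subrep_sub[OF sN i] bN]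
    have "\<pi> i (\<beta>Y N i t) = \<zero>\<^bsub>vspace S i\<^esub>"
    proof (rule dual_basis_zero[OF d''[OF i]])
      show "\<pi> i (\<beta>Y N i t) \<in> ?N'' i" using bN i by (simp add: image_rep_def)
      show "\<mu> i r (\<pi> i (\<beta>Y N i t)) = 0" if "r < g i" for r
        using dual_basis_delta[OF d[OF i], of "f i + r" t] that t by (simp add: \<theta>Y_def)
    qed
    then show "\<rho> i (\<beta>Y N i t) \<in> ?N' i"
      using ker_pi[OF i bc] bN lin_closed[OF rho_lin[OF i] bc] i by (simp add: preimage_rep_def)
    show "p i r (\<rho> i (\<beta>Y N i t)) = (if r = t then 1 else 0)" if "r < f i" for r
      using dual_basis_delta[OF d[OF i], of r t] that t by (simp add: \<theta>Y_def)
  qed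
  show "?N' \<in> UX" using d' by (rule chart_domainI[OF X strat_pre[OF N]])
  show "?N'' \<in> US" using d'' by (rule chart_domainI[OF S strat_im[OF N]])
qed

end



section \<open>Pivots\<close>

lemma fdet_column_sum:
  assumes "r < n"
  shows "fdet n (\<lambda>i j. if j = r then (\<Sum>c\<in>C. G c * v c i) else a i j) =
    (\<Sum>c\<in>C. G c * fdet n (\<lambda>i j. if j = r then v c i else a i j))"
  unfolding fdet_column[OF assms]
  by (simp add: sum_distrib_left sum_distrib_right mult.assoc) (rule sum.swap)

lemma fdet_equal_columns:
  assumes "k < n" "k' < n" "k \<noteq> k'" "\<And>i. i < n \<Longrightarrow> a i k = a i k'"
  shows "fdet n a = 0"
  unfolding fdet_def
  by (rule det_identical_columns[of _ n k k']) (use assms in \<open>auto intro!: eq_vecI\<close>)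

text \<open>Start from the identity matrix and replace its columns one after the other by columns of \<open>t\<close>: the unit
  vector to be replaced is a linear combination of columns of \<open>t\<close>, so by linearity of the determinant
  one of them can take its place without the determinant becoming zero.\<close>
lemma pivots:
  fixes t :: "nat \<Rightarrow> 'c \<Rightarrow> 'k::field"
  assumes sur: "\<And>y. \<exists>\<Phi>. \<forall>r<R. (\<Sum>q\<in>C. t r q * \<Phi> q) = y r"
  obtains j where "\<And>k. k < R \<Longrightarrow> j k \<in> C" "inj_on j {..<R}" "fdet R (\<lambda>r k. t r (j k)) \<noteq> 0"
proof -
  have "m \<le> R \<Longrightarrow> \<exists>j. (\<forall>k<m. j k \<in> C) \<and>
      fdet R (\<lambda>r k. if k < m then t r (j k) else if r = k then 1 else 0) \<noteq> 0" for m
  proof (induction m)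
    case 0
    show ?case using fdet_one[where 'k='k, of R] by simp
  next
    case (Suc m)
    then obtain j where j: "\<forall>k<m. j k \<in> C"
      "fdet R (\<lambda>r k. if k < m then t r (j k) else if r = k then 1 else 0) \<noteq> 0" by auto
    let ?a = "\<lambda>r k. if k < m then t r (j k) else if r = k then 1 else 0"
    \<comment> \<open>\<open>G\<close> writes the unit vector in column \<open>m\<close> in terms of the columns of \<open>t\<close>\<close>
    obtain G where G: "\<And>r. r < R \<Longrightarrow> (\<Sum>q\<in>C. t r q * G q) = (if r = m then 1 else 0)"
      using sur[of "\<lambda>r. if r = m then 1 else 0"] by blast
    have "fdet R ?a = fdet R (\<lambda>r k. if k = m then (\<Sum>q\<in>C. G q * t r q) else ?a r k)"
      using G by (intro fdet_cong) (auto simp: mult.commute)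
    also have "\<dots> = (\<Sum>q\<in>C. G q * fdet R (\<lambda>r k. if k = m then t r q else ?a r k))"
      using Suc.prems by (intro fdet_column_sum) simp
    finally have "(\<Sum>q\<in>C. G q * fdet R (\<lambda>r k. if k = m then t r q else ?a r k)) \<noteq> 0" using j(2) by simp
    then obtain q where "q \<in> C" "G q * fdet R (\<lambda>r k. if k = m then t r q else ?a r k) \<noteq> 0"
      by (rule sum.not_neutral_contains_not_neutral)
    then have q: "q \<in> C" "fdet R (\<lambda>r k. if k = m then t r q else ?a r k) \<noteq> 0" by simp_all
    have "fdet R (\<lambda>r k. if k = m then t r q else ?a r k) =
        fdet R (\<lambda>r k. if k < Suc m then t r ((j(m := q)) k) else if r = k then 1 else 0)"
      by (intro fdet_cong) auto
    then show ?case using j(1) q by (intro exI[of _ "j(m := q)"]) (auto simp: less_Suc_eq)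
  qed
  from this[of R] obtain j where j: "\<forall>k<R. j k \<in> C"
    "fdet R (\<lambda>r k. if k < R then t r (j k) else if r = k then 1 else 0) \<noteq> 0" by auto
  have "fdet R (\<lambda>r k. if k < R then t r (j k) else if r = k then 1 else 0) = fdet R (\<lambda>r k. t r (j k))"
    by (rule fdet_cong) simp
  then have d: "fdet R (\<lambda>r k. t r (j k)) \<noteq> 0" using j(2) by simp
  moreover have "inj_on j {..<R}"
    using d fdet_equal_columns[of _ R _ "\<lambda>r k. t r (j k)"] by (intro inj_onI) force
  ultimately show ?thesis using that[of j] j(1) by blast
qed

lemma cramer:
  assumes nz: "fdet R M \<noteq> 0"
  shows "(\<forall>r<R. (\<Sum>k<R. M r k * x k) = y r) \<longleftrightarrow>
    (\<forall>k<R. x k = fdet R (\<lambda>i j. if j = k then y i else M i j) / fdet R M)"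
proof -
  have e: "(x k = fdet R (\<lambda>i j. if j = k then y i else M i j) / fdet R M) \<longleftrightarrow>
      x k = (\<Sum>s<R. finv R M k s * y s)" if "k < R" for k
    unfolding finv_column[OF that] by simp
  have "(\<forall>r<R. (\<Sum>k<R. M r k * x k) = y r) \<longleftrightarrow> (\<forall>k<R. x k = (\<Sum>s<R. finv R M k s * y s))"
  proof (intro iffI allI impI)
    fix k assume h: "\<forall>r<R. (\<Sum>k<R. M r k * x k) = y r" and k: "k < R"
    have "(\<Sum>s<R. finv R M k s * y s) = (\<Sum>s<R. \<Sum>l<R. finv R M k s * M s l * x l)"
      using h by (intro sum.cong refl) (simp add: sum_distrib_left mult.assoc flip: h[rule_format])
    also have "\<dots> = (\<Sum>l<R. (\<Sum>s<R. finv R M k s * M s l) * x l)"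
      by (subst sum.swap) (simp add: sum_distrib_right)
    also have "\<dots> = (\<Sum>l<R. if l = k then x k else 0)"
      using k by (intro sum.cong) (auto simp: finv_left[OF nz])
    finally show "x k = (\<Sum>s<R. finv R M k s * y s)" using k by simp
  next
    fix r assume h: "\<forall>k<R. x k = (\<Sum>s<R. finv R M k s * y s)" and r: "r < R"
    have "(\<Sum>k<R. M r k * x k) = (\<Sum>k<R. \<Sum>s<R. M r k * finv R M k s * y s)"
      using h by (intro sum.cong refl) (simp add: sum_distrib_left mult.assoc)
    also have "\<dots> = (\<Sum>s<R. (\<Sum>k<R. M r k * finv R M k s) * y s)"
      by (subst sum.swap) (simp add: sum_distrib_right)
    also have "\<dots> = (\<Sum>s<R. if s = r then y r else 0)"
      using r by (intro sum.cong) (auto simp: finv_right[OF nz])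
    finally show "(\<Sum>k<R. M r k * x k) = y r" using r by simp
  qed
  then show ?thesis using e by simp
qed

section \<open>The image of the stratum\<close>
text \<open>Functions on a fibre of the form \<open>\<langle>k, \<phi> (s)\<rangle>\<close> with \<open>s\<close> in \<open>N''\<^sub>i\<close> and \<open>k\<close> a form on \<open>X\<^sub>i / N'\<^sub>i\<close>.  They do not refer to
  a chart and mediate between the coordinates of different charts.\<close>
definition fibre_coordinate where
  "fibre_coordinate Q Y \<pi> X \<rho> b F h \<longleftrightarrow>
     (\<exists>i\<in>verts Q. \<exists>s\<in>snd b i. \<exists>k\<in>linear_forms (vspace X i). (\<forall>x\<in>fst b i. k x = 0) \<and>
        (\<forall>N\<in>F. \<forall>y\<in>N i. \<pi> i y = s \<longrightarrow> h N = k (\<rho> i y)))"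

context split_extension_data
begin

abbreviation "Img \<equiv> Psi Q X \<iota> \<pi> ` strat"
abbreviation "B0 \<equiv> product_kspace (Gr Q X f) (Gr Q S g)"
abbreviation "B \<equiv> restrict_kspace B0 Img"
abbreviation "Esp \<equiv> restrict_kspace (Gr Q Y e) strat"
abbreviation "\<Psi> \<equiv> Psi Q X \<iota> \<pi>"

lemma fin: "finite (verts Q)" "finite (arcs Q)" by auto

lemma B0_swf: "swf B0" by (intro product_swf Gr_swf)
lemma B_swf: "swf B" by (intro restrict_swf B0_swf)
lemma Esp_swf: "swf Esp" by (intro restrict_swf Gr_swf)

lemma strat_subset: "strat \<subseteq> quiver_grassmannian Q Y e" by (auto simp: stratum_def)

lemma Esp_points: "points Esp = strat" using strat_subset by (auto simp: Gr_points)

lemma Im_subset: "Img \<subseteq> quiver_grassmannian Q X f \<times> quiver_grassmannian Q S g"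
  using strat_pre strat_im by (auto simp: Psi_def)

lemma B0_points: "points B0 = quiver_grassmannian Q X f \<times> quiver_grassmannian Q S g"
  by (simp add: product_points Gr_points)

lemma B_points: "points B = Img" using Im_subset B0_points by auto

text \<open>Bases adapted to a given point yield a chart around it.\<close>
lemma chart_data_exists:
  assumes N': "N' \<in> quiver_grassmannian Q X f" and N'': "N'' \<in> quiver_grassmannian Q S g"
  obtains xb p \<mu> where "chart_data Q X S Y \<iota> \<pi> \<sigma> \<rho> f g (\<lambda>i. dimvec X i - f i) xb p \<mu>"
    and "\<forall>i\<in>verts Q. f i \<le> dimvec X i"
    and "N' \<in> chart_domain Q X f p" and "N'' \<in> chart_domain Q S g \<mu>"
proof -
  have "\<forall>i. \<exists>b l. i \<in> verts Q \<longrightarrow> dual_basis (vspace X i) (carrier (vspace X i)) (dimvec X i) b l \<and>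
      dual_basis (vspace X i) (N' i) (f i) b l \<and> f i \<le> dimvec X i"
  proof
    fix i
    show "\<exists>b l. i \<in> verts Q \<longrightarrow> dual_basis (vspace X i) (carrier (vspace X i)) (dimvec X i) b l \<and>
      dual_basis (vspace X i) (N' i) (f i) b l \<and> f i \<le> dimvec X i"
    proof (cases "i \<in> verts Q")
      case True
      obtain b l where "dual_basis (vspace X i) (carrier (vspace X i)) (vectorspace.dim class_ring (vspace X i)) b l"
        "dual_basis (vspace X i) (N' i) (vectorspace.dim class_ring ((vspace X i)\<lparr>carrier := N' i\<rparr>)) b l"
        "vectorspace.dim class_ring ((vspace X i)\<lparr>carrier := N' i\<rparr>) \<le> vectorspace.dim class_ring (vspace X i)"
        by (rule adapted_dual_basis[OF rep_fin_dim[OF X True] gr_sub[OF N' True]])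
      then show ?thesis unfolding gr_dim[OF N' True] dimvec_def by blast
    qed auto
  qed
  then obtain xb p where xp: "\<And>i. i \<in> verts Q \<Longrightarrow> dual_basis (vspace X i) (carrier (vspace X i)) (dimvec X i) (xb i) (p i) \<and>
      dual_basis (vspace X i) (N' i) (f i) (xb i) (p i) \<and> f i \<le> dimvec X i" by metis
  have "\<forall>i. \<exists>b l. i \<in> verts Q \<longrightarrow> dual_basis (vspace S i) (N'' i) (g i) b l"
    using dual_basis_exists[OF rep_fin_dim[OF S] gr_sub[OF N'']] gr_dim[OF N''] by metis
  then obtain m \<mu> where m: "\<And>i. i \<in> verts Q \<Longrightarrow> dual_basis (vspace S i) (N'' i) (g i) (m i) (\<mu> i)" by metis
  have "chart_data Q X S Y \<iota> \<pi> \<sigma> \<rho> f g (\<lambda>i. dimvec X i - f i) xb p \<mu>"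
    using split_extension_data_axioms xp dual_basis_form[OF m]
    unfolding chart_data_def chart_data_axioms_def by simp
  moreover have "N' \<in> chart_domain Q X f p"
    using xp by (intro chart_domainI[OF X N', of xb]) auto
  moreover have "N'' \<in> chart_domain Q S g \<mu>" by (rule chart_domainI[OF S N'' m])
  ultimately show ?thesis using that xp by blast
qed

end

context chart_data
begin

abbreviation "surjective_at N' N'' \<equiv> \<forall>y. \<exists>\<Phi>. solves N' N'' \<Phi> y"

lemma Ext1_vanishes_iff_surjective:
  assumes N': "N' \<in> UX" and N'': "N'' \<in> US"
  shows "Ext1_vanishes Q (sub_rep S N'') (quotient_rep Q X N') \<longleftrightarrow> surjective_at N' N''"
  using Ext1_vanishes_sub_quotient_iff[OF wf X S gr_subrep[OF chart_domain_gr[OF N']]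
      gr_subrep[OF chart_domain_gr[OF N'']] US_dual[OF N''] kappa_cobasis[OF N']]
  unfolding solves_def matS_def[abs_def] matX_def[abs_def] by simp

lemma sylvester_affine:
  "sylvester Q g c B' A' (\<lambda>i r s. a * \<Phi> i r s + \<Phi>' i r s) \<alpha> r s =
    a * sylvester Q g c B' A' \<Phi> \<alpha> r s + sylvester Q g c B' A' \<Phi>' \<alpha> r s"
  unfolding sylvester_def by (simp add: algebra_simps sum.distrib sum_distrib_left)

text \<open>A matrix \<open>y\<close> of cocycle coordinates on \<open>N''\<close> with values in \<open>X / N'\<close> extends to a cocycle on all of \<open>S\<close> with
  values in \<open>X\<close>, since the forms \<open>\<mu>\<close> are defined on \<open>S\<close> and the vectors \<open>w\<close> lie in \<open>X\<close>.  This is the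
  surjectivity of \<open>Ext\<^sup>1 (S, X) \<rightarrow> Ext\<^sup>1 (N'', X / N')\<close>.\<close>
lemma generating_coordinates:
  assumes G: "generating_extension Q S X Y \<iota> \<pi>" and N': "N' \<in> UX" and N'': "N'' \<in> US"
  obtains a \<Phi> where "\<And>\<alpha> r s. \<alpha> \<in> arcs Q \<Longrightarrow> r < c (head Q \<alpha>) \<Longrightarrow> s < g (tail Q \<alpha>) \<Longrightarrow>
    y \<alpha> r s = a * rhs N' N'' \<alpha> r s + sylvester Q g c (matS N'') (matX N') \<Phi> \<alpha> r s"
proof -
  define \<zeta> where "\<zeta> \<alpha> x = comb (vspace X (head Q \<alpha>)) (c (head Q \<alpha>))
      (\<lambda>r. \<Sum>s<g (tail Q \<alpha>). y \<alpha> r s * \<mu> (tail Q \<alpha>) s x) (w (head Q \<alpha>))" for \<alpha> x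
  have zl: "lin (vspace S (tail Q \<alpha>)) (vspace X (head Q \<alpha>)) (\<zeta> \<alpha>)" if "\<alpha> \<in> arcs Q" for \<alpha>
    unfolding \<zeta>_def using ends[OF that] mu w_in
    by (intro comb_lin form_lincomb) (auto simp: rep_vsp[OF S] rep_vsp[OF X])
  show ?thesis
  proof (rule generating_extension_cocycle[OF wf X S G split zl])
    fix u a
    assume u: "\<And>i. i \<in> verts Q \<Longrightarrow> lin (vspace S i) (vspace X i) (u i)"
    and eq: "\<And>\<alpha> s. \<alpha> \<in> arcs Q \<Longrightarrow> s \<in> carrier (vspace S (tail Q \<alpha>)) \<Longrightarrow>
       \<zeta> \<alpha> s \<oplus>\<^bsub>vspace X (head Q \<alpha>)\<^esub> act X \<alpha> (u (tail Q \<alpha>) s) =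
       a \<odot>\<^bsub>vspace X (head Q \<alpha>)\<^esub> \<xi> \<alpha> s \<oplus>\<^bsub>vspace X (head Q \<alpha>)\<^esub> u (head Q \<alpha>) (act S \<alpha> s)"
  show ?thesis
  proof (rule that[of a "\<lambda>i r s. \<kappa> N' i r (u i (\<beta>'' N'' i s))"])
    fix \<alpha> r s assume al: "\<alpha> \<in> arcs Q" and r: "r < c (head Q \<alpha>)" and s: "s < g (tail Q \<alpha>)"
    note en = ends[OF al]
    let ?i = "tail Q \<alpha>" and ?j = "head Q \<alpha>" and ?b = "\<beta>'' N'' (tail Q \<alpha>) s"
    note b = beta''_in[OF N'' en(1) s] and k = kappa_form[OF en(2) r, of N']
    have bN: "?b \<in> N'' ?i" using dual_basis_in[OF US_dual[OF N'' en(1)] s] .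
    have z: "\<kappa> N' ?j r (\<zeta> \<alpha> ?b) = y \<alpha> r s"
    proof -
      have "(\<Sum>s'<g ?i. y \<alpha> r s' * \<mu> ?i s' ?b) = (\<Sum>s'<g ?i. if s' = s then y \<alpha> r s else 0)"
        using s by (intro sum.cong) (auto simp: dual_basis_delta[OF US_dual[OF N'' en(1)]])
      then show ?thesis unfolding \<zeta>_def using s by (simp add: kappa_comb_w[OF N' N'' en(2) r])
    qed
    have c1: "\<zeta> \<alpha> ?b \<in> carrier (vspace X ?j)" "act X \<alpha> (u ?i ?b) \<in> carrier (vspace X ?j)"
      "\<xi> \<alpha> ?b \<in> carrier (vspace X ?j)" "u ?j (act S \<alpha> ?b) \<in> carrier (vspace X ?j)"
      using lin_closed[OF zl[OF al] b] lin_closed[OF rep_lin[OF X al] lin_closed[OF u[OF en(1)] b]]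
        lin_closed[OF xi_lin[OF al] b] lin_closed[OF u[OF en(2)] lin_closed[OF rep_lin[OF S al] b]] .
    have "y \<alpha> r s + \<kappa> N' ?j r (act X \<alpha> (u ?i ?b)) = a * rhs N' N'' \<alpha> r s + \<kappa> N' ?j r (u ?j (act S \<alpha> ?b))"
      using arg_cong[OF eq[OF al b], of "\<kappa> N' ?j r"] z
        form_add[OF k c1(1,2)] form_add[OF k vsp_smult[OF rep_vsp[OF X en(2)] c1(3)] c1(4)] form_smult[OF k c1(3)]
      by (simp add: rhs_def)
    moreover have "\<kappa> N' ?j r (act X \<alpha> (u ?i ?b)) = (\<Sum>t<c ?i. matX N' \<alpha> r t * \<kappa> N' ?i t (u ?i ?b))"
      by (rule kappa_act_expand[OF N' al r lin_closed[OF u[OF en(1)] b]])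
    moreover have "\<kappa> N' ?j r (u ?j (act S \<alpha> ?b)) = (\<Sum>v<g ?j. matS N'' \<alpha> v s * \<kappa> N' ?j r (u ?j (\<beta>'' N'' ?j v)))"
      using form_expand'[OF US_dual[OF N'' en(2)] US_sub[OF N'' en(2)]
          subrep_act[OF gr_subrep[OF chart_domain_gr[OF N'']] al bN] form_comp[OF u[OF en(2)] k]]
      by (simp add: matS_def)
    ultimately show "y \<alpha> r s = a * rhs N' N'' \<alpha> r s +
        sylvester Q g c (matS N'') (matX N') (\<lambda>i r s. \<kappa> N' i r (u i (\<beta>'' N'' i s))) \<alpha> r s"
      by (simp add: sylvester_def algebra_simps)
  qed
  qed
qed

text \<open>If \<open>\<xi>\<close> is a coboundary on \<open>N''\<close> modulo \<open>N'\<close>, then so are its multiples and hence, \<open>\<xi>\<close> being generating, all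
  cocycles.\<close>
lemma image_iff_surjective:
  assumes G: "generating_extension Q S X Y \<iota> \<pi>" and N': "N' \<in> UX" and N'': "N'' \<in> US"
  shows "(N', N'') \<in> Img \<longleftrightarrow> surjective_at N' N''"
proof (intro iffI allI)
  assume "(N', N'') \<in> Img"
  then obtain N where N: "N \<in> strat" "preimage_rep Q X \<iota> N = N'" "image_rep Q \<pi> N = N''"
    by (auto simp: Psi_def)
  have sol: "solves N' N'' (coord N) (rhs N' N'')" using stratum_frame(5)[OF N(1)] N N' N'' by simp
  fix y
  obtain a \<Phi> where "\<And>\<alpha> r s. \<alpha> \<in> arcs Q \<Longrightarrow> r < c (head Q \<alpha>) \<Longrightarrow> s < g (tail Q \<alpha>) \<Longrightarrow>
    y \<alpha> r s = a * rhs N' N'' \<alpha> r s + sylvester Q g c (matS N'') (matX N') \<Phi> \<alpha> r s"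
    using generating_coordinates[OF G N' N''] by blast
  then have "solves N' N'' (\<lambda>i r s. a * coord N i r s + \<Phi> i r s) y"
    using sol unfolding solves_def sylvester_affine by simp
  then show "\<exists>\<Phi>. solves N' N'' \<Phi> y" by blast
next
  assume "surjective_at N' N''"
  then obtain \<Phi> where "solves N' N'' \<Phi> (rhs N' N'')" by blast
  from sub_of_stratum(1,2)[OF N' N'' this] show "(N', N'') \<in> Img" by (metis imageI)
qed

end

context split_extension_data
begin

lemma image_eq:
  assumes G: "generating_extension Q S X Y \<iota> \<pi>"
  shows "Img = {(N', N''). N' \<in> quiver_grassmannian Q X f \<and> N'' \<in> quiver_grassmannian Q S g \<and>
              Ext1_vanishes Q (sub_rep S N'') (quotient_rep Q X N')}"
proof -
  have "(N', N'') \<in> Img \<longleftrightarrow> Ext1_vanishes Q (sub_rep S N'') (quotient_rep Q X N')"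
    if N': "N' \<in> quiver_grassmannian Q X f" and N'': "N'' \<in> quiver_grassmannian Q S g" for N' N''
  proof -
    obtain xb p \<mu> where c: "chart_data Q X S Y \<iota> \<pi> \<sigma> \<rho> f g (\<lambda>i. dimvec X i - f i) xb p \<mu>"
      and U: "N' \<in> chart_domain Q X f p" "N'' \<in> chart_domain Q S g \<mu>"
      by (rule chart_data_exists[OF N' N''])
    interpret chart_data Q X S Y \<iota> \<pi> \<sigma> \<rho> f g "\<lambda>i. dimvec X i - f i" xb p \<mu> by (rule c)
    show ?thesis using image_iff_surjective[OF G U] Ext1_vanishes_iff_surjective[OF U] by simp
  qed
  then show ?thesis using Im_subset by auto
qed

section \<open>The projection is a morphism\<close>

text \<open>Locally on the stratum, the projections of a normalised frame of \<open>N\<close> are frames of \<open>\<iota>\<^sup>-\<^sup>1 (N)\<close> and \<open>\<pi> (N)\<close>.\<close>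
lemma Psi_morphism: "morphism Esp B0 \<Psi>"
proof -
  have W: "\<exists>W p \<mu> xb. openin (zariski Esp) W \<and> N \<in> W \<and>
      chart_data Q X S Y \<iota> \<pi> \<sigma> \<rho> f g (\<lambda>i. dimvec X i - f i) xb p \<mu> \<and>
      W = chart_domain Q Y e (chart_data.\<theta>Y \<pi> \<rho> f p \<mu>) \<inter> strat"
    if N: "N \<in> points Esp" for N
  proof -
    have Ns: "N \<in> strat" using N Esp_points by simp
    obtain xb p \<mu> where c: "chart_data Q X S Y \<iota> \<pi> \<sigma> \<rho> f g (\<lambda>i. dimvec X i - f i) xb p \<mu>"
      and U: "preimage_rep Q X \<iota> N \<in> chart_domain Q X f p" "image_rep Q \<pi> N \<in> chart_domain Q S g \<mu>"
      by (rule chart_data_exists[OF strat_pre[OF Ns] strat_im[OF Ns]])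
    interpret chart_data Q X S Y \<iota> \<pi> \<sigma> \<rho> f g "\<lambda>i. dimvec X i - f i" xb p \<mu> by (rule c)
    have "openin (zariski (Gr Q Y e)) UY" by (rule chart_domain_open[OF fin(1) thetaY_form])
    then have "openin (zariski Esp) (UY \<inter> strat)" unfolding restrict_openin by blast
    then show ?thesis using c stratum_frame(1)[OF Ns U] Ns by blast
  qed
  have reg: "(\<lambda>N. k (normal_frame Q Y e (chart_data.\<theta>Y \<pi> \<rho> f p \<mu>) N i t))
      \<in> regular Esp (chart_domain Q Y e (chart_data.\<theta>Y \<pi> \<rho> f p \<mu>) \<inter> strat)"
    if c: "chart_data Q X S Y \<iota> \<pi> \<sigma> \<rho> f g (\<lambda>i. dimvec X i - f i) xb p \<mu>"
      and i: "i \<in> verts Q" and t: "t < f i + g i" and k: "k \<in> linear_forms (vspace Y i)" for xb p \<mu> i t k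
  proof -
    interpret chart_data Q X S Y \<iota> \<pi> \<sigma> \<rho> f g "\<lambda>i. dimvec X i - f i" xb p \<mu> by (rule c)
    show ?thesis
      by (rule regular_restrict[OF chart_domain_open[OF fin(1) thetaY_form]
            normal_frame_regular[where k = k and e = e and M = Y, OF Y fin(1) thetaY_form i t k]])
  qed
  have 1: "morphism Esp (Gr Q X f) (preimage_rep Q X \<iota>)"
  proof (rule morphism_into_Gr[OF Esp_swf fin(1) X])
    show "preimage_rep Q X \<iota> N \<in> quiver_grassmannian Q X f" if "N \<in> points Esp" for N
      using that strat_pre Esp_points by auto
    fix N assume N: "N \<in> points Esp"
    obtain W p \<mu> xb where W: "openin (zariski Esp) W" "N \<in> W"
      and c: "chart_data Q X S Y \<iota> \<pi> \<sigma> \<rho> f g (\<lambda>i. dimvec X i - f i) xb p \<mu>"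
      and We: "W = chart_domain Q Y e (chart_data.\<theta>Y \<pi> \<rho> f p \<mu>) \<inter> strat" using W[OF N] by (elim exE conjE)
    interpret chart_data Q X S Y \<iota> \<pi> \<sigma> \<rho> f g "\<lambda>i. dimvec X i - f i" xb p \<mu> by (rule c)
    show "\<exists>W \<beta>. openin (zariski Esp) W \<and> N \<in> W \<and>
        (\<forall>y\<in>W. \<forall>i\<in>verts Q. \<exists>\<theta>. dual_basis (vspace X i) (preimage_rep Q X \<iota> y i) (f i) (\<beta> y i) \<theta>) \<and>
        (\<forall>i\<in>verts Q. \<forall>s<f i. \<forall>l\<in>linear_forms (vspace X i). (\<lambda>y. l (\<beta> y i s)) \<in> regular Esp W)"
    proof (rule exI[of _ W], rule exI[of _ "\<lambda>N i t. \<rho> i (\<beta>Y N i t)"], intro conjI ballI allI impI W)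
      show "\<exists>\<theta>. dual_basis (vspace X i) (preimage_rep Q X \<iota> y i) (f i) (\<lambda>t. \<rho> i (\<beta>Y y i t)) \<theta>"
        if "y \<in> W" "i \<in> verts Q" for y i
        using stratum_UY(3)[of y i] that We by blast
      show "(\<lambda>y. l (\<rho> i (\<beta>Y y i s))) \<in> regular Esp W"
        if "i \<in> verts Q" "s < f i" "l \<in> linear_forms (vspace X i)" for i s l
        using reg[OF c that(1) _ form_comp[OF rho_lin[OF that(1)] that(3)], of s] that(2) We by simp
    qed
  qed
  have 2: "morphism Esp (Gr Q S g) (image_rep Q \<pi>)"
  proof (rule morphism_into_Gr[OF Esp_swf fin(1) S])
    show "image_rep Q \<pi> N \<in> quiver_grassmannian Q S g" if "N \<in> points Esp" for N
      using that strat_im Esp_points by auto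
    fix N assume N: "N \<in> points Esp"
    obtain W p \<mu> xb where W: "openin (zariski Esp) W" "N \<in> W"
      and c: "chart_data Q X S Y \<iota> \<pi> \<sigma> \<rho> f g (\<lambda>i. dimvec X i - f i) xb p \<mu>"
      and We: "W = chart_domain Q Y e (chart_data.\<theta>Y \<pi> \<rho> f p \<mu>) \<inter> strat" using W[OF N] by (elim exE conjE)
    interpret chart_data Q X S Y \<iota> \<pi> \<sigma> \<rho> f g "\<lambda>i. dimvec X i - f i" xb p \<mu> by (rule c)
    show "\<exists>W \<beta>. openin (zariski Esp) W \<and> N \<in> W \<and>
        (\<forall>y\<in>W. \<forall>i\<in>verts Q. \<exists>\<theta>. dual_basis (vspace S i) (image_rep Q \<pi> y i) (g i) (\<beta> y i) \<theta>) \<and>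
        (\<forall>i\<in>verts Q. \<forall>s<g i. \<forall>l\<in>linear_forms (vspace S i). (\<lambda>y. l (\<beta> y i s)) \<in> regular Esp W)"
    proof (rule exI[of _ W], rule exI[of _ "\<lambda>N i t. \<pi> i (\<beta>Y N i (f i + t))"], intro conjI ballI allI impI W)
      show "\<exists>\<theta>. dual_basis (vspace S i) (image_rep Q \<pi> y i) (g i) (\<lambda>t. \<pi> i (\<beta>Y y i (f i + t))) \<theta>"
        if "y \<in> W" "i \<in> verts Q" for y i
        using stratum_UY(4)[of y i] that We by blast
      show "(\<lambda>y. l (\<pi> i (\<beta>Y y i (f i + s)))) \<in> regular Esp W"
        if "i \<in> verts Q" "s < g i" "l \<in> linear_forms (vspace S i)" for i s l
        using reg[OF c that(1) _ form_comp[OF pi_lin[OF that(1)] that(3)], of "f i + s"] that(2) We by simp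
    qed
  qed
  show ?thesis unfolding Psi_def[abs_def] by (rule morphism_into_product[OF Esp_swf 1 2])
qed

lemma Psi_morphism_image: "morphism Esp B \<Psi>"
  by (rule morphism_into_restrict[OF Esp_swf Psi_morphism]) (simp add: Esp_points)

end

section \<open>Charts\<close>

definition affine_fn :: "nat \<Rightarrow> ((nat \<Rightarrow> 'k::field) \<Rightarrow> 'k) \<Rightarrow> bool" where
  "affine_fn n F \<longleftrightarrow> (\<exists>a0 a. \<forall>v. F v = a0 + (\<Sum>k<n. a k * v k))"

lemma affine_fn_const: "affine_fn n (\<lambda>_. a)"
  unfolding affine_fn_def by (rule exI[of _ a], rule exI[of _ "\<lambda>_. 0"]) simp

lemma affine_fn_coordinate: "k < n \<Longrightarrow> affine_fn n (\<lambda>v. v k)"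
proof -
  assume k: "k < n"
  have "v k = 0 + (\<Sum>l<n. (if l = k then 1 else 0) * v l)" for v :: "nat \<Rightarrow> 'a"
  proof -
    have "(\<Sum>l<n. (if l = k then 1 else 0) * v l) = (\<Sum>l<n. if l = k then v k else 0)"
      by (intro sum.cong) auto
    then show ?thesis using k by simp
  qed
  then show ?thesis unfolding affine_fn_def
    by (intro exI[of _ 0] exI[of _ "\<lambda>l. if l = k then 1 else 0"] allI)
qed

lemma affine_fn_add: "affine_fn n F \<Longrightarrow> affine_fn n G \<Longrightarrow> affine_fn n (\<lambda>v. F v + G v)"
proof -
  assume "affine_fn n F" "affine_fn n G"
  then obtain a0 a b0 b where "\<And>v. F v = a0 + (\<Sum>k<n. a k * v k)" "\<And>v. G v = b0 + (\<Sum>k<n. b k * v k)"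
    unfolding affine_fn_def by blast
  then have "F v + G v = (a0 + b0) + (\<Sum>k<n. (a k + b k) * v k)" for v
    by (simp add: algebra_simps sum.distrib)
  then show ?thesis unfolding affine_fn_def
    by (intro exI[of _ "a0 + b0"] exI[of _ "\<lambda>k. a k + b k"]) simp
qed

lemma affine_fn_smult: "affine_fn n F \<Longrightarrow> affine_fn n (\<lambda>v. a * F v)"
proof -
  assume "affine_fn n F"
  then obtain a0 b where "\<And>v. F v = a0 + (\<Sum>k<n. b k * v k)" unfolding affine_fn_def by blast
  then have "a * F v = a * a0 + (\<Sum>k<n. (a * b k) * v k)" for v
    by (simp add: algebra_simps sum_distrib_left)
  then show ?thesis unfolding affine_fn_def
    by (intro exI[of _ "a * a0"] exI[of _ "\<lambda>k. a * b k"]) simp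
qed

lemma affine_fn_sum: "(\<And>i. i \<in> I \<Longrightarrow> affine_fn n (F i)) \<Longrightarrow> affine_fn n (\<lambda>v. \<Sum>i\<in>I. F i v)"
  by (induction I rule: infinite_finite_induct) (auto intro: affine_fn_const affine_fn_add)

lemma affine_fn_diff: "affine_fn n F \<Longrightarrow> affine_fn n G \<Longrightarrow> affine_fn n (\<lambda>v. F v - G v)"
  using affine_fn_add[OF _ affine_fn_smult[of n G "- 1"], of F] by simp

context chart_data
begin

definition rows :: "('a \<times> nat \<times> nat) set" where
  "rows = (SIGMA \<alpha>:arcs Q. {..<c (head Q \<alpha>)} \<times> {..<g (tail Q \<alpha>)})"

definition columns :: "('v \<times> nat \<times> nat) set" where
  "columns = (SIGMA i:verts Q. {..<c i} \<times> {..<g i})"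

text \<open>The matrix of \<open>sylvester\<close> with respect to the entries \<open>(i, r, s)\<close> of \<open>\<Phi>\<close>.\<close>
definition entry :: "('v \<Rightarrow> 'x set) \<times> ('v \<Rightarrow> 's set) \<Rightarrow> 'a \<times> nat \<times> nat \<Rightarrow> 'v \<times> nat \<times> nat \<Rightarrow> 'k" where
  "entry b = (\<lambda>(\<alpha>, r, s) (i, r', s').
     (if i = head Q \<alpha> \<and> r' = r then matS (snd b) \<alpha> s' s else 0) -
     (if i = tail Q \<alpha> \<and> s' = s then matX (fst b) \<alpha> r r' else 0))"

definition uncur :: "('v \<Rightarrow> nat \<Rightarrow> nat \<Rightarrow> 'k) \<Rightarrow> 'v \<times> nat \<times> nat \<Rightarrow> 'k" where
  "uncur \<Phi> = (\<lambda>(i, r, s). \<Phi> i r s)"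

definition cur :: "('v \<times> nat \<times> nat \<Rightarrow> 'k) \<Rightarrow> 'v \<Rightarrow> nat \<Rightarrow> nat \<Rightarrow> 'k" where
  "cur F i r s = F (i, r, s)"

definition uncur3 :: "('a \<Rightarrow> nat \<Rightarrow> nat \<Rightarrow> 'k) \<Rightarrow> 'a \<times> nat \<times> nat \<Rightarrow> 'k" where
  "uncur3 y = (\<lambda>(\<alpha>, r, s). y \<alpha> r s)"

lemma uncur_cur [simp]: "uncur (cur F) = F" by (auto simp: uncur_def cur_def)

lemma finite_rows: "finite rows" and finite_columns: "finite columns"
  unfolding rows_def columns_def by auto

lemma sum_columns: "(\<Sum>q\<in>columns. h q) = (\<Sum>i\<in>verts Q. \<Sum>r<c i. \<Sum>s<g i. h (i, r, s))"
proof -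
  have "(\<Sum>q\<in>columns. h q) = (\<Sum>i\<in>verts Q. \<Sum>z\<in>{..<c i} \<times> {..<g i}. h (i, z))"
    unfolding columns_def by (subst sum.Sigma) auto
  also have "\<dots> = (\<Sum>i\<in>verts Q. \<Sum>r<c i. \<Sum>s<g i. h (i, r, s))"
    by (subst sum.cartesian_product) (simp add: case_prod_unfold)
  finally show ?thesis .
qed

lemma sylvester_entry:
  assumes "\<alpha> \<in> arcs Q" "r < c (head Q \<alpha>)" "s < g (tail Q \<alpha>)"
  shows "sylvester Q g c (matS (snd b)) (matX (fst b)) \<Phi> \<alpha> r s = (\<Sum>q\<in>columns. entry b (\<alpha>, r, s) q * uncur \<Phi> q)"
proof -
  note en = ends[OF assms(1)]
  have 1: "(\<Sum>i\<in>verts Q. \<Sum>r'<c i. \<Sum>s'<g i. (if i = head Q \<alpha> \<and> r' = r then matS (snd b) \<alpha> s' s else 0) * \<Phi> i r' s') =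
      (\<Sum>u<g (head Q \<alpha>). matS (snd b) \<alpha> u s * \<Phi> (head Q \<alpha>) r u)"
  proof -
    have "(\<Sum>r'<c i. \<Sum>s'<g i. (if i = head Q \<alpha> \<and> r' = r then matS (snd b) \<alpha> s' s else 0) * \<Phi> i r' s') =
       (if i = head Q \<alpha> then (\<Sum>u<g (head Q \<alpha>). matS (snd b) \<alpha> u s * \<Phi> (head Q \<alpha>) r u) else 0)" for i
    proof (cases "i = head Q \<alpha>")
      case True
      have "(\<Sum>r'<c i. \<Sum>s'<g i. (if i = head Q \<alpha> \<and> r' = r then matS (snd b) \<alpha> s' s else 0) * \<Phi> i r' s') =
          (\<Sum>r'<c i. if r' = r then (\<Sum>u<g i. matS (snd b) \<alpha> u s * \<Phi> i r u) else 0)"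
        using True by (intro sum.cong) auto
      then show ?thesis using True assms by simp
    qed simp
    then show ?thesis using en fin by simp
  qed
  have 2: "(\<Sum>i\<in>verts Q. \<Sum>r'<c i. \<Sum>s'<g i. (if i = tail Q \<alpha> \<and> s' = s then matX (fst b) \<alpha> r r' else 0) * \<Phi> i r' s') =
      (\<Sum>t<c (tail Q \<alpha>). matX (fst b) \<alpha> r t * \<Phi> (tail Q \<alpha>) t s)"
  proof -
    have "(\<Sum>r'<c i. \<Sum>s'<g i. (if i = tail Q \<alpha> \<and> s' = s then matX (fst b) \<alpha> r r' else 0) * \<Phi> i r' s') =
       (if i = tail Q \<alpha> then (\<Sum>t<c (tail Q \<alpha>). matX (fst b) \<alpha> r t * \<Phi> (tail Q \<alpha>) t s) else 0)" for i
    proof (cases "i = tail Q \<alpha>")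
      case True
      have "(\<Sum>s'<g i. (if i = tail Q \<alpha> \<and> s' = s then matX (fst b) \<alpha> r r' else 0) * \<Phi> i r' s') =
          (\<Sum>s'<g i. if s' = s then matX (fst b) \<alpha> r r' * \<Phi> i r' s else 0)" for r'
        using True by (intro sum.cong) auto
      then show ?thesis using True assms by simp
    qed simp
    then show ?thesis using en fin by simp
  qed
  show ?thesis
    unfolding sum_columns entry_def uncur_def prod.case left_diff_distrib sum_subtractf 1 2 sylvester_def ..
qed

lemma solves_entry:
  "solves (fst b) (snd b) \<Phi> y \<longleftrightarrow> (\<forall>z\<in>rows. (\<Sum>q\<in>columns. entry b z q * uncur \<Phi> q) = uncur3 y z)"
  unfolding solves_def rows_def uncur3_def using sylvester_entry[of _ _ _ b \<Phi>] by auto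

subsection \<open>Regularity of the coefficients\<close>

abbreviation "UXS \<equiv> UX \<times> US"

lemma UX_open: "openin (zariski (Gr Q X f)) UX"
  by (rule chart_domain_open[OF fin(1)]) (simp add: p_form)

lemma US_open: "openin (zariski (Gr Q S g)) US"
  by (rule chart_domain_open[OF fin(1)]) (simp add: mu)

lemma UXS_open: "openin (zariski B0) UXS"
  by (rule product_open[OF UX_open US_open])

lemma beta'_regular:
  assumes "i \<in> verts Q" "t < f i" "l \<in> linear_forms (vspace X i)"
  shows "(\<lambda>b. l (\<beta>' (fst b) i t)) \<in> regular B0 UXS"
proof -
  interpret B0: space_with_functions B0 by (rule B0_swf)
  have "(\<lambda>N. l (\<beta>' N i t)) \<in> regular (Gr Q X f) UX"
    using assms by (intro normal_frame_regular[where k = l and e = f and M = X] X fin(1)) (auto simp: p_form)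
  from morphism_regular[OF product_fst UX_open this]
  show ?thesis
    by (rule B0.regular_mono[OF _ morphism_open[OF product_fst UX_open] UXS_open])
      (use openin_subset[OF UXS_open] in auto)
qed

lemma beta''_regular:
  assumes "i \<in> verts Q" "t < g i" "l \<in> linear_forms (vspace S i)"
  shows "(\<lambda>b. l (\<beta>'' (snd b) i t)) \<in> regular B0 UXS"
proof -
  interpret B0: space_with_functions B0 by (rule B0_swf)
  have "(\<lambda>N. l (\<beta>'' N i t)) \<in> regular (Gr Q S g) US"
    using assms by (intro normal_frame_regular[where k = l and e = g and M = S] S fin(1)) (auto simp: mu)
  from morphism_regular[OF product_snd US_open this]
  show ?thesis
    by (rule B0.regular_mono[OF _ morphism_open[OF product_snd US_open] UXS_open])
      (use openin_subset[OF UXS_open] in auto)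
qed

lemma entry_regular:
  assumes z: "z \<in> rows" and q: "q \<in> columns"
  shows "(\<lambda>b. entry b z q) \<in> regular B0 UXS"
proof -
  interpret B0: space_with_functions B0 by (rule B0_swf)
  obtain \<alpha> r s where z': "z = (\<alpha>, r, s)" "\<alpha> \<in> arcs Q" "r < c (head Q \<alpha>)" "s < g (tail Q \<alpha>)"
    using z unfolding rows_def by auto
  obtain i r' s' where q': "q = (i, r', s')" "i \<in> verts Q" "r' < c i" "s' < g i"
    using q unfolding columns_def by auto
  note en = ends[OF z'(2)]
  have 1: "(\<lambda>b. if i = head Q \<alpha> \<and> r' = r then matS (snd b) \<alpha> s' s else 0) \<in> regular B0 UXS"
  proof (cases "i = head Q \<alpha> \<and> r' = r")
    case True
    have "(\<lambda>x. \<mu> (head Q \<alpha>) s' (act S \<alpha> x)) \<in> linear_forms (vspace S (tail Q \<alpha>))"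
      using True q' by (intro form_comp[OF rep_lin[OF S z'(2)]] mu) auto
    from beta''_regular[OF en(1) z'(4) this] show ?thesis using True by (simp add: matS_def)
  next
    case False
    show ?thesis unfolding if_not_P[OF False] by (rule B0.regular_const[OF UXS_open])
  qed
  have 2: "(\<lambda>b. if i = tail Q \<alpha> \<and> s' = s then matX (fst b) \<alpha> r r' else 0) \<in> regular B0 UXS"
  proof (cases "i = tail Q \<alpha> \<and> s' = s")
    case True
    have "(\<lambda>b. \<kappa> (fst b) (head Q \<alpha>) r x) \<in> regular B0 UXS" for x
      unfolding \<kappa>_def using en z'
      by (intro B0.regular_diff B0.regular_sum B0.regular_mult B0.regular_const UXS_open beta'_regular p_form) auto
    then show ?thesis using True by (simp add: matX_def)
  next
    case False
    show ?thesis unfolding if_not_P[OF False] by (rule B0.regular_const[OF UXS_open])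
  qed
  show ?thesis unfolding z' q' entry_def prod.case by (rule B0.regular_diff[OF UXS_open 1 2])
qed

lemma rhs_regular:
  assumes z: "z \<in> rows"
  shows "(\<lambda>b. uncur3 (rhs (fst b) (snd b)) z) \<in> regular B0 UXS"
proof -
  interpret B0: space_with_functions B0 by (rule B0_swf)
  obtain \<alpha> r s where z': "z = (\<alpha>, r, s)" "\<alpha> \<in> arcs Q" "r < c (head Q \<alpha>)" "s < g (tail Q \<alpha>)"
    using z unfolding rows_def by auto
  note en = ends[OF z'(2)]
  show ?thesis
    unfolding z' uncur3_def prod.case rhs_def \<kappa>_def
    using en z'
    by (intro B0.regular_diff B0.regular_sum B0.regular_mult UXS_open beta'_regular p_form
        beta''_regular form_comp[OF xi_lin[OF z'(2)]]) auto
qed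

end

text \<open>A maximal minor: \<open>row\<close> enumerates all equations, \<open>piv\<close> the unknowns belonging to the minor and \<open>free\<close> the
  other ones.\<close>
locale bundle_chart_data = chart_data Q X S Y \<iota> \<pi> \<sigma> \<rho> f g c xb p \<mu>
  for Q :: "('v, 'a) pre_digraph"
    and X :: "('v, 'a, 'k::field, 'x) rep"
    and S :: "('v, 'a, 'k, 's) rep"
    and Y :: "('v, 'a, 'k, 'y) rep"
    and \<iota> :: "'v \<Rightarrow> 'x \<Rightarrow> 'y"
    and \<pi> :: "'v \<Rightarrow> 'y \<Rightarrow> 's"
    and \<sigma> :: "'v \<Rightarrow> 's \<Rightarrow> 'y"
    and \<rho> :: "'v \<Rightarrow> 'y \<Rightarrow> 'x"
    and f g :: "'v \<Rightarrow> nat"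
    and c :: "'v \<Rightarrow> nat"
    and xb :: "'v \<Rightarrow> nat \<Rightarrow> 'x"
    and p :: "'v \<Rightarrow> nat \<Rightarrow> 'x \<Rightarrow> 'k"
    and \<mu> :: "'v \<Rightarrow> nat \<Rightarrow> 's \<Rightarrow> 'k" +
  fixes R n :: nat
    and row :: "nat \<Rightarrow> 'a \<times> nat \<times> nat"
    and piv free :: "nat \<Rightarrow> 'v \<times> nat \<times> nat"
  assumes gen: "generating_extension Q S X Y \<iota> \<pi>"
    and row: "bij_betw row {..<R} rows"
    and piv_in: "\<And>k. k < R \<Longrightarrow> piv k \<in> columns" and piv_inj: "inj_on piv {..<R}"
    and free: "bij_betw free {..<n} (columns - piv ` {..<R})"
begin

definition minor :: "('v \<Rightarrow> 'x set) \<times> ('v \<Rightarrow> 's set) \<Rightarrow> nat \<Rightarrow> nat \<Rightarrow> 'k" where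
  "minor b r k = entry b (row r) (piv k)"

definition U :: "(('v \<Rightarrow> 'x set) \<times> ('v \<Rightarrow> 's set)) set" where
  "U = {b \<in> UXS. fdet R (minor b) \<noteq> 0}"

text \<open>The right-hand side \<open>y\<close> after the free unknowns have been given the values \<open>v\<close>.\<close>
definition residue :: "('v \<Rightarrow> 'x set) \<times> ('v \<Rightarrow> 's set) \<Rightarrow> (nat \<Rightarrow> 'k) \<Rightarrow> (nat \<Rightarrow> 'k) \<Rightarrow> nat \<Rightarrow> 'k" where
  "residue b y v r = y r - (\<Sum>k<n. entry b (row r) (free k) * v k)"

definition solution :: "('v \<Rightarrow> 'x set) \<times> ('v \<Rightarrow> 's set) \<Rightarrow> (nat \<Rightarrow> 'k) \<Rightarrow> (nat \<Rightarrow> 'k) \<Rightarrow> 'v \<times> nat \<times> nat \<Rightarrow> 'k" where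
  "solution b y v q =
     (if q \<in> piv ` {..<R}
      then fdet R (\<lambda>i j. if j = the_inv_into {..<R} piv q then residue b y v i else minor b i j) / fdet R (minor b)
      else v (the_inv_into {..<n} free q))"

abbreviation "rhs_row b \<equiv> \<lambda>r. uncur3 (rhs (fst b) (snd b)) (row r)"

lemma row_in: "r < R \<Longrightarrow> row r \<in> rows" using bij_betwE[OF row] by simp

lemma free_in: "k < n \<Longrightarrow> free k \<in> columns" "k < n \<Longrightarrow> free k \<notin> piv ` {..<R}"
  using bij_betwE[OF free] by auto

lemma free_inj: "inj_on free {..<n}" using free by (rule bij_betw_imp_inj_on)

lemma solution_free: "k < n \<Longrightarrow> solution b y v (free k) = v k"
  using free_in(2)[of k] by (simp add: solution_def the_inv_into_f_f[OF free_inj])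

lemma solution_piv: "k < R \<Longrightarrow> solution b y v (piv k) =
    fdet R (\<lambda>i j. if j = k then residue b y v i else minor b i j) / fdet R (minor b)"
  by (simp add: solution_def the_inv_into_f_f[OF piv_inj])

lemma column_cases:
  assumes "q \<in> columns" obtains k where "k < R" "q = piv k" | k where "k < n" "q = free k"
proof (cases "q \<in> piv ` {..<R}")
  case False
  then have "q \<in> free ` {..<n}" using assms free by (simp add: bij_betw_def)
  then show ?thesis using that by blast
qed (use that in blast)

lemma sum_columns_split:
  fixes h :: "'v \<times> nat \<times> nat \<Rightarrow> 'k"
  shows "(\<Sum>q\<in>columns. h q) = (\<Sum>k<R. h (piv k)) + (\<Sum>k<n. h (free k))"
proof -
  have "(\<Sum>q\<in>columns. h q) = (\<Sum>q\<in>piv ` {..<R}. h q) + (\<Sum>q\<in>columns - piv ` {..<R}. h q)"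
    using finite_columns piv_in by (subst add.commute, intro sum.subset_diff) auto
  also have "(\<Sum>q\<in>piv ` {..<R}. h q) = (\<Sum>k<R. h (piv k))" by (simp add: sum.reindex[OF piv_inj])
  also have "(\<Sum>q\<in>columns - piv ` {..<R}. h q) = (\<Sum>k<n. h (free k))"
    using sum.reindex_bij_betw[OF free, of h] by simp
  finally show ?thesis .
qed

text \<open>Cramer's rule: a solution is determined by the values of the free unknowns.\<close>
lemma solves_iff:
  assumes b: "b \<in> U"
  shows "solves (fst b) (snd b) \<Phi> y \<longleftrightarrow>
    (\<forall>q\<in>columns. uncur \<Phi> q = solution b (\<lambda>r. uncur3 y (row r)) (\<lambda>k. uncur \<Phi> (free k)) q)"
proof -
  let ?y = "\<lambda>r. uncur3 y (row r)" and ?v = "\<lambda>k. uncur \<Phi> (free k)"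
  have nz: "fdet R (minor b) \<noteq> 0" using b by (simp add: U_def)
  have rows: "rows = row ` {..<R}" using row by (simp add: bij_betw_def)
  have "solves (fst b) (snd b) \<Phi> y \<longleftrightarrow> (\<forall>r<R. (\<Sum>q\<in>columns. entry b (row r) q * uncur \<Phi> q) = ?y r)"
    unfolding solves_entry rows by auto
  also have "\<dots> \<longleftrightarrow> (\<forall>r<R. (\<Sum>k<R. minor b r k * uncur \<Phi> (piv k)) = residue b ?y ?v r)"
    unfolding sum_columns_split minor_def residue_def by (simp add: eq_diff_eq)
  also have "\<dots> \<longleftrightarrow> (\<forall>k<R. uncur \<Phi> (piv k) = solution b ?y ?v (piv k))"
    unfolding cramer[OF nz] by (simp add: solution_piv)
  also have "\<dots> \<longleftrightarrow> (\<forall>q\<in>columns. uncur \<Phi> q = solution b ?y ?v q)"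
  proof (intro iffI ballI allI impI)
    fix q assume h: "\<forall>k<R. uncur \<Phi> (piv k) = solution b ?y ?v (piv k)" and q: "q \<in> columns"
    show "uncur \<Phi> q = solution b ?y ?v q"
      using q by (cases rule: column_cases) (use h solution_free in auto)
  qed (use piv_in in auto)
  finally show ?thesis .
qed

lemma solution_solves:
  assumes b: "b \<in> U"
  shows "solves (fst b) (snd b) (cur (solution b (\<lambda>r. uncur3 y (row r)) v)) y"
proof -
  have "solution b z (\<lambda>k. solution b z v (free k)) q = solution b z v q" if "q \<in> columns" for z q
  proof -
    have r: "residue b z (\<lambda>k. solution b z v (free k)) = residue b z v"
      by (rule ext) (simp add: residue_def solution_free)
    show ?thesis using that
      by (cases rule: column_cases) (simp_all add: solution_free solution_piv r cong: if_cong)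
  qed
  then show ?thesis unfolding solves_iff[OF b] by simp
qed

lemma U_subset: "U \<subseteq> UXS" by (auto simp: U_def)

text \<open>Where the minor does not vanish, \<open>d\<close> is surjective.\<close>
lemma U_Im: "U \<subseteq> Img"
proof
  fix b assume b: "b \<in> U"
  have "surjective_at (fst b) (snd b)" using solution_solves[OF b] by blast
  then have "(fst b, snd b) \<in> Img" using image_iff_surjective[OF gen] b U_subset by auto
  then show "b \<in> Img" by simp
qed

lemma U_open: "openin (zariski B0) U"
proof -
  interpret B0: space_with_functions B0 by (rule B0_swf)
  have "(\<lambda>b. fdet R (minor b)) \<in> regular B0 UXS"
    unfolding minor_def[abs_def] using row_in piv_in
    by (intro B0.regular_fdet UXS_open entry_regular) auto
  from B0.nonzero_open[OF UXS_open this] show ?thesis unfolding U_def .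
qed

lemma U_open_B: "openin (zariski B) U"
  unfolding restrict_openin using U_open U_Im by blast

subsection \<open>The chart and its inverse\<close>

definition chart :: "('v \<Rightarrow> 'y set) \<Rightarrow> (('v \<Rightarrow> 'x set) \<times> ('v \<Rightarrow> 's set)) \<times> 'k vec" where
  "chart N = (\<Psi> N, vec n (\<lambda>k. uncur (coord N) (free k)))"

definition inverse_chart :: "(('v \<Rightarrow> 'x set) \<times> ('v \<Rightarrow> 's set)) \<times> 'k vec \<Rightarrow> 'v \<Rightarrow> 'y set" where
  "inverse_chart z = sub_of (fst (fst z)) (snd (fst z)) (cur (solution (fst z) (rhs_row (fst z)) (\<lambda>k. snd z $ k)))"

abbreviation "EU \<equiv> restrict_kspace Esp {N \<in> points Esp. \<Psi> N \<in> U}"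
abbreviation "CU \<equiv> product_kspace (restrict_kspace B U) (affine_space n)"

lemma EU_points: "points EU = {N \<in> strat. \<Psi> N \<in> U}" using Esp_points by auto

lemma CU_points: "points CU = U \<times> carrier_vec n"
  using B_points U_Im by (auto simp: product_points affine_points)

lemma EU_swf: "swf EU" by (intro restrict_swf Esp_swf)
lemma CU_swf: "swf CU" by (intro product_swf restrict_swf B_swf affine_swf)

lemma EU_D:
  assumes "N \<in> strat" "\<Psi> N \<in> U"
  shows "preimage_rep Q X \<iota> N \<in> UX" "image_rep Q \<pi> N \<in> US" "N \<in> UY"
    "preimage_rep Q X \<iota> N = fst (\<Psi> N)" "image_rep Q \<pi> N = snd (\<Psi> N)"
proof -
  show a: "preimage_rep Q X \<iota> N \<in> UX" "image_rep Q \<pi> N \<in> US"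
    using assms(2) U_subset unfolding Psi_def by auto
  show "N \<in> UY" using stratum_frame(1)[OF assms(1) a] .
qed (simp_all add: Psi_def)

lemma coord_solution:
  assumes N: "N \<in> strat" "\<Psi> N \<in> U" and q: "q \<in> columns"
  shows "uncur (coord N) q = solution (\<Psi> N) (rhs_row (\<Psi> N)) (\<lambda>k. snd (chart N) $ k) q"
proof -
  note D = EU_D[OF N]
  have "solves (fst (\<Psi> N)) (snd (\<Psi> N)) (coord N) (rhs (fst (\<Psi> N)) (snd (\<Psi> N)))"
    using stratum_frame(5)[OF N(1) D(1,2)] D(4,5) by simp
  then have "uncur (coord N) q = solution (\<Psi> N) (rhs_row (\<Psi> N)) (\<lambda>k. uncur (coord N) (free k)) q"
    using solves_iff[OF N(2)] q by simp
  also have "\<dots> = solution (\<Psi> N) (rhs_row (\<Psi> N)) (\<lambda>k. snd (chart N) $ k) q"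
  proof -
    have r: "residue b y (\<lambda>k. uncur (coord N) (free k)) = residue b y (\<lambda>k. snd (chart N) $ k)" for b y
      by (rule ext) (simp add: residue_def chart_def)
    show ?thesis using q
    proof (cases rule: column_cases)
      case (1 k)
      show ?thesis unfolding 1(2) solution_piv[OF 1(1)] r ..
    next
      case (2 k)
      show ?thesis unfolding 2(2) solution_free[OF 2(1)] using 2(1) by (simp add: chart_def)
    qed
  qed
  finally show ?thesis .
qed

lemma sub_of_cong:
  assumes "\<And>q. q \<in> columns \<Longrightarrow> uncur \<Phi> q = uncur \<Phi>' q"
  shows "sub_of N' N'' \<Phi> = sub_of N' N'' \<Phi>'"
proof -
  have "\<Phi> i r s = \<Phi>' i r s" if "i \<in> verts Q" "r < c i" "s < g i" for i r s
    using assms[of "(i, r, s)"] that by (simp add: uncur_def columns_def)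
  then show ?thesis unfolding sub_of_def by (intro restrict_ext) auto
qed

lemma inverse_chart_chart:
  assumes N: "N \<in> points EU" shows "inverse_chart (chart N) = N"
proof -
  have N': "N \<in> strat" "\<Psi> N \<in> U" using N EU_points by auto
  note D = EU_D[OF N']
  have "inverse_chart (chart N) = sub_of (fst (\<Psi> N)) (snd (\<Psi> N)) (coord N)"
    unfolding inverse_chart_def
    by (subst sub_of_cong[of _ "coord N"]) (simp_all add: coord_solution[OF N'], simp_all add: chart_def)
  then show ?thesis using stratum_frame(6)[OF N'(1) D(1,2)] D(4,5) by simp
qed

lemma inverse_chart_facts:
  assumes z: "z \<in> points CU"
  shows inverse_chart_strat: "inverse_chart z \<in> strat"
    and Psi_inverse_chart: "\<Psi> (inverse_chart z) = fst z"
    and chart_inverse_chart: "chart (inverse_chart z) = z"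
proof -
  obtain b v where bv: "z = (b, v)" "b \<in> U" "v \<in> carrier_vec n" using z CU_points by auto
  let ?P = "cur (solution b (rhs_row b) (\<lambda>k. v $ k))"
  have U': "fst b \<in> UX" "snd b \<in> US" using bv(2) U_subset by auto
  have sol: "solves (fst b) (snd b) ?P (rhs (fst b) (snd b))" by (rule solution_solves[OF bv(2)])
  have e: "inverse_chart z = sub_of (fst b) (snd b) ?P" by (simp add: inverse_chart_def bv)
  note st = sub_of_stratum[OF U' sol]
  show "inverse_chart z \<in> strat" using st(1) e by simp
  show Pz: "\<Psi> (inverse_chart z) = fst z" using st(2) e bv by simp
  have "uncur (coord (inverse_chart z)) (free k) = v $ k" if k: "k < n" for k
  proof -
    obtain i r s where q: "free k = (i, r, s)" "i \<in> verts Q" "r < c i" "s < g i"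
      using free_in(1)[OF k] unfolding columns_def by auto
    have "uncur (coord (inverse_chart z)) (free k) = ?P i r s"
      using st(5)[OF q(2-4)] by (simp add: e q(1) uncur_def)
    also have "\<dots> = solution b (rhs_row b) (\<lambda>k. v $ k) (free k)" by (simp add: cur_def q(1))
    finally show ?thesis by (simp add: solution_free[OF k])
  qed
  then have "vec n (\<lambda>k. uncur (coord (inverse_chart z)) (free k)) = v" using bv(3) by (intro eq_vecI) auto
  then show "chart (inverse_chart z) = z" using Pz bv by (simp add: chart_def)
qed

lemma chart_morphism: "morphism EU CU chart"
  unfolding chart_def[abs_def]
proof (rule morphism_into_product[OF EU_swf])
  interpret EU: space_with_functions EU by (rule EU_swf)
  show "morphism EU (restrict_kspace B U) \<Psi>"
    by (rule morphism_into_restrict[OF EU_swf morphism_restrict[OF Psi_morphism_image]]) auto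
  show "morphism EU (affine_space n) (\<lambda>N. vec n (\<lambda>k. uncur (coord N) (free k)))"
  proof (rule morphism_into_affine[OF EU_swf])
    fix k assume k: "k < n"
    obtain i r s where q: "free k = (i, r, s)" "i \<in> verts Q" "r < c i" "s < g i"
      using free_in(1)[OF k] unfolding columns_def by auto
    have l: "(\<lambda>y. p i (f i + r) (\<rho> i y)) \<in> linear_forms (vspace Y i)"
      using q by (intro form_comp[OF rho_lin[OF q(2)]] p_form) auto
    have s: "f i + s < e i" using q by simp
    have o: "openin (zariski (Gr Q Y e)) UY" by (rule chart_domain_open[OF fin(1) thetaY_form])
    have o1: "openin (zariski Esp) (UY \<inter> strat)" unfolding restrict_openin using o by blast
    have "(\<lambda>N. coord N i r s) \<in> regular EU (UY \<inter> strat \<inter> {N \<in> points Esp. \<Psi> N \<in> U})"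
      unfolding coord_def
      by (intro regular_restrict o o1 normal_frame_regular[where k = "\<lambda>y. p i (f i + r) (\<rho> i y)" and e = e and M = Y]
          Y fin(1) thetaY_form q(2) s l)
    moreover have "UY \<inter> strat \<inter> {N \<in> points Esp. \<Psi> N \<in> U} = points EU"
      using EU_D(3) EU_points Esp_points by auto
    ultimately have "(\<lambda>N. coord N i r s) \<in> regular EU (points EU)" by simp
    then show "(\<lambda>N. vec n (\<lambda>k. uncur (coord N) (free k)) $ k) \<in> regular EU (points EU)"
      using k q(1) by (simp add: uncur_def)
  qed auto
qed

lemma regular_CU:
  assumes "h \<in> regular B0 UXS" shows "(\<lambda>z. h (fst z)) \<in> regular CU (points CU)"
proof -
  have m: "morphism CU B0 fst"
    using morphism_comp[OF morphism_comp[OF product_fst restrict_inclusion] restrict_inclusion] .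
  have "{z \<in> points CU. fst z \<in> UXS} = points CU" using CU_points U_subset by auto
  then show ?thesis using morphism_regular[OF m UXS_open assms] by simp
qed

lemma solution_regular:
  assumes q: "q \<in> columns"
  shows "(\<lambda>z. solution (fst z) (rhs_row (fst z)) (\<lambda>k. snd z $ k) q) \<in> regular CU (points CU)"
proof -
  interpret CU: space_with_functions CU by (rule CU_swf)
  note o = CU.open_points
  have v: "(\<lambda>z. snd z $ k) \<in> regular CU (points CU)" if "k < n" for k
    by (rule morphism_regular_global[OF product_snd affine_coordinate[OF that]])
  have e: "(\<lambda>z. entry (fst z) (row r) q) \<in> regular CU (points CU)" if "r < R" "q \<in> columns" for r q
    by (rule regular_CU[OF entry_regular[OF row_in[OF that(1)] that(2)]])
  have res: "(\<lambda>z. residue (fst z) (rhs_row (fst z)) (\<lambda>k. snd z $ k) r) \<in> regular CU (points CU)" if "r < R" for r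
    unfolding residue_def
    by (intro CU.regular_diff CU.regular_sum CU.regular_mult o e v regular_CU[OF rhs_regular[OF row_in[OF that]]] that)
      (auto simp: free_in)
  have mi: "(\<lambda>z. minor (fst z) r k) \<in> regular CU (points CU)" if "r < R" "k < R" for r k
    unfolding minor_def by (intro e that piv_in)
  show ?thesis using q
  proof (cases rule: column_cases)
    case (1 k)
    have "(\<lambda>z. if j = k then residue (fst z) (rhs_row (fst z)) (\<lambda>k. snd z $ k) i else minor (fst z) i j) \<in> regular CU (points CU)"
      if "i < R" "j < R" for i j
      using res[OF that(1)] mi[OF that] by (cases "j = k") simp_all
    then have "(\<lambda>z. fdet R (\<lambda>i j. if j = k then residue (fst z) (rhs_row (fst z)) (\<lambda>k. snd z $ k) i else minor (fst z) i j)
        / fdet R (minor (fst z))) \<in> regular CU (points CU)"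
      by (intro CU.regular_divide CU.regular_fdet o mi) (use CU_points in \<open>auto simp: U_def\<close>)
    then show ?thesis unfolding 1(2) solution_piv[OF 1(1)] .
  next
    case (2 k)
    then show ?thesis unfolding 2(2) solution_free[OF 2(1)] using v by simp
  qed
qed

text \<open>The frame \<open>frameY\<close> of the graph has regular entries: its vectors are linear in the frames of \<open>N'\<close> and \<open>N''\<close>
  and in the solution of the equations.\<close>
lemma inverse_chart_morphism: "morphism CU EU inverse_chart"
proof (rule morphism_into_restrict[OF CU_swf morphism_into_restrict[OF CU_swf]])
  interpret CU: space_with_functions CU by (rule CU_swf)
  note o = CU.open_points
  show "inverse_chart z \<in> strat" if "z \<in> points CU" for z using inverse_chart_strat[OF that] .
  show "inverse_chart z \<in> {N \<in> points Esp. \<Psi> N \<in> U}" if "z \<in> points CU" for z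
    using inverse_chart_strat[OF that] Psi_inverse_chart[OF that] that CU_points Esp_points by auto
  let ?F = "\<lambda>z. cur (solution (fst z) (rhs_row (fst z)) (\<lambda>k. snd z $ k))"
  let ?b = "\<lambda>z. frameY (fst (fst z)) (snd (fst z)) (?F z)"
  show "morphism CU (Gr Q Y e) inverse_chart"
  proof (rule morphism_into_Gr[OF CU_swf fin(1) Y])
    show "inverse_chart z \<in> quiver_grassmannian Q Y e" if "z \<in> points CU" for z
      using inverse_chart_strat[OF that] strat_gr by blast
    fix z0 assume z0: "z0 \<in> points CU"
    show "\<exists>W \<beta>. openin (zariski CU) W \<and> z0 \<in> W \<and>
        (\<forall>y\<in>W. \<forall>i\<in>verts Q. \<exists>\<theta>. dual_basis (vspace Y i) (inverse_chart y i) (e i) (\<beta> y i) \<theta>) \<and>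
        (\<forall>i\<in>verts Q. \<forall>s<e i. \<forall>l\<in>linear_forms (vspace Y i). (\<lambda>y. l (\<beta> y i s)) \<in> regular CU W)"
    proof (rule exI[of _ "points CU"], rule exI[of _ ?b], intro conjI ballI allI impI o z0)
      fix z i assume z: "z \<in> points CU" and i: "i \<in> verts Q"
      have "fst (fst z) \<in> UX" "snd (fst z) \<in> US" using z CU_points U_subset by auto
      from frameY_dual[OF this i, of "?F z"]
      show "\<exists>\<theta>. dual_basis (vspace Y i) (inverse_chart z i) (e i) (?b z i) \<theta>"
        unfolding inverse_chart_def by blast
    next
      fix i t l assume i: "i \<in> verts Q" and t: "t < e i" and l: "l \<in> linear_forms (vspace Y i)"
      show "(\<lambda>z. l (?b z i t)) \<in> regular CU (points CU)"
      proof (cases "t < f i")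
        case True
        then show ?thesis
          using regular_CU[OF beta'_regular[OF i True form_comp[OF iota_lin[OF i] l]]] by (simp add: frameY_def)
      next
        case False
        then obtain s where s: "t = f i + s" "s < g i" using t by (metis less_diff_conv2 add.commute add_diff_inverse_nat leI)
        have r: "(\<lambda>z. (\<Sum>r<c i. solution (fst z) (rhs_row (fst z)) (\<lambda>k. snd z $ k) (i, r, s) * l (\<iota> i (w i r)))
            + l (\<sigma> i (\<beta>'' (snd (fst z)) i s))) \<in> regular CU (points CU)"
          using i s by (intro CU.regular_add CU.regular_sum CU.regular_mult CU.regular_const o solution_regular
              regular_CU[OF beta''_regular[OF i s(2) form_comp[OF sigma_lin[OF i] l]]]) (auto simp: columns_def)
        show ?thesis
        proof (rule CU.regular_cong[OF o r])
          fix z assume "z \<in> points CU"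
          then have U': "fst (fst z) \<in> UX" "snd (fst z) \<in> US" using CU_points U_subset by auto
          note b = beta''_in[OF U'(2) i s(2)] and il = form_comp[OF iota_lin[OF i] l]
          let ?x = "comb (vspace X i) (c i) (\<lambda>r. ?F z i r s) (w i)"
          have x: "?x \<in> carrier (vspace X i)" by (rule comb_w_in[OF U' i])
          have "l (?b z i t) = l (\<iota> i ?x) + l (\<sigma> i (\<beta>'' (snd (fst z)) i s))"
            unfolding frameY_def glue_def using s form_add[OF l lin_closed[OF iota_lin[OF i] x] lin_closed[OF sigma_lin[OF i] b]]
            by simp
          also have "l (\<iota> i ?x) = (\<Sum>r<c i. ?F z i r s * l (\<iota> i (w i r)))"
            using w_in[OF i] by (rule form_comb[OF rep_vsp[OF X i] il])
          also have "\<dots> = (\<Sum>r<c i. solution (fst z) (rhs_row (fst z)) (\<lambda>k. snd z $ k) (i, r, s) * l (\<iota> i (w i r)))"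
            by (simp add: cur_def)
          finally show "l (?b z i t) = (\<Sum>r<c i. solution (fst z) (rhs_row (fst z)) (\<lambda>k. snd z $ k) (i, r, s) * l (\<iota> i (w i r)))
            + l (\<sigma> i (\<beta>'' (snd (fst z)) i s))" .
        qed
      qed
    qed
  qed
qed

lemma is_bundle_chart: "bundle_chart Esp B \<Psi> n U chart"
  unfolding bundle_chart_def isomorphism_def
  using U_open_B chart_morphism inverse_chart_morphism inverse_chart_chart chart_inverse_chart
  by (auto simp: chart_def)

subsection \<open>Fibre coordinates\<close>

text \<open>The coordinates of the chart are fibre coordinates: take \<open>s\<close> from the frame of \<open>N''\<close> and \<open>k\<close> among the
  forms \<open>\<kappa>\<close>.\<close>
lemma chart_fibre_coordinate:
  assumes b: "b \<in> U" and k: "k < n"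
  shows "fibre_coordinate Q Y \<pi> X \<rho> b {N \<in> strat. \<Psi> N = b} (\<lambda>N. snd (chart N) $ k)"
proof -
  obtain i r s where q: "free k = (i, r, s)" "i \<in> verts Q" "r < c i" "s < g i"
    using free_in(1)[OF k] unfolding columns_def by auto
  have U': "fst b \<in> UX" "snd b \<in> US" using b U_subset by auto
  note d = US_dual[OF U'(2) q(2)]
  have "snd (chart N) $ k = \<kappa> (fst b) i r (\<rho> i y)"
    if N: "N \<in> strat" "\<Psi> N = b" and y: "y \<in> N i" "\<pi> i y = \<beta>'' (snd b) i s" for N y
  proof -
    have NU: "\<Psi> N \<in> U" using N b by simp
    note D = EU_D[OF N(1) NU]
    have "\<kappa> (fst b) i r (\<rho> i y) = (\<Sum>s'<g i. coord N i r s' * \<mu> i s' (\<beta>'' (snd b) i s))"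
      using stratum_frame(4)[OF N(1) D(1,2) q(2) y(1) q(3)] y(2) D(4) N(2) by simp
    also have "\<dots> = (\<Sum>s'<g i. if s' = s then coord N i r s else 0)"
      using q by (intro sum.cong) (auto simp: dual_basis_delta[OF d])
    finally show ?thesis using q k by (simp add: chart_def uncur_def)
  qed
  then show ?thesis
    unfolding fibre_coordinate_def
    using q dual_basis_in[OF d q(4)] kappa_form[OF q(2,3)] kappa_zero[OF U'(1) q(2,3)]
    by (intro bexI[of _ i] bexI[of _ "\<beta>'' (snd b) i s"] bexI[of _ "\<kappa> (fst b) i r"]) auto
qed

lemma solution_affine:
  assumes q: "q \<in> columns" shows "affine_fn n (\<lambda>v. solution b y v q)"
  using q
proof (cases rule: column_cases)
  case (1 k)
  have "affine_fn n (\<lambda>v. \<Sum>s<R. finv R (minor b) k s * residue b y v s)"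
    unfolding residue_def
    by (intro affine_fn_sum affine_fn_smult affine_fn_diff affine_fn_const affine_fn_coordinate) auto
  then show ?thesis unfolding 1(2) solution_piv[OF 1(1)] finv_column[OF 1(1), symmetric] .
next
  case (2 k)
  then show ?thesis unfolding 2(2) solution_free[OF 2(1)] by (intro affine_fn_coordinate)
qed

text \<open>Conversely \<open>\<langle>k, \<phi> (s)\<rangle>\<close> is linear in the matrix of \<open>\<phi>\<close>, whose entries are affine functions of the free
  unknowns.\<close>
lemma fibre_coordinate_affine:
  assumes b: "b \<in> U" and h: "fibre_coordinate Q Y \<pi> X \<rho> b {N \<in> strat. \<Psi> N = b} h"
  shows "\<exists>a0 a. \<forall>N\<in>strat. \<Psi> N = b \<longrightarrow> h N = a0 + (\<Sum>k<n. a k * snd (chart N) $ k)"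
proof -
  obtain i s k where i: "i \<in> verts Q" and s: "s \<in> snd b i" and k: "k \<in> linear_forms (vspace X i)"
    and kk: "(\<forall>x\<in>fst b i. k x = 0) \<and>
        (\<forall>N\<in>{N \<in> strat. \<Psi> N = b}. \<forall>y\<in>N i. \<pi> i y = s \<longrightarrow> h N = k (\<rho> i y))"
    using h unfolding fibre_coordinate_def by (elim bexE)
  have kz: "k x = 0" if "x \<in> fst b i" for x using kk that by blast
  have hk: "h N = k (\<rho> i y)" if "N \<in> strat" "\<Psi> N = b" "y \<in> N i" "\<pi> i y = s" for N y
    using kk that by simp
  have U': "fst b \<in> UX" "snd b \<in> US" using b U_subset by auto
  let ?G = "\<lambda>v. \<Sum>t<c i. k (w i t) * (\<Sum>u<g i. \<mu> i u s * solution b (rhs_row b) v (i, t, u))"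
  have "affine_fn n ?G"
    using i by (intro affine_fn_sum affine_fn_smult solution_affine) (auto simp: columns_def)
  then obtain a0 a where a: "\<And>v. ?G v = a0 + (\<Sum>l<n. a l * v l)" unfolding affine_fn_def by blast
  have "h N = ?G (\<lambda>l. snd (chart N) $ l)" if N: "N \<in> strat" "\<Psi> N = b" for N
  proof -
    have NU: "\<Psi> N \<in> U" using N b by simp
    note D = EU_D[OF N(1) NU]
    have "s \<in> \<pi> i ` N i" using s fun_cong[OF D(5), of i] N(2) i by (simp add: image_rep_def)
    then obtain y where y: "y \<in> N i" "\<pi> i y = s" by auto
    have yc: "y \<in> carrier (vspace Y i)" using sub_in[OF gr_sub[OF strat_gr[OF N(1)] i] y(1)] .
    have "h N = k (\<rho> i y)" using hk[OF N y] .
    also have "\<dots> = (\<Sum>t<c i. \<kappa> (fst b) i t (\<rho> i y) * k (w i t))"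
      by (rule cobasis_expand[OF UX_sub[OF U'(1) i] kappa_cobasis[OF U'(1) i] k kz lin_closed[OF rho_lin[OF i] yc]])
    also have "\<dots> = (\<Sum>t<c i. k (w i t) * (\<Sum>u<g i. \<mu> i u s * solution b (rhs_row b) (\<lambda>l. snd (chart N) $ l) (i, t, u)))"
    proof (rule sum.cong[OF refl])
      fix t assume t: "t \<in> {..<c i}"
      have "\<kappa> (fst b) i t (\<rho> i y) = (\<Sum>u<g i. coord N i t u * \<mu> i u s)"
        using stratum_frame(4)[OF N(1) D(1,2) i y(1), of t] t y(2) D(4) N(2) by simp
      also have "\<dots> = (\<Sum>u<g i. \<mu> i u s * solution b (rhs_row b) (\<lambda>l. snd (chart N) $ l) (i, t, u))"
        using coord_solution[OF N(1) NU, of "(i, t, _)"] t i N(2)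
        by (intro sum.cong) (auto simp: uncur_def columns_def mult.commute)
      finally show "\<kappa> (fst b) i t (\<rho> i y) * k (w i t) =
          k (w i t) * (\<Sum>u<g i. \<mu> i u s * solution b (rhs_row b) (\<lambda>l. snd (chart N) $ l) (i, t, u))"
        by (simp add: mult.commute)
    qed
    finally show ?thesis .
  qed
  then have "h N = a0 + (\<Sum>l<n. a l * snd (chart N) $ l)" if "N \<in> strat" "\<Psi> N = b" for N
    using that unfolding a .
  then show ?thesis by (intro exI[of _ a0] exI[of _ a]) simp
qed

end

section \<open>The affine bundle\<close>

context split_extension_data
begin

text \<open>At \<open>b0\<close> the map \<open>d\<close> is surjective, so its matrix has a non-vanishing minor involving all rows.  The
  numbers of unknowns and of equations are the two sums in the Euler form.\<close>
lemma chart_exists: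
  assumes G: "generating_extension Q S X Y \<iota> \<pi>" and b0: "b0 \<in> Img"
  obtains n U \<phi> where "b0 \<in> U" "U \<subseteq> Img" "openin (zariski B0) U" "bundle_chart Esp B \<Psi> n U \<phi>"
    and "int n = euler_form Q (\<lambda>i. int (g i)) (\<lambda>i. int (dimvec X i) - int (f i))"
    and "\<And>N. snd (\<phi> N) \<in> carrier_vec n"
    and "\<And>b k. b \<in> U \<Longrightarrow> k < n \<Longrightarrow>
        fibre_coordinate Q Y \<pi> X \<rho> b {N \<in> strat. \<Psi> N = b} (\<lambda>N. snd (\<phi> N) $ k)"
    and "\<And>b h. b \<in> U \<Longrightarrow> fibre_coordinate Q Y \<pi> X \<rho> b {N \<in> strat. \<Psi> N = b} h \<Longrightarrow>
        \<exists>a0 a. \<forall>N\<in>strat. \<Psi> N = b \<longrightarrow> h N = a0 + (\<Sum>k<n. a k * snd (\<phi> N) $ k)"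
proof -
  obtain N' N'' where b0e: "b0 = (N', N'')" by (cases b0)
  have gr: "N' \<in> quiver_grassmannian Q X f" "N'' \<in> quiver_grassmannian Q S g"
    using b0 Im_subset b0e by auto
  let ?c = "\<lambda>i. dimvec X i - f i"
  obtain xb p \<mu> where cd: "chart_data Q X S Y \<iota> \<pi> \<sigma> \<rho> f g ?c xb p \<mu>"
    and le: "\<forall>i\<in>verts Q. f i \<le> dimvec X i"
    and U: "N' \<in> chart_domain Q X f p" "N'' \<in> chart_domain Q S g \<mu>"
    by (rule chart_data_exists[OF gr])
  interpret chart_data Q X S Y \<iota> \<pi> \<sigma> \<rho> f g ?c xb p \<mu> by (rule cd)
  define R where "R = card rows"
  obtain row where row: "bij_betw row {..<R} rows"
    using ex_bij_betw_nat_finite[OF finite_rows] unfolding R_def atLeast0LessThan by blast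
  have sur: "surjective_at N' N''" using image_iff_surjective[OF G U] b0 b0e by simp
  have "\<exists>\<Phi>. \<forall>r<R. (\<Sum>q\<in>columns. entry b0 (row r) q * \<Phi> q) = y r" for y :: "nat \<Rightarrow> 'k"
  proof -
    obtain \<Phi> where P: "solves N' N'' \<Phi> (\<lambda>\<alpha> r s. y (the_inv_into {..<R} row (\<alpha>, r, s)))" using sur by blast
    have "(\<Sum>q\<in>columns. entry b0 (row r) q * uncur \<Phi> q) = y r" if "r < R" for r
    proof -
      have "row r \<in> rows" using bij_betwE[OF row] that by simp
      then have "(\<Sum>q\<in>columns. entry b0 (row r) q * uncur \<Phi> q) = y (the_inv_into {..<R} row (row r))"
        using P solves_entry[of b0 \<Phi>] b0e by (auto simp: uncur3_def split: prod.splits)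
      then show ?thesis using that by (simp add: the_inv_into_f_f[OF bij_betw_imp_inj_on[OF row]])
    qed
    then show ?thesis by blast
  qed
  then obtain piv where piv: "\<And>k. k < R \<Longrightarrow> piv k \<in> columns" "inj_on piv {..<R}"
    "fdet R (\<lambda>r k. entry b0 (row r) (piv k)) \<noteq> 0" using pivots[where R = R and C = columns and t = "\<lambda>r q. entry b0 (row r) q"] by blast
  define n where "n = card (columns - piv ` {..<R})"
  obtain free where free: "bij_betw free {..<n} (columns - piv ` {..<R})"
    using ex_bij_betw_nat_finite[of "columns - piv ` {..<R}"] finite_columns unfolding n_def atLeast0LessThan by blast
  \<comment> \<open>the unknowns outside the pivots, in any order, are the coordinates of the chart\<close>
  interpret D: bundle_chart_data Q X S Y \<iota> \<pi> \<sigma> \<rho> f g ?c xb p \<mu> R n row piv free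
    using G row piv free by unfold_locales auto
  have sub: "piv ` {..<R} \<subseteq> columns" using piv by auto
  have cR: "card (piv ` {..<R}) = R" using card_image[OF piv(2)] by simp
  have nR: "n + R = card columns"
    using card_Diff_subset[OF _ sub] card_mono[OF finite_columns sub] cR unfolding n_def by simp
  have "int (card columns) = (\<Sum>i\<in>verts Q. int (g i) * (int (dimvec X i) - int (f i)))"
  proof -
    have "card columns = (\<Sum>i\<in>verts Q. ?c i * g i)"
      unfolding columns_def using fin by (subst card_SigmaI) auto
    then show ?thesis using le by (simp add: of_nat_diff mult.commute)
  qed
  moreover have "int R = (\<Sum>\<alpha>\<in>arcs Q. int (g (tail Q \<alpha>)) * (int (dimvec X (head Q \<alpha>)) - int (f (head Q \<alpha>))))"
  proof -
    have "R = (\<Sum>\<alpha>\<in>arcs Q. ?c (head Q \<alpha>) * g (tail Q \<alpha>))"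
      unfolding R_def rows_def using fin by (subst card_SigmaI) auto
    then show ?thesis using le ends by (simp add: of_nat_diff mult.commute)
  qed
  ultimately have "int n = euler_form Q (\<lambda>i. int (g i)) (\<lambda>i. int (dimvec X i) - int (f i))"
    using nR unfolding euler_form_def by linarith
  moreover have "b0 \<in> D.U" using U piv(3) b0e by (simp add: D.U_def D.minor_def[abs_def])
  ultimately show ?thesis
    using that[of D.U n D.chart] D.U_Im D.U_open D.is_bundle_chart D.chart_fibre_coordinate
      D.fibre_coordinate_affine by (simp add: D.chart_def)
qed

text \<open>A coordinate of the second chart is a fibre coordinate and thus affine-linear in the first chart.\<close>
lemma affine_bundle_over_image:
  assumes G: "generating_extension Q S X Y \<iota> \<pi>"
  shows "Img = {(N', N''). N' \<in> quiver_grassmannian Q X f \<and> N'' \<in> quiver_grassmannian Q S g \<and>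
              Ext1_vanishes Q (sub_rep S N'') (quotient_rep Q X N')}"
    and "openin (zariski B0) Img"
    and "affine_bundle Esp B \<Psi> (euler_form Q (\<lambda>i. int (g i)) (\<lambda>i. int (dimvec X i) - int (f i)))"
proof -
  show "Img = {(N', N''). N' \<in> quiver_grassmannian Q X f \<and> N'' \<in> quiver_grassmannian Q S g \<and>
              Ext1_vanishes Q (sub_rep S N'') (quotient_rep Q X N')}" by (rule image_eq[OF G])
  let ?r = "euler_form Q (\<lambda>i. int (g i)) (\<lambda>i. int (dimvec X i) - int (f i))"
  let ?fc = "\<lambda>b. fibre_coordinate Q Y \<pi> X \<rho> b {N \<in> strat. \<Psi> N = b}"
  define admissible where "admissible U \<phi> \<longleftrightarrow> U \<subseteq> Img \<and> openin (zariski B0) U \<and> 0 \<le> ?r \<and> bundle_chart Esp B \<Psi> (nat ?r) U \<phi> \<and>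
     (\<forall>N. snd (\<phi> N) \<in> carrier_vec (nat ?r)) \<and>
     (\<forall>b\<in>U. \<forall>k<nat ?r. ?fc b (\<lambda>N. snd (\<phi> N) $ k)) \<and>
     (\<forall>b\<in>U. \<forall>h. ?fc b h \<longrightarrow> (\<exists>a0 a. \<forall>N\<in>strat. \<Psi> N = b \<longrightarrow> h N = a0 + (\<Sum>k<nat ?r. a k * snd (\<phi> N) $ k)))" for U \<phi>
  have admissibleD: "U \<subseteq> Img" "openin (zariski B0) U" "0 \<le> ?r" "bundle_chart Esp B \<Psi> (nat ?r) U \<phi>"
    "snd (\<phi> N) \<in> carrier_vec (nat ?r)" "b \<in> U \<Longrightarrow> k < nat ?r \<Longrightarrow> ?fc b (\<lambda>N. snd (\<phi> N) $ k)"
    "b \<in> U \<Longrightarrow> ?fc b h \<Longrightarrow> \<exists>a0 a. \<forall>N\<in>strat. \<Psi> N = b \<longrightarrow> h N = a0 + (\<Sum>k<nat ?r. a k * snd (\<phi> N) $ k)"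
    if "admissible U \<phi>" for U \<phi> N b k h using that unfolding admissible_def by simp_all
  have ex: "\<exists>U \<phi>. b0 \<in> U \<and> admissible U \<phi>" if "b0 \<in> Img" for b0
  proof (rule chart_exists[OF G that])
    fix n U \<phi>
    assume 1: "b0 \<in> U" "U \<subseteq> Img" "openin (zariski B0) U" "bundle_chart Esp B \<Psi> n U \<phi>"
      and n: "int n = ?r"
      and 2: "\<And>N. snd (\<phi> N) \<in> carrier_vec n" "\<And>b k. b \<in> U \<Longrightarrow> k < n \<Longrightarrow> ?fc b (\<lambda>N. snd (\<phi> N) $ k)"
        "\<And>b h. b \<in> U \<Longrightarrow> ?fc b h \<Longrightarrow>
        \<exists>a0 a. \<forall>N\<in>strat. \<Psi> N = b \<longrightarrow> h N = a0 + (\<Sum>k<n. a k * snd (\<phi> N) $ k)"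
    have nn: "nat ?r = n" "0 \<le> ?r" using n by linarith+
    have "admissible U \<phi>" unfolding admissible_def nn(1) using 1 2 nn(2) by simp
    then show ?thesis using 1(1) by blast
  qed
  show "openin (zariski B0) Img"
    by (subst openin_subopen) (use ex admissible_def in meson)
  show "affine_bundle Esp B \<Psi> ?r"
    unfolding affine_bundle_def
  proof (intro conjI Psi_morphism_image exI[of _ "{(U, \<phi>). admissible U \<phi>}"])
    show "(\<Union>(U, \<phi>)\<in>{(U, \<phi>). admissible U \<phi>}. U) = points B"
      unfolding B_points
    proof (rule equalityI; rule subsetI)
      show "b \<in> Img" if "b \<in> (\<Union>(U, \<phi>)\<in>{(U, \<phi>). admissible U \<phi>}. U)" for b
        using that unfolding admissible_def by blast
      show "b \<in> (\<Union>(U, \<phi>)\<in>{(U, \<phi>). admissible U \<phi>}. U)" if "b \<in> Img" for b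
        using ex[OF that] by blast
    qed
    show "\<forall>(U, \<phi>)\<in>{(U, \<phi>). admissible U \<phi>}. \<exists>n. int n = ?r \<and> bundle_chart Esp B \<Psi> n U \<phi>"
      unfolding admissible_def by (auto intro!: exI[of _ "nat ?r"])
    show "\<forall>(U, \<phi>)\<in>{(U, \<phi>). admissible U \<phi>}. \<forall>(U', \<phi>')\<in>{(U, \<phi>). admissible U \<phi>}. \<forall>b\<in>U \<inter> U'.
           \<exists>A\<in>carrier_mat (nat ?r) (nat ?r). \<exists>c\<in>carrier_vec (nat ?r).
             \<forall>x\<in>points Esp. \<Psi> x = b \<longrightarrow> snd (\<phi>' x) = A *\<^sub>v snd (\<phi> x) + c"
    proof (clarify)
      fix U \<phi> U' \<phi>' N' N'' assume g: "admissible U \<phi>" "admissible U' \<phi>'" and b: "(N', N'') \<in> U" "(N', N'') \<in> U'"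
      let ?b = "(N', N'')" and ?n = "nat ?r"
      have "\<forall>k. \<exists>a0 a. k < ?n \<longrightarrow> (\<forall>N\<in>strat. \<Psi> N = ?b \<longrightarrow> snd (\<phi>' N) $ k = a0 + (\<Sum>l<?n. a l * snd (\<phi> N) $ l))"
      proof
        fix k
        show "\<exists>a0 a. k < ?n \<longrightarrow> (\<forall>N\<in>strat. \<Psi> N = ?b \<longrightarrow> snd (\<phi>' N) $ k = a0 + (\<Sum>l<?n. a l * snd (\<phi> N) $ l))"
        proof (cases "k < ?n")
          case True
          show ?thesis using admissibleD(7)[OF g(1) b(1) admissibleD(6)[OF g(2) b(2) True]] by blast
        qed simp
      qed
      from choice[OF this] obtain a0 where "\<forall>k. \<exists>a. k < ?n \<longrightarrow> (\<forall>N\<in>strat. \<Psi> N = ?b \<longrightarrow>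
          snd (\<phi>' N) $ k = a0 k + (\<Sum>l<?n. a l * snd (\<phi> N) $ l))" by (elim exE)
      from choice[OF this] obtain a where a': "\<forall>k. k < ?n \<longrightarrow> (\<forall>N\<in>strat. \<Psi> N = ?b \<longrightarrow>
          snd (\<phi>' N) $ k = a0 k + (\<Sum>l<?n. a k l * snd (\<phi> N) $ l))" by (elim exE)
      have a: "snd (\<phi>' N) $ k = a0 k + (\<Sum>l<?n. a k l * snd (\<phi> N) $ l)"
        if "k < ?n" "N \<in> strat" "\<Psi> N = ?b" for k N using a' that by simp
      let ?A = "mat ?n ?n (\<lambda>(k, l). a k l)" and ?c = "vec ?n a0"
      have c: "snd (\<phi> N) \<in> carrier_vec ?n" "snd (\<phi>' N) \<in> carrier_vec ?n" for N
        using admissibleD(5)[OF g(1)] admissibleD(5)[OF g(2)] .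
      have "snd (\<phi>' N) = ?A *\<^sub>v snd (\<phi> N) + ?c" if N: "N \<in> strat" "\<Psi> N = ?b" for N
      proof (rule eq_vecI)
        show "dim_vec (snd (\<phi>' N)) = dim_vec (?A *\<^sub>v snd (\<phi> N) + ?c)" using c(2)[of N] by simp
        fix k assume "k < dim_vec (?A *\<^sub>v snd (\<phi> N) + ?c)"
        then have k: "k < ?n" by simp
        have "(\<Sum>l<?n. a k l * snd (\<phi> N) $ l) = (?A *\<^sub>v snd (\<phi> N)) $ k"
          using k c(1)[of N] by (auto simp: scalar_prod_def intro!: sum.cong)
        then show "snd (\<phi>' N) $ k = (?A *\<^sub>v snd (\<phi> N) + ?c) $ k" using a[OF k N] k by simp
      qed
      then show "\<exists>A\<in>carrier_mat ?n ?n. \<exists>c\<in>carrier_vec ?n.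
             \<forall>x\<in>points Esp. \<Psi> x = ?b \<longrightarrow> snd (\<phi>' x) = A *\<^sub>v snd (\<phi> x) + c"
        by (intro bexI[of _ ?A] bexI[of _ ?c]) (auto simp: Esp_points)
    qed
  qed
qed

end

theorem theorem26:
  fixes Q :: "('v, 'a) pre_digraph"
    and X :: "('v, 'a, 'k::alg_closed_field, 'x) rep"
    and S :: "('v, 'a, 'k, 's) rep"
    and Y :: "('v, 'a, 'k, 'y) rep"
    and \<iota> :: "'v \<Rightarrow> 'x \<Rightarrow> 'y"
    and \<pi> :: "'v \<Rightarrow> 'y \<Rightarrow> 's"
    and f g :: "'v \<Rightarrow> nat"
  assumes "fin_digraph Q" and "acyclic (arcs_ends Q)"
    and "representation Q X" and "representation Q S"
    and "generating_extension Q S X Y \<iota> \<pi>"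
  shows "Psi Q X \<iota> \<pi> ` stratum Q S X Y \<iota> \<pi> f g =
           {(N', N''). N' \<in> quiver_grassmannian Q X f \<and> N'' \<in> quiver_grassmannian Q S g \<and>
              Ext1_vanishes Q (sub_rep S N'') (quotient_rep Q X N')}
       \<and> openin (zariski (product_kspace (Gr Q X f) (Gr Q S g)))
           (Psi Q X \<iota> \<pi> ` stratum Q S X Y \<iota> \<pi> f g)
       \<and> affine_bundle
           (restrict_kspace (Gr Q Y (\<lambda>i. f i + g i)) (stratum Q S X Y \<iota> \<pi> f g))
           (restrict_kspace (product_kspace (Gr Q X f) (Gr Q S g))
              (Psi Q X \<iota> \<pi> ` stratum Q S X Y \<iota> \<pi> f g))
           (Psi Q X \<iota> \<pi>)
           (euler_form Q (\<lambda>i. int (g i)) (\<lambda>i. int (dimvec X i) - int (f i)))"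
proof -
  have E: "extension Q S X Y \<iota> \<pi>" using assms(5) by (simp add: generating_extension_def)
  obtain \<sigma> \<rho> where v: "vertex_splitting_of Q S X Y \<iota> \<pi> \<sigma> \<rho>"
    using vertex_splitting_exists[OF E assms(4)] .
  interpret split_extension_data Q X S Y \<iota> \<pi> \<sigma> \<rho> f g
    using assms E v unfolding split_extension_data_def split_extension_data_axioms_def by simp
  show ?thesis using affine_bundle_over_image[OF assms(5)] by simp
qed

end
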